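(* Consider the tensor space $\mathbb{C}^{\ell+1}\otimes\mathbb{C}^{m+1}\otimes\mathbb{C}^{n+1}$ of dimension $M=(\ell+1)(m+1)(n+1)$ with $\ell\ge m\ge n>0$. If the Regularity Conjecture (stated in the context) holds and $\mathcal{A}$ is a generic tensor of rank $r\le \phi\, mn$ (with $r\le \ell+1$), where $\phi\in[0,1)$ is a fixed constant, then the algorithm cpd_hnf (described in the context) runs in polynomial time $\mathcal{O}\big(M^{\frac52\lceil \frac{1}{1-\phi}\rceil+1}\big)$.
   Context: $\mathbb{N}=\{0,1,2,\dots\}$. Time means number of operations. "Generic" means: contained in a Zariski dense open subset of the set of all rank-$r$ tensors of the given format. Inequalities between pairs are entry-wise. Notation. $X=\mathbb{P}^m\times\mathbb{P}^n$; $S=\mathbb{C}[x_0,\dots,x_m,y_0,\dots,y_n]=\bigoplus_{(d,e)\in\mathbb{N}^2}S_{(d,e)}$, where $S_{(d,e)}$ is spanned by the monomials of degree $d$ in $x$ and $e$ in $y$. For a homogeneous ideal $I\subset S$, $I_{(d,e)}=I\cap S_{(d,e)}$, $V_X(I)\subset X$ is its zero set, and $\mathrm{HF}_{S/I}(d,e)=\dim_{\mathbb{C}} S_{(d,e)}/I_{(d,e)}$; also $\mathrm{HF}_S(d,e)=\dim_{\mathbb{C}} S_{(d,e)}=\binom{m+d}{d}\binom{n+e}{e}$. The 1-flattening of $\mathcal{A}=\sum_{i=1}^r\alpha_i\otimes\beta_i\otimes\gamma_i$ is $\mathcal{A}_{(1)}=\sum_i\alpha_i(\beta_i\otimes\gamma_i)^\top\in\mathbb{C}^{(\ell+1)\times(m+1)(n+1)}$,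 viewed as a linear map $S_{(1,1)}\to\mathbb{C}^{\ell+1}$ by identifying $e_k\otimes e_l\in \mathbb{C}^{m+1}\otimes\mathbb{C}^{n+1}$ with $x_ky_l$. Regularity Conjecture. For $(d,e)\ge(1,1)$ put $\mathcal{R}(m,n,(1,1))=\infty$ and otherwise $$\mathcal{R}(m,n,(d,e))=\frac{\mathrm{HF}_S(1,1)\,\mathrm{HF}_S(d-1,e-1)-\mathrm{HF}_S(d,e)}{\mathrm{HF}_S(d-1,e-1)-1}.$$ For $Z=(\zeta_1,\dots,\zeta_r)\in X^r$, let $J(Z)\subset S$ be the ideal generated by all $f\in S_{(1,1)}$ vanishing at $\zeta_1,\dots,\zeta_r$. Conjecture: let $d\ge1$ and let $m,n,r$ be such that $r\le\min\{\mathcal{R}(m,n,(d,1)),mn\}$. Then there is a Zariski open dense subset $U^\circ\subset X^r$ such that for all $Z\in U^\circ$: the evaluation functionals at $\zeta_1,\dots,\zeta_r$ on $S_{(1,1)}$ are linearly independent, $V_X(J(Z))=\{\zeta_1,\dots,\zeta_r\}$ consists of $r$ points of multiplicity one, and $\mathrm{HF}_{S/J(Z)}(d,1)=r$. Algorithm cpd_hnf (computes the rank-$r$ decomposition of $\mathcal{A}$; input $\mathcal{A}$ and $r$). (1) Compute a basis $f_1,\dots,f_s$ of $\ker\mathcal{A}_{(1)}\subset S_{(1,1)}$; let $I=\langle f_1,\dots,f_s\rangle$. For generic $\mathcal{A}$, $V_X(I)=\{(\beta_i,\gamma_i)\}_{i=1}^r$, with all points of multiplicity one. (2) Compute $V_X(I)$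 as follows. (2a) If $r\le m+1$ and $[\beta_1\cdots\beta_r]$ has rank $r$: let $N$ be an $r\times(m+1)(n+1)$ matrix representing the row space of $\mathcal{A}_{(1)}$, viewed as a map $S_{(1,1)}\to\mathbb{C}^r$. For a random $h_0\in S_{(0,1)}$ form the maps $f\mapsto N(h_0f)$ and $f\mapsto N(y_jf)$, $j=0,\dots,n$, on $S_{(1,0)}$, restrict them to an $r$-dimensional subspace $B\subset S_{(1,0)}$ on which the first one is invertible, and read off the coordinates of the $\gamma_i$ from the eigenvalues of the (simultaneously diagonalizable) matrices obtained by composing the inverse of the first map with the others; the $\beta_i$ are then found from the linear equations $f_j(x,\gamma_i)=0$, $j=1,\dots,s$. (2b) Otherwise: choose a tuple $(d,e)\in\mathbb{N}^2$ with $(d,e)\ne(1,1)$, $(d-1,e-1)\ge(0,0)$ and $\mathrm{HF}_{S/I}(d,e)=r$. Form the matrix $R_I(d,e)$ whose columns are the coefficient vectors, in the monomial basis of $S_{(d,e)}$, of all products $x^{a'}y^{b'}f_i$ with $|a'|=d-1$, $|b'|=e-1$, $1\le i\le s$. Compute an $r\times\mathrm{HF}_S(d,e)$ matrix $N$ representing the left null space of $R_I(d,e)$, viewed as a map $S_{(d,e)}\to\mathbb{C}^r$. For random $h_0\in S_{(d-1,e-1)}$ and $h\in S_{(d-2,e-1)}$ (for $d\ge2$; if $d=1$ the roles of $x$ and $y$ are swapped) form the maps $N_{h_0}:f\mapsto N(h_0f)$ and $N_k:f\mapsto N(x_khf)$, $k=0,\dots,m$, on $S_{(1,1)}$; by a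 QR factorization with column pivoting choose $r$ columns (spanning $B\subset S_{(1,1)}$) with $(N_{h_0})_{|B}$ invertible; simultaneously diagonalize the matrices $(N_{h_0})_{|B}^{-1}(N_k)_{|B}$; their eigenvalues give homogeneous coordinates of $\beta_1,\dots,\beta_r$. Then solve $f_1(\beta_i,y)=\dots=f_s(\beta_i,y)=0$ for $y=\gamma_i$. (2c) Refine each $(\beta_i,\gamma_i)$ by Newton iteration on $f_1=\dots=f_s=0$ (a fixed small number of steps). (3) Solve the linear system $\mathcal{A}_{(1)}=[\alpha_1\cdots\alpha_r]\,[\beta_1\otimes\gamma_1\cdots\beta_r\otimes\gamma_r]^\top$ for $\alpha_1,\dots,\alpha_r$. The tuple $(d,e)$ in (2b) is a parameter of the algorithm that determines its cost; the complexity statement concerns the algorithm with this degree selected suitably of the form $(d,1)$.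
   Formalization: Exact eigenvalues are not computable in finitely many arithmetic operations, so the eigendecomposition of a k×k diagonalizable matrix is taken as a correct subroutine charged O(k³) operations; all other steps are counted explicitly in exact arithmetic. *)

theory Defs
  imports
    Complex_Main
    "HOL-Library.Extended_Real"
    "HOL-Library.Product_Plus"
    "HOL-Library.Poly_Mapping"
    "HOL-Library.Extended_Nat"
    "HOL-Library.Monad_Syntax"
    "Jordan_Normal_Form.Matrix"
    "Jordan_Normal_Form.Gauss_Jordan_Elimination"
begin

section \<open>Zariski topology and genericity\<close>

text \<open>\<open>coord_space J\<close> is the affine space with coordinates indexed by \<open>J\<close>; its points are
  extended by zero.\<close>

definition coord_space :: "'i set \<Rightarrow> ('i \<Rightarrow> complex) set" where
  "coord_space J = {x. \<forall>i. i \<notin> J \<longrightarrow> x i = 0}"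

inductive_set polyfuns :: "(('i \<Rightarrow> complex) \<Rightarrow> complex) set" where
  const: "(\<lambda>x. c) \<in> polyfuns"
| coord: "(\<lambda>x. x i) \<in> polyfuns"
| add: "p \<in> polyfuns \<Longrightarrow> q \<in> polyfuns \<Longrightarrow> (\<lambda>x. p x + q x) \<in> polyfuns"
| mult: "p \<in> polyfuns \<Longrightarrow> q \<in> polyfuns \<Longrightarrow> (\<lambda>x. p x * q x) \<in> polyfuns"

definition zariski_open_in :: "('i \<Rightarrow> complex) set \<Rightarrow> ('i \<Rightarrow> complex) set \<Rightarrow> bool" where
  "zariski_open_in W U \<longleftrightarrow> (\<exists>P \<subseteq> polyfuns. U = {x \<in> W. \<exists>p\<in>P. p x \<noteq> 0})"

definition zariski_dense_in :: "('i \<Rightarrow> complex) set \<Rightarrow> ('i \<Rightarrow> complex) set \<Rightarrow> bool" where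
  "zariski_dense_in W U \<longleftrightarrow> U \<subseteq> W \<and> (\<forall>V. zariski_open_in W V \<and> V \<noteq> {} \<longrightarrow> U \<inter> V \<noteq> {})"

definition generically_in :: "('i \<Rightarrow> complex) set \<Rightarrow> (('i \<Rightarrow> complex) \<Rightarrow> bool) \<Rightarrow> bool" where
  "generically_in W Q \<longleftrightarrow>
     (\<exists>U. zariski_open_in W U \<and> zariski_dense_in W U \<and> (\<forall>x\<in>U. Q x))"


section \<open>The bigraded ring S\<close>

text \<open>The monomial \<open>x\<^sup>a y\<^sup>b\<close> is the pair \<open>(a, b)\<close> of exponent vectors.\<close>

type_synonym mono = "(nat \<Rightarrow>\<^sub>0 nat) \<times> (nat \<Rightarrow>\<^sub>0 nat)"
type_synonym bipoly = "mono \<Rightarrow>\<^sub>0 complex"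

definition mdeg :: "(nat \<Rightarrow>\<^sub>0 nat) \<Rightarrow> nat" where
  "mdeg a = (\<Sum>k\<in>Poly_Mapping.keys a. Poly_Mapping.lookup a k)"

definition S_ring :: "nat \<Rightarrow> nat \<Rightarrow> bipoly set" where
  "S_ring m n = {f. \<forall>(a, b)\<in>Poly_Mapping.keys f.
      Poly_Mapping.keys a \<subseteq> {..m} \<and> Poly_Mapping.keys b \<subseteq> {..n}}"

definition S_comp :: "nat \<Rightarrow> nat \<Rightarrow> nat \<Rightarrow> nat \<Rightarrow> bipoly set" where
  "S_comp m n d e =
     {f \<in> S_ring m n. \<forall>(a, b)\<in>Poly_Mapping.keys f. mdeg a = d \<and> mdeg b = e}"

definition monom :: "mono \<Rightarrow> bipoly" where
  "monom ab = Poly_Mapping.single ab 1"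

definition var_x :: "nat \<Rightarrow> nat \<Rightarrow>\<^sub>0 nat" where
  "var_x k = Poly_Mapping.single k 1"

definition peval :: "bipoly \<Rightarrow> (nat \<Rightarrow> complex) \<Rightarrow> (nat \<Rightarrow> complex) \<Rightarrow> complex" where
  "peval f x y = (\<Sum>(a, b)\<in>Poly_Mapping.keys f. Poly_Mapping.lookup f (a, b) *
      (\<Prod>k\<in>Poly_Mapping.keys a. x k ^ Poly_Mapping.lookup a k) *
      (\<Prod>l\<in>Poly_Mapping.keys b. y l ^ Poly_Mapping.lookup b l))"

definition pscale :: "complex \<Rightarrow> bipoly \<Rightarrow> bipoly" where
  "pscale c f = Poly_Mapping.single 0 c * f"

global_interpretation bp: vector_space pscale
proof
  fix a b :: complex and f g :: bipoly
  show "pscale a (f + g) = pscale a f + pscale a g"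
    by (simp add: pscale_def distrib_left)
  show "pscale (a + b) f = pscale a f + pscale b f"
    by (simp add: pscale_def single_add distrib_right)
  show "pscale a (pscale b f) = pscale (a * b) f"
    by (simp add: pscale_def mult.assoc[symmetric] mult_single)
  show "pscale 1 f = f"
    by (simp add: pscale_def)
qed

definition ideal_gen :: "nat \<Rightarrow> nat \<Rightarrow> bipoly set \<Rightarrow> bipoly set" where
  "ideal_gen m n F = {\<Sum>f\<in>G. q f * f | G q. finite G \<and> G \<subseteq> F \<and> (\<forall>f\<in>G. q f \<in> S_ring m n)}"

definition HF_S :: "nat \<Rightarrow> nat \<Rightarrow> nat \<Rightarrow> nat \<Rightarrow> nat" where
  "HF_S m n d e = bp.dim (S_comp m n d e)"

text \<open>The Hilbert function of \<open>S/I\<close>: the dimension of \<open>S\<^bsub>(d,e)\<^esub>/I\<^bsub>(d,e)\<^esub>\<close>.\<close>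

definition HF_quot :: "nat \<Rightarrow> nat \<Rightarrow> bipoly set \<Rightarrow> nat \<Rightarrow> nat \<Rightarrow> nat" where
  "HF_quot m n I d e = bp.dim (S_comp m n d e) - bp.dim (I \<inter> S_comp m n d e)"


section \<open>Points of the product of projective spaces\<close>

text \<open>Points of projective space are given by nonzero homogeneous coordinate vectors, up to
  \<open>proj_eq\<close>.\<close>

definition hcoords :: "nat \<Rightarrow> (nat \<Rightarrow> complex) set" where
  "hcoords m = {x \<in> coord_space {..m}. \<exists>k. x k \<noteq> 0}"

definition proj_eq :: "(nat \<Rightarrow> complex) \<Rightarrow> (nat \<Rightarrow> complex) \<Rightarrow> bool" where
  "proj_eq x x' \<longleftrightarrow> (\<exists>c. c \<noteq> 0 \<and> x' = (\<lambda>k. c * x k))"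

definition same_point ::
  "(nat \<Rightarrow> complex) \<times> (nat \<Rightarrow> complex) \<Rightarrow> (nat \<Rightarrow> complex) \<times> (nat \<Rightarrow> complex) \<Rightarrow> bool" where
  "same_point p p' \<longleftrightarrow> proj_eq (fst p) (fst p') \<and> proj_eq (snd p) (snd p')"

definition V_X :: "nat \<Rightarrow> nat \<Rightarrow> bipoly set \<Rightarrow> ((nat \<Rightarrow> complex) \<times> (nat \<Rightarrow> complex)) set" where
  "V_X m n I = {(x, y) \<in> hcoords m \<times> hcoords n. \<forall>f\<in>I. peval f x y = 0}"

text \<open>Contraction to \<open>S\<close> of the extension of \<open>I\<close> to the local ring of \<open>X\<close> at \<open>p\<close>.\<close>

definition local_ideal ::
  "nat \<Rightarrow> nat \<Rightarrow> bipoly set \<Rightarrow> (nat \<Rightarrow> complex) \<times> (nat \<Rightarrow> complex) \<Rightarrow> bipoly set" where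
  "local_ideal m n I p = {g \<in> S_ring m n.
     \<exists>d e. \<exists>v \<in> S_comp m n d e. peval v (fst p) (snd p) \<noteq> 0 \<and> v * g \<in> I}"

text \<open>The multiplicity of \<open>p\<close> on the scheme of \<open>I\<close> is the dimension of the local ring
  \<open>O\<^bsub>X,p\<^esub>/I O\<^bsub>X,p\<^esub>\<close>. This is the directed union, over the bidegrees, of the spaces of fractions
  \<open>g/u\<close> with \<open>g, u\<close> of bidegree \<open>(d, e)\<close> and \<open>u\<close> fixed with \<open>u(p) \<noteq> 0\<close>; modulo \<open>I\<close> the space of
  bidegree \<open>(d, e)\<close> is isomorphic to that graded piece of \<open>S/local_ideal\<close>.\<close>

definition multiplicity_at ::
  "nat \<Rightarrow> nat \<Rightarrow> bipoly set \<Rightarrow> (nat \<Rightarrow> complex) \<times> (nat \<Rightarrow> complex) \<Rightarrow> enat" where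
  "multiplicity_at m n I p = (SUP (d, e) \<in> UNIV. enat (HF_quot m n (local_ideal m n I p) d e))"


section \<open>The Regularity Conjecture\<close>

definition reg_bound :: "nat \<Rightarrow> nat \<Rightarrow> nat \<Rightarrow> nat \<Rightarrow> ereal" where
  "reg_bound m n d e = (if (d, e) = (1, 1) then \<infinity> else
     ereal ((real (HF_S m n 1 1) * real (HF_S m n (d - 1) (e - 1)) - real (HF_S m n d e)) /
            (real (HF_S m n (d - 1) (e - 1)) - 1)))"

text \<open>A configuration of \<open>r\<close> points: \<open>z (i, Inl k)\<close> and \<open>z (i, Inr l)\<close> are the homogeneous
  coordinates \<open>x\<^sub>k\<close> and \<open>y\<^sub>l\<close> of the point with index \<open>i\<close>.\<close>

definition config_pt ::
  "(nat \<times> (nat + nat) \<Rightarrow> complex) \<Rightarrow> nat \<Rightarrow> (nat \<Rightarrow> complex) \<times> (nat \<Rightarrow> complex)" where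
  "config_pt z i = ((\<lambda>k. z (i, Inl k)), (\<lambda>l. z (i, Inr l)))"

definition configs :: "nat \<Rightarrow> nat \<Rightarrow> nat \<Rightarrow> (nat \<times> (nat + nat) \<Rightarrow> complex) set" where
  "configs m n r = {z \<in> coord_space ({..<r} \<times> (Inl ` {..m} \<union> Inr ` {..n})).
     \<forall>i<r. config_pt z i \<in> hcoords m \<times> hcoords n}"

text \<open>\<open>X\<^sup>r\<close> carries the quotient topology of \<open>configs m n r\<close>: its open sets correspond to the open
  sets of the latter that are closed under rescaling.\<close>

definition scaling_closed ::
  "nat \<Rightarrow> nat \<Rightarrow> nat \<Rightarrow> (nat \<times> (nat + nat) \<Rightarrow> complex) set \<Rightarrow> bool" where
  "scaling_closed m n r U \<longleftrightarrow> (\<forall>z\<in>U. \<forall>z'\<in>configs m n r.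
     (\<forall>i<r. same_point (config_pt z i) (config_pt z' i)) \<longrightarrow> z' \<in> U)"

definition ideal_J :: "nat \<Rightarrow> nat \<Rightarrow> nat \<Rightarrow> (nat \<times> (nat + nat) \<Rightarrow> complex) \<Rightarrow> bipoly set" where
  "ideal_J m n r z = ideal_gen m n
     {f \<in> S_comp m n 1 1. \<forall>i<r. peval f (fst (config_pt z i)) (snd (config_pt z i)) = 0}"

definition indep_evaluations ::
  "nat \<Rightarrow> nat \<Rightarrow> nat \<Rightarrow> (nat \<times> (nat + nat) \<Rightarrow> complex) \<Rightarrow> bool" where
  "indep_evaluations m n r z \<longleftrightarrow> (\<forall>c :: nat \<Rightarrow> complex.
     (\<forall>f\<in>S_comp m n 1 1.
        (\<Sum>i<r. c i * peval f (fst (config_pt z i)) (snd (config_pt z i))) = 0) \<longrightarrow>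
     (\<forall>i<r. c i = 0))"

definition reduced_zero_set ::
  "nat \<Rightarrow> nat \<Rightarrow> nat \<Rightarrow> bipoly set \<Rightarrow> (nat \<times> (nat + nat) \<Rightarrow> complex) \<Rightarrow> bool" where
  "reduced_zero_set m n r I z \<longleftrightarrow>
     V_X m n I = {p. \<exists>i<r. same_point (config_pt z i) p} \<and>
     (\<forall>i<r. \<forall>j<r. i \<noteq> j \<longrightarrow> \<not> same_point (config_pt z i) (config_pt z j)) \<and>
     (\<forall>i<r. multiplicity_at m n I (config_pt z i) = 1)"

definition regularity_conjecture :: bool where
  "regularity_conjecture \<longleftrightarrow> (\<forall>d m n r :: nat.
     1 \<le> d \<and> 0 < m \<and> 0 < n \<and> ereal (real r) \<le> min (reg_bound m n d 1) (ereal (real (m * n))) \<longrightarrow>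
     (\<exists>U. zariski_open_in (configs m n r) U \<and> zariski_dense_in (configs m n r) U \<and>
          scaling_closed m n r U \<and>
          (\<forall>z\<in>U. indep_evaluations m n r z \<and>
                 reduced_zero_set m n r (ideal_J m n r z) z \<and>
                 HF_quot m n (ideal_J m n r z) d 1 = r)))"


section \<open>Tensors\<close>

type_synonym tensor = "nat \<times> nat \<times> nat \<Rightarrow> complex"

definition tensor_space :: "nat \<Rightarrow> nat \<Rightarrow> nat \<Rightarrow> tensor set" where
  "tensor_space l m n = coord_space ({..l} \<times> {..m} \<times> {..n})"

definition tensor_of ::
  "nat \<Rightarrow> nat \<Rightarrow> nat \<Rightarrow> (complex vec \<times> complex vec \<times> complex vec) list \<Rightarrow> tensor" where
  "tensor_of l m n ts = (\<lambda>(i, j, k). if i \<le> l \<and> j \<le> m \<and> k \<le> n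
      then \<Sum>(a, b, c)\<leftarrow>ts. a $ i * b $ j * c $ k else 0)"

definition is_decomposition ::
  "nat \<Rightarrow> nat \<Rightarrow> nat \<Rightarrow> nat \<Rightarrow> tensor \<Rightarrow> (complex vec \<times> complex vec \<times> complex vec) list \<Rightarrow> bool" where
  "is_decomposition l m n r A ts \<longleftrightarrow> length ts = r \<and>
     (\<forall>(a, b, c)\<in>set ts.
        a \<in> carrier_vec (l + 1) \<and> b \<in> carrier_vec (m + 1) \<and> c \<in> carrier_vec (n + 1)) \<and>
     A = tensor_of l m n ts"

definition tensor_rank :: "nat \<Rightarrow> nat \<Rightarrow> nat \<Rightarrow> tensor \<Rightarrow> nat" where
  "tensor_rank l m n A = (LEAST r. \<exists>ts. is_decomposition l m n r A ts)"

definition tensors_of_rank :: "nat \<Rightarrow> nat \<Rightarrow> nat \<Rightarrow> nat \<Rightarrow> tensor set" where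
  "tensors_of_rank l m n r = {A \<in> tensor_space l m n. tensor_rank l m n A = r}"

text \<open>The 1-flattening; column \<open>k (n + 1) + c\<close> belongs to the monomial \<open>x\<^sub>k y\<^sub>c\<close>.\<close>

definition flattening1 :: "nat \<Rightarrow> nat \<Rightarrow> nat \<Rightarrow> tensor \<Rightarrow> complex mat" where
  "flattening1 l m n A = mat (l + 1) ((m + 1) * (n + 1))
     (\<lambda>(i, j). A (i, j div (n + 1), j mod (n + 1)))"

definition coeffs11 :: "nat \<Rightarrow> nat \<Rightarrow> bipoly \<Rightarrow> complex vec" where
  "coeffs11 m n f = vec ((m + 1) * (n + 1))
     (\<lambda>j. Poly_Mapping.lookup f (var_x (j div (n + 1)), var_x (j mod (n + 1))))"

definition cpd_ideal :: "nat \<Rightarrow> nat \<Rightarrow> nat \<Rightarrow> tensor \<Rightarrow> bipoly set" where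
  "cpd_ideal l m n A = ideal_gen m n
     {f \<in> S_comp m n 1 1. flattening1 l m n A *\<^sub>v coeffs11 m n f = 0\<^sub>v (l + 1)}"


section \<open>Counting operations\<close>

text \<open>A computation is a value together with the number of operations spent. An operation is an
  arithmetic operation on numbers, a conjugation, a squared modulus, a real square root, or a
  comparison of numbers. Moving and copying numbers and the bookkeeping of indices are free.\<close>

type_synonym 'a timed = "'a \<times> nat"

definition ret :: "'a \<Rightarrow> 'a timed" where
  "ret x = (x, 0)"

definition bindT :: "'a timed \<Rightarrow> ('a \<Rightarrow> 'b timed) \<Rightarrow> 'b timed" where
  "bindT M f = (fst (f (fst M)), snd M + snd (f (fst M)))"

adhoc_overloading Monad_Syntax.bind \<rightleftharpoons> bindT

definition addT :: "'a::plus \<Rightarrow> 'a \<Rightarrow> 'a timed" where "addT x y = (x + y, 1)"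
definition subT :: "'a::minus \<Rightarrow> 'a \<Rightarrow> 'a timed" where "subT x y = (x - y, 1)"
definition negT :: "'a::uminus \<Rightarrow> 'a timed" where "negT x = (- x, 1)"
definition mulT :: "'a::times \<Rightarrow> 'a \<Rightarrow> 'a timed" where "mulT x y = (x * y, 1)"
definition divT :: "'a::divide \<Rightarrow> 'a \<Rightarrow> 'a timed" where "divT x y = (x div y, 1)"
definition is_zeroT :: "'a::zero \<Rightarrow> bool timed" where "is_zeroT x = (x = 0, 1)"
definition lessT :: "real \<Rightarrow> real \<Rightarrow> bool timed" where "lessT x y = (x < y, 1)"
definition cnjT :: "complex \<Rightarrow> complex timed" where "cnjT z = (cnj z, 1)"
definition sqmodT :: "complex \<Rightarrow> real timed" where "sqmodT z = ((cmod z)\<^sup>2, 1)"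
definition sqrtT :: "real \<Rightarrow> real timed" where "sqrtT x = (sqrt x, 1)"

fun mapT :: "('a \<Rightarrow> 'b timed) \<Rightarrow> 'a list \<Rightarrow> 'b list timed" where
  "mapT f [] = ret []"
| "mapT f (x # xs) = do { y \<leftarrow> f x; ys \<leftarrow> mapT f xs; ret (y # ys) }"

fun foldT :: "('a \<Rightarrow> 's \<Rightarrow> 's timed) \<Rightarrow> 'a list \<Rightarrow> 's \<Rightarrow> 's timed" where
  "foldT f [] s = ret s"
| "foldT f (x # xs) s = do { s' \<leftarrow> f x s; foldT f xs s' }"

fun sumT :: "nat \<Rightarrow> (nat \<Rightarrow> 'a::comm_monoid_add timed) \<Rightarrow> 'a timed" where
  "sumT 0 f = ret 0"
| "sumT (Suc k) f = do { s \<leftarrow> sumT k f; t \<leftarrow> f k; addT s t }"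

definition vecT :: "nat \<Rightarrow> (nat \<Rightarrow> 'a timed) \<Rightarrow> 'a vec timed" where
  "vecT k f = (vec k (\<lambda>i. fst (f i)), \<Sum>i<k. snd (f i))"

definition matT :: "nat \<Rightarrow> nat \<Rightarrow> (nat \<Rightarrow> nat \<Rightarrow> 'a timed) \<Rightarrow> 'a mat timed" where
  "matT nr nc f = (mat nr nc (\<lambda>(i, j). fst (f i j)), \<Sum>i<nr. \<Sum>j<nc. snd (f i j))"

definition mat_mulT :: "complex mat \<Rightarrow> complex mat \<Rightarrow> complex mat timed" where
  "mat_mulT A B = matT (dim_row A) (dim_col B)
     (\<lambda>i j. sumT (dim_col A) (\<lambda>k. mulT (A $$ (i, k)) (B $$ (k, j))))"


section \<open>Linear algebra subroutines\<close>

fun find_pivotT :: "complex mat \<Rightarrow> nat \<Rightarrow> nat list \<Rightarrow> nat option timed" where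
  "find_pivotT A j [] = ret None"
| "find_pivotT A j (i # is) = do {
     z \<leftarrow> is_zeroT (A $$ (i, j));
     if z then find_pivotT A j is else ret (Some i) }"

text \<open>Gauss--Jordan elimination; the list collects the pivot columns, its position \<open>p\<close> belonging
  to row \<open>p\<close>.\<close>

definition gauss_stepT :: "nat \<Rightarrow> complex mat \<times> nat list \<Rightarrow> (complex mat \<times> nat list) timed" where
  "gauss_stepT j s = (case s of (A, ps) \<Rightarrow> (let p = length ps in do {
     q \<leftarrow> find_pivotT A j [p..<dim_row A];
     (case q of
        None \<Rightarrow> ret (A, ps)
      | Some i \<Rightarrow> do {
          let B = swaprows i p A;
          C \<leftarrow> matT (dim_row A) (dim_col A) (\<lambda>k c.
                 if k = p then divT (B $$ (p, c)) (B $$ (p, j)) else ret (B $$ (k, c)));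
          D \<leftarrow> matT (dim_row A) (dim_col A) (\<lambda>k c.
                 if k = p then ret (C $$ (p, c))
                 else do { t \<leftarrow> mulT (C $$ (k, j)) (C $$ (p, c)); subT (C $$ (k, c)) t });
          ret (D, ps @ [j]) }) }))"

definition rrefT :: "nat \<Rightarrow> complex mat \<Rightarrow> (complex mat \<times> nat list) timed" where
  "rrefT nc A = foldT gauss_stepT [0..<nc] (A, [])"

definition pivot_row :: "nat list \<Rightarrow> nat \<Rightarrow> nat option" where
  "pivot_row ps c = map_of (zip ps [0..<length ps]) c"

definition null_basisT :: "complex mat \<times> nat list \<Rightarrow> complex vec list timed" where
  "null_basisT s = (case s of (R, ps) \<Rightarrow>
     mapT (\<lambda>j. vecT (dim_col R) (\<lambda>c. case pivot_row ps c of
                Some p \<Rightarrow> negT (R $$ (p, j))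
              | None \<Rightarrow> ret (if c = j then 1 else 0)))
       (filter (\<lambda>j. j \<notin> set ps) [0..<dim_col R]))"

definition kernelT :: "complex mat \<Rightarrow> complex vec list timed" where
  "kernelT A = do { s \<leftarrow> rrefT (dim_col A) A; null_basisT s }"

text \<open>A solution \<open>X\<close> of the consistent system \<open>A X = B\<close>, free variables being set to zero.\<close>

definition solveT :: "complex mat \<Rightarrow> complex mat \<Rightarrow> complex mat timed" where
  "solveT A B = (let nc = dim_col A in do {
     (R, ps) \<leftarrow> rrefT nc (mat (dim_row A) (nc + dim_col B)
        (\<lambda>(i, j). if j < nc then A $$ (i, j) else B $$ (i, j - nc)));
     ret (mat nc (dim_col B) (\<lambda>(i, j). case pivot_row ps i of
            Some p \<Rightarrow> R $$ (p, nc + j)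
          | None \<Rightarrow> 0)) })"

text \<open>QR factorization with column pivoting by the modified Gram--Schmidt process. Only the list
  of pivot columns is kept; its length is the rank if the number \<open>r\<close> of steps is large enough.\<close>

definition argmaxT :: "real list \<Rightarrow> nat timed" where
  "argmaxT xs = foldT (\<lambda>j b. do { t \<leftarrow> lessT (xs ! b) (xs ! j); ret (if t then j else b) })
     [1..<length xs] 0"

definition qr_stepT :: "complex mat \<times> nat list \<Rightarrow> (complex mat \<times> nat list) timed" where
  "qr_stepT s = (case s of (W, js) \<Rightarrow> do {
     ns \<leftarrow> mapT (\<lambda>j. sumT (dim_row W) (\<lambda>i. sqmodT (W $$ (i, j)))) [0..<dim_col W];
     p \<leftarrow> argmaxT ns;
     z \<leftarrow> is_zeroT (ns ! p);
     if z then ret (W, js) else do {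
       s \<leftarrow> sqrtT (ns ! p);
       q \<leftarrow> vecT (dim_row W) (\<lambda>i. divT (W $$ (i, p)) (complex_of_real s));
       R \<leftarrow> vecT (dim_col W) (\<lambda>j. sumT (dim_row W) (\<lambda>i. do {
              c \<leftarrow> cnjT (q $ i); mulT c (W $$ (i, j)) }));
       W' \<leftarrow> matT (dim_row W) (dim_col W) (\<lambda>i j. do {
              t \<leftarrow> mulT (q $ i) (R $ j); subT (W $$ (i, j)) t });
       ret (W', js @ [p]) } })"

definition qr_pivotsT :: "nat \<Rightarrow> complex mat \<Rightarrow> nat list timed" where
  "qr_pivotsT r N = do { (W, js) \<leftarrow> foldT (\<lambda>_. qr_stepT) [0..<r] (N, []); ret js }"

text \<open>Eigenvalues cannot be computed by finitely many of the above operations. As usual in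
  numerical linear algebra, the eigendecomposition of a diagonalizable \<open>k \<times> k\<close> matrix is a
  subroutine with \<open>O(k\<^sup>3)\<close> operations, which returns an invertible matrix of eigenvectors.\<close>

definition diagonalizable :: "complex mat \<Rightarrow> bool" where
  "diagonalizable A \<longleftrightarrow> (\<exists>D. diagonal_mat D \<and> similar_mat A D)"

definition eigensolver :: "(complex mat \<Rightarrow> complex mat timed) \<Rightarrow> bool" where
  "eigensolver eig \<longleftrightarrow> (\<exists>c. \<forall>k. \<forall>A \<in> carrier_mat k k. diagonalizable A \<longrightarrow>
     fst (eig A) \<in> carrier_mat k k \<and> invertible_mat (fst (eig A)) \<and>
     (\<exists>D \<in> carrier_mat k k. diagonal_mat D \<and> A * fst (eig A) = fst (eig A) * D) \<and>
     snd (eig A) \<le> c * k ^ 3)"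


section \<open>The algorithm cpd\_hnf\<close>

text \<open>The random numbers used by the algorithm: the coefficients of \<open>h\<^sub>0\<close> in the first case of the
  second step, those of \<open>h\<^sub>0\<close> and \<open>h\<close> in the second case, and the weights of the linear combination
  used for simultaneous diagonalization.\<close>

datatype rvar = RLin nat | RH0 nat | RH nat | RMix nat

type_synonym rand = "rvar \<Rightarrow> complex"

text \<open>Exponents of degree \<open>d\<close> in the variables \<open>0, \<dots>, m\<close>.\<close>

fun expos :: "nat \<Rightarrow> nat \<Rightarrow> (nat \<Rightarrow>\<^sub>0 nat) list" where
  "expos 0 d = [Poly_Mapping.single 0 d]"
| "expos (Suc m) d =
     concat (map (\<lambda>k. map (\<lambda>a. a + Poly_Mapping.single (Suc m) k) (expos m (d - k))) [0..<Suc d])"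

definition monlist :: "nat \<Rightarrow> nat \<Rightarrow> nat \<Rightarrow> nat \<Rightarrow> mono list" where
  "monlist m n d e = List.product (expos m d) (expos n e)"

lemma expos_1: "expos m (Suc 0) = map var_x [0..<Suc m]"
proof -
  have expos_0: "expos m 0 = [0]" for m by (induction m) auto
  show ?thesis by (induction m) (auto simp: var_x_def expos_0)
qed

text \<open>The order of \<open>monlist m n 1 1\<close> is that of the columns of the flattening.\<close>

lemma monlist_11_nth:
  assumes "k \<le> m" "l \<le> n"
  shows "monlist m n 1 1 ! (k * (n + 1) + l) = (var_x k, var_x l)"
proof -
  have "k * Suc n + l < Suc m * Suc n"
  proof -
    have "k * Suc n + l < Suc k * Suc n" using assms(2) by simp
    also have "\<dots> \<le> Suc m * Suc n" using assms(1) by (intro mult_le_mono1) simp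
    finally show ?thesis .
  qed
  moreover have "(k * Suc n + l) div Suc n = k" "(k * Suc n + l) mod Suc n = l"
    using assms(2) by (simp_all del: mult_Suc_right)
  ultimately show ?thesis using assms
    by (simp add: monlist_def expos_1 product_nth del: upt_Suc)
qed

text \<open>The polynomial with given coefficients with respect to a list of distinct monomials.\<close>

definition poly_of :: "mono list \<Rightarrow> (nat \<Rightarrow> complex) \<Rightarrow> bipoly" where
  "poly_of ms c = (\<Sum>i<length ms. Poly_Mapping.single (ms ! i) (c i))"

text \<open>The columns are the coefficient vectors of the products of the monomials in
  \<open>monlist m n (d - 1) (e - 1)\<close> with the polynomials in \<open>F \<subseteq> S\<^bsub>(1,1)\<^esub>\<close>, which are given by their
  coefficient vectors. Multiplication by a monomial merely moves coefficients.\<close>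

definition resultant_map ::
  "nat \<Rightarrow> nat \<Rightarrow> nat \<Rightarrow> nat \<Rightarrow> complex vec list \<Rightarrow> complex mat" where
  "resultant_map m n d e F =
     (let ms = monlist m n d e; cs = List.product (monlist m n (d - 1) (e - 1)) F
      in mat (length ms) (length cs) (\<lambda>(i, j). case cs ! j of (ab, f) \<Rightarrow>
           Poly_Mapping.lookup (monom ab * poly_of (monlist m n 1 1) (\<lambda>c. f $ c)) (ms ! i)))"

text \<open>The matrix of \<open>f \<mapsto> N (g f)\<close> on the span of \<open>us\<close>, where \<open>N\<close> acts on the span of \<open>ms\<close>.\<close>

definition mult_mapT :: "complex mat \<Rightarrow> mono list \<Rightarrow> bipoly \<Rightarrow> mono list \<Rightarrow> complex mat timed" where
  "mult_mapT N ms g us = matT (dim_row N) (length us) (\<lambda>i c.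
     sumT (length ms) (\<lambda>q.
       mulT (N $$ (i, q)) (Poly_Mapping.lookup (g * monom (us ! c)) (ms ! q))))"

text \<open>Simultaneous diagonalization of the matrices \<open>N0\<^sub>B\<^sup>-\<^sup>1 N\<^sub>B\<close>, \<open>N \<in> set Ns\<close>, where \<open>B\<close> is spanned by
  the columns \<open>js\<close>: the eigenvectors of a random linear combination diagonalize all of them. The
  result lists, for each eigenvector, the vector of its eigenvalues.\<close>

definition joint_eigenvaluesT ::
  "(complex mat \<Rightarrow> complex mat timed) \<Rightarrow> rand \<Rightarrow> nat \<Rightarrow> nat list \<Rightarrow> complex mat \<Rightarrow> complex mat list
    \<Rightarrow> complex vec list timed" where
  "joint_eigenvaluesT eig \<rho> r js N0 Ns = do {
     let restr = (\<lambda>N. mat r r (\<lambda>(i, j). N $$ (i, js ! j)));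
     Ms \<leftarrow> mapT (\<lambda>N. solveT (restr N0) (restr N)) Ns;
     M \<leftarrow> matT r r (\<lambda>i j. sumT (length Ms) (\<lambda>k. mulT (\<rho> (RMix k)) ((Ms ! k) $$ (i, j))));
     V \<leftarrow> eig M;
     Ds \<leftarrow> mapT (\<lambda>M'. do { P \<leftarrow> mat_mulT M' V; solveT V P }) Ms;
     ret (map (\<lambda>i. vec (length Ds) (\<lambda>k. (Ds ! k) $$ (i, i))) [0..<r]) }"

text \<open>Coefficient vectors after exchanging \<open>x\<close> and \<open>y\<close>.\<close>

definition swap_coeffs :: "nat \<Rightarrow> nat \<Rightarrow> complex vec \<Rightarrow> complex vec" where
  "swap_coeffs m n f = vec ((n + 1) * (m + 1)) (\<lambda>j. f $ ((j mod (m + 1)) * (n + 1) + j div (m + 1)))"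

text \<open>A solution \<open>y\<close> of the linear equations \<open>f(\<beta>, y) = 0\<close>, \<open>f \<in> set F\<close>.\<close>

definition solve_yT :: "nat \<Rightarrow> nat \<Rightarrow> complex vec list \<Rightarrow> complex vec \<Rightarrow> complex vec timed" where
  "solve_yT m n F \<beta> = do {
     G \<leftarrow> matT (length F) (n + 1) (\<lambda>j c.
            sumT (m + 1) (\<lambda>k. mulT ((F ! j) $ (k * (n + 1) + c)) (\<beta> $ k)));
     K \<leftarrow> kernelT G;
     ret (case K of [] \<Rightarrow> 0\<^sub>v (n + 1) | y # _ \<Rightarrow> y) }"

text \<open>Step (2a). For almost all \<open>h\<^sub>0\<close>, the map \<open>f \<mapsto> N (h\<^sub>0 f)\<close> on \<open>S\<^bsub>(1,0)\<^esub>\<close> has rank \<open>r\<close> if and only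
  if \<open>[\<beta>\<^sub>1 \<dots> \<beta>\<^sub>r]\<close> has; this is how the condition of (2a) is tested. The result is \<open>None\<close> if it
  fails.\<close>

definition step_2aT ::
  "(complex mat \<Rightarrow> complex mat timed) \<Rightarrow> rand \<Rightarrow> nat \<Rightarrow> nat \<Rightarrow> nat \<Rightarrow> complex vec list \<Rightarrow> complex mat
    \<Rightarrow> (complex vec \<times> complex vec) list option timed" where
  "step_2aT eig \<rho> m n r F N =
    (if r \<le> m + 1 then do {
       let us = monlist m n 1 0;
       let h0 = poly_of (monlist m n 0 1) (\<lambda>c. \<rho> (RLin c));
       N0 \<leftarrow> mult_mapT N (monlist m n 1 1) h0 us;
       js \<leftarrow> qr_pivotsT r N0;
       if length js \<noteq> r then ret None else do {
         Ns \<leftarrow> mapT (\<lambda>j. mult_mapT N (monlist m n 1 1) (monom (0, var_x j)) us) [0..<n + 1];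
         \<gamma>s \<leftarrow> joint_eigenvaluesT eig \<rho> r js N0 Ns;
         ps \<leftarrow> mapT (\<lambda>\<gamma>. do { \<beta> \<leftarrow> solve_yT n m (map (swap_coeffs m n) F) \<gamma>; ret (\<beta>, \<gamma>) }) \<gamma>s;
         ret (Some ps) } }
     else ret None)"

text \<open>Step (2b) for \<open>d \<ge> 2\<close>. The dimension of the left null space is the Hilbert function of \<open>S/I\<close>
  at \<open>(d, e)\<close>, so the first test checks that the degree is admissible.\<close>

definition step_2bT ::
  "(complex mat \<Rightarrow> complex mat timed) \<Rightarrow> rand \<Rightarrow> nat \<Rightarrow> nat \<Rightarrow> nat \<Rightarrow> nat \<Rightarrow> nat \<Rightarrow> complex vec list
    \<Rightarrow> (complex vec \<times> complex vec) list option timed" where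
  "step_2bT eig \<rho> m n d e r F = do {
     let ms = monlist m n d e;
     K \<leftarrow> kernelT (transpose_mat (resultant_map m n d e F));
     if length K \<noteq> r then ret None else do {
       let N = mat_of_rows (length ms) K;
       let h0 = poly_of (monlist m n (d - 1) (e - 1)) (\<lambda>c. \<rho> (RH0 c));
       let h = poly_of (monlist m n (d - 2) (e - 1)) (\<lambda>c. \<rho> (RH c));
       N0 \<leftarrow> mult_mapT N ms h0 (monlist m n 1 1);
       js \<leftarrow> qr_pivotsT r N0;
       if length js \<noteq> r then ret None else do {
         Ns \<leftarrow> mapT (\<lambda>k. mult_mapT N ms (monom (var_x k, 0) * h) (monlist m n 1 1)) [0..<m + 1];
         \<beta>s \<leftarrow> joint_eigenvaluesT eig \<rho> r js N0 Ns;
         ps \<leftarrow> mapT (\<lambda>\<beta>. do { \<gamma> \<leftarrow> solve_yT m n F \<beta>; ret (\<beta>, \<gamma>) }) \<beta>s;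
         ret (Some ps) } } }"

text \<open>Step (2c). One Gauss--Newton step for \<open>f(\<beta>, \<gamma>) = 0\<close>, \<open>f \<in> set F\<close>, in homogeneous coordinates,
  with the correction orthogonal to \<open>\<beta>\<close> and to \<open>\<gamma>\<close>; the overdetermined linear system is solved in
  the least squares sense by the normal equations.\<close>

definition newton_stepT ::
  "nat \<Rightarrow> nat \<Rightarrow> complex vec list \<Rightarrow> complex vec \<times> complex vec \<Rightarrow> (complex vec \<times> complex vec) timed" where
  "newton_stepT m n F p = (case p of (\<beta>, \<gamma>) \<Rightarrow> (let s = length F; w = (m + 1) + (n + 1) in do {
     J \<leftarrow> matT (s + 2) w (\<lambda>j c.
       if j < s then
         (if c < m + 1
          then sumT (n + 1) (\<lambda>l. mulT ((F ! j) $ (c * (n + 1) + l)) (\<gamma> $ l))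
          else sumT (m + 1) (\<lambda>k. mulT ((F ! j) $ (k * (n + 1) + (c - (m + 1)))) (\<beta> $ k)))
       else if j = s then (if c < m + 1 then cnjT (\<beta> $ c) else ret 0)
       else (if c < m + 1 then ret 0 else cnjT (\<gamma> $ (c - (m + 1)))));
     b \<leftarrow> matT (s + 2) 1 (\<lambda>j _.
       if j < s then do { v \<leftarrow> sumT (m + 1) (\<lambda>k. mulT (J $$ (j, k)) (\<beta> $ k)); negT v }
       else ret 0);
     Jh \<leftarrow> matT w (s + 2) (\<lambda>c j. cnjT (J $$ (j, c)));
     H \<leftarrow> mat_mulT Jh J;
     g \<leftarrow> mat_mulT Jh b;
     \<Delta> \<leftarrow> solveT H g;
     \<beta>' \<leftarrow> vecT (m + 1) (\<lambda>k. addT (\<beta> $ k) (\<Delta> $$ (k, 0)));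
     \<gamma>' \<leftarrow> vecT (n + 1) (\<lambda>l. addT (\<gamma> $ l) (\<Delta> $$ ((m + 1) + l, 0)));
     ret (\<beta>', \<gamma>') }))"

definition newtonT ::
  "nat \<Rightarrow> nat \<Rightarrow> nat \<Rightarrow> complex vec list \<Rightarrow> complex vec \<times> complex vec \<Rightarrow> (complex vec \<times> complex vec) timed" where
  "newtonT steps m n F p = foldT (\<lambda>_. newton_stepT m n F) [0..<steps] p"

text \<open>Step (3); the rows of the solution are the \<open>\<alpha>\<^sub>i\<close>.\<close>

definition step_3T ::
  "nat \<Rightarrow> nat \<Rightarrow> complex mat \<Rightarrow> (complex vec \<times> complex vec) list
    \<Rightarrow> (complex vec \<times> complex vec \<times> complex vec) list timed" where
  "step_3T m n A1 ps = do {
     K \<leftarrow> matT ((m + 1) * (n + 1)) (length ps)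
            (\<lambda>j i. mulT (fst (ps ! i) $ (j div (n + 1))) (snd (ps ! i) $ (j mod (n + 1))));
     Y \<leftarrow> solveT K (transpose_mat A1);
     ret (map (\<lambda>i. (row Y i, ps ! i)) [0..<length ps]) }"

text \<open>The parameters are the eigenvalue subroutine, the number of Newton steps, the degree
  \<open>(d, e)\<close> and the random numbers. The result is \<open>None\<close> on failure.\<close>

definition cpd_hnf ::
  "(complex mat \<Rightarrow> complex mat timed) \<Rightarrow> nat \<Rightarrow> nat \<Rightarrow> nat \<Rightarrow> rand \<Rightarrow> nat \<Rightarrow> nat \<Rightarrow> nat \<Rightarrow> tensor \<Rightarrow> nat
    \<Rightarrow> (complex vec \<times> complex vec \<times> complex vec) list option timed" where
  "cpd_hnf eig steps d e \<rho> l m n A r = do {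
     let A1 = flattening1 l m n A;
     (R, pc) \<leftarrow> rrefT ((m + 1) * (n + 1)) A1;
     F \<leftarrow> null_basisT (R, pc);
     if length pc \<noteq> r then ret None else do {
       let N = mat r ((m + 1) * (n + 1)) (\<lambda>(i, j). R $$ (i, j));
       qa \<leftarrow> step_2aT eig \<rho> m n r F N;
       q \<leftarrow> (case qa of
          Some ps \<Rightarrow> ret (Some ps)
        | None \<Rightarrow>
            if 2 \<le> d then step_2bT eig \<rho> m n d e r F
            else do {
              qb \<leftarrow> step_2bT eig \<rho> n m e d r (map (swap_coeffs m n) F);
              ret (map_option (map prod.swap) qb) });
       (case q of
          None \<Rightarrow> ret None
        | Some ps \<Rightarrow> do {
            ps' \<leftarrow> mapT (newtonT steps m n F) ps;
            ts \<leftarrow> step_3T m n A1 ps';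
            ret (Some ts) }) } }"

text \<open>The space of the random numbers that \<open>cpd_hnf\<close> may read.\<close>

definition rand_space :: "nat \<Rightarrow> nat \<Rightarrow> nat \<Rightarrow> nat \<Rightarrow> rand set" where
  "rand_space m n d e =
    (let dh = (if 2 \<le> d then monlist m n (d - 2) (e - 1) else monlist n m (e - 2) (d - 1))
     in coord_space (RLin ` {..n} \<union> RH0 ` {..<length (monlist m n (d - 1) (e - 1))} \<union>
          RH ` {..<length dh} \<union> RMix ` {..max m n}))"

end

(* The cost bound reduces to the degree d = max 2 (ceiling (1 / (1 - phi))). Since
   R(m,n,(d,1)) >= m n (1 - 1/d) >= phi m n, the Regularity Conjecture applies to r and d, and it
   gives points whose evaluations on S_(1,1) are independent and whose ideal in degree (d,1) consists
   of all forms vanishing at the points. Completed by the unit vectors e_1, ..., e_r they yield a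
   tensor at which a polynomial p in the tensor entries does not vanish; p is a maximal minor of the
   1-flattening times a minor of the resultant map, the kernel of the flattening being written by
   Cramer's rule. If p does not vanish at a rank r tensor, its decomposition is in general position:
   in degree (d,1) the ideal of the kernel consists of all forms vanishing at the points. This
   determines the common zeros of the kernel and the left null space of the resultant map, hence the
   algorithm is correct for all random choices outside a hypersurface; the matrices that it
   diagonalizes are conjugate to diagonal matrices of values at the points. Nonemptiness and density
   follow by joining two parameter points by a line and counting roots of univariate polynomials. *)

theory Submission
  imports Defs "Jordan_Normal_Form.Determinant" "HOL-Computational_Algebra.Polynomial"
begin

section \<open>Timed computations\<close>

text \<open>The decomposition of the tensor is not assumed unique. The generic condition is
  therefore a polynomial in the entries, and the analysis is made for an arbitrary decomposition.
  The flattening minor also bounds the rank from below, which keeps the connecting paths inside the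
  tensors of rank exactly r. The fixed monomials of degree (d,1) all contain \<open>y_0\<close>.
  Their values at the points form an invertible matrix, and two proportional \<beta> would make two
  of its rows proportional; so one determinant expresses that the monomials complement the ideal and
  that the \<beta> are distinct. For r \<le> m + 1 the monomials are \<open>x_t x_0^(d-1)\<close>,
  and the same determinant yields the rank condition of step (2a). The exponent: with P = (m+1)^d
  (n+1), step (2b) costs O(P^4), and P^4 \<le> M^(2d) by d \<ge> 2 and l \<ge> m. If the ceiling is
  1, then \<phi> = 0 and r = 0, so step (2a) applies and the cost is O(M^2); otherwise d is the
  ceiling and 2d \<le> 5/2 d + 1. The Newton steps are stationary, since the computed points are
  exact.\<close>

lemma ret_simps [simp]: "fst (ret x) = x" "snd (ret x) = 0"
  by (simp_all add: ret_def)

lemma bindT_simps [simp]: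
  "fst (bindT M f) = fst (f (fst M))" "snd (bindT M f) = snd M + snd (f (fst M))"
  by (simp_all add: bindT_def)

lemma op_simps [simp]:
  "fst (addT a b) = a + b" "snd (addT a b) = 1"
  "fst (subT a' b') = a' - b'" "snd (subT a' b') = 1"
  "fst (negT c) = - c" "snd (negT c) = 1"
  "fst (mulT d e) = d * e" "snd (mulT d e) = 1"
  "fst (divT d' e') = d' div e'" "snd (divT d' e') = 1"
  "fst (is_zeroT f) = (f = 0)" "snd (is_zeroT f) = 1"
  "fst (lessT x y) = (x < y)" "snd (lessT x y) = 1"
  "fst (cnjT z) = cnj z" "snd (cnjT z) = 1"
  "fst (sqmodT z) = (cmod z)\<^sup>2" "snd (sqmodT z) = 1"
  "fst (sqrtT x) = sqrt x" "snd (sqrtT x) = 1"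
  by (simp_all add: addT_def subT_def negT_def mulT_def divT_def is_zeroT_def lessT_def cnjT_def
      sqmodT_def sqrtT_def)

lemma mapT_simps: "fst (mapT f xs) = map (\<lambda>x. fst (f x)) xs" "snd (mapT f xs) = (\<Sum>x\<leftarrow>xs. snd (f x))"
  by (induction xs) auto

lemma fst_mapT [simp]: "fst (mapT f xs) = map (\<lambda>x. fst (f x)) xs"
  by (rule mapT_simps)

lemma snd_mapT_le:
  assumes "\<And>x. x \<in> set xs \<Longrightarrow> snd (f x) \<le> c"
  shows "snd (mapT f xs) \<le> length xs * c"
  using assms by (induction xs) fastforce+

lemma fst_sumT [simp]: "fst (sumT k f) = (\<Sum>i<k. fst (f i))"
  by (induction k) auto

lemma snd_sumT_const:
  assumes "\<And>i. snd (f i) = c"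
  shows "snd (sumT k f) = k * (c + 1)"
  by (induction k) (auto simp: assms)

lemma vecT_simps [simp]: "fst (vecT k f) = vec k (\<lambda>i. fst (f i))"
  by (simp add: vecT_def)

lemma snd_vecT_le:
  assumes "\<And>i. i < k \<Longrightarrow> snd (f i) \<le> c"
  shows "snd (vecT k f) \<le> k * c"
  using sum_mono[of "{..<k}" "\<lambda>i. snd (f i)" "\<lambda>_. c"] assms by (simp add: vecT_def)

lemma matT_simps [simp]: "fst (matT nr nc f) = mat nr nc (\<lambda>(i, j). fst (f i j))"
  by (simp add: matT_def)

lemma snd_matT_le:
  assumes "\<And>i j. i < nr \<Longrightarrow> j < nc \<Longrightarrow> snd (f i j) \<le> c"
  shows "snd (matT nr nc f) \<le> nr * nc * c"
proof -
  have "(\<Sum>i<nr. \<Sum>j<nc. snd (f i j)) \<le> (\<Sum>i<nr. \<Sum>j<nc. c)"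
    using assms by (intro sum_mono) auto
  then show ?thesis by (simp add: matT_def)
qed

lemma fst_mat_mulT:
  assumes "A \<in> carrier_mat nr k" "B \<in> carrier_mat k nc"
  shows "fst (mat_mulT A B) = A * B"
  using assms by (intro eq_matI) (auto simp: mat_mulT_def scalar_prod_def lessThan_atLeast0)

lemma snd_mat_mulT_le: "snd (mat_mulT A B) \<le> dim_row A * dim_col B * (dim_col A * 2)"
  unfolding mat_mulT_def by (rule snd_matT_le) (simp add: snd_sumT_const)

lemma fst_foldT_invariant:
  assumes "\<And>x s. x \<in> set xs \<Longrightarrow> P s \<Longrightarrow> P (fst (f x s))" "P s"
  shows "P (fst (foldT f xs s))"
  using assms by (induction xs arbitrary: s) auto

text \<open>The invariant \<open>P\<close> carries what the cost of one step depends on, in the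
  applications the dimensions of the matrix being transformed.\<close>

lemma snd_foldT_le:
  assumes "\<And>x s. x \<in> set xs \<Longrightarrow> P s \<Longrightarrow> P (fst (f x s)) \<and> snd (f x s) \<le> c" "P s"
  shows "snd (foldT f xs s) \<le> length xs * c"
  using assms
proof (induction xs arbitrary: s)
  case (Cons x xs)
  have 1: "P (fst (f x s)) \<and> snd (f x s) \<le> c" using Cons.prems by simp
  have "snd (foldT f xs (fst (f x s))) \<le> length xs * c"
    using 1 by (intro Cons.IH) (auto simp: Cons.prems(1))
  with 1 show ?case by simp
qed simp

lemma foldT_append:
  "fst (foldT f (xs @ ys) s) = fst (foldT f ys (fst (foldT f xs s)))"
  by (induction xs arbitrary: s) auto


section \<open>Gauss--Jordan elimination\<close>

text \<open>Vectors are coefficient functions, of which only the arguments below the number of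
  columns count. Sums over points and monomials then need no conversion to
  \<open>vec\<close>.\<close>

definition kerv :: "complex mat \<Rightarrow> (nat \<Rightarrow> complex) \<Rightarrow> bool" where
  "kerv A v \<longleftrightarrow> (\<forall>i<dim_row A. (\<Sum>c<dim_col A. A $$ (i, c) * v c) = 0)"

lemma find_pivotT_fst: "fst (find_pivotT A j is) = find (\<lambda>i. A $$ (i, j) \<noteq> 0) is"
  by (induction "is") auto

lemma find_pivotT_snd: "snd (find_pivotT A j is) \<le> length is"
  by (induction "is") auto

text \<open>The state \<open>(R, ps)\<close> of the elimination of the matrix \<open>A\<close> after treating \<open>j\<close> columns.\<close>

definition rref_inv :: "complex mat \<Rightarrow> nat \<Rightarrow> complex mat \<times> nat list \<Rightarrow> bool" where
  "rref_inv A j s \<longleftrightarrow> (case s of (R, ps) \<Rightarrow> R \<in> carrier_mat (dim_row A) (dim_col A) \<and>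
     distinct ps \<and> set ps \<subseteq> {..<j} \<and> length ps \<le> dim_row A \<and>
     (\<forall>p<length ps. \<forall>i<dim_row A. R $$ (i, ps ! p) = of_bool (i = p)) \<and>
     (\<forall>i<dim_row A. \<forall>c<j. length ps \<le> i \<longrightarrow> R $$ (i, c) = 0) \<and>
     (\<forall>v. kerv R v \<longleftrightarrow> kerv A v))"

lemma gauss_stepT_fst:
  "fst (gauss_stepT j (A, ps)) =
    (case find (\<lambda>i. A $$ (i, j) \<noteq> 0) [length ps..<dim_row A] of
       None \<Rightarrow> (A, ps)
     | Some i \<Rightarrow> (let B = swaprows i (length ps) A; p = length ps;
          C = mat (dim_row A) (dim_col A)
            (\<lambda>(k, c). if k = p then B $$ (p, c) / B $$ (p, j) else B $$ (k, c))
        in (mat (dim_row A) (dim_col A)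
              (\<lambda>(k, c). if k = p then C $$ (p, c) else C $$ (k, c) - C $$ (k, j) * C $$ (p, c)), ps @ [j])))"
  by (auto simp: gauss_stepT_def Let_def find_pivotT_fst if_distrib[where f = fst]
      split: option.splits intro!: eq_matI cong: if_cong)

lemma gauss_stepT_dims:
  "dim_row (fst (fst (gauss_stepT j s))) = dim_row (fst s)"
  "dim_col (fst (fst (gauss_stepT j s))) = dim_col (fst s)"
  by (cases s; auto simp: gauss_stepT_fst Let_def split: option.splits)+

lemma gauss_stepT_snd:
  "snd (gauss_stepT j s) \<le> dim_row (fst s) * (3 * dim_col (fst s) + 1)"
proof -
  obtain A ps where s: "s = (A, ps)" by force
  let ?p = "length ps"
  have 1: "snd (find_pivotT A j [?p..<dim_row A]) \<le> dim_row A"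
    using find_pivotT_snd[of A j "[?p..<dim_row A]"] by simp
  have 2: "snd (matT (dim_row A) (dim_col A) (\<lambda>k c.
                 if k = ?p then divT (B $$ (?p, c)) (B $$ (?p, j)) else ret (B $$ (k, c))))
      \<le> dim_row A * dim_col A * 1" for B :: "complex mat"
    by (rule snd_matT_le) auto
  have 3: "snd (matT (dim_row A) (dim_col A) (\<lambda>k c.
                 if k = ?p then ret (C $$ (?p, c))
                 else do { t \<leftarrow> mulT (C $$ (k, j)) (C $$ (?p, c)); subT (C $$ (k, c)) t }))
      \<le> dim_row A * dim_col A * 2" for C :: "complex mat"
    by (rule snd_matT_le) auto
  show ?thesis
  proof (cases "fst (find_pivotT A j [?p..<dim_row A])")
    case None
    then show ?thesis using 1 by (simp add: s gauss_stepT_def Let_def)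
  next
    case (Some i)
    let ?B = "swaprows i ?p A"
    let ?C = "fst (matT (dim_row A) (dim_col A) (\<lambda>k c.
                 if k = ?p then divT (?B $$ (?p, c)) (?B $$ (?p, j)) else ret (?B $$ (k, c))))"
    have "snd (gauss_stepT j s) = snd (find_pivotT A j [?p..<dim_row A])
        + (snd (matT (dim_row A) (dim_col A) (\<lambda>k c.
                 if k = ?p then divT (?B $$ (?p, c)) (?B $$ (?p, j)) else ret (?B $$ (k, c))))
        + snd (matT (dim_row A) (dim_col A) (\<lambda>k c.
                 if k = ?p then ret (?C $$ (?p, c))
                 else do { t \<leftarrow> mulT (?C $$ (k, j)) (?C $$ (?p, c)); subT (?C $$ (k, c)) t })))"
      using Some by (simp add: s gauss_stepT_def Let_def del: matT_simps)
    then have "snd (gauss_stepT j s) \<le> dim_row A + dim_row A * dim_col A * 1 + dim_row A * dim_col A * 2"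
      using 1 2[of ?B] 3[of ?C] by linarith
    then show ?thesis by (simp add: s algebra_simps)
  qed
qed

text \<open>The pivot row has only zeros to the left of column \<open>j\<close>, so the elimination
  disturbs neither the earlier pivot columns nor the zero block. The kernel survives because the row
  operations are reversible.\<close>

lemma gauss_stepT_inv:
  assumes "rref_inv A j s" "j < dim_col A"
  shows "rref_inv A (Suc j) (fst (gauss_stepT j s))"
proof -
  obtain R ps where s: "s = (R, ps)" by force
  let ?nr = "dim_row A" and ?nc = "dim_col A" and ?p = "length ps"
  have R: "dim_row R = ?nr" "dim_col R = ?nc" and d: "distinct ps" "set ps \<subseteq> {..<j}" "?p \<le> ?nr"
    and piv: "\<And>q i. q < ?p \<Longrightarrow> i < ?nr \<Longrightarrow> R $$ (i, ps ! q) = of_bool (i = q)"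
    and low: "\<And>i c. i < ?nr \<Longrightarrow> c < j \<Longrightarrow> ?p \<le> i \<Longrightarrow> R $$ (i, c) = 0"
    and ker: "\<And>v. kerv R v \<longleftrightarrow> kerv A v"
    using assms(1) by (auto simp: rref_inv_def s)
  have lt: "ps ! q < j" if "q < ?p" for q using d(2) that by (meson lessThan_iff nth_mem subsetD)
  show ?thesis
  proof (cases "find (\<lambda>i. R $$ (i, j) \<noteq> 0) [?p..<?nr]")
    case None
    then have "\<forall>i. i < ?nr \<longrightarrow> ?p \<le> i \<longrightarrow> R $$ (i, j) = 0" by (auto simp: find_None_iff)
    moreover have "fst (gauss_stepT j s) = (R, ps)" by (simp add: s gauss_stepT_fst None R)
    ultimately show ?thesis using R d piv low ker by (auto simp: rref_inv_def less_Suc_eq)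
  next
    case (Some i)
    then have i: "?p \<le> i" "i < ?nr" "R $$ (i, j) \<noteq> 0" by (auto simp: find_Some_iff)
    define B where "B = swaprows i ?p R"
    define a where "a = R $$ (i, j)"
    \<comment> \<open>The transposition of the rows \<open>i\<close> and \<open>?p\<close>, the
      identity when they coincide.\<close>
    define t where "t k = (if k = ?p then i else if k = i then ?p else k)" for k
    have B: "B $$ (k, c) = R $$ (t k, c)" if "k < ?nr" "c < ?nc" for k c
      using that i by (auto simp: B_def R t_def)
    have t: "t k < ?nr" "t (t k) = k" if "k < ?nr" for k using that i by (auto simp: t_def)
    have pn: "?p < ?nr" using i by simp
    define D where "D = mat ?nr ?nc (\<lambda>(k, c). if k = ?p then R $$ (i, c) / a
        else B $$ (k, c) - B $$ (k, j) * (R $$ (i, c) / a))"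
    have Bp: "B $$ (?p, c) = R $$ (i, c)" if "c < ?nc" for c using B[OF pn that] by (simp add: t_def)
    have step: "fst (gauss_stepT j s) = (D, ps @ [j])"
      unfolding s gauss_stepT_fst R Some
      using pn assms(2) Bp by (auto simp: Let_def B_def[symmetric] D_def R a_def intro!: eq_matI)
    have dim: "dim_row D = ?nr" "dim_col D = ?nc" by (simp_all add: D_def)
    have Dix: "D $$ (k, c) = (if k = ?p then R $$ (i, c) / a
        else B $$ (k, c) - B $$ (k, j) * (R $$ (i, c) / a))" if "k < ?nr" "c < ?nc" for k c
      using that by (simp add: D_def)
    have row0: "R $$ (i, c) = 0" if "c < j" for c using low i that by auto
    have Dlow: "D $$ (k, c) = (if k = ?p then 0 else R $$ (t k, c))" if "k < ?nr" "c < j" for k c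
      using Dix[of k c] B[of k c] row0[of c] that assms(2) by auto
    have piv': "D $$ (k, (ps @ [j]) ! q) = of_bool (k = q)" if "q < Suc ?p" "k < ?nr" for q k
    proof (cases "q < ?p")
      case True
      have "D $$ (k, ps ! q) = (if k = ?p then 0 else R $$ (t k, ps ! q))"
        using Dlow lt True that by auto
      also have "\<dots> = of_bool (k = q)"
        using piv[OF True t(1)[OF that(2)]] True i by (auto simp: t_def)
      finally show ?thesis using True by (simp add: nth_append)
    next
      case False
      then have "q = ?p" using that by simp
      moreover have "D $$ (k, j) = of_bool (k = ?p)"
        using Dix[OF that(2) assms(2)] i(3) by (auto simp: a_def)
      ultimately show ?thesis by simp
    qed
    have low': "D $$ (k, c) = 0" if "k < ?nr" "c < Suc j" "Suc ?p \<le> k" for k c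
    proof (cases "c < j")
      case True
      have "t k \<ge> ?p" using that i by (auto simp: t_def)
      then show ?thesis using Dlow[OF that(1) True] low[OF t(1)[OF that(1)] True] by auto
    next
      case False
      then have "c = j" using that by simp
      then show ?thesis using piv'[of ?p k] that by simp
    qed
    \<comment> \<open>Row \<open>?p\<close> of \<open>D\<close> yields \<open>f i / a\<close>, which
      has to vanish first; the other rows then return the remaining \<open>f k\<close>, reached
      through the involution \<open>t\<close>.\<close>
    have ker': "kerv D v \<longleftrightarrow> kerv R v" for v
    proof -
      define f where "f k = (\<Sum>c<?nc. R $$ (k, c) * v c)" for k
      have e: "(\<Sum>c<?nc. D $$ (k, c) * v c) =
          (if k = ?p then f i / a else f (t k) - B $$ (k, j) * (f i / a))" if "k < ?nr" for k
      proof -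
        have "(\<Sum>c<?nc. D $$ (k, c) * v c) = (\<Sum>c<?nc. (if k = ?p then R $$ (i, c) * v c / a
            else R $$ (t k, c) * v c - B $$ (k, j) * (R $$ (i, c) * v c / a)))"
          using that by (intro sum.cong) (auto simp: Dix B algebra_simps)
        then show ?thesis
          by (auto simp: f_def sum_subtractf sum_distrib_left sum_divide_distrib)
      qed
      have "(\<forall>k<?nr. (\<Sum>c<?nc. D $$ (k, c) * v c) = 0) \<longleftrightarrow> (\<forall>k<?nr. f k = 0)"
      proof
        assume L: "\<forall>k<?nr. (\<Sum>c<?nc. D $$ (k, c) * v c) = 0"
        have fi: "f i = 0" using L pn e[OF pn] i(3) by (simp add: a_def)
        show "\<forall>k<?nr. f k = 0"
        proof (intro allI impI)
          fix k assume k: "k < ?nr"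
          show "f k = 0"
          proof (cases "k = i")
            case False
            then have "t k \<noteq> ?p" by (auto simp: t_def)
            then have "f (t (t k)) = 0" using e[OF t(1)[OF k]] fi L t(1)[OF k] by auto
            then show ?thesis using t(2)[OF k] by simp
          qed (simp add: fi)
        qed
      next
        assume R: "\<forall>k<?nr. f k = 0"
        show "\<forall>k<?nr. (\<Sum>c<?nc. D $$ (k, c) * v c) = 0" using e R t i by auto
      qed
      then show ?thesis by (simp add: kerv_def dim R f_def)
    qed
    show ?thesis unfolding step rref_inv_def prod.case
    proof (intro conjI)
      show "D \<in> carrier_mat ?nr ?nc" using dim by (intro carrier_matI)
      show "distinct (ps @ [j])" "set (ps @ [j]) \<subseteq> {..<Suc j}" using d by auto
      show "length (ps @ [j]) \<le> ?nr" using pn by simp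
    qed (use piv' low' ker' ker in auto)
  qed
qed

text \<open>Elimination may stop before the last column. \<open>solveT\<close> relies on this: its
  right-hand sides are passive columns that never receive a pivot.\<close>

lemma rrefT_inv:
  assumes "nc \<le> dim_col A"
  shows "rref_inv A nc (fst (rrefT nc A))"
  using assms
proof (induction nc)
  case 0
  then show ?case by (auto simp: rref_inv_def rrefT_def)
next
  case (Suc j)
  then show ?case using gauss_stepT_inv[of A j] by (simp add: rrefT_def foldT_append)
qed

lemma rrefT_snd: "snd (rrefT nc A) \<le> nc * (dim_row A * (3 * dim_col A + 1))"
proof -
  have "snd (foldT gauss_stepT [0..<nc] (A, [])) \<le> length [0..<nc] * (dim_row A * (3 * dim_col A + 1))"
  proof (rule snd_foldT_le[where P = "\<lambda>s. dim_row (fst s) = dim_row A \<and> dim_col (fst s) = dim_col A"])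
    fix x and s :: "complex mat \<times> nat list"
    assume s: "dim_row (fst s) = dim_row A \<and> dim_col (fst s) = dim_col A"
    show "(dim_row (fst (fst (gauss_stepT x s))) = dim_row A \<and>
        dim_col (fst (fst (gauss_stepT x s))) = dim_col A) \<and>
        snd (gauss_stepT x s) \<le> dim_row A * (3 * dim_col A + 1)"
      using gauss_stepT_snd[of x s] s by (simp only: gauss_stepT_dims)
  qed simp
  then show ?thesis by (simp add: rrefT_def)
qed

section \<open>Kernels and linear systems\<close>

lemma pivot_row_Some:
  assumes "distinct ps"
  shows "pivot_row ps c = Some p \<longleftrightarrow> p < length ps \<and> ps ! p = c"
proof -
  have "distinct (map fst (zip ps [0..<length ps]))" using assms by simp
  then have "pivot_row ps c = Some p \<longleftrightarrow> (c, p) \<in> set (zip ps [0..<length ps])"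
    by (simp add: pivot_row_def)
  then show ?thesis by (auto simp: set_zip)
qed

lemma pivot_row_None: "pivot_row ps c = None \<longleftrightarrow> c \<notin> set ps"
proof -
  have "map fst (zip ps [0..<length ps]) = ps" by simp
  then have "fst ` set (zip ps [0..<length ps]) = set ps" by (metis set_map)
  then show ?thesis by (simp add: pivot_row_def map_of_eq_None_iff)
qed

lemma sum_pivots:
  fixes f :: "nat \<Rightarrow> complex"
  assumes "distinct ps" "set ps \<subseteq> {..<nc}" "\<And>c. c < nc \<Longrightarrow> c \<notin> set ps \<Longrightarrow> f c = 0"
  shows "(\<Sum>c<nc. f c) = (\<Sum>p<length ps. f (ps ! p))"
proof -
  have "(\<Sum>c<nc. f c) = (\<Sum>c\<in>set ps. f c)"
    using assms by (intro sum.mono_neutral_right) auto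
  also have "\<dots> = (\<Sum>p<length ps. f (ps ! p))"
    using assms(1) by (intro sum.reindex_bij_betw[symmetric] bij_betw_nth) auto
  finally show ?thesis .
qed

locale rref_state =
  fixes A R :: "complex mat" and ps :: "nat list"
  assumes inv: "rref_inv A (dim_col A) (R, ps)"
begin

lemma dims: "dim_row R = dim_row A" "dim_col R = dim_col A"
  and ps: "distinct ps" "set ps \<subseteq> {..<dim_col A}" "length ps \<le> dim_row A"
  and piv: "p < length ps \<Longrightarrow> i < dim_row A \<Longrightarrow> R $$ (i, ps ! p) = of_bool (i = p)"
  and low: "i < dim_row A \<Longrightarrow> c < dim_col A \<Longrightarrow> length ps \<le> i \<Longrightarrow> R $$ (i, c) = 0"
  and ker: "kerv R v \<longleftrightarrow> kerv A v"
  using inv by (auto simp: rref_inv_def)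

definition "free = filter (\<lambda>j. j \<notin> set ps) [0..<dim_col A]"

definition "F = fst (null_basisT (R, ps))"

lemma F_eq: "F = map (\<lambda>j. vec (dim_col A) (\<lambda>c. case pivot_row ps c of
    Some p \<Rightarrow> - (R $$ (p, j)) | None \<Rightarrow> if c = j then 1 else 0)) free"
  by (auto simp: F_def null_basisT_def free_def dims intro!: eq_vecI split: option.split)

lemma free: "distinct free" "set free = {..<dim_col A} - set ps"
  by (auto simp: free_def)

lemma length_F: "length F = dim_col A - length ps"
proof -
  have "length free = card ({..<dim_col A} - set ps)" using free distinct_card by metis
  also have "\<dots> = dim_col A - card (set ps)" using ps(2) by (simp add: card_Diff_subset)
  finally show ?thesis by (simp add: F_eq distinct_card[OF ps(1)])
qed

lemma F_nth:
  assumes "t < length F" "c < dim_col A"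
  shows "F ! t $ c = (case pivot_row ps c of
    Some p \<Rightarrow> - (R $$ (p, free ! t)) | None \<Rightarrow> if c = free ! t then 1 else 0)"
  using assms by (simp add: F_eq)

text \<open>On the free columns the kernel basis is an identity matrix; spanning and independence
  are both read off there.\<close>

lemma F_free:
  assumes "t < length F" "t' < length F"
  shows "F ! t $ (free ! t') = of_bool (t = t')"
proof -
  have "free ! t' \<in> set free" using assms by (simp add: F_eq)
  then have "free ! t' \<notin> set ps" "free ! t' < dim_col A" using free by auto
  then have "F ! t $ (free ! t') = (if free ! t' = free ! t then 1 else 0)"
    using assms pivot_row_None[of ps "free ! t'"] by (simp add: F_nth)
  then show ?thesis using assms free(1) by (auto simp: F_eq nth_eq_iff_index_eq)
qed

text \<open>The kernel is a graph: the free coordinates are arbitrary and the pivot coordinates are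
  linear functions of them.\<close>

lemma kerv_iff: "kerv A v \<longleftrightarrow>
    (\<forall>p<length ps. v (ps ! p) = - (\<Sum>t<length F. R $$ (p, free ! t) * v (free ! t)))"
proof -
  have split: "(\<Sum>c<dim_col A. R $$ (i, c) * v c) =
      (\<Sum>p<length ps. R $$ (i, ps ! p) * v (ps ! p)) + (\<Sum>t<length F. R $$ (i, free ! t) * v (free ! t))"
    for i
  proof -
    have "(\<Sum>c<dim_col A. R $$ (i, c) * v c) =
        (\<Sum>c\<in>set ps. R $$ (i, c) * v c) + (\<Sum>c\<in>set free. R $$ (i, c) * v c)"
      using ps(2) free by (subst sum.union_disjoint[symmetric]) (auto intro!: sum.cong)
    moreover have "(\<Sum>c\<in>set ps. R $$ (i, c) * v c) = (\<Sum>p<length ps. R $$ (i, ps ! p) * v (ps ! p))"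
      using ps(1) by (intro sum.reindex_bij_betw[symmetric] bij_betw_nth) auto
    moreover have "(\<Sum>c\<in>set free. R $$ (i, c) * v c) = (\<Sum>t<length F. R $$ (i, free ! t) * v (free ! t))"
      using free(1) by (intro sum.reindex_bij_betw[symmetric] bij_betw_nth) (auto simp: F_eq)
    ultimately show ?thesis by simp
  qed
  have main: "(\<Sum>c<dim_col A. R $$ (i, c) * v c) =
      v (ps ! i) + (\<Sum>t<length F. R $$ (i, free ! t) * v (free ! t))" if "i < length ps" for i
  proof -
    have "(\<Sum>p<length ps. R $$ (i, ps ! p) * v (ps ! p)) = (\<Sum>p<length ps. if p = i then v (ps ! p) else 0)"
      using that ps(3) by (intro sum.cong) (auto simp: piv)
    then show ?thesis using that by (simp add: split)
  qed
  have "kerv A v \<longleftrightarrow> (\<forall>i<dim_row A. (\<Sum>c<dim_col A. R $$ (i, c) * v c) = 0)"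
    using ker[of v] by (simp add: kerv_def dims)
  also have "\<dots> \<longleftrightarrow> (\<forall>i<length ps. (\<Sum>c<dim_col A. R $$ (i, c) * v c) = 0)"
  proof -
    have "(\<Sum>c<dim_col A. R $$ (i, c) * v c) = 0" if "i < dim_row A" "\<not> i < length ps" for i
      using low that by (intro sum.neutral) simp
    then show ?thesis using ps(3) by (meson order_less_le_trans)
  qed
  also have "\<dots> \<longleftrightarrow>
      (\<forall>i<length ps. v (ps ! i) + (\<Sum>t<length F. R $$ (i, free ! t) * v (free ! t)) = 0)"
    using main by simp
  finally show ?thesis unfolding eq_neg_iff_add_eq_0 .
qed

lemma F_ker:
  assumes "f \<in> set F"
  shows "f \<in> carrier_vec (dim_col A)" "kerv A (vec_index f)"
proof -
  obtain t where t: "t < length F" "f = F ! t" using assms by (auto simp: in_set_conv_nth)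
  show "f \<in> carrier_vec (dim_col A)" using assms by (auto simp: F_eq)
  have "F ! t $ (ps ! p) = - (\<Sum>t'<length F. R $$ (p, free ! t') * F ! t $ (free ! t'))"
    if "p < length ps" for p
  proof -
    have "ps ! p < dim_col A" using ps(2) that by (meson lessThan_iff nth_mem subsetD)
    moreover have "pivot_row ps (ps ! p) = Some p" using that ps(1) by (simp add: pivot_row_Some)
    ultimately have "F ! t $ (ps ! p) = - R $$ (p, free ! t)" using t(1) by (simp add: F_nth)
    then show ?thesis using t(1) by (simp add: F_free of_bool_def if_distrib cong: if_cong)
  qed
  then show "kerv A (vec_index f)" by (simp add: kerv_iff t(2))
qed

lemma F_spans:
  assumes "kerv A v" "c < dim_col A"
  shows "v c = (\<Sum>t<length F. v (free ! t) * F ! t $ c)"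
proof (cases "c \<in> set ps")
  case True
  then obtain p where p: "p < length ps" "ps ! p = c" by (auto simp: in_set_conv_nth)
  have "pivot_row ps c = Some p" using p ps(1) by (simp add: pivot_row_Some)
  then have "(\<Sum>t<length F. v (free ! t) * F ! t $ c) = - (\<Sum>t<length F. R $$ (p, free ! t) * v (free ! t))"
    using assms(2) by (simp add: F_nth sum_negf[symmetric] mult.commute)
  then show ?thesis using assms(1) p by (auto simp: kerv_iff)
next
  case False
  then have "c \<in> set free" using free assms(2) by auto
  then obtain t' where t': "t' < length F" "free ! t' = c" by (auto simp: in_set_conv_nth F_eq)
  have "(\<Sum>t<length F. v (free ! t) * F ! t $ c) = (\<Sum>t<length F. if t = t' then v c else 0)"
    using t' by (intro sum.cong) (auto simp: F_free simp flip: t'(2))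
  then show ?thesis using t' by simp
qed

lemma F_indep:
  assumes "\<And>i. i < dim_col A \<Longrightarrow> (\<Sum>t<length F. c t * F ! t $ i) = 0" "t' < length F"
  shows "c t' = 0"
proof -
  have "free ! t' < dim_col A" using assms(2) free(2) nth_mem[of t' free] by (auto simp: F_eq)
  then have "0 = (\<Sum>t<length F. c t * F ! t $ (free ! t'))" using assms(1) by simp
  also have "\<dots> = (\<Sum>t<length F. if t = t' then c t else 0)"
    using assms(2) by (intro sum.cong) (auto simp: F_free)
  finally show ?thesis using assms(2) by simp
qed

end

lemma null_basisT_snd: "snd (null_basisT (R, ps)) \<le> dim_col R * dim_col R"
proof -
  have "snd (null_basisT (R, ps)) \<le> length (filter (\<lambda>j. j \<notin> set ps) [0..<dim_col R]) * (dim_col R * 1)"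
    unfolding null_basisT_def prod.case
    by (intro snd_mapT_le snd_vecT_le) (auto split: option.split)
  also have "\<dots> \<le> dim_col R * (dim_col R * 1)"
    by (intro mult_le_mono1 order.trans[OF length_filter_le]) simp
  finally show ?thesis by simp
qed

text \<open>The last clause is the rank inequality: there are at most as many pivots as
  rows.\<close>

lemma kernelT_basis:
  fixes A :: "complex mat"
  defines "F \<equiv> fst (kernelT A)"
  shows "\<And>f. f \<in> set F \<Longrightarrow> f \<in> carrier_vec (dim_col A) \<and> kerv A (vec_index f)"
    and "\<And>v. kerv A v \<Longrightarrow> \<exists>c. \<forall>i<dim_col A. v i = (\<Sum>t<length F. c t * F ! t $ i)"
    and "\<And>c. (\<And>i. i < dim_col A \<Longrightarrow> (\<Sum>t<length F. c t * F ! t $ i) = 0) \<Longrightarrow> \<forall>t<length F. c t = 0"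
    and "length F \<ge> dim_col A - dim_row A"
proof -
  obtain R ps where s: "fst (rrefT (dim_col A) A) = (R, ps)" by force
  interpret rref_state A R ps using rrefT_inv[of "dim_col A" A] by unfold_locales (simp add: s)
  have F: "local.F = F" by (simp add: F_def assms kernelT_def s)
  show "\<And>f. f \<in> set F \<Longrightarrow> f \<in> carrier_vec (dim_col A) \<and> kerv A (vec_index f)"
    using F_ker by (simp add: F)
  show "\<exists>c. \<forall>i<dim_col A. v i = (\<Sum>t<length F. c t * F ! t $ i)" if "kerv A v" for v
    using F_spans[OF that] by (auto simp: F intro!: exI[of _ "\<lambda>t. v (free ! t)"])
  show "\<forall>t<length F. c t = 0" if "\<And>i. i < dim_col A \<Longrightarrow> (\<Sum>t<length F. c t * F ! t $ i) = 0" for c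
    using F_indep[of c] that by (simp add: F)
  show "length F \<ge> dim_col A - dim_row A" using length_F ps(3) F by simp
qed

lemma kernelT_snd:
  "snd (kernelT A) \<le> dim_col A * (dim_row A * (3 * dim_col A + 1)) + dim_col A * dim_col A"
proof -
  obtain R ps where s: "fst (rrefT (dim_col A) A) = (R, ps)" by force
  have "dim_col R = dim_col A" using rrefT_inv[of "dim_col A" A] by (auto simp: s rref_inv_def)
  then show ?thesis
    using null_basisT_snd[of R ps] rrefT_snd[of "dim_col A" A] by (simp add: kernelT_def s)
qed

text \<open>Fewer equations than unknowns leave a nonempty kernel basis, and its first vector is the
  solution. The verified elimination thus replaces any abstract dimension theory.\<close>

lemma dependent_columns:
  fixes M :: "nat \<Rightarrow> nat \<Rightarrow> complex"
  assumes "k < r"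
  obtains c where "\<exists>t<r. c t \<noteq> 0" "\<And>i. i < k \<Longrightarrow> (\<Sum>t<r. M i t * c t) = 0"
proof -
  let ?A = "mat k r (\<lambda>(i, t). M i t)"
  let ?F = "fst (kernelT ?A)"
  have "length ?F > 0" using kernelT_basis(4)[of ?A] assms by (metis diff_is_0_eq dim_row_mat(1) dim_col_mat(1) not_less le_0_eq gr_zeroI)
  then have 1: "?F ! 0 \<in> set ?F" by simp
  \<comment> \<open>A basis vector is nonzero, since otherwise the coefficients 1, 0, 0, ... would
    contradict independence.\<close>
  have "\<exists>t<r. ?F ! 0 $ t \<noteq> 0"
  proof (rule ccontr)
    assume "\<not> ?thesis"
    then have "(\<Sum>t<length ?F. of_bool (t = 0) * ?F ! t $ i) = 0" if "i < r" for i
      using that \<open>\<not> (\<exists>t<r. ?F ! 0 $ t \<noteq> 0)\<close> by (intro sum.neutral ballI) (metis mult_zero_left mult_zero_right of_bool_eq(1))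
    then have "\<forall>t<length ?F. (of_bool (t = 0) :: complex) = 0"
      by (intro kernelT_basis(3)) simp
    then show False using \<open>length ?F > 0\<close> by auto
  qed
  moreover have "(\<Sum>t<r. M i t * ?F ! 0 $ t) = 0" if "i < k" for i
  proof -
    have "(\<Sum>t<r. M i t * ?F ! 0 $ t) = (\<Sum>t<dim_col ?A. ?A $$ (i, t) * ?F ! 0 $ t)"
      using that by (intro sum.cong) auto
    then show ?thesis using kernelT_basis(1)[OF 1] that by (simp add: kerv_def)
  qed
  ultimately show ?thesis using that by blast
qed

lemma det_nonzero_inverse:
  assumes "A \<in> carrier_mat n n" "det A \<noteq> (0 :: complex)"
  obtains B where "B \<in> carrier_mat n n" "A * B = 1\<^sub>m n" "B * A = 1\<^sub>m n"
  using det_non_zero_imp_unit[OF assms, of "()"] by (auto simp: Units_def ring_mat_def)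

text \<open>Nonsingularity for entries given by a function; the transposed form follows. These two
  forms are what passes between determinants, which are polynomial, and independence, which is what
  the arguments use.\<close>

lemma det_nonzero_iff:
  fixes M :: "nat \<Rightarrow> nat \<Rightarrow> complex"
  shows "det (mat r r (\<lambda>(i, j). M i j)) \<noteq> 0 \<longleftrightarrow>
    (\<forall>c. (\<forall>i<r. (\<Sum>j<r. M i j * c j) = 0) \<longrightarrow> (\<forall>j<r. c j = 0))" (is "?l \<longleftrightarrow> ?r")
proof -
  let ?A = "mat r r (\<lambda>(i, j). M i j)"
  have e: "?A *\<^sub>v vec r c = 0\<^sub>v r \<longleftrightarrow> (\<forall>i<r. (\<Sum>j<r. M i j * c j) = 0)" for c
    by (auto simp: vec_eq_iff scalar_prod_def lessThan_atLeast0)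
  have z: "vec r c \<noteq> 0\<^sub>v r \<longleftrightarrow> (\<exists>j<r. c j \<noteq> 0)" for c :: "nat \<Rightarrow> complex"
    by (auto simp: vec_eq_iff)
  have "det ?A = 0 \<longleftrightarrow> (\<exists>v. v \<in> carrier_vec r \<and> v \<noteq> 0\<^sub>v r \<and> ?A *\<^sub>v v = 0\<^sub>v r)"
    by (intro det_0_iff_vec_prod_zero_field) simp
  also have "\<dots> \<longleftrightarrow> (\<exists>c. vec r c \<noteq> 0\<^sub>v r \<and> ?A *\<^sub>v vec r c = 0\<^sub>v r)"
  proof
    assume "\<exists>v. v \<in> carrier_vec r \<and> v \<noteq> 0\<^sub>v r \<and> ?A *\<^sub>v v = 0\<^sub>v r"
    then obtain v where v: "v \<in> carrier_vec r" "v \<noteq> 0\<^sub>v r" "?A *\<^sub>v v = 0\<^sub>v r" by blast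
    moreover have "vec r (vec_index v) = v" using v by auto
    ultimately show "\<exists>c. vec r c \<noteq> 0\<^sub>v r \<and> ?A *\<^sub>v vec r c = 0\<^sub>v r" by metis
  qed (metis vec_carrier)
  finally have "det ?A = 0 \<longleftrightarrow> (\<exists>c. (\<exists>j<r. c j \<noteq> 0) \<and> (\<forall>i<r. (\<Sum>j<r. M i j * c j) = 0))"
    by (simp only: e z)
  then show ?thesis by blast
qed

lemma det_nonzero_iff_left:
  fixes M :: "nat \<Rightarrow> nat \<Rightarrow> complex"
  shows "det (mat r r (\<lambda>(i, j). M i j)) \<noteq> 0 \<longleftrightarrow>
    (\<forall>c. (\<forall>j<r. (\<Sum>i<r. c i * M i j) = 0) \<longrightarrow> (\<forall>i<r. c i = 0))"
proof -
  have "transpose_mat (mat r r (\<lambda>(i, j). M i j)) = mat r r (\<lambda>(i, j). M j i)"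
    by (intro eq_matI) auto
  then have "det (mat r r (\<lambda>(i, j). M i j)) = det (mat r r (\<lambda>(i, j). M j i))"
    using det_transpose[of "mat r r (\<lambda>(i, j). M i j)" r] by simp
  then show ?thesis using det_nonzero_iff[of r "\<lambda>i j. M j i"] by (simp add: mult.commute)
qed

definition augment :: "complex mat \<Rightarrow> complex mat \<Rightarrow> complex mat" where
  "augment A B = mat (dim_row A) (dim_col A + dim_col B)
        (\<lambda>(i, j). if j < dim_col A then A $$ (i, j) else B $$ (i, j - dim_col A))"

lemma sum_split_add:
  "(\<Sum>c<a + b. f c) = (\<Sum>c<a. f c) + (\<Sum>c<b. f (a + c :: nat))" for f :: "nat \<Rightarrow> complex"
  by (induction b) (simp_all add: add.assoc)

text \<open>A solution of the system with right-hand side column \<open>j\<close> is the same as a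
  kernel vector of the augmented matrix with entry -1 in that column. Invariance of the kernel under
  elimination then becomes invariance of the solutions.\<close>

lemma kerv_augment:
  assumes "j < dim_col B"
  shows "kerv (augment A B) (\<lambda>c. if c < dim_col A then v c else if c = dim_col A + j then -1 else 0) \<longleftrightarrow>
    (\<forall>i<dim_row A. (\<Sum>c<dim_col A. A $$ (i, c) * v c) = B $$ (i, j))"
proof -
  have "(\<Sum>c<dim_col A + dim_col B. augment A B $$ (i, c) *
      (if c < dim_col A then v c else if c = dim_col A + j then -1 else 0)) =
      (\<Sum>c<dim_col A. A $$ (i, c) * v c) + (\<Sum>c<dim_col B. if c = j then - B $$ (i, c) else 0)"
    if "i < dim_row A" for i
    unfolding sum_split_add using that by (intro arg_cong2[where f = "(+)"] sum.cong) (auto simp: augment_def)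
  then show ?thesis using assms by (auto simp: kerv_def augment_def)
qed

text \<open>The last clause holds for singular \<open>A\<close> too; the Newton step applies it to
  its normal equations.\<close>

lemma solveT_sol:
  assumes A: "A \<in> carrier_mat nr nc" and B: "B \<in> carrier_mat nr k" and X: "X \<in> carrier_mat nc k"
    and "A * X = B"
  shows "fst (solveT A B) \<in> carrier_mat nc k" "A * fst (solveT A B) = B"
    and "B = 0\<^sub>m nr k \<Longrightarrow> fst (solveT A B) = 0\<^sub>m nc k"
proof -
  define E where "E = augment A B"
  obtain R ps where s: "fst (rrefT nc E) = (R, ps)" by force
  have E: "dim_row E = nr" "dim_col E = nc + k" using A B by (auto simp: E_def augment_def)
  have inv: "rref_inv E nc (R, ps)" using rrefT_inv[of nc E] by (simp add: s E)
  have ps: "distinct ps" "set ps \<subseteq> {..<nc}" "length ps \<le> nr" and dimR: "dim_row R = nr" "dim_col R = nc + k"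
    and piv: "\<And>p i. p < length ps \<Longrightarrow> i < nr \<Longrightarrow> R $$ (i, ps ! p) = of_bool (i = p)"
    and low: "\<And>i c. i < nr \<Longrightarrow> c < nc \<Longrightarrow> length ps \<le> i \<Longrightarrow> R $$ (i, c) = 0"
    and ker: "\<And>v. kerv R v \<longleftrightarrow> kerv E v"
    using inv by (auto simp: rref_inv_def E)
  define Y where "Y = mat nc k (\<lambda>(i, j). case pivot_row ps i of Some p \<Rightarrow> R $$ (p, nc + j) | None \<Rightarrow> 0)"
  have sol: "fst (solveT A B) = Y"
    using A B s unfolding solveT_def Let_def E_def augment_def by (auto simp: Y_def)
  show "fst (solveT A B) \<in> carrier_mat nc k" by (simp add: sol Y_def)
  \<comment> \<open>The vector \<open>v\<close> extended by -1 in the column of the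
    \<open>j\<close>-th right-hand side.\<close>
  define u where "u v j = (\<lambda>c. if c < nc then v c else if c = nc + j then - 1 else (0::complex))" for v j
  have aug: "kerv E (u v j) \<longleftrightarrow> (\<forall>i<nr. (\<Sum>c<nc. A $$ (i, c) * v c) = B $$ (i, j))" if "j < k" for v j
  proof -
    have "dim_col A = nc" "dim_row A = nr" "dim_col B = k" using A B by auto
    then show ?thesis using kerv_augment[of j B A v] that by (simp only: E_def u_def)
  qed
  have R_sum: "(\<Sum>c<nc + k. R $$ (i, c) * u v j c) = (\<Sum>c<nc. R $$ (i, c) * v c) - R $$ (i, nc + j)"
    if "j < k" for i v j
  proof -
    have "(\<Sum>c<nc + k. R $$ (i, c) * u v j c) = (\<Sum>c<nc. R $$ (i, c) * v c) +
        (\<Sum>c<k. if c = j then - R $$ (i, nc + c) else 0)"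
      unfolding sum_split_add by (intro arg_cong2[where f = "(+)"] sum.cong) (auto simp: u_def)
    then show ?thesis using that by simp
  qed
  have AX: "(\<Sum>c<nc. A $$ (i, c) * X $$ (c, j)) = B $$ (i, j)" if "i < nr" "j < k" for i j
    using assms that by (auto simp: scalar_prod_def lessThan_atLeast0)
  \<comment> \<open>Consistency enters here: below the pivots the coefficient part of
    \<open>R\<close> is zero, and the given solution \<open>X\<close> forces the right-hand side to
    vanish as well.\<close>
  have zero: "R $$ (i, nc + j) = 0" if "i < nr" "length ps \<le> i" "j < k" for i j
  proof -
    have "kerv R (u (\<lambda>c. X $$ (c, j)) j)" using ker aug that AX by simp
    then have "(\<Sum>c<nc. R $$ (i, c) * X $$ (c, j)) - R $$ (i, nc + j) = 0"
      using that R_sum[OF that(3), of i "\<lambda>c. X $$ (c, j)"] by (simp add: kerv_def dimR)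
    moreover have "(\<Sum>c<nc. R $$ (i, c) * X $$ (c, j)) = 0" using that low by (intro sum.neutral) auto
    ultimately show ?thesis by simp
  qed
  have Y: "Y $$ (c, j) = 0" if "c < nc" "c \<notin> set ps" "j < k" for c j
    using that pivot_row_None[of ps c] by (simp add: Y_def)
  have Yp: "Y $$ (ps ! p, j) = R $$ (p, nc + j)" if "p < length ps" "j < k" for p j
  proof -
    have "ps ! p < nc" using ps(2) that by (meson lessThan_iff nth_mem subsetD)
    moreover have "pivot_row ps (ps ! p) = Some p" using that ps(1) by (simp add: pivot_row_Some)
    ultimately show ?thesis using that by (simp add: Y_def)
  qed
  have "kerv R (u (\<lambda>c. Y $$ (c, j)) j)" if j: "j < k" for j
  proof -
    have "(\<Sum>c<nc. R $$ (i, c) * Y $$ (c, j)) = R $$ (i, nc + j)" if "i < nr" for i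
    proof -
      have "(\<Sum>c<nc. R $$ (i, c) * Y $$ (c, j)) = (\<Sum>p<length ps. R $$ (i, ps ! p) * Y $$ (ps ! p, j))"
        using ps Y j by (intro sum_pivots) auto
      also have "\<dots> = (\<Sum>p<length ps. if p = i then R $$ (i, nc + j) else 0)"
        using that j by (intro sum.cong) (auto simp: piv Yp)
      also have "\<dots> = R $$ (i, nc + j)" using zero[OF that _ j] by auto
      finally show ?thesis .
    qed
    then show ?thesis using R_sum[OF j] by (simp add: kerv_def dimR)
  qed
  then have "(\<Sum>c<nc. A $$ (i, c) * Y $$ (c, j)) = B $$ (i, j)" if "i < nr" "j < k" for i j
    using ker aug that by simp
  then show "A * fst (solveT A B) = B" unfolding sol
    using A B by (intro eq_matI) (auto simp: scalar_prod_def lessThan_atLeast0 Y_def)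
  show "fst (solveT A B) = 0\<^sub>m nc k" if B0: "B = 0\<^sub>m nr k"
  proof -
    have "R $$ (i, nc + j) = 0" if "i < nr" "j < k" for i j
    proof -
      have "kerv R (u (\<lambda>_. 0) j)" using ker aug that B0 by simp
      then show ?thesis using R_sum[OF that(2), of i "\<lambda>_. 0"] that by (simp add: kerv_def dimR)
    qed
    moreover have "p < nr" if "pivot_row ps c = Some p" for c p
      using that ps by (auto simp: pivot_row_Some)
    ultimately show ?thesis unfolding sol Y_def by (intro eq_matI) (auto split: option.split)
  qed
qed

lemma solveT_unique:
  assumes A: "A \<in> carrier_mat nr nc" and B: "B \<in> carrier_mat nr k" and X: "X \<in> carrier_mat nc k"
    and AX: "A * X = B" and L: "L \<in> carrier_mat nc nr" "L * A = 1\<^sub>m nc"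
  shows "fst (solveT A B) = X"
proof -
  let ?Y = "fst (solveT A B)"
  have Y: "?Y \<in> carrier_mat nc k" "A * ?Y = B" using solveT_sol[OF A B X AX] by auto
  have "?Y = (L * A) * ?Y" using L Y by simp
  also have "\<dots> = L * B" using assoc_mult_mat[OF L(1) A Y(1)] Y(2) by simp
  also have "\<dots> = (L * A) * X" using assoc_mult_mat[OF L(1) A X] AX by simp
  also have "\<dots> = X" using L X by simp
  finally show ?thesis .
qed

lemma solveT_snd:
  "snd (solveT A B) \<le> dim_col A * (dim_row A * (3 * (dim_col A + dim_col B) + 1))"
  using rrefT_snd[of "dim_col A" "augment A B"]
  by (simp add: solveT_def Let_def split_beta augment_def)

section \<open>Column pivoting\<close>

lemma argmaxT_fst:
  assumes "xs \<noteq> []"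
  shows "fst (argmaxT xs) < length xs" "j < length xs \<Longrightarrow> xs ! j \<le> xs ! fst (argmaxT xs)"
proof -
  let ?f = "\<lambda>j b. do { t \<leftarrow> lessT (xs ! b) (xs ! j); ret (if t then j else b) }"
  have "fst (foldT ?f [1..<k] 0) < k \<and> (\<forall>j<k. xs ! j \<le> xs ! fst (foldT ?f [1..<k] 0))" if "0 < k" for k
    using that
  proof (induction k)
    case (Suc k)
    show ?case
    proof (cases "k = 0")
      case False
      then have "[1..<Suc k] = [1..<k] @ [k]" by simp
      then show ?thesis using Suc.IH False by (auto simp: foldT_append less_Suc_eq)
    qed simp
  qed simp
  from this[of "length xs"] assms
  show "fst (argmaxT xs) < length xs" "j < length xs \<Longrightarrow> xs ! j \<le> xs ! fst (argmaxT xs)"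
    by (auto simp: argmaxT_def)
qed

lemma argmaxT_snd: "snd (argmaxT xs) \<le> length xs"
proof -
  have "snd (argmaxT xs) \<le> length [1..<length xs] * 1"
    unfolding argmaxT_def by (rule snd_foldT_le[where P = "\<lambda>_. True"]) auto
  then show ?thesis by simp
qed

definition colsqs :: "complex mat \<Rightarrow> real list" where
  "colsqs W = map (\<lambda>j. \<Sum>i<dim_row W. (cmod (W $$ (i, j)))\<^sup>2) [0..<dim_col W]"

lemma qr_stepT_fst:
  "fst (qr_stepT (W, js)) = (let ns = colsqs W; p = fst (argmaxT ns) in
     if ns ! p = 0 then (W, js) else
       (let q = (\<lambda>i. W $$ (i, p) / complex_of_real (sqrt (ns ! p)));
            R = (\<lambda>j. \<Sum>i<dim_row W. cnj (q i) * W $$ (i, j))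
        in (mat (dim_row W) (dim_col W) (\<lambda>(i, j). W $$ (i, j) - q i * R j), js @ [p])))"
  by (auto simp: qr_stepT_def Let_def colsqs_def if_distrib[where f = fst] intro!: eq_matI)

lemma qr_stepT_dims:
  "dim_row (fst (fst (qr_stepT s))) = dim_row (fst s)"
  "dim_col (fst (fst (qr_stepT s))) = dim_col (fst s)"
  by (cases s; auto simp: qr_stepT_fst Let_def)+

lemma qr_stepT_snd:
  "snd (qr_stepT s) \<le> dim_col (fst s) * (7 * dim_row (fst s) + 1) + dim_row (fst s) + 2"
proof -
  obtain W js where s: "s = (W, js)" by force
  let ?nr = "dim_row W" and ?nc = "dim_col W"
  let ?nsT = "mapT (\<lambda>j. sumT ?nr (\<lambda>i. sqmodT (W $$ (i, j)))) [0..<?nc]"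
  let ?ns = "fst ?nsT"
  let ?p = "fst (argmaxT ?ns)"
  let ?q = "vecT ?nr (\<lambda>i. divT (W $$ (i, ?p)) (complex_of_real (sqrt (?ns ! ?p))))"
  let ?R = "vecT ?nc (\<lambda>j. sumT ?nr (\<lambda>i. do { c \<leftarrow> cnjT (fst ?q $ i); mulT c (W $$ (i, j)) }))"
  let ?W = "matT ?nr ?nc (\<lambda>i j. do { t \<leftarrow> mulT (fst ?q $ i) (fst ?R $ j); subT (W $$ (i, j)) t })"
  have 1: "snd ?nsT \<le> ?nc * (?nr * 2)"
    using snd_mapT_le[of "[0..<?nc]" "\<lambda>j. sumT ?nr (\<lambda>i. sqmodT (W $$ (i, j)))" "?nr * 2"]
    by (simp add: snd_sumT_const)
  have 2: "snd (argmaxT ?ns) \<le> ?nc" using argmaxT_snd[of ?ns] by simp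
  have 3: "snd ?q \<le> ?nr * 1" by (rule snd_vecT_le) simp
  have 4: "snd ?R \<le> ?nc * (?nr * 3)" by (rule snd_vecT_le) (simp add: snd_sumT_const)
  have 5: "snd ?W \<le> ?nr * ?nc * 2" by (rule snd_matT_le) simp
  have "snd (qr_stepT s) \<le> snd ?nsT + (snd (argmaxT ?ns) + (1 + (1 + (snd ?q + (snd ?R + snd ?W)))))"
    unfolding s qr_stepT_def prod.case bindT_simps op_simps
    by (cases "?ns ! ?p = 0") (simp_all del: fst_mapT vecT_simps matT_simps)
  also have "\<dots> \<le> ?nc * (?nr * 2) + (?nc + (1 + (1 + (?nr * 1 + (?nc * (?nr * 3) + ?nr * ?nc * 2)))))"
    using 1 2 3 4 5 by linarith
  finally show ?thesis by (simp add: s algebra_simps)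
qed

text \<open>\<open>X\<close> is the accumulated projection and \<open>Q\<close> collects the directions projected out so far.\<close>

definition qr_inv :: "complex mat \<Rightarrow> complex mat \<times> nat list \<Rightarrow> bool" where
  "qr_inv N s \<longleftrightarrow> (case s of (W, js) \<Rightarrow> W \<in> carrier_mat (dim_row N) (dim_col N) \<and>
     set js \<subseteq> {..<dim_col N} \<and>
     (\<exists>Q U. \<forall>i<dim_row N. \<forall>j<dim_col N.
        N $$ (i, j) = W $$ (i, j) + (\<Sum>t<length js. Q i t * U t j)) \<and>
     (\<exists>X. \<forall>i<dim_row N. \<forall>j<dim_col N. W $$ (i, j) = (\<Sum>k<dim_row N. X i k * N $$ (k, j))) \<and>
     (\<forall>t<length js. \<forall>i<dim_row N. W $$ (i, js ! t) = 0) \<and>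
     (\<forall>c. (\<forall>i<dim_row N. (\<Sum>t<length js. c t * N $$ (i, js ! t)) = 0) \<longrightarrow> (\<forall>t<length js. c t = 0)))"

lemma qr_inv_init: "qr_inv N (N, [])"
proof -
  have "\<exists>X. \<forall>i<dim_row N. \<forall>j<dim_col N. N $$ (i, j) = (\<Sum>k<dim_row N. X i k * N $$ (k, j))"
    by (intro exI[of _ "\<lambda>i k. of_bool (k = i)"]) (simp add: of_bool_def if_distrib if_distribR cong: if_cong)
  then show ?thesis by (simp add: qr_inv_def)
qed

text \<open>The new direction joins \<open>Q\<close>, and projecting it out is a left
  multiplication, so it is absorbed by \<open>X\<close>. The residual certifies that the new column
  is independent of the earlier ones.\<close>

lemma qr_stepT_inv:
  assumes inv: "qr_inv N (W, js)" and nc: "0 < dim_col N"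
    and p: "p = fst (argmaxT (colsqs W))" and nz: "colsqs W ! p \<noteq> 0"
  shows "\<exists>W'. fst (qr_stepT (W, js)) = (W', js @ [p]) \<and> qr_inv N (W', js @ [p])"
proof -
  let ?nr = "dim_row N" and ?nc = "dim_col N"
  have dim: "dim_row W = ?nr" "dim_col W = ?nc" using inv by (auto simp: qr_inv_def)
  have js: "set js \<subseteq> {..<?nc}" using inv by (simp add: qr_inv_def)
  have "colsqs W \<noteq> []" using nc by (simp add: colsqs_def dim)
  then have pn: "p < ?nc" using argmaxT_fst(1)[of "colsqs W"] p by (simp add: colsqs_def dim)
  define s where "s = complex_of_real (sqrt (colsqs W ! p))"
  define q where "q i = W $$ (i, p) / s" for i
  define R where "R j = (\<Sum>i<?nr. cnj (q i) * W $$ (i, j))" for j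
  define W' where "W' = mat ?nr ?nc (\<lambda>(i, j). W $$ (i, j) - q i * R j)"
  have step: "fst (qr_stepT (W, js)) = (W', js @ [p])"
    unfolding qr_stepT_fst Let_def p[symmetric] using nz by (simp add: dim W'_def R_def q_def s_def)
  have W': "W' $$ (i, j) = W $$ (i, j) - q i * R j" if "i < ?nr" "j < ?nc" for i j
    using that by (simp add: W'_def)
  have sq: "colsqs W ! p = (\<Sum>i<?nr. (cmod (W $$ (i, p)))\<^sup>2)" using pn by (simp add: colsqs_def dim)
  have s0: "s \<noteq> 0" using nz by (simp add: s_def)
  \<comment> \<open>The squared norm of column \<open>p\<close> is \<open>s\<close> squared, so
    subtracting \<open>q i * R p\<close> clears exactly this column.\<close>
  have Rp: "R p = s"
  proof -
    have "R p = (\<Sum>i<?nr. complex_of_real ((cmod (W $$ (i, p)))\<^sup>2)) / s"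
      unfolding R_def q_def sum_divide_distrib
      by (intro sum.cong) (simp_all add: s_def complex_norm_square mult.commute del: of_real_power)
    also have "\<dots> = complex_of_real (colsqs W ! p) / s" by (simp add: sq)
    also have "\<dots> = s * s / s"
    proof -
      have "0 \<le> colsqs W ! p" unfolding sq by (intro sum_nonneg) simp
      then show ?thesis by (simp add: s_def flip: of_real_mult)
    qed
    finally show ?thesis using s0 by simp
  qed
  obtain Q U where QU: "\<And>i j. i < ?nr \<Longrightarrow> j < ?nc \<Longrightarrow>
      N $$ (i, j) = W $$ (i, j) + (\<Sum>t<length js. Q i t * U t j)"
    using inv by (auto simp: qr_inv_def)
  obtain X where X: "\<And>i j. i < ?nr \<Longrightarrow> j < ?nc \<Longrightarrow> W $$ (i, j) = (\<Sum>k<?nr. X i k * N $$ (k, j))"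
    using inv by (auto simp: qr_inv_def)
  have z: "W $$ (i, js ! t) = 0" if "t < length js" "i < ?nr" for t i
    using inv that by (auto simp: qr_inv_def)
  have ind: "\<forall>t<length js. c t = 0" if "\<forall>i<?nr. (\<Sum>t<length js. c t * N $$ (i, js ! t)) = 0" for c
    using inv that by (auto simp: qr_inv_def)
  have jt: "js ! t < ?nc" if "t < length js" for t using js that by (meson lessThan_iff nth_mem subsetD)
  have "qr_inv N (W', js @ [p])" unfolding qr_inv_def prod.case
  proof (intro conjI)
    show "W' \<in> carrier_mat ?nr ?nc" by (simp add: W'_def)
    show "set (js @ [p]) \<subseteq> {..<?nc}" using js pn by simp
    let ?Q = "\<lambda>i t. if t < length js then Q i t else q i"
    let ?U = "\<lambda>t j. if t < length js then U t j else R j"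
    show "\<exists>Q U. \<forall>i<?nr. \<forall>j<?nc. N $$ (i, j) = W' $$ (i, j) + (\<Sum>t<length (js @ [p]). Q i t * U t j)"
      by (rule exI[of _ ?Q], rule exI[of _ ?U]) (simp add: W' QU)
    show "\<exists>X. \<forall>i<?nr. \<forall>j<?nc. W' $$ (i, j) = (\<Sum>k<?nr. X i k * N $$ (k, j))"
    proof (intro exI allI impI)
      fix i j assume ij: "i < ?nr" "j < ?nc"
      have "R j = (\<Sum>l<?nr. \<Sum>k<?nr. cnj (q l) * X l k * N $$ (k, j))"
        unfolding R_def using ij by (intro sum.cong) (auto simp: X sum_distrib_left mult.assoc)
      also have "\<dots> = (\<Sum>k<?nr. (\<Sum>l<?nr. cnj (q l) * X l k) * N $$ (k, j))"
        by (subst sum.swap) (simp add: sum_distrib_right)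
      finally have Rj: "R j = (\<Sum>k<?nr. (\<Sum>l<?nr. cnj (q l) * X l k) * N $$ (k, j))" .
      have "q i * R j = (\<Sum>k<?nr. q i * ((\<Sum>l<?nr. cnj (q l) * X l k) * N $$ (k, j)))"
        unfolding Rj by (rule sum_distrib_left)
      then have "q i * R j = (\<Sum>k<?nr. q i * (\<Sum>l<?nr. cnj (q l) * X l k) * N $$ (k, j))"
        by (simp only: mult.assoc)
      then show "W' $$ (i, j) = (\<Sum>k<?nr. (X i k - q i * (\<Sum>l<?nr. cnj (q l) * X l k)) * N $$ (k, j))"
        unfolding W'[OF ij] X[OF ij] left_diff_distrib sum_subtractf by simp
    qed
    show "\<forall>t<length (js @ [p]). \<forall>i<?nr. W' $$ (i, (js @ [p]) ! t) = 0"
    proof (intro allI impI)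
      fix t i assume t: "t < length (js @ [p])" and i: "i < ?nr"
      show "W' $$ (i, (js @ [p]) ! t) = 0"
      proof (cases "t < length js")
        case True
        have "R (js ! t) = 0" unfolding R_def using z[OF True] by simp
        then show ?thesis using True i by (simp add: nth_append W' jt z)
      next
        case False
        then have "(js @ [p]) ! t = p" using t by (simp add: nth_append)
        then show ?thesis using i pn Rp s0 by (simp add: W' q_def)
      qed
    qed
    show "\<forall>c. (\<forall>i<?nr. (\<Sum>t<length (js @ [p]). c t * N $$ (i, (js @ [p]) ! t)) = 0) \<longrightarrow>
        (\<forall>t<length (js @ [p]). c t = 0)"
    proof (intro allI impI)
      fix c t
      assume c: "\<forall>i<?nr. (\<Sum>t<length (js @ [p]). c t * N $$ (i, (js @ [p]) ! t)) = 0"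
        and t: "t < length (js @ [p])"
      have c': "(\<Sum>t<length js. c t * N $$ (i, js ! t)) + c (length js) * N $$ (i, p) = 0" if "i < ?nr" for i
      proof -
        have "(\<Sum>t<length js. c t * N $$ (i, js ! t)) = (\<Sum>t<length js. c t * N $$ (i, (js @ [p]) ! t))"
          by (intro sum.cong) (auto simp: nth_append)
        then show ?thesis using c that by simp
      qed
      \<comment> \<open>Applying \<open>X\<close> to a relation among the chosen columns kills the
        earlier ones, whose residuals vanish, and leaves the multiple of the nonzero residual of
        column \<open>p\<close>.\<close>
      have cW: "c (length js) * W $$ (i, p) = 0" if i: "i < ?nr" for i
      proof -
        have "0 = (\<Sum>k<?nr. X i k * ((\<Sum>t<length js. c t * N $$ (k, js ! t)) + c (length js) * N $$ (k, p)))"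
          by (simp add: c')
        also have "\<dots> = (\<Sum>k<?nr. \<Sum>t<length js. c t * (X i k * N $$ (k, js ! t)))
            + (\<Sum>k<?nr. c (length js) * (X i k * N $$ (k, p)))"
          by (simp add: distrib_left sum.distrib sum_distrib_left mult.left_commute)
        also have "(\<Sum>k<?nr. \<Sum>t<length js. c t * (X i k * N $$ (k, js ! t))) = 
            (\<Sum>t<length js. c t * W $$ (i, js ! t))"
          using i by (subst sum.swap) (intro sum.cong, auto simp: X jt sum_distrib_left)
        also have "\<dots> = 0" using z i by simp
        also have "(\<Sum>k<?nr. c (length js) * (X i k * N $$ (k, p))) = c (length js) * W $$ (i, p)"
          using X[OF i pn] by (simp add: sum_distrib_left)
        finally show ?thesis by simp
      qed
      have "c (length js) = 0"
      proof (rule ccontr)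
        assume "c (length js) \<noteq> 0"
        then have "colsqs W ! p = 0" unfolding sq using cW by (intro sum.neutral) auto
        then show False using nz by simp
      qed
      then have "\<forall>t<length js. c t = 0" using c' by (intro ind) simp
      with \<open>c (length js) = 0\<close> t show "c t = 0" by (auto simp: less_Suc_eq)
    qed
  qed
  with step show ?thesis by blast
qed

lemma qr_stepT_cases:
  assumes inv: "qr_inv N (W, js)" and nc: "0 < dim_col N"
  obtains (stop) "fst (qr_stepT (W, js)) = (W, js)" "\<And>i j. i < dim_row N \<Longrightarrow> j < dim_col N \<Longrightarrow> W $$ (i, j) = 0"
  | (step) W' p where "fst (qr_stepT (W, js)) = (W', js @ [p])" "qr_inv N (W', js @ [p])"
proof (cases "colsqs W ! fst (argmaxT (colsqs W)) = 0")
  case True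
  have dim: "dim_row W = dim_row N" "dim_col W = dim_col N" using inv by (auto simp: qr_inv_def)
  then have ne: "colsqs W \<noteq> []" using nc by (simp add: colsqs_def)
  have "W $$ (i, j) = 0" if ij: "i < dim_row N" "j < dim_col N" for i j
  proof -
    have "colsqs W ! j \<le> 0" using argmaxT_fst(2)[OF ne, of j] True ij by (simp add: colsqs_def dim)
    then have "(\<Sum>i<dim_row N. (cmod (W $$ (i, j)))\<^sup>2) \<le> 0" using ij by (simp add: colsqs_def dim)
    then have "(\<Sum>i<dim_row N. (cmod (W $$ (i, j)))\<^sup>2) = 0" by (simp add: sum_nonneg antisym)
    then show ?thesis using ij by (simp add: sum_nonneg_eq_0_iff)
  qed
  moreover have "fst (qr_stepT (W, js)) = (W, js)" using True by (simp add: qr_stepT_fst Let_def)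
  ultimately show ?thesis using stop by simp
next
  case False
  then show ?thesis using qr_stepT_inv[OF inv nc refl] step by blast
qed

text \<open>Stopping after k steps with k below the number of rows would write \<open>N\<close> as a
  sum of k terms of rank one, and its rows would be dependent.\<close>

lemma qr_pivotsT_fst:
  assumes nc: "0 < dim_col N"
    and rank: "\<And>u. (\<And>j. j < dim_col N \<Longrightarrow> (\<Sum>i<dim_row N. u i * N $$ (i, j)) = 0) \<Longrightarrow> \<forall>i<dim_row N. u i = 0"
  defines "js \<equiv> fst (qr_pivotsT (dim_row N) N)"
  shows "length js = dim_row N" "set js \<subseteq> {..<dim_col N}"
    "\<And>c. (\<And>i. i < dim_row N \<Longrightarrow> (\<Sum>t<dim_row N. c t * N $$ (i, js ! t)) = 0) \<Longrightarrow> \<forall>t<dim_row N. c t = 0"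
proof -
  have "qr_inv N (fst (foldT (\<lambda>_. qr_stepT) [0..<k] (N, []))) \<and>
      length (snd (fst (foldT (\<lambda>_. qr_stepT) [0..<k] (N, [])))) = k" if "k \<le> dim_row N" for k
    using that
  proof (induction k)
    case (Suc k)
    obtain W js where s: "fst (foldT (\<lambda>_. qr_stepT) [0..<k] (N, [])) = (W, js)" by force
    then have inv: "qr_inv N (W, js)" and len: "length js = k" using Suc by auto
    have next_state: "fst (foldT (\<lambda>_. qr_stepT) [0..<Suc k] (N, [])) = fst (qr_stepT (W, js))"
      by (simp add: foldT_append s)
    show ?case
      using inv nc
    proof (cases rule: qr_stepT_cases)
      case stop
      obtain Q U where QU: "\<And>i j. i < dim_row N \<Longrightarrow> j < dim_col N \<Longrightarrow>
          N $$ (i, j) = W $$ (i, j) + (\<Sum>t<length js. Q i t * U t j)"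
        using inv by (auto simp: qr_inv_def)
      \<comment> \<open>The vector \<open>u\<close> is orthogonal to the k columns of
        \<open>Q\<close>, hence annihilates \<open>N\<close> from the left.\<close>
      have "k < dim_row N" using Suc.prems by simp
      then obtain u where u: "\<exists>i<dim_row N. u i \<noteq> 0" "\<And>t. t < k \<Longrightarrow> (\<Sum>i<dim_row N. Q i t * u i) = 0"
        by (rule dependent_columns[where M = "\<lambda>t i. Q i t"]) blast
      have "(\<Sum>i<dim_row N. u i * N $$ (i, j)) = 0" if "j < dim_col N" for j
      proof -
        have "(\<Sum>i<dim_row N. u i * N $$ (i, j)) = (\<Sum>i<dim_row N. \<Sum>t<k. (Q i t * u i) * U t j)"
          using that stop(2) by (intro sum.cong) (auto simp: QU len sum_distrib_left mult_ac)
        also have "\<dots> = (\<Sum>t<k. (\<Sum>i<dim_row N. Q i t * u i) * U t j)"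
          by (subst sum.swap) (simp add: sum_distrib_right)
        also have "\<dots> = 0" using u(2) by simp
        finally show ?thesis .
      qed
      then have "\<forall>i<dim_row N. u i = 0" by (rule rank)
      then show ?thesis using u(1) by blast
    next
      case (step W' p)
      then show ?thesis using len next_state by simp
    qed
  qed (simp add: qr_inv_init)
  from this[of "dim_row N"] obtain W where
    W: "fst (foldT (\<lambda>_. qr_stepT) [0..<dim_row N] (N, [])) = (W, js)" "qr_inv N (W, js)" "length js = dim_row N"
    by (cases "fst (foldT (\<lambda>_. qr_stepT) [0..<dim_row N] (N, []))") (auto simp: js_def qr_pivotsT_def)
  show "length js = dim_row N" by (fact W(3))
  show "set js \<subseteq> {..<dim_col N}" using W by (simp add: qr_inv_def)
  show "\<forall>t<dim_row N. c t = 0"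
    if "\<And>i. i < dim_row N \<Longrightarrow> (\<Sum>t<dim_row N. c t * N $$ (i, js ! t)) = 0" for c
    using W that by (auto simp: qr_inv_def)
qed

lemma qr_pivotsT_snd:
  "snd (qr_pivotsT r N) \<le> r * (dim_col N * (7 * dim_row N + 1) + dim_row N + 2)"
proof -
  have "snd (foldT (\<lambda>_. qr_stepT) [0..<r] (N, [])) \<le>
      length [0..<r] * (dim_col N * (7 * dim_row N + 1) + dim_row N + 2)"
  proof (rule snd_foldT_le[where P = "\<lambda>s. dim_row (fst s) = dim_row N \<and> dim_col (fst s) = dim_col N"])
    fix x and s :: "complex mat \<times> nat list"
    assume s: "dim_row (fst s) = dim_row N \<and> dim_col (fst s) = dim_col N"
    show "(dim_row (fst (fst (qr_stepT s))) = dim_row N \<and> dim_col (fst (fst (qr_stepT s))) = dim_col N) \<and>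
        snd (qr_stepT s) \<le> dim_col N * (7 * dim_row N + 1) + dim_row N + 2"
      using qr_stepT_snd[of s] s by (simp only: qr_stepT_dims)
  qed simp
  then show ?thesis by (simp add: qr_pivotsT_def split_beta)
qed

section \<open>Simultaneous diagonalization\<close>


lemma inverse_mult:
  fixes A :: "complex mat"
  assumes "A \<in> carrier_mat r r" "A' \<in> carrier_mat r r" "A' * A = 1\<^sub>m r"
    and "B \<in> carrier_mat r r" "B' \<in> carrier_mat r r" "B' * B = 1\<^sub>m r"
  shows "(B' * A') * (A * B) = 1\<^sub>m r"
proof -
  have "(B' * A') * (A * B) = B' * (A' * (A * B))" using assms by (intro assoc_mult_mat) auto
  also have "A' * (A * B) = (A' * A) * B" using assms by (intro assoc_mult_mat[symmetric]) auto
  finally show ?thesis using assms by simp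
qed

text \<open>Entrywise, \<open>\<mu> i * W_ij = W_ij * D_jj\<close>. As \<mu> is injective, each
  column of the invertible \<open>W\<close> has exactly one nonzero entry: \<open>W\<close> is a
  permutation matrix up to scaling, and \<sigma> is its permutation.\<close>

lemma eigenvectors_of_simple_spectrum:
  fixes W D :: "complex mat"
  assumes W: "W \<in> carrier_mat r r" "W' \<in> carrier_mat r r" "W * W' = 1\<^sub>m r" "W' * W = 1\<^sub>m r"
    and D: "D \<in> carrier_mat r r" "diagonal_mat D" and eq: "mat_diag r \<mu> * W = W * D"
    and inj: "inj_on \<mu> {..<r}"
  obtains \<sigma> where "bij_betw \<sigma> {..<r} {..<r}" "\<And>i j. i < r \<Longrightarrow> j < r \<Longrightarrow> W $$ (i, j) \<noteq> 0 \<Longrightarrow> i = \<sigma> j"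
proof -
  have ent: "\<mu> i * W $$ (i, j) = W $$ (i, j) * D $$ (j, j)" if ij: "i < r" "j < r" for i j
  proof -
    have "(W * D) $$ (i, j) = (\<Sum>k<r. W $$ (i, k) * D $$ (k, j))"
      using W D ij by (auto simp: scalar_prod_def lessThan_atLeast0)
    also have "\<dots> = (\<Sum>k<r. if k = j then W $$ (i, j) * D $$ (j, j) else 0)"
      using D ij by (intro sum.cong) (auto simp: diagonal_mat_def)
    also have "\<dots> = W $$ (i, j) * D $$ (j, j)" using ij by simp
    finally show ?thesis using arg_cong[OF eq, of "\<lambda>M. M $$ (i, j)"] ij W
      by (simp add: mat_diag_mult_left)
  qed
  have ex: "\<exists>i<r. W $$ (i, j) \<noteq> 0" if j: "j < r" for j
  proof (rule ccontr)
    assume "\<not> ?thesis"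
    moreover have "(W' * W) $$ (j, j) = (\<Sum>k<r. W' $$ (j, k) * W $$ (k, j))"
      using W(1,2) j by (simp add: scalar_prod_def lessThan_atLeast0)
    ultimately show False using W j by simp
  qed
  define \<sigma> where "\<sigma> j = (SOME i. i < r \<and> W $$ (i, j) \<noteq> 0)" for j
  have \<sigma>: "\<sigma> j < r" "W $$ (\<sigma> j, j) \<noteq> 0" if "j < r" for j
    using someI_ex[OF ex[OF that]] by (auto simp: \<sigma>_def)
  have uniq: "i = \<sigma> j" if "i < r" "j < r" "W $$ (i, j) \<noteq> 0" for i j
  proof -
    have "\<mu> i = D $$ (j, j)" using ent[OF that(1,2)] that(3) by (simp add: mult.commute)
    moreover have "\<mu> (\<sigma> j) = D $$ (j, j)"
      using ent[OF \<sigma>(1)[OF that(2)] that(2)] \<sigma>(2)[OF that(2)] by (simp add: mult.commute)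
    ultimately show ?thesis using inj that(1) \<sigma>(1)[OF that(2)] by (auto simp: inj_on_def)
  qed
  have "{..<r} \<subseteq> \<sigma> ` {..<r}"
  proof
    fix i assume i: "i \<in> {..<r}"
    have "\<exists>j<r. W $$ (i, j) \<noteq> 0"
    proof (rule ccontr)
      assume "\<not> ?thesis"
      moreover have "(W * W') $$ (i, i) = (\<Sum>k<r. W $$ (i, k) * W' $$ (k, i))"
        using W(1,2) i by (simp add: scalar_prod_def lessThan_atLeast0)
      ultimately show False using W i by simp
    qed
    then show "i \<in> \<sigma> ` {..<r}" using uniq i by auto
  qed
  moreover have "\<sigma> ` {..<r} \<subseteq> {..<r}" using \<sigma>(1) by auto
  ultimately have im: "\<sigma> ` {..<r} = {..<r}" by blast
  then have "inj_on \<sigma> {..<r}" by (intro eq_card_imp_inj_on) auto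
  with im have "bij_betw \<sigma> {..<r} {..<r}" by (simp add: bij_betw_def)
  then show ?thesis using uniq that by blast
qed


text \<open>The restricted maps are \<open>T diag(d0) E\<close> and \<open>T diag(d k) E\<close>, where \<open>E\<close> evaluates the elements of
  the basis \<open>B\<close> at the points.\<close>

locale joint_diag =
  fixes eig :: "complex mat \<Rightarrow> complex mat timed" and ce :: nat and r :: nat
    and T E N0 :: "complex mat" and js :: "nat list" and Ns :: "complex mat list"
    and d0 :: "nat \<Rightarrow> complex" and d :: "nat \<Rightarrow> nat \<Rightarrow> complex" and \<rho> :: rand
  assumes eig: "\<And>k A. A \<in> carrier_mat k k \<Longrightarrow> diagonalizable A \<Longrightarrow>
     fst (eig A) \<in> carrier_mat k k \<and> invertible_mat (fst (eig A)) \<and>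
     (\<exists>D \<in> carrier_mat k k. diagonal_mat D \<and> A * fst (eig A) = fst (eig A) * D) \<and>
     snd (eig A) \<le> ce * k ^ 3"
    and T: "T \<in> carrier_mat r r" "det T \<noteq> 0"
    and E: "E \<in> carrier_mat r r" "det E \<noteq> 0"
    and N0: "mat r r (\<lambda>(i, j). N0 $$ (i, js ! j)) = T * mat_diag r d0 * E"
    and N: "\<And>k. k < length Ns \<Longrightarrow> mat r r (\<lambda>(i, j). Ns ! k $$ (i, js ! j)) = T * mat_diag r (d k) * E"
    and d0: "\<And>i. i < r \<Longrightarrow> d0 i \<noteq> 0"
    and inj: "inj_on (\<lambda>i. \<Sum>k<length Ns. \<rho> (RMix k) * (d k i / d0 i)) {..<r}"
begin

definition "\<Lambda> k = mat_diag r (\<lambda>i. d k i / d0 i)"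

definition "E' = (SOME B. B \<in> carrier_mat r r \<and> E * B = 1\<^sub>m r \<and> B * E = 1\<^sub>m r)"

lemma E': "E' \<in> carrier_mat r r" "E * E' = 1\<^sub>m r" "E' * E = 1\<^sub>m r"
proof -
  obtain B where "B \<in> carrier_mat r r \<and> E * B = 1\<^sub>m r \<and> B * E = 1\<^sub>m r"
    using det_nonzero_inverse[OF E] by metis
  then show "E' \<in> carrier_mat r r" "E * E' = 1\<^sub>m r" "E' * E = 1\<^sub>m r"
    unfolding E'_def by (metis (mono_tags, lifting) someI_ex)+
qed

abbreviation "restr N \<equiv> mat r r (\<lambda>(i, j). N $$ (i, js ! j))"

lemma Lam_carrier: "\<Lambda> k \<in> carrier_mat r r" by (simp add: \<Lambda>_def)

text \<open>The factor \<open>T\<close> cancels and the quotient of the two maps is diagonal in the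
  basis given by \<open>E\<close>. An explicit left inverse of the first map makes the computed
  solution the only one.\<close>

lemma Ms:
  assumes k: "k < length Ns"
  shows "fst (solveT (restr N0) (restr (Ns ! k))) = E' * \<Lambda> k * E"
proof -
  obtain T' where T': "T' \<in> carrier_mat r r" "T' * T = 1\<^sub>m r"
    using det_nonzero_inverse[OF T] by metis
  let ?D0 = "mat_diag r d0" and ?D0' = "mat_diag r (\<lambda>i. 1 / d0 i)"
  have D0': "?D0' * ?D0 = 1\<^sub>m r"
    unfolding mat_diag_diag by (intro eq_matI) (auto simp: mat_diag_def d0)
  have TD: "(?D0' * T') * (T * ?D0) = 1\<^sub>m r"
    by (rule inverse_mult[OF T(1) T' mat_diag_dim mat_diag_dim D0'])
  have L: "(E' * (?D0' * T')) * restr N0 = 1\<^sub>m r" unfolding N0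
    using T T' by (intro inverse_mult[OF _ _ TD E(1) E'(1,3)] mult_carrier_mat[where n = r]) auto
  have "restr N0 * (E' * \<Lambda> k * E) = T * ?D0 * E * (E' * (\<Lambda> k * E))"
    unfolding N0 using E(1) E'(1) Lam_carrier[of k] by simp
  also have "\<dots> = T * ?D0 * (E * (E' * (\<Lambda> k * E)))"
    using T(1) E(1) E'(1) Lam_carrier[of k]
    by (intro assoc_mult_mat[where n\<^sub>1 = r and n\<^sub>2 = r and n\<^sub>3 = r and n\<^sub>4 = r] mult_carrier_mat[where n = r]) auto
  also have "E * (E' * (\<Lambda> k * E)) = (E * E') * (\<Lambda> k * E)"
    using E(1) E'(1) Lam_carrier[of k] by (intro assoc_mult_mat[of _ r r _ r _ r, symmetric] mult_carrier_mat[of _ r r _ r]) auto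
  also have "\<dots> = \<Lambda> k * E" using E(1) E' Lam_carrier[of k] by simp
  also have "T * ?D0 * (\<Lambda> k * E) = T * (?D0 * (\<Lambda> k * E))"
    using T(1) E(1) Lam_carrier[of k] by (intro assoc_mult_mat[of _ r r _ r _ r] mult_carrier_mat[of _ r r _ r]) auto
  also have "?D0 * (\<Lambda> k * E) = (?D0 * \<Lambda> k) * E"
    using E(1) Lam_carrier[of k] by (intro assoc_mult_mat[of _ r r _ r _ r, symmetric] mult_carrier_mat[of _ r r _ r]) auto
  also have "?D0 * \<Lambda> k = mat_diag r (d k)"
    unfolding \<Lambda>_def mat_diag_diag using d0 by (auto simp: mat_diag_def)
  also have "T * (mat_diag r (d k) * E) = restr (Ns ! k)"
    unfolding N[OF k] using T(1) E(1) by (intro assoc_mult_mat[of _ r r _ r _ r, symmetric] mult_carrier_mat[of _ r r _ r]) auto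
  finally have "restr N0 * (E' * \<Lambda> k * E) = restr (Ns ! k)" .
  moreover have "E' * \<Lambda> k * E \<in> carrier_mat r r" "E' * (?D0' * T') \<in> carrier_mat r r"
    using E(1) E'(1) T'(1) Lam_carrier[of k] by (auto intro!: mult_carrier_mat[where n = r])
  ultimately show ?thesis using L by (intro solveT_unique[where nr = r]) auto
qed

text \<open>The random combination has the spectrum \<open>\<mu>\<close>, which is simple. Hence
  \<open>E\<close> times the computed eigenvector matrix is a scaled permutation matrix, and these
  eigenvectors diagonalize all the matrices at once, in an order common to all.\<close>

lemma joint_eigenvalues:
  "\<exists>\<sigma>. bij_betw \<sigma> {..<r} {..<r} \<and> fst (joint_eigenvaluesT eig \<rho> r js N0 Ns) =
    map (\<lambda>i. vec (length Ns) (\<lambda>k. d k (\<sigma> i) / d0 (\<sigma> i))) [0..<r]"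
  and joint_eigenvalues_snd: "snd (joint_eigenvaluesT eig \<rho> r js N0 Ns) \<le> (length Ns + 1) * (ce + 20) * r ^ 3"
proof -
  let ?K = "length Ns"
  define Ms where "Ms = map (\<lambda>N. fst (solveT (restr N0) (restr N))) Ns"
  define \<mu> where "\<mu> i = (\<Sum>k<?K. \<rho> (RMix k) * (d k i / d0 i))" for i
  define M where "M = mat r r (\<lambda>(i, j). \<Sum>k<?K. \<rho> (RMix k) * (Ms ! k) $$ (i, j))"
  have Ms: "Ms ! k = E' * \<Lambda> k * E" if "k < ?K" for k using Ms[OF that] that by (simp add: Ms_def)
  have M: "M = E' * mat_diag r \<mu> * E"
  proof (rule eq_matI)
    fix i j assume "i < dim_row (E' * mat_diag r \<mu> * E)" "j < dim_col (E' * mat_diag r \<mu> * E)"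
    then have ij: "i < r" "j < r" using E E' by auto
    have ent: "(E' * mat_diag r f * E) $$ (i, j) = (\<Sum>l<r. E' $$ (i, l) * f l * E $$ (l, j))" for f
      using E(1) E'(1) ij by (subst mat_diag_mult_right[OF E'(1)]) (auto simp: scalar_prod_def lessThan_atLeast0)
    have "M $$ (i, j) = (\<Sum>k<?K. \<Sum>l<r. E' $$ (i, l) * (\<rho> (RMix k) * (d k l / d0 l)) * E $$ (l, j))"
      using ij by (simp add: M_def Ms \<Lambda>_def ent sum_distrib_left mult_ac)
    also have "\<dots> = (\<Sum>l<r. E' $$ (i, l) * \<mu> l * E $$ (l, j))"
      unfolding \<mu>_def by (subst sum.swap) (simp only: sum_distrib_left sum_distrib_right)
    finally show "M $$ (i, j) = (E' * mat_diag r \<mu> * E) $$ (i, j)" by (simp add: ent)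
  qed (use E E' in \<open>auto simp: M_def\<close>)
  have Mc: "M \<in> carrier_mat r r" by (simp add: M_def)
  have "similar_mat_wit M (mat_diag r \<mu>) E' E"
    using E(1) E' Mc M by (intro similar_mat_witI) auto
  moreover have "diagonal_mat (mat_diag r \<mu>)" by (auto simp: diagonal_mat_def mat_diag_def)
  ultimately have "diagonalizable M" unfolding diagonalizable_def similar_mat_def by blast
  define V where "V = fst (eig M)"
  obtain D where V: "V \<in> carrier_mat r r" "invertible_mat V" and D: "D \<in> carrier_mat r r" "diagonal_mat D"
    and MV: "M * V = V * D" and eig_time: "snd (eig M) \<le> ce * r ^ 3"
    using eig[OF Mc \<open>diagonalizable M\<close>] by (auto simp: V_def)
  obtain V' where V'i: "inverts_mat V V'" "inverts_mat V' V" using V(2) by (auto simp: invertible_mat_def)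
  have V'c: "V' \<in> carrier_mat r r"
    using V'i V(1) unfolding inverts_mat_def
    by (metis carrier_matD carrier_matI index_mult_mat(2,3) index_one_mat(2,3))
  have V': "V * V' = 1\<^sub>m r" "V' * V = 1\<^sub>m r" using V'i V(1) V'c by (auto simp: inverts_mat_def)
  define W where "W = E * V"
  define W' where "W' = V' * E'"
  have Wc: "W \<in> carrier_mat r r" "W' \<in> carrier_mat r r" using E E' V V'c by (auto simp: W_def W'_def)
  have W'W: "W' * W = 1\<^sub>m r" unfolding W_def W'_def
    by (rule inverse_mult[OF E(1) E'(1,3) V(1) V'c V'(2)])
  have WW': "W * W' = 1\<^sub>m r" unfolding W_def W'_def
    by (rule inverse_mult[OF V'c V(1) V'(1) E'(1) E(1) E'(2)])
  have VW: "V = E' * W"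
    using assoc_mult_mat[OF E'(1) E(1) V(1)] E'(3) V(1) by (simp add: W_def)
  have EM: "E * (E' * mat_diag r f * E) * V = mat_diag r f * W" for f
  proof -
    have "E * (E' * mat_diag r f * E) = E * (E' * (mat_diag r f * E))"
      by (subst assoc_mult_mat[OF E'(1) mat_diag_dim E(1)]) simp
    also have "\<dots> = (E * E') * (mat_diag r f * E)"
      by (rule assoc_mult_mat[OF E(1) E'(1) mult_carrier_mat[OF mat_diag_dim E(1)], symmetric])
    also have "\<dots> = mat_diag r f * E"
      unfolding E'(2) by (rule left_mult_one_mat[OF mult_carrier_mat[OF mat_diag_dim E(1)]])
    finally show ?thesis using assoc_mult_mat[OF mat_diag_dim E(1) V(1)] by (simp add: W_def)
  qed
  have "mat_diag r \<mu> * W = E * M * V" using EM[of \<mu>] M by simp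
  also have "\<dots> = E * (V * D)" using E(1) Mc V(1) MV by simp
  also have "\<dots> = W * D" using E(1) V(1) D(1) by (simp add: W_def)
  finally have "mat_diag r \<mu> * W = W * D" .
  then obtain \<sigma> where bij: "bij_betw \<sigma> {..<r} {..<r}"
    and \<sigma>: "\<And>i j. i < r \<Longrightarrow> j < r \<Longrightarrow> W $$ (i, j) \<noteq> 0 \<Longrightarrow> i = \<sigma> j"
    by (rule eigenvectors_of_simple_spectrum[OF Wc WW' W'W D _ inj[folded \<mu>_def[abs_def]]]) blast
  define Ds where "Ds = map (\<lambda>M'. fst (solveT V (fst (mat_mulT M' V)))) Ms"
  \<comment> \<open>In each column of \<open>W\<close> only the entry in row
    \<open>\<sigma> j\<close> survives, so multiplying \<open>W\<close> by the diagonal matrix on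
    the left or by the permuted one on the right is the same.\<close>
  have Ds: "Ds ! k = mat_diag r (\<lambda>j. d k (\<sigma> j) / d0 (\<sigma> j))" (is "_ = ?X") if k: "k < ?K" for k
  proof -
    have "W $$ (i, j) * (d k (\<sigma> j) / d0 (\<sigma> j)) = d k i / d0 i * W $$ (i, j)" if "i < r" "j < r" for i j
      using \<sigma>[OF that] by (cases "W $$ (i, j) = 0") auto
    then have "W * ?X = \<Lambda> k * W"
      unfolding \<Lambda>_def mat_diag_mult_right[OF Wc(1)] mat_diag_mult_left[OF Wc(1)]
      by (intro eq_matI) auto
    then have "E' * (W * ?X) = E' * (\<Lambda> k * W)" by simp
    then have "V * ?X = E' * (\<Lambda> k * W)"
      unfolding VW assoc_mult_mat[OF E'(1) Wc(1) mat_diag_dim] .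
    also have "\<dots> = Ms ! k * V"
      unfolding Ms[OF k] W_def using E(1) E'(1) V(1) Lam_carrier[of k]
      by (simp add: assoc_mult_mat[of _ r r _ r _ r] mult_carrier_mat[of _ r r _ r])
    finally have eq: "V * ?X = Ms ! k * V" .
    have Mk: "Ms ! k \<in> carrier_mat r r" unfolding Ms[OF k] using E(1) E'(1) Lam_carrier[of k] by auto
    have "fst (mat_mulT (Ms ! k) V) = Ms ! k * V" by (rule fst_mat_mulT[OF Mk V(1)])
    then have "Ds ! k = fst (solveT V (Ms ! k * V))" using k by (simp add: Ds_def Ms_def)
    also have "\<dots> = ?X" using Mk V(1) V'c V'(2) eq by (intro solveT_unique[where nr = r]) auto
    finally show ?thesis .
  qed
  have len: "length Ds = ?K" "length Ms = ?K" by (simp_all add: Ds_def Ms_def)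
  have "fst (joint_eigenvaluesT eig \<rho> r js N0 Ns) =
      map (\<lambda>i. vec (length Ds) (\<lambda>k. (Ds ! k) $$ (i, i))) [0..<r]"
    unfolding joint_eigenvaluesT_def Let_def bindT_simps ret_simps fst_mapT matT_simps fst_sumT op_simps
      Ms_def[symmetric] len(2) M_def[symmetric] V_def[symmetric] Ds_def[symmetric] ..
  also have "\<dots> = map (\<lambda>i. vec ?K (\<lambda>k. d k (\<sigma> i) / d0 (\<sigma> i))) [0..<r]"
    by (auto simp: len Ds mat_diag_def intro!: eq_vecI)
  finally show "\<exists>\<sigma>. bij_betw \<sigma> {..<r} {..<r} \<and> fst (joint_eigenvaluesT eig \<rho> r js N0 Ns) =
    map (\<lambda>i. vec (length Ns) (\<lambda>k. d k (\<sigma> i) / d0 (\<sigma> i))) [0..<r]" using bij by blast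
  have t1: "snd (mapT (\<lambda>N. solveT (restr N0) (restr N)) Ns) \<le> ?K * (r * (r * (3 * (r + r) + 1)))"
    by (intro snd_mapT_le order.trans[OF solveT_snd]) simp
  have t2: "snd (matT r r (\<lambda>i j. sumT ?K (\<lambda>k. mulT (\<rho> (RMix k)) ((Ms ! k) $$ (i, j))))) \<le> r * r * (?K * 2)"
    by (intro snd_matT_le) (simp add: snd_sumT_const)
  have t3: "snd (mapT (\<lambda>M'. do { P \<leftarrow> mat_mulT M' V; solveT V P }) Ms)
      \<le> length Ms * (r * r * (r * 2) + r * (r * (3 * (r + r) + 1)))"
  proof (intro snd_mapT_le)
    fix M' assume "M' \<in> set Ms"
    then obtain k where k: "k < ?K" "M' = Ms ! k" by (auto simp: in_set_conv_nth len)
    have Mk: "M' \<in> carrier_mat r r" unfolding k(2) Ms[OF k(1)] using E(1) E'(1) Lam_carrier[of k] by auto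
    have "snd (mat_mulT M' V) \<le> r * r * (r * 2)" using snd_mat_mulT_le[of M' V] Mk V(1) by auto
    moreover have "snd (solveT V (fst (mat_mulT M' V))) \<le> r * (r * (3 * (r + r) + 1))"
      using solveT_snd[of V "M' * V"] fst_mat_mulT[OF Mk V(1)] Mk V(1) by auto
    ultimately show "snd (do { P \<leftarrow> mat_mulT M' V; solveT V P }) \<le> r * r * (r * 2) + r * (r * (3 * (r + r) + 1))"
      by simp
  qed
  have "snd (joint_eigenvaluesT eig \<rho> r js N0 Ns) =
      snd (mapT (\<lambda>N. solveT (restr N0) (restr N)) Ns) +
      (snd (matT r r (\<lambda>i j. sumT ?K (\<lambda>k. mulT (\<rho> (RMix k)) ((Ms ! k) $$ (i, j))))) +
      (snd (eig M) + snd (mapT (\<lambda>M'. do { P \<leftarrow> mat_mulT M' V; solveT V P }) Ms)))"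
    unfolding joint_eigenvaluesT_def Let_def bindT_simps ret_simps fst_mapT matT_simps fst_sumT op_simps
      Ms_def[symmetric] len(2) M_def[symmetric] V_def[symmetric] by simp
  also have "\<dots> \<le> ?K * (r * (r * (3 * (r + r) + 1))) + (r * r * (?K * 2) + (ce * r ^ 3 +
      ?K * (r * r * (r * 2) + r * (r * (3 * (r + r) + 1)))))"
    using t1 t2 t3 eig_time unfolding len by linarith
  also have "\<dots> = ?K * (14 * r ^ 3 + 4 * r\<^sup>2) + ce * r ^ 3"
    by (simp add: algebra_simps power2_eq_square power3_eq_cube)
  also have "\<dots> \<le> ?K * (14 * r ^ 3 + 4 * r ^ 3) + ce * r ^ 3"
  proof -
    have "r\<^sup>2 \<le> r ^ 3" by (cases "r = 0") (auto intro: power_increasing)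
    then show ?thesis by simp
  qed
  also have "\<dots> \<le> (?K + 1) * (ce + 20) * r ^ 3" by (simp add: algebra_simps)
  finally show "snd (joint_eigenvaluesT eig \<rho> r js N0 Ns) \<le> (length Ns + 1) * (ce + 20) * r ^ 3" .
qed

end

hide_const (open) Polynomial.monom

section \<open>Bihomogeneous polynomials\<close>

abbreviation "lookup \<equiv> Poly_Mapping.lookup"
abbreviation "keys \<equiv> Poly_Mapping.keys"
abbreviation "single \<equiv> Poly_Mapping.single"

definition xpow :: "(nat \<Rightarrow>\<^sub>0 nat) \<Rightarrow> (nat \<Rightarrow> complex) \<Rightarrow> complex" where
  "xpow a x = (\<Prod>k\<in>keys a. x k ^ lookup a k)"

definition meval :: "mono \<Rightarrow> (nat \<Rightarrow> complex) \<Rightarrow> (nat \<Rightarrow> complex) \<Rightarrow> complex" where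
  "meval k x y = xpow (fst k) x * xpow (snd k) y"

text \<open>Exponents with different supports can be treated over a common index set; the analogous
  lemmas for \<open>peval\<close> and \<open>mdeg\<close> serve the same purpose.\<close>

lemma xpow_superset: "finite K \<Longrightarrow> keys a \<subseteq> K \<Longrightarrow> xpow a x = (\<Prod>k\<in>K. x k ^ lookup a k)"
  unfolding xpow_def by (rule prod.mono_neutral_left) (auto simp: in_keys_iff)

lemma xpow_add: "xpow (a + b) x = xpow a x * xpow b x"
proof -
  let ?K = "keys a \<union> keys b"
  have "keys (a + b) \<subseteq> ?K" by (rule Poly_Mapping.keys_add)
  then show ?thesis
    by (simp add: xpow_superset[of ?K] lookup_add power_add prod.distrib)
qed

lemma xpow_0 [simp]: "xpow 0 x = 1"
  by (simp add: xpow_def)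

lemma xpow_single: "xpow (single k j) x = x k ^ j"
  by (cases "j = 0") (simp_all add: xpow_def)

lemma xpow_var_x [simp]: "xpow (var_x k) x = x k"
  by (simp add: var_x_def xpow_single)

lemma meval_add: "meval (k + l) x y = meval k x y * meval l x y"
  by (simp add: meval_def xpow_add)

lemma meval_0 [simp]: "meval 0 x y = 1"
  by (simp add: meval_def)

lemma peval_eq: "peval f x y = (\<Sum>k\<in>keys f. lookup f k * meval k x y)"
  by (auto simp: peval_def meval_def xpow_def mult.assoc intro!: sum.cong)

lemma peval_superset: "finite K \<Longrightarrow> keys f \<subseteq> K \<Longrightarrow> peval f x y = (\<Sum>k\<in>K. lookup f k * meval k x y)"
  unfolding peval_eq by (rule sum.mono_neutral_left) (auto simp: in_keys_iff)

lemma peval_0 [simp]: "peval 0 x y = 0"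
  by (simp add: peval_eq)

lemma peval_add [simp]: "peval (f + g) x y = peval f x y + peval g x y"
proof -
  have "keys (f + g) \<subseteq> keys f \<union> keys g" by (rule Poly_Mapping.keys_add)
  then show ?thesis
    by (simp add: peval_superset[of "keys f \<union> keys g"] lookup_add distrib_right sum.distrib)
qed

lemma peval_sum [simp]: "peval (\<Sum>i\<in>I. f i) x y = (\<Sum>i\<in>I. peval (f i) x y)"
  by (induction I rule: infinite_finite_induct) auto

lemma peval_single: "peval (single k c) x y = c * meval k x y"
  by (cases "c = 0") (simp_all add: peval_eq)

lemma peval_monom [simp]: "peval (monom k) x y = meval k x y"
  by (simp add: Defs.monom_def peval_single)

lemma bipoly_sum: "f = (\<Sum>k\<in>keys f. single k (lookup f k))"
  by (intro poly_mapping_eqI)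
    (auto simp: lookup_sum lookup_single when_def in_keys_iff sum.delta' simp flip: sum.inter_filter)

lemma peval_mult [simp]: "peval (f * g) x y = peval f x y * peval g x y"
proof -
  have "f * g = (\<Sum>k\<in>keys f. \<Sum>l\<in>keys g. single (k + l) (lookup f k * lookup g l))"
    by (subst bipoly_sum[of f], subst bipoly_sum[of g]) (simp add: sum_product mult_single)
  then have "peval (f * g) x y =
      (\<Sum>k\<in>keys f. \<Sum>l\<in>keys g. lookup f k * lookup g l * meval (k + l) x y)"
    by (simp add: peval_single)
  also have "\<dots> = peval f x y * peval g x y"
    unfolding peval_eq sum_product by (intro sum.cong refl) (simp add: meval_add)
  finally show ?thesis .
qed

lemma lookup_pscale [simp]: "lookup (pscale c f) k = c * lookup f k"
proof -
  have "pscale c f = pscale c (\<Sum>l\<in>keys f. single l (lookup f l))" using bipoly_sum[of f] by simp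
  also have "\<dots> = (\<Sum>l\<in>keys f. single l (c * lookup f l))"
    by (simp add: pscale_def sum_distrib_left mult_single)
  finally show ?thesis
    by (auto simp: lookup_sum lookup_single when_def in_keys_iff sum.delta')
qed

lemma peval_pscale [simp]: "peval (pscale c f) x y = c * peval f x y"
  by (simp add: pscale_def peval_single)

lemma pscale_mult: "pscale c f * g = pscale c (f * g)" "f * pscale c g = pscale c (f * g)"
  by (simp_all add: pscale_def mult_ac)

lemma pscale_single: "pscale c (single k a) = single k (c * a)"
  by (simp add: pscale_def mult_single)

lemma peval_minus [simp]: "peval (- f) x y = - peval f x y" "peval (f - g) x y = peval f x y - peval g x y"
proof -
  have "peval (- f) x y + peval f x y = 0" for f by (simp flip: peval_add)
  then have 1: "peval (- f) x y = - peval f x y" for f by (simp add: eq_neg_iff_add_eq_0)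
  show "peval (- f) x y = - peval f x y" by (rule 1)
  show "peval (f - g) x y = peval f x y - peval g x y"
    using peval_add[of f "- g" x y] 1[of g] by simp
qed

lemma mdeg_superset: "finite K \<Longrightarrow> keys a \<subseteq> K \<Longrightarrow> mdeg a = (\<Sum>k\<in>K. lookup a k)"
  unfolding mdeg_def by (rule sum.mono_neutral_left) (auto simp: in_keys_iff)

lemma mdeg_add: "mdeg (a + b) = mdeg a + mdeg b"
proof -
  have "keys (a + b) \<subseteq> keys a \<union> keys b" by (rule Poly_Mapping.keys_add)
  then show ?thesis by (simp add: mdeg_superset[of "keys a \<union> keys b"] lookup_add sum.distrib)
qed

lemma mdeg_single [simp]: "mdeg (single k j) = j"
  by (cases "j = 0") (simp_all add: mdeg_def)

lemma mdeg_0 [simp]: "mdeg 0 = 0"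
  by (simp add: mdeg_def)

lemma keys_add_nat: "keys (a + b :: nat \<Rightarrow>\<^sub>0 nat) = keys a \<union> keys b"
  by (auto simp: in_keys_iff lookup_add)

lemma expos_set: "set (expos m d) = {a. keys a \<subseteq> {..m} \<and> mdeg a = d}"
proof (induction m arbitrary: d)
  case 0
  have "a = single 0 (mdeg a)" if "keys a \<subseteq> {0}" for a :: "nat \<Rightarrow>\<^sub>0 nat"
    using that mdeg_superset[of "{0}" a]
    by (intro poly_mapping_eqI) (auto simp: lookup_single when_def in_keys_iff)
  then have "keys a \<subseteq> {..0} \<and> mdeg a = d \<longleftrightarrow> a = single 0 d" for a :: "nat \<Rightarrow>\<^sub>0 nat"
    by (metis atMost_0 keys_single empty_subsetI mdeg_single subset_refl)
  then show ?case by simp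
next
  case (Suc m)
  have set_eq: "set (expos (Suc m) d) = (\<Union>k\<in>{..<Suc d}. (\<lambda>a. a + single (Suc m) k) ` set (expos m (d - k)))"
    by (simp add: atLeast0LessThan del: upt_Suc)
  show ?case
  proof (intro equalityI subsetI)
    fix a assume "a \<in> set (expos (Suc m) d)"
    then obtain k b where k: "k < Suc d" and b: "b \<in> set (expos m (d - k))" and ab: "a = b + single (Suc m) k"
      unfolding set_eq by blast
    have "keys b \<subseteq> {..m}" "mdeg b = d - k" using Suc.IH b by auto
    moreover have "keys (single (Suc m) k) \<subseteq> {..Suc m}" by simp
    ultimately have "keys b \<union> keys (single (Suc m) k) \<subseteq> {..Suc m}" "mdeg b + k = d"
      using k by (auto simp: subset_iff simp del: keys_single)
    then show "a \<in> {a. keys a \<subseteq> {..Suc m} \<and> mdeg a = d}" unfolding ab by (simp only: keys_add_nat mdeg_add mdeg_single mem_Collect_eq)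
  next
    fix a assume "a \<in> {a. keys a \<subseteq> {..Suc m} \<and> mdeg a = d}"
    then have a: "keys a \<subseteq> {..Suc m}" "mdeg a = d" by auto
    define k where "k = lookup a (Suc m)"
    define b where "b = a - single (Suc m) k"
    have ab: "a = b + single (Suc m) k"
      by (intro poly_mapping_eqI) (auto simp: b_def k_def lookup_add lookup_minus lookup_single when_def)
    have nb: "Suc m \<notin> keys b" by (simp add: b_def k_def lookup_minus in_keys_iff)
    have "keys b \<subseteq> keys a" unfolding ab keys_add_nat by simp
    then have "keys b \<subseteq> {..Suc m}" using a(1) by (rule order_trans)
    then have "keys b \<subseteq> {..m}" using nb unfolding atMost_Suc by (simp add: subset_insert)
    moreover have d: "d = mdeg b + k" using a(2) mdeg_add[of b "single (Suc m) k"] ab by simp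
    ultimately have "b \<in> set (expos m (d - k))" using Suc.IH by simp
    moreover have "k \<in> {..<Suc d}" using d by simp
    ultimately show "a \<in> set (expos (Suc m) d)" unfolding set_eq using ab by blast
  qed
qed

text \<open>The blocks of the recursion are separated by the exponent of the last variable.\<close>

lemma expos_distinct: "distinct (expos m d)"
proof (induction m arbitrary: d)
  case (Suc m)
  have k: "lookup a (Suc m) = 0" if "a \<in> set (expos m d)" for a d
    using that expos_set[of m d] by (force simp: in_keys_iff)
  define G where "G k = map (\<lambda>a. a + single (Suc m) k) (expos m (d - k))" for k
  have G: "distinct (G k)" for k
    using Suc by (auto simp: G_def distinct_map inj_on_def)
  have l: "lookup a (Suc m) = k" if "a \<in> set (G k)" for a k
    using that k by (auto simp: G_def lookup_add)
  have "distinct (concat (map G ks))" if "distinct ks" for ks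
    using that
  proof (induction ks)
    case (Cons k ks)
    have "a \<notin> set (concat (map G ks))" if "a \<in> set (G k)" for a
    proof
      assume "a \<in> set (concat (map G ks))"
      then obtain k' where "k' \<in> set ks" "a \<in> set (G k')" by auto
      then show False using l[of a k] l[of a k'] that Cons.prems by simp
    qed
    then have "set (G k) \<inter> set (concat (map G ks)) = {}" by blast
    then show ?case using Cons G by simp
  qed simp
  then show ?case unfolding expos.simps G_def[symmetric, abs_def] by (simp del: upt_Suc)
qed simp

text \<open>The recursion on the last variable is the hockey stick identity for binomial
  coefficients.\<close>

lemma expos_length: "length (expos m d) = (m + d) choose d"
proof (induction m arbitrary: d)
  case (Suc m)
  have "length (expos (Suc m) d) = (\<Sum>k\<le>d. (m + (d - k)) choose (d - k))"
    by (simp add: length_concat comp_def Suc sum_list_sum_nth atLeast0LessThan lessThan_Suc_atMost del: upt_Suc)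
  also have "\<dots> = (\<Sum>k\<le>d. (m + k) choose k)"
    by (rule sum.reindex_bij_witness[of _ "\<lambda>k. d - k" "\<lambda>k. d - k"]) auto
  also have "\<dots> = (Suc m + d) choose d" using sum_choose_lower[of m d] by simp
  finally show ?case .
qed simp

text \<open>Induction on \<open>d\<close>: passing from d to d + 1 multiplies the binomial
  coefficient by (m+d+1)/(d+1), which is at most m + 1.\<close>

lemma expos_length_le: "length (expos m d) \<le> (m + 1) ^ d"
  unfolding expos_length
proof (induction d arbitrary: m)
  case (Suc d)
  have e: "Suc d * ((m + Suc d) choose Suc d) = (m + Suc d) * ((m + d) choose d)"
    using Suc_times_binomial_eq[of "m + d" d] by simp
  have "(m + Suc d) * ((m + d) choose d) \<le> (Suc d * (m + 1)) * (m + 1) ^ d"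
    by (intro mult_le_mono Suc) simp
  then have "Suc d * ((m + Suc d) choose Suc d) \<le> Suc d * (m + 1) ^ Suc d"
    unfolding e power_Suc mult.assoc .
  then show ?case by (simp only: Suc_mult_le_cancel1)
qed simp

lemma monlist_set: "ab \<in> set (monlist m n d e) \<longleftrightarrow>
    keys (fst ab) \<subseteq> {..m} \<and> mdeg (fst ab) = d \<and> keys (snd ab) \<subseteq> {..n} \<and> mdeg (snd ab) = e"
  by (cases ab) (auto simp: monlist_def expos_set)

lemma monlist_distinct: "distinct (monlist m n d e)"
  by (simp add: monlist_def distinct_product expos_distinct)

lemma monlist_length: "length (monlist m n d e) = ((m + d) choose d) * ((n + e) choose e)"
  by (simp add: monlist_def expos_length)

text \<open>A graded piece is thus described by one finite list of monomials, the list that indexes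
  the matrices of the algorithm.\<close>

lemma S_comp_eq: "S_comp m n d e = {f. keys f \<subseteq> set (monlist m n d e)}"
proof -
  have "f \<in> S_comp m n d e \<longleftrightarrow> (\<forall>k\<in>keys f. k \<in> set (monlist m n d e))" for f
    unfolding S_comp_def S_ring_def monlist_set by (simp add: case_prod_beta) metis
  then show ?thesis unfolding subset_iff by (intro Set.set_eqI) (simp only: mem_Collect_eq Ball_def)
qed

lemma S_comp_closed:
  "0 \<in> S_comp m n d e"
  "f \<in> S_comp m n d e \<Longrightarrow> g \<in> S_comp m n d e \<Longrightarrow> f + g \<in> S_comp m n d e"
  "f \<in> S_comp m n d e \<Longrightarrow> pscale c f \<in> S_comp m n d e"
  using Poly_Mapping.keys_add[of f g] by (auto simp: S_comp_eq in_keys_iff)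

lemma S_comp_subspace: "bp.subspace (S_comp m n d e)"
  by (simp add: bp.subspace_def S_comp_closed)

lemmas S_comp_sum = bp.subspace_sum[OF S_comp_subspace]
lemmas S_comp_diff = bp.subspace_diff[OF S_comp_subspace]

lemma monom_S_comp: "k \<in> set (monlist m n d e) \<Longrightarrow> monom k \<in> S_comp m n d e"
  by (auto simp: S_comp_eq Defs.monom_def)

lemma single_S_comp: "k \<in> set (monlist m n d e) \<Longrightarrow> single k c \<in> S_comp m n d e"
  by (auto simp: S_comp_eq)

lemma S_comp_mult:
  assumes "f \<in> S_comp m n d e" "g \<in> S_comp m n d' e'"
  shows "f * g \<in> S_comp m n (d + d') (e + e')"
proof -
  have "f * g = (\<Sum>k\<in>keys f. \<Sum>l\<in>keys g. single (k + l) (lookup f k * lookup g l))"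
    by (subst bipoly_sum[of f], subst bipoly_sum[of g]) (simp add: sum_product mult_single)
  moreover have "k + l \<in> set (monlist m n (d + d') (e + e'))" if "k \<in> keys f" "l \<in> keys g" for k l
  proof -
    have "k \<in> set (monlist m n d e)" "l \<in> set (monlist m n d' e')"
      using assms that by (auto simp: S_comp_eq)
    then show ?thesis by (simp add: monlist_set keys_add_nat mdeg_add)
  qed
  ultimately show ?thesis by (auto intro!: S_comp_sum single_S_comp)
qed

lemma peval_S_comp:
  assumes "f \<in> S_comp m n d e"
  shows "peval f x y = (\<Sum>q<length (monlist m n d e). lookup f (monlist m n d e ! q) * meval (monlist m n d e ! q) x y)"
proof -
  have "peval f x y = (\<Sum>k\<in>set (monlist m n d e). lookup f k * meval k x y)"
    using assms by (intro peval_superset) (auto simp: S_comp_eq)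
  also have "\<dots> = (\<Sum>q<length (monlist m n d e). lookup f (monlist m n d e ! q) * meval (monlist m n d e ! q) x y)"
    using monlist_distinct by (intro sum.reindex_bij_betw[symmetric] bij_betw_nth) auto
  finally show ?thesis .
qed

lemma poly_of_S_comp: "poly_of (monlist m n d e) c \<in> S_comp m n d e"
  unfolding poly_of_def by (intro S_comp_sum single_S_comp) auto

lemma lookup_poly_of:
  assumes "distinct ms" "i < length ms"
  shows "lookup (poly_of ms c) (ms ! i) = c i"
proof -
  have "lookup (poly_of ms c) (ms ! i) = (\<Sum>j<length ms. if j = i then c j else 0)"
    unfolding poly_of_def lookup_sum lookup_single when_def
    using assms by (intro sum.cong) (auto simp: nth_eq_iff_index_eq)
  then show ?thesis using assms by simp
qed

lemma poly_of_lookup: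
  assumes "f \<in> S_comp m n d e"
  shows "poly_of (monlist m n d e) (\<lambda>i. lookup f (monlist m n d e ! i)) = f"
proof (rule poly_mapping_eqI)
  fix k
  let ?ms = "monlist m n d e"
  show "lookup (poly_of ?ms (\<lambda>i. lookup f (?ms ! i))) k = lookup f k"
  proof (cases "k \<in> set ?ms")
    case True
    then obtain i where "i < length ?ms" "k = ?ms ! i" by (auto simp: in_set_conv_nth)
    then show ?thesis by (simp add: lookup_poly_of monlist_distinct)
  next
    case False
    then have "k \<notin> keys f" "k \<notin> keys (poly_of ?ms (\<lambda>i. lookup f (?ms ! i)))"
      using assms poly_of_S_comp[of m n d e] unfolding S_comp_eq by blast+
    then show ?thesis by (simp only: in_keys_iff not_not)
  qed
qed

lemma peval_poly_of: "peval (poly_of ms c) x y = (\<Sum>i<length ms. c i * meval (ms ! i) x y)"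
  by (simp add: poly_of_def peval_single)

lemma S_comp_span: "S_comp m n d e = bp.span (monom ` set (monlist m n d e))"
proof
  show "S_comp m n d e \<subseteq> bp.span (monom ` set (monlist m n d e))"
  proof
    fix f assume f: "f \<in> S_comp m n d e"
    have "f = (\<Sum>k\<in>keys f. pscale (lookup f k) (monom k))"
      by (subst bipoly_sum[of f]) (simp add: Defs.monom_def pscale_single)
    also have "\<dots> \<in> bp.span (monom ` set (monlist m n d e))"
      using f by (intro bp.span_sum bp.span_scale bp.span_base) (auto simp: S_comp_eq)
    finally show "f \<in> bp.span (monom ` set (monlist m n d e))" .
  qed
  show "bp.span (monom ` set (monlist m n d e)) \<subseteq> S_comp m n d e"
    by (intro bp.span_minimal S_comp_subspace) (auto intro: monom_S_comp)
qed

lemma monom_inj: "inj monom"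
  by (rule injI) (metis Defs.monom_def keys_single one_neq_zero the_elem_eq)

lemma monom_independent: "finite K \<Longrightarrow> bp.independent (monom ` K)"
proof (induction K rule: finite_induct)
  case (insert k K)
  have "monom k \<notin> bp.span (monom ` K)"
  proof
    assume "monom k \<in> bp.span (monom ` K)"
    moreover have "bp.span (monom ` K) \<subseteq> {f. lookup f k = 0}"
      using insert.hyps by (intro bp.span_minimal) (auto simp: bp.subspace_def lookup_add Defs.monom_def lookup_single when_def)
    ultimately show False by (auto simp: Defs.monom_def)
  qed
  then have "bp.independent (insert (monom k) (monom ` K))"
    using insert.IH by (rule bp.independent_insertI)
  then show ?case by simp
qed (simp add: bp.independent_empty)

lemma HF_S_eq: "HF_S m n d e = length (monlist m n d e)"
proof -
  have "bp.dim (S_comp m n d e) = card (monom ` set (monlist m n d e))"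
    by (rule bp.dim_eq_card) (simp_all add: S_comp_span monom_independent bp.span_span)
  also have "\<dots> = length (monlist m n d e)"
    using distinct_card[OF monlist_distinct] card_image[OF inj_on_subset[OF monom_inj subset_UNIV]] by metis
  finally show ?thesis by (simp add: HF_S_def)
qed

lemma independent_S_comp_card:
  assumes "bp.independent B" "B \<subseteq> S_comp m n d e"
  shows "finite B" "card B \<le> HF_S m n d e"
proof -
  have "finite B \<and> card B \<le> card (monom ` set (monlist m n d e))"
    using assms S_comp_span by (intro bp.independent_span_bound) auto
  moreover have "card (monom ` set (monlist m n d e)) \<le> length (monlist m n d e)"
    by (metis card_image_le card_length finite_set order_trans)
  ultimately show "finite B" "card B \<le> HF_S m n d e" by (auto simp: HF_S_eq)
qed

text \<open>Each \<open>H k\<close> lies outside the span of \<open>B\<close> and the earlier ones,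
  because the functional \<open>L k\<close> vanishes on that span but not on \<open>H k\<close>.
  This is the dimension count behind the Hilbert functions below.\<close>

lemma independent_extend_dual:
  assumes B: "bp.independent B" "finite B" "\<And>f t. f \<in> B \<Longrightarrow> t < r \<Longrightarrow> L t f = (0 :: complex)"
    and L: "\<And>t f g. L t (f + g) = L t f + L t g" "\<And>t c f. L t (pscale c f) = c * L t f"
    and H: "\<And>s t. s < r \<Longrightarrow> t < r \<Longrightarrow> L t (H s) = of_bool (s = t)"
  shows "bp.independent (B \<union> H ` {..<r}) \<and> card (B \<union> H ` {..<r}) = card B + r"
proof -
  have "bp.independent (B \<union> H ` {..<k}) \<and> card (B \<union> H ` {..<k}) = card B + k" if "k \<le> r" for k
    using that
  proof (induction k)
    case (Suc k)
    have "H k \<notin> bp.span (B \<union> H ` {..<k})"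
    proof
      assume "H k \<in> bp.span (B \<union> H ` {..<k})"
      moreover have "bp.span (B \<union> H ` {..<k}) \<subseteq> {f. L k f = 0}"
        using Suc.prems B(3) H L(2)[of k 0 0] by (intro bp.span_minimal) (auto simp: bp.subspace_def L)
      ultimately show False using H[of k k] Suc.prems by auto
    qed
    moreover have "B \<union> H ` {..<Suc k} = insert (H k) (B \<union> H ` {..<k})"
      by (simp only: lessThan_Suc image_insert Un_insert_right)
    moreover have "H k \<notin> B \<union> H ` {..<k}" using calculation(1) by (metis bp.span_base)
    moreover have "finite (B \<union> H ` {..<k})" using B(2) by simp
    moreover have "bp.independent (B \<union> H ` {..<k})" "card (B \<union> H ` {..<k}) = card B + k"
      using Suc.IH Suc.prems by simp_all
    moreover have "bp.independent (insert (H k) (B \<union> H ` {..<k}))"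
      using calculation(1) calculation(5) by (rule bp.independent_insertI)
    ultimately show ?case by (simp only: card_insert_disjoint) simp
  qed (simp add: B)
  then show ?thesis by blast
qed

text \<open>Interpolation: the \<open>H t\<close> extend a basis of the degree (d,e) part of
  \<open>I\<close> to one of the whole graded piece, since subtracting from a form its interpolant
  lands in \<open>I\<close>.\<close>

lemma HF_quot_eq:
  assumes van: "I \<inter> S_comp m n d e = {f \<in> S_comp m n d e. \<forall>t<r. peval f (be t) (ga t) = 0}"
    and H: "\<And>t. t < r \<Longrightarrow> H t \<in> S_comp m n d e"
      "\<And>s t. s < r \<Longrightarrow> t < r \<Longrightarrow> peval (H s) (be t) (ga t) = of_bool (s = t)"
  shows "HF_quot m n I d e = r"
proof -
  let ?V = "I \<inter> S_comp m n d e"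
  obtain B where B: "B \<subseteq> ?V" "bp.independent B" "?V \<subseteq> bp.span B" "card B = bp.dim ?V"
    using bp.basis_exists[of ?V] by metis
  have fin: "finite B" using independent_S_comp_card[of B m n d e] B by auto
  have ext: "bp.independent (B \<union> H ` {..<r}) \<and> card (B \<union> H ` {..<r}) = card B + r"
    using B(1) van H(2)
    by (intro independent_extend_dual[OF B(2) fin, where L = "\<lambda>t f. peval f (be t) (ga t)"]) auto
  have sub: "B \<union> H ` {..<r} \<subseteq> S_comp m n d e" using B(1) H(1) by auto
  have "S_comp m n d e \<subseteq> bp.span (B \<union> H ` {..<r})"
  proof
    fix f assume f: "f \<in> S_comp m n d e"
    let ?g = "\<Sum>t<r. pscale (peval f (be t) (ga t)) (H t)"
    have g: "?g \<in> S_comp m n d e" using H(1) by (intro S_comp_sum S_comp_closed) auto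
    have "peval (f - ?g) (be s) (ga s) = 0" if "s < r" for s
    proof -
      have "peval ?g (be s) (ga s) = (\<Sum>t<r. if t = s then peval f (be t) (ga t) else 0)"
        using that by (simp add: H(2) of_bool_def if_distrib cong: if_cong)
      then show ?thesis using that by simp
    qed
    then have "f - ?g \<in> ?V" unfolding van using f g S_comp_diff by auto
    then have "f - ?g \<in> bp.span (B \<union> H ` {..<r})" using B(3) bp.span_mono[of B "B \<union> H ` {..<r}"] by auto
    moreover have "?g \<in> bp.span (B \<union> H ` {..<r})"
      by (intro bp.span_sum bp.span_scale bp.span_base) auto
    ultimately have "(f - ?g) + ?g \<in> bp.span (B \<union> H ` {..<r})" by (rule bp.span_add)
    then show "f \<in> bp.span (B \<union> H ` {..<r})" by simp
  qed
  then have "bp.dim (S_comp m n d e) = card B + r"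
    using ext sub bp.basis_card_eq_dim by metis
  then show ?thesis by (simp add: HF_quot_def B(4))
qed

text \<open>Projection to a bidegree. It is needed because \<open>ideal_gen\<close> admits
  coefficients that are not bihomogeneous.\<close>

definition bcomp :: "nat \<Rightarrow> nat \<Rightarrow> bipoly \<Rightarrow> bipoly" where
  "bcomp d e f = (\<Sum>k\<in>{k \<in> keys f. mdeg (fst k) = d \<and> mdeg (snd k) = e}. single k (lookup f k))"

lemma lookup_bcomp: "lookup (bcomp d e f) k = (if mdeg (fst k) = d \<and> mdeg (snd k) = e then lookup f k else 0)"
  unfolding bcomp_def lookup_sum lookup_single when_def
  by (auto simp: in_keys_iff sum.delta')

lemma bcomp_add: "bcomp d e (f + g) = bcomp d e f + bcomp d e g"
  by (intro poly_mapping_eqI) (simp add: lookup_bcomp lookup_add)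

lemma bcomp_0 [simp]: "bcomp d e 0 = 0"
  by (intro poly_mapping_eqI) (simp add: lookup_bcomp)

lemma bcomp_sum: "bcomp d e (\<Sum>i\<in>I. f i) = (\<Sum>i\<in>I. bcomp d e (f i))"
  by (induction I rule: infinite_finite_induct) (auto simp: bcomp_add)

lemma bcomp_S_comp:
  assumes "f \<in> S_comp m n d' e'"
  shows "bcomp d e f = (if d = d' \<and> e = e' then f else 0)"
proof (intro poly_mapping_eqI)
  fix k
  have "k \<in> keys f \<Longrightarrow> mdeg (fst k) = d' \<and> mdeg (snd k) = e'"
    using assms monlist_set[of k m n d' e'] unfolding S_comp_eq by blast
  then show "lookup (bcomp d e f) k = lookup (if d = d' \<and> e = e' then f else 0) k"
    by (cases "k \<in> keys f") (auto simp: lookup_bcomp in_keys_iff)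
qed

lemma bcomp_S_ring: "f \<in> S_ring m n \<Longrightarrow> bcomp d e f \<in> S_comp m n d e"
proof -
  assume f: "f \<in> S_ring m n"
  have "k \<in> set (monlist m n d e)" if "k \<in> keys (bcomp d e f)" for k
  proof -
    have "k \<in> keys f" "mdeg (fst k) = d" "mdeg (snd k) = e"
      using that by (auto simp: in_keys_iff lookup_bcomp split: if_splits)
    then show ?thesis using f unfolding S_ring_def monlist_set by (cases k) auto
  qed
  then show ?thesis by (auto simp: S_comp_eq)
qed

lemma bcomp_mult:
  assumes "q \<in> S_ring m n" "g \<in> S_comp m n 1 1" "1 \<le> d" "1 \<le> e"
  shows "bcomp d e (q * g) = bcomp (d - 1) (e - 1) q * g"
proof -
  have k: "single k c \<in> S_comp m n (mdeg (fst k)) (mdeg (snd k))" if "k \<in> keys q" for k c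
    using that assms(1) by (intro single_S_comp) (simp add: S_ring_def monlist_set case_prod_beta)
  have "bcomp d e (single k c * g) = (if mdeg (fst k) = d - 1 \<and> mdeg (snd k) = e - 1 then single k c * g else 0)"
    if "k \<in> keys q" for k c
    using bcomp_S_comp[OF S_comp_mult[OF k[OF that] assms(2)], of d e] assms(3,4) by auto
  then have "bcomp d e ((\<Sum>k\<in>keys q. single k (lookup q k)) * g) =
      (\<Sum>k\<in>keys q. if mdeg (fst k) = d - 1 \<and> mdeg (snd k) = e - 1 then single k (lookup q k) * g else 0)"
    by (simp add: sum_distrib_right bcomp_sum)
  also have "\<dots> = bcomp (d - 1) (e - 1) q * g"
    unfolding bcomp_def sum_distrib_right by (rule sum.inter_filter[symmetric]) simp
  finally show ?thesis using bipoly_sum[of q] by simp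
qed

text \<open>For a set \<open>F\<close> of forms of bidegree (1,1) this is the column space of the
  resultant map in degree (d,1).\<close>

definition mult_span :: "nat \<Rightarrow> nat \<Rightarrow> nat \<Rightarrow> bipoly set \<Rightarrow> bipoly set" where
  "mult_span m n d F = bp.span {monom k * f | k f. k \<in> set (monlist m n (d - 1) 0) \<and> f \<in> F}"

text \<open>Projecting a combination to bidegree (d,1) replaces every coefficient by its component
  of bidegree (d-1,0). This turns the ideal into finite linear algebra.\<close>

lemma ideal_gen_S_comp:
  assumes F: "F \<subseteq> S_comp m n 1 1" and d: "1 \<le> d"
  shows "ideal_gen m n F \<inter> S_comp m n d 1 = mult_span m n d F"
proof
  show "ideal_gen m n F \<inter> S_comp m n d 1 \<subseteq> mult_span m n d F"
  proof
    fix f assume "f \<in> ideal_gen m n F \<inter> S_comp m n d 1"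
    then obtain G q where f: "f = (\<Sum>g\<in>G. q g * g)" "finite G" "G \<subseteq> F" "\<And>g. g \<in> G \<Longrightarrow> q g \<in> S_ring m n"
      and fc: "f \<in> S_comp m n d 1"
      by (auto simp: ideal_gen_def)
    have "f = bcomp d 1 f" using bcomp_S_comp[OF fc] by simp
    also have "\<dots> = (\<Sum>g\<in>G. bcomp (d - 1) 0 (q g) * g)"
      unfolding f(1) bcomp_sum using f F d by (intro sum.cong) (auto simp: bcomp_mult[where m = m and n = n])
    also have "\<dots> \<in> mult_span m n d F"
    proof -
      have "bcomp (d - 1) 0 (q g) * g \<in> mult_span m n d F" if g: "g \<in> G" for g
      proof -
        let ?b = "bcomp (d - 1) 0 (q g)"
        have "?b \<in> S_comp m n (d - 1) 0" using f(4) g by (simp add: bcomp_S_ring)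
        then have k: "keys ?b \<subseteq> set (monlist m n (d - 1) 0)" by (simp add: S_comp_eq)
        have "?b * g = (\<Sum>k\<in>keys ?b. pscale (lookup ?b k) (monom k * g))"
          by (subst bipoly_sum[of ?b]) (simp add: sum_distrib_right pscale_mult(1)[symmetric] Defs.monom_def pscale_single)
        also have "\<dots> \<in> mult_span m n d F" unfolding mult_span_def
          using k g f(3) by (intro bp.span_sum bp.span_scale bp.span_base) blast
        finally show ?thesis .
      qed
      then show ?thesis unfolding mult_span_def by (intro bp.span_sum) auto
    qed
    finally show "f \<in> mult_span m n d F" .
  qed
  have sub: "monom k * f \<in> ideal_gen m n F \<inter> S_comp m n d 1"
    if "k \<in> set (monlist m n (d - 1) 0)" "f \<in> F" for k f
  proof -
    have "monom k * f \<in> S_comp m n (d - 1 + 1) (0 + 1)"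
      using that F by (intro S_comp_mult monom_S_comp) auto
    moreover have "monom k \<in> S_ring m n" using monom_S_comp[OF that(1)] by (simp add: S_comp_def)
    then have "monom k * f \<in> ideal_gen m n F" unfolding ideal_gen_def
      using that by (intro CollectI exI[of _ "{f}"] exI[of _ "\<lambda>_. monom k"]) auto
    ultimately show ?thesis using d by simp
  qed
  have S_ring_add: "p + q \<in> S_ring m n" if "p \<in> S_ring m n" "q \<in> S_ring m n" for p q
    using that Poly_Mapping.keys_add[of p q] unfolding S_ring_def by blast
  have S_ring_scale: "pscale c p \<in> S_ring m n" if "p \<in> S_ring m n" for c p
  proof -
    have "keys (pscale c p) \<subseteq> keys p" by (auto simp: in_keys_iff)
    then show ?thesis using that unfolding S_ring_def by blast
  qed
  have "bp.subspace (ideal_gen m n F)" unfolding bp.subspace_def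
  proof (intro conjI ballI allI)
    show "0 \<in> ideal_gen m n F" unfolding ideal_gen_def by (intro CollectI exI[of _ "{}"]) auto
  next
    fix f g assume "f \<in> ideal_gen m n F" "g \<in> ideal_gen m n F"
    then obtain G p G' q where f: "f = (\<Sum>h\<in>G. p h * h)" "finite G" "G \<subseteq> F" "\<forall>h\<in>G. p h \<in> S_ring m n"
      and g: "g = (\<Sum>h\<in>G'. q h * h)" "finite G'" "G' \<subseteq> F" "\<forall>h\<in>G'. q h \<in> S_ring m n"
      unfolding ideal_gen_def by blast
    have 0: "0 \<in> S_ring m n" by (simp add: S_ring_def)
    \<comment> \<open>Coefficients extended by zero, so that both combinations run over the union of
      the two generator sets.\<close>
    let ?p = "\<lambda>h. (if h \<in> G then p h else 0)" and ?q = "\<lambda>h. (if h \<in> G' then q h else 0)"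
    have "f = (\<Sum>h\<in>G \<union> G'. ?p h * h)" "g = (\<Sum>h\<in>G \<union> G'. ?q h * h)"
      unfolding f(1) g(1) using f(2) g(2) by (auto intro!: sum.mono_neutral_cong_left)
    then have "f + g = (\<Sum>h\<in>G \<union> G'. (?p h + ?q h) * h)" by (simp add: distrib_right sum.distrib)
    moreover have "\<forall>h\<in>G \<union> G'. ?p h + ?q h \<in> S_ring m n" using f(4) g(4) 0 S_ring_add by auto
    ultimately show "f + g \<in> ideal_gen m n F" unfolding ideal_gen_def
      using f(2,3) g(2,3) by (intro CollectI exI[of _ "G \<union> G'"] exI[of _ "\<lambda>h. ?p h + ?q h"]) auto
  next
    fix c f assume "f \<in> ideal_gen m n F"
    then obtain G p where f: "f = (\<Sum>h\<in>G. p h * h)" "finite G" "G \<subseteq> F" "\<forall>h\<in>G. p h \<in> S_ring m n"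
      unfolding ideal_gen_def by blast
    then show "pscale c f \<in> ideal_gen m n F" unfolding ideal_gen_def
      by (intro CollectI exI[of _ G] exI[of _ "\<lambda>h. pscale c (p h)"])
        (auto simp: S_ring_scale bp.scale_sum_right pscale_mult)
  qed
  then have "bp.subspace (ideal_gen m n F \<inter> S_comp m n d 1)" by (intro bp.subspace_inter S_comp_subspace)
  then show "mult_span m n d F \<subseteq> ideal_gen m n F \<inter> S_comp m n d 1"
    unfolding mult_span_def using sub by (intro bp.span_minimal) auto
qed

section \<open>The steps of the algorithm\<close>

text \<open>Two families of independent functionals with the same common kernel differ by an
  invertible matrix. The dual vectors \<open>g\<close> make the matrix explicit:
  \<open>T i t\<close> is the value of row \<open>i\<close> on \<open>g t\<close>.\<close>

lemma same_kernel_rows: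
  fixes Ev :: "nat \<Rightarrow> nat \<Rightarrow> complex"
  assumes dual: "\<And>s t. s < r \<Longrightarrow> t < r \<Longrightarrow> (\<Sum>j<K. Ev t j * g s j) = of_bool (s = t)"
    and sub: "\<And>v i. (\<And>t. t < r \<Longrightarrow> (\<Sum>j<K. Ev t j * v j) = 0) \<Longrightarrow> i < r' \<Longrightarrow> (\<Sum>j<K. N i j * v j) = 0"
    and sup: "\<And>v t. (\<And>i. i < r' \<Longrightarrow> (\<Sum>j<K. N i j * v j) = 0) \<Longrightarrow> t < r \<Longrightarrow> (\<Sum>j<K. Ev t j * v j) = 0"
    and ind: "\<And>u. (\<And>j. j < K \<Longrightarrow> (\<Sum>i<r'. u i * N i j) = 0) \<Longrightarrow> \<forall>i<r'. u i = 0"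
  shows "r' = r \<and> (\<exists>T. det (mat r r (\<lambda>(i, t). T i t)) \<noteq> 0 \<and> (\<forall>i<r. \<forall>j<K. N i j = (\<Sum>t<r. T i t * Ev t j)))"
proof -
  define T where "T i t = (\<Sum>j<K. N i j * g t j)" for i t
  have N: "N i j = (\<Sum>t<r. T i t * Ev t j)" if i: "i < r'" and j: "j < K" for i j
  proof -
    \<comment> \<open>A unit vector minus its interpolant, so all functionals in \<open>Ev\<close>
      vanish on it.\<close>
    let ?v = "\<lambda>j'. of_bool (j' = j) - (\<Sum>t<r. Ev t j * g t j')"
    have "(\<Sum>j'<K. Ev s j' * ?v j') = 0" if s: "s < r" for s
    proof -
      have "(\<Sum>j'<K. Ev s j' * ?v j') = (\<Sum>j'<K. if j' = j then Ev s j else 0) -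
          (\<Sum>j'<K. \<Sum>t<r. Ev t j * (Ev s j' * g t j'))"
        unfolding sum_subtractf[symmetric] by (intro sum.cong) (auto simp: right_diff_distrib sum_distrib_left mult_ac)
      also have "(\<Sum>j'<K. \<Sum>t<r. Ev t j * (Ev s j' * g t j')) = (\<Sum>t<r. Ev t j * (\<Sum>j'<K. Ev s j' * g t j'))"
        by (subst sum.swap) (simp add: sum_distrib_left)
      also have "\<dots> = (\<Sum>t<r. if t = s then Ev s j else 0)" using s by (intro sum.cong) (auto simp: dual)
      finally show ?thesis using s j by simp
    qed
    then have "(\<Sum>j'<K. N i j' * ?v j') = 0" using i by (rule sub)
    moreover have "(\<Sum>j'<K. N i j' * ?v j') = (\<Sum>j'<K. if j' = j then N i j else 0) -
        (\<Sum>j'<K. \<Sum>t<r. (N i j' * g t j') * Ev t j)"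
      unfolding sum_subtractf[symmetric] by (intro sum.cong) (auto simp: right_diff_distrib sum_distrib_left mult_ac)
    moreover have "(\<Sum>j'<K. \<Sum>t<r. (N i j' * g t j') * Ev t j) = (\<Sum>t<r. T i t * Ev t j)"
      unfolding T_def by (subst sum.swap) (simp add: sum_distrib_right)
    ultimately show ?thesis using j by simp
  qed
  \<comment> \<open>A kernel vector \<open>c\<close> of \<open>T\<close> gives the combination of
    the \<open>g t\<close> with these coefficients; it is killed by \<open>N\<close>, hence by
    \<open>Ev\<close>, while \<open>Ev\<close> returns \<open>c\<close>.\<close>
  have inj: "\<forall>t<r. c t = 0" if c: "\<And>i. i < r' \<Longrightarrow> (\<Sum>t<r. T i t * c t) = 0" for c
  proof -
    let ?v = "\<lambda>j. \<Sum>t<r. c t * g t j"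
    have Nv: "(\<Sum>j<K. N i j * ?v j) = 0" if "i < r'" for i
    proof -
      have "(\<Sum>j<K. N i j * ?v j) = (\<Sum>t<r. \<Sum>j<K. (N i j * g t j) * c t)"
        by (subst sum.swap) (simp add: sum_distrib_left mult_ac)
      then show ?thesis using c[OF that] by (simp add: T_def sum_distrib_right)
    qed
    have v: "(\<Sum>j<K. Ev s j * ?v j) = 0" if "s < r" for s by (rule sup[OF Nv that])
    have "c s = 0" if s: "s < r" for s
    proof -
      have "(\<Sum>j<K. Ev s j * ?v j) = (\<Sum>t<r. c t * (\<Sum>j<K. Ev s j * g t j))"
        unfolding sum_distrib_left by (subst sum.swap) (simp add: mult_ac)
      also have "\<dots> = (\<Sum>t<r. if t = s then c s else 0)" using s by (intro sum.cong) (auto simp: dual)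
      finally show ?thesis using v[OF s] s by simp
    qed
    then show ?thesis by blast
  qed
  \<comment> \<open>With too many rows, \<open>T\<close> has a left kernel vector, which is a
    relation among the rows of \<open>N\<close>.\<close>
  have "\<not> r < r'"
  proof
    assume "r < r'"
    then obtain u where u: "\<exists>i<r'. u i \<noteq> 0" "\<And>t. t < r \<Longrightarrow> (\<Sum>i<r'. T i t * u i) = 0"
      by (rule dependent_columns[where M = "\<lambda>t i. T i t"]) blast
    have "(\<Sum>i<r'. u i * N i j) = 0" if "j < K" for j
    proof -
      have "(\<Sum>i<r'. u i * N i j) = (\<Sum>i<r'. \<Sum>t<r. (T i t * u i) * Ev t j)"
        using that by (intro sum.cong) (auto simp: N sum_distrib_left mult_ac)
      also have "\<dots> = (\<Sum>t<r. (\<Sum>i<r'. T i t * u i) * Ev t j)"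
        by (subst sum.swap) (simp add: sum_distrib_right)
      finally show ?thesis using u(2) by simp
    qed
    then show False using ind[of u] u(1) by blast
  qed
  moreover have "\<not> r' < r"
  proof
    assume "r' < r"
    then obtain c where "\<exists>t<r. c t \<noteq> 0" "\<And>i. i < r' \<Longrightarrow> (\<Sum>t<r. T i t * c t) = 0"
      by (rule dependent_columns[where M = T]) blast
    then show False using inj[of c] by blast
  qed
  ultimately have r: "r' = r" by simp
  have "det (mat r r (\<lambda>(i, t). T i t)) \<noteq> 0" unfolding det_nonzero_iff using inj unfolding r by blast
  then show ?thesis using r N by blast
qed

definition eig_ok :: "(complex mat \<Rightarrow> complex mat timed) \<Rightarrow> nat \<Rightarrow> bool" where
  "eig_ok eig ce \<longleftrightarrow> (\<forall>k. \<forall>A \<in> carrier_mat k k. diagonalizable A \<longrightarrow>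
     fst (eig A) \<in> carrier_mat k k \<and> invertible_mat (fst (eig A)) \<and>
     (\<exists>D \<in> carrier_mat k k. diagonal_mat D \<and> A * fst (eig A) = fst (eig A) * D) \<and>
     snd (eig A) \<le> ce * k ^ 3)"

lemma eigensolver_eig_ok: "eigensolver eig \<longleftrightarrow> (\<exists>ce. eig_ok eig ce)"
  by (simp add: eigensolver_def eig_ok_def)

lemma mult_mapT_dims [simp]:
  "dim_row (fst (mult_mapT N ms g us)) = dim_row N" "dim_col (fst (mult_mapT N ms g us)) = length us"
  by (simp_all add: mult_mapT_def)

text \<open>As \<open>N\<close> is evaluation at the points followed by \<open>T\<close>,
  multiplication by \<open>g\<close> becomes the diagonal matrix of the values of
  \<open>g\<close>.\<close>

lemma mult_mapT_fst:
  assumes N: "\<And>q. q < length (monlist m n d e) \<Longrightarrow>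
      N $$ (i, q) = (\<Sum>t<r. T i t * meval (monlist m n d e ! q) (be t) (ga t))"
    and i: "i < dim_row N" "c < length us" and g: "g * monom (us ! c) \<in> S_comp m n d e"
  shows "fst (mult_mapT N (monlist m n d e) g us) $$ (i, c) =
    (\<Sum>t<r. T i t * peval g (be t) (ga t) * meval (us ! c) (be t) (ga t))"
proof -
  let ?ms = "monlist m n d e" and ?f = "g * monom (us ! c)"
  have "fst (mult_mapT N ?ms g us) $$ (i, c) = (\<Sum>q<length ?ms. N $$ (i, q) * lookup ?f (?ms ! q))"
    using i by (simp add: mult_mapT_def)
  also have "\<dots> = (\<Sum>q<length ?ms. \<Sum>t<r. T i t * (lookup ?f (?ms ! q) * meval (?ms ! q) (be t) (ga t)))"
    by (intro sum.cong) (auto simp: N sum_distrib_left sum_distrib_right mult_ac)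
  also have "\<dots> = (\<Sum>t<r. T i t * peval ?f (be t) (ga t))"
    unfolding peval_S_comp[OF g] sum_distrib_left by (rule sum.swap)
  finally show ?thesis by (simp add: mult.assoc)
qed

lemma mult_mapT_snd: "snd (mult_mapT N ms g us) \<le> dim_row N * length us * (length ms * 2)"
  unfolding mult_mapT_def by (intro snd_matT_le) (simp add: snd_sumT_const)

text \<open>Common core of the two eigenvalue computations. Step (2a) is the instance (d,e) = (1,1),
  (d',e') = (1,0); step (2b) is the instance (d,1), (1,1). The second assumption \<open>us\<close>
  says that the evaluations on bidegree (d',e') are independent.\<close>

locale eigen_step =
  fixes eig ce \<rho> r m n d e d' e' and T :: "nat \<Rightarrow> nat \<Rightarrow> complex" and N :: "complex mat"
    and be ga :: "nat \<Rightarrow> nat \<Rightarrow> complex" and h0 :: bipoly and gs :: "bipoly list"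
  assumes eig: "eig_ok eig ce"
    and N: "dim_row N = r" "dim_col N = length (monlist m n d e)"
      "\<And>i q. i < r \<Longrightarrow> q < length (monlist m n d e) \<Longrightarrow>
         N $$ (i, q) = (\<Sum>t<r. T i t * meval (monlist m n d e ! q) (be t) (ga t))"
    and T: "det (mat r r (\<lambda>(i, t). T i t)) \<noteq> 0"
    and us: "length (monlist m n d' e') > 0"
      "\<And>b. (\<And>c. c < length (monlist m n d' e') \<Longrightarrow>
          (\<Sum>t<r. b t * meval (monlist m n d' e' ! c) (be t) (ga t)) = 0) \<Longrightarrow> \<forall>t<r. b t = 0"
    and deg: "d' \<le> d" "e' \<le> e"
    and h0: "h0 \<in> S_comp m n (d - d') (e - e')" "\<And>t. t < r \<Longrightarrow> peval h0 (be t) (ga t) \<noteq> 0"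
    and gs: "set gs \<subseteq> S_comp m n (d - d') (e - e')"
    and inj: "inj_on (\<lambda>t. \<Sum>k<length gs. \<rho> (RMix k) * (peval (gs ! k) (be t) (ga t) / peval h0 (be t) (ga t))) {..<r}"
begin

abbreviation "ms \<equiv> monlist m n d e"
abbreviation "us \<equiv> monlist m n d' e'"

definition "N0 = fst (mult_mapT N ms h0 us)"
definition "js = fst (qr_pivotsT r N0)"
definition "Ns = map (\<lambda>g. fst (mult_mapT N ms g us)) gs"

lemma entry:
  assumes "g \<in> S_comp m n (d - d') (e - e')" "i < r" "c < length us"
  shows "fst (mult_mapT N ms g us) $$ (i, c) =
    (\<Sum>t<r. T i t * peval g (be t) (ga t) * meval (us ! c) (be t) (ga t))"
proof (rule mult_mapT_fst)
  have "g * monom (us ! c) \<in> S_comp m n (d - d' + d') (e - e' + e')"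
    using assms by (intro S_comp_mult monom_S_comp) auto
  then show "g * monom (us ! c) \<in> S_comp m n d e" using deg by simp
qed (use N assms in auto)

text \<open>\<open>N0\<close> is the product of \<open>T\<close>, the diagonal of the values of
  \<open>h0\<close>, and an evaluation matrix with independent rows. So pivoting finds
  \<open>r\<close> columns, and cancelling the two invertible factors leaves an invertible square
  evaluation matrix.\<close>

lemma pivots: "length js = r" "set js \<subseteq> {..<length us}"
  and det_E: "det (mat r r (\<lambda>(t, j). meval (us ! (js ! j)) (be t) (ga t))) \<noteq> 0"
proof -
  have dim: "dim_row N0 = r" "dim_col N0 = length us" by (simp_all add: N0_def N)
  have rank: "\<forall>i<dim_row N0. u i = 0"
    if u: "\<And>j. j < dim_col N0 \<Longrightarrow> (\<Sum>i<dim_row N0. u i * N0 $$ (i, j)) = 0" for u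
  proof -
    have "(\<Sum>t<r. ((\<Sum>i<r. u i * T i t) * peval h0 (be t) (ga t)) * meval (us ! c) (be t) (ga t)) = 0"
      if c: "c < length us" for c
    proof -
      have "(\<Sum>i<r. u i * N0 $$ (i, c)) =
          (\<Sum>i<r. \<Sum>t<r. u i * T i t * peval h0 (be t) (ga t) * meval (us ! c) (be t) (ga t))"
        unfolding N0_def using c by (intro sum.cong) (auto simp: entry[OF h0(1)] sum_distrib_left mult_ac)
      also have "\<dots> = (\<Sum>t<r. ((\<Sum>i<r. u i * T i t) * peval h0 (be t) (ga t)) * meval (us ! c) (be t) (ga t))"
        by (subst sum.swap) (simp add: sum_distrib_right)
      finally show ?thesis using u[of c] c by (simp add: dim)
    qed
    then have "\<forall>t<r. (\<Sum>i<r. u i * T i t) * peval h0 (be t) (ga t) = 0" by (rule us(2))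
    then have "\<forall>t<r. (\<Sum>i<r. u i * T i t) = 0" using h0(2) by auto
    then show ?thesis using T unfolding det_nonzero_iff_left dim by blast
  qed
  have "0 < dim_col N0" using us(1) dim by simp
  note qr = qr_pivotsT_fst[OF this rank, unfolded dim, folded js_def]
  show js: "length js = r" "set js \<subseteq> {..<length us}" using qr(1,2) by auto
  have jt: "js ! j < length us" if "j < r" for j
  proof -
    have "js ! j \<in> set js" using js(1) that by simp
    then show ?thesis using js(2) by blast
  qed
  show "det (mat r r (\<lambda>(t, j). meval (us ! (js ! j)) (be t) (ga t))) \<noteq> 0"
    unfolding det_nonzero_iff
  proof (intro allI impI)
    fix c j assume c: "\<forall>t<r. (\<Sum>j<r. meval (us ! (js ! j)) (be t) (ga t) * c j) = 0" and j: "j < r"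
    have "(\<Sum>j<r. c j * N0 $$ (i, js ! j)) = 0" if i: "i < r" for i
    proof -
      have "(\<Sum>j<r. c j * N0 $$ (i, js ! j)) =
          (\<Sum>j<r. \<Sum>t<r. T i t * peval h0 (be t) (ga t) * (meval (us ! (js ! j)) (be t) (ga t) * c j))"
        unfolding N0_def using i jt by (intro sum.cong) (auto simp: entry[OF h0(1)] sum_distrib_left mult_ac)
      also have "\<dots> = (\<Sum>t<r. T i t * peval h0 (be t) (ga t) * (\<Sum>j<r. meval (us ! (js ! j)) (be t) (ga t) * c j))"
        by (subst sum.swap) (simp add: sum_distrib_left)
      finally show ?thesis using c by simp
    qed
    then show "c j = 0" using qr(3)[of c] j by blast
  qed
qed

lemma joint: "\<exists>\<sigma>. bij_betw \<sigma> {..<r} {..<r} \<and> fst (joint_eigenvaluesT eig \<rho> r js N0 Ns) =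
    map (\<lambda>i. vec (length gs) (\<lambda>k. peval (gs ! k) (be (\<sigma> i)) (ga (\<sigma> i)) / peval h0 (be (\<sigma> i)) (ga (\<sigma> i)))) [0..<r]"
  and joint_snd: "snd (joint_eigenvaluesT eig \<rho> r js N0 Ns) \<le> (length gs + 1) * (ce + 20) * r ^ 3"
proof -
  let ?T = "mat r r (\<lambda>(i, t). T i t)" and ?E = "mat r r (\<lambda>(t, j). meval (us ! (js ! j)) (be t) (ga t))"
  have jt: "js ! j < length us" if "j < r" for j
  proof -
    have "js ! j \<in> set js" using pivots(1) that by simp
    then show ?thesis using pivots(2) by blast
  qed
  have restr: "mat r r (\<lambda>(i, j). fst (mult_mapT N ms g us) $$ (i, js ! j)) =
      ?T * mat_diag r (\<lambda>t. peval g (be t) (ga t)) * ?E" if g: "g \<in> S_comp m n (d - d') (e - e')" for g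
    by (subst mat_diag_mult_right[of _ r r], simp, rule eq_matI)
      (use jt in \<open>auto simp: entry[OF g] scalar_prod_def lessThan_atLeast0\<close>)
  interpret joint_diag eig ce r ?T ?E N0 js Ns "\<lambda>t. peval h0 (be t) (ga t)"
      "\<lambda>k t. peval (gs ! k) (be t) (ga t)" \<rho>
  proof
    show "fst (eig A) \<in> carrier_mat k k \<and> invertible_mat (fst (eig A)) \<and>
       (\<exists>D\<in>carrier_mat k k. diagonal_mat D \<and> A * fst (eig A) = fst (eig A) * D) \<and> snd (eig A) \<le> ce * k ^ 3"
      if "A \<in> carrier_mat k k" "diagonalizable A" for k A using eig that by (simp add: eig_ok_def)
    show "mat r r (\<lambda>(i, j). Ns ! k $$ (i, js ! j)) = ?T * mat_diag r (\<lambda>t. peval (gs ! k) (be t) (ga t)) * ?E"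
      if "k < length Ns" for k
    proof -
      have k: "k < length gs" using that by (simp add: Ns_def)
      then have "gs ! k \<in> S_comp m n (d - d') (e - e')" using gs nth_mem by blast
      then show ?thesis using k restr[of "gs ! k"] by (simp add: Ns_def)
    qed
    show "mat r r (\<lambda>(i, j). N0 $$ (i, js ! j)) = ?T * mat_diag r (\<lambda>t. peval h0 (be t) (ga t)) * ?E"
      unfolding N0_def by (rule restr[OF h0(1)])
    show "inj_on (\<lambda>t. \<Sum>k<length Ns. \<rho> (RMix k) * (peval (gs ! k) (be t) (ga t) / peval h0 (be t) (ga t))) {..<r}"
      using inj by (simp add: Ns_def)
  qed (use T det_E h0 in auto)
  show "\<exists>\<sigma>. bij_betw \<sigma> {..<r} {..<r} \<and> fst (joint_eigenvaluesT eig \<rho> r js N0 Ns) =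
    map (\<lambda>i. vec (length gs) (\<lambda>k. peval (gs ! k) (be (\<sigma> i)) (ga (\<sigma> i)) / peval h0 (be (\<sigma> i)) (ga (\<sigma> i)))) [0..<r]"
    using joint_eigenvalues by (simp add: Ns_def)
  show "snd (joint_eigenvaluesT eig \<rho> r js N0 Ns) \<le> (length gs + 1) * (ce + 20) * r ^ 3"
    using joint_eigenvalues_snd by (simp add: Ns_def)
qed

end

text \<open>The solution space is the line through \<open>w\<close>, and the first kernel basis
  vector is nonzero, hence a nonzero multiple of \<open>w\<close>.\<close>

lemma solve_yT_fst:
  assumes F: "\<And>j. j < length F \<Longrightarrow> (\<Sum>c\<le>n. (\<Sum>k\<le>m. F ! j $ (k * (n + 1) + c) * \<beta> $ k) * w c) = 0"
    and uniq: "\<And>y. (\<And>j. j < length F \<Longrightarrow> (\<Sum>c\<le>n. (\<Sum>k\<le>m. F ! j $ (k * (n + 1) + c) * \<beta> $ k) * y c) = 0) \<Longrightarrow>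
        \<exists>a. \<forall>c\<le>n. y c = a * w c"
    and w: "\<exists>c\<le>n. w c \<noteq> 0"
  shows "\<exists>a. a \<noteq> 0 \<and> fst (solve_yT m n F \<beta>) = vec (n + 1) (\<lambda>c. a * w c)"
proof -
  define G where "G = fst (matT (length F) (n + 1) (\<lambda>j c.
            sumT (m + 1) (\<lambda>k. mulT ((F ! j) $ (k * (n + 1) + c)) (\<beta> $ k))))"
  have kerv: "kerv G y \<longleftrightarrow> (\<forall>j<length F. (\<Sum>c\<le>n. (\<Sum>k\<le>m. F ! j $ (k * (n + 1) + c) * \<beta> $ k) * y c) = 0)" for y
    by (simp add: kerv_def G_def lessThan_Suc_atMost[symmetric] del: mult_Suc_right)
  have dim: "dim_col G = n + 1" by (simp add: G_def)
  define K where "K = fst (kernelT G)"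
  note K = kernelT_basis[where A = G, folded K_def, unfolded dim]
  have "K \<noteq> []"
  proof
    assume "K = []"
    moreover obtain c where "\<forall>i<n + 1. w i = (\<Sum>t<length K. c t * K ! t $ i)"
      using K(2)[of w] F kerv by blast
    ultimately show False using w by auto
  qed
  then have 0: "K ! 0 \<in> set K" by simp
  then obtain a where a: "\<forall>c\<le>n. K ! 0 $ c = a * w c" using K(1)[OF 0] kerv uniq by blast
  have "a \<noteq> 0"
  proof
    assume "a = 0"
    then have "(\<Sum>t<length K. of_bool (t = 0) * K ! t $ i) = 0" if "i < n + 1" for i
      using a that \<open>a = 0\<close> by (intro sum.neutral ballI) (auto simp: of_bool_def)
    then have "\<forall>t<length K. (of_bool (t = 0) :: complex) = 0" by (rule K(3))
    then show False using \<open>K \<noteq> []\<close> by auto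
  qed
  moreover have "K ! 0 = vec (n + 1) (\<lambda>c. a * w c)"
    using K(1)[OF 0] a by (intro eq_vecI) auto
  moreover have "fst (solve_yT m n F \<beta>) = (case K of [] \<Rightarrow> 0\<^sub>v (n + 1) | y # _ \<Rightarrow> y)"
    by (simp only: solve_yT_def bindT_simps ret_simps K_def G_def)
  then have "fst (solve_yT m n F \<beta>) = K ! 0" using \<open>K \<noteq> []\<close> by (cases K) auto
  ultimately show ?thesis by auto
qed

lemma solve_yT_snd:
  "snd (solve_yT m n F \<beta>) \<le> length F * (n + 1) * ((m + 1) * 2) +
     ((n + 1) * (length F * (3 * (n + 1) + 1)) + (n + 1) * (n + 1))"
proof -
  let ?G = "matT (length F) (n + 1) (\<lambda>j c. sumT (m + 1) (\<lambda>k. mulT ((F ! j) $ (k * (n + 1) + c)) (\<beta> $ k)))"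
  have "snd ?G \<le> length F * (n + 1) * ((m + 1) * 2)"
    by (rule snd_matT_le) (simp add: snd_sumT_const del: mult_Suc_right)
  moreover have "snd (kernelT (fst ?G)) \<le> (n + 1) * (length F * (3 * (n + 1) + 1)) + (n + 1) * (n + 1)"
    using kernelT_snd[of "fst ?G"] by simp
  moreover have "snd (solve_yT m n F \<beta>) = snd ?G + snd (kernelT (fst ?G))"
    by (simp only: solve_yT_def bindT_simps ret_simps)
  ultimately show ?thesis by linarith
qed

text \<open>The right-hand side of the Newton system vanishes at an exact zero, so the step is stationary
  there.\<close>

lemma newton_stepT_zero:
  assumes \<beta>: "\<beta> \<in> carrier_vec (m + 1)" and \<gamma>: "\<gamma> \<in> carrier_vec (n + 1)"
    and F: "\<And>j. j < length F \<Longrightarrow> (\<Sum>k\<le>m. (\<Sum>c\<le>n. F ! j $ (k * (n + 1) + c) * \<gamma> $ c) * \<beta> $ k) = 0"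
  shows "fst (newton_stepT m n F (\<beta>, \<gamma>)) = (\<beta>, \<gamma>)"
proof -
  let ?s = "length F" and ?w = "(m + 1) + (n + 1)"
  define J where "J = fst (matT (?s + 2) ?w (\<lambda>j c.
       if j < ?s then
         (if c < m + 1
          then sumT (n + 1) (\<lambda>l. mulT ((F ! j) $ (c * (n + 1) + l)) (\<gamma> $ l))
          else sumT (m + 1) (\<lambda>k. mulT ((F ! j) $ (k * (n + 1) + (c - (m + 1)))) (\<beta> $ k)))
       else if j = ?s then (if c < m + 1 then cnjT (\<beta> $ c) else ret 0)
       else (if c < m + 1 then ret 0 else cnjT (\<gamma> $ (c - (m + 1))))))"
  define b where "b = fst (matT (?s + 2) 1 (\<lambda>j _.
       if j < ?s then do { v \<leftarrow> sumT (m + 1) (\<lambda>k. mulT (J $$ (j, k)) (\<beta> $ k)); negT v }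
       else ret 0))"
  define Jh where "Jh = fst (matT ?w (?s + 2) (\<lambda>c j. cnjT (J $$ (j, c))))"
  have Jc: "J \<in> carrier_mat (?s + 2) ?w" "Jh \<in> carrier_mat ?w (?s + 2)" by (simp_all add: J_def Jh_def)
  have J: "J $$ (j, k) = (\<Sum>c\<le>n. F ! j $ (k * (n + 1) + c) * \<gamma> $ c)" if "j < ?s" "k \<le> m" for j k
    using that by (simp add: J_def lessThan_Suc_atMost[symmetric] del: mult_Suc_right)
  have "b = 0\<^sub>m (?s + 2) 1"
  proof (rule eq_matI)
    fix i j assume "i < dim_row (0\<^sub>m (?s + 2) 1)" "j < dim_col (0\<^sub>m (?s + 2) 1)"
    then have ij: "i < ?s + 2" "j < 1" by auto
    show "b $$ (i, j) = 0\<^sub>m (?s + 2) 1 $$ (i, j)"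
    proof (cases "i < ?s")
      case True
      have "(\<Sum>k<m + 1. J $$ (i, k) * \<beta> $ k) = (\<Sum>k\<le>m. (\<Sum>c\<le>n. F ! i $ (k * (n + 1) + c) * \<gamma> $ c) * \<beta> $ k)"
        using True by (intro sum.cong) (auto simp: J)
      then show ?thesis using ij True F[OF True] by (simp add: b_def)
    qed (use ij in \<open>simp add: b_def\<close>)
  qed (simp_all add: b_def)
  then have "fst (mat_mulT Jh b) = 0\<^sub>m ?w 1"
    using fst_mat_mulT[OF Jc(2), of b 1] Jc by simp
  moreover have "fst (mat_mulT Jh J) \<in> carrier_mat ?w ?w"
    using fst_mat_mulT[OF Jc(2,1)] Jc by simp
  then have "fst (solveT (fst (mat_mulT Jh J)) (0\<^sub>m ?w 1)) = 0\<^sub>m ?w 1"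
    by (intro solveT_sol(3)[where nr = ?w, OF _ _ zero_carrier_mat right_mult_zero_mat]) auto
  ultimately have \<Delta>: "fst (solveT (fst (mat_mulT Jh J)) (fst (mat_mulT Jh b))) = 0\<^sub>m ?w 1" by simp
  have "fst (newton_stepT m n F (\<beta>, \<gamma>)) =
      (vec (m + 1) (\<lambda>k. \<beta> $ k + fst (solveT (fst (mat_mulT Jh J)) (fst (mat_mulT Jh b))) $$ (k, 0)),
       vec (n + 1) (\<lambda>l. \<gamma> $ l + fst (solveT (fst (mat_mulT Jh J)) (fst (mat_mulT Jh b))) $$ ((m + 1) + l, 0)))"
    unfolding newton_stepT_def prod.case Let_def bindT_simps J_def[symmetric] b_def[symmetric] Jh_def[symmetric]
      ret_simps vecT_simps op_simps ..
  also have "\<dots> = (\<beta>, \<gamma>)" unfolding \<Delta> using \<beta> \<gamma> by (auto intro!: eq_vecI)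
  finally show ?thesis .
qed

text \<open>With w = m + n + 2, forming the normal matrix is of order (s + 2) w^2 and eliminating it
  of order w^3; the constants are rough.\<close>

lemma newton_stepT_snd:
  "snd (newton_stepT m n F p) \<le> 100 * (length F + 2) * (m + n + 2) ^ 2 + 20 * (m + n + 2) ^ 3"
proof -
  obtain \<beta> \<gamma> where p: "p = (\<beta>, \<gamma>)" by force
  let ?s = "length F" and ?w = "(m + 1) + (n + 1)"
  let ?J = "matT (?s + 2) ?w (\<lambda>j c.
       if j < ?s then
         (if c < m + 1
          then sumT (n + 1) (\<lambda>l. mulT ((F ! j) $ (c * (n + 1) + l)) (\<gamma> $ l))
          else sumT (m + 1) (\<lambda>k. mulT ((F ! j) $ (k * (n + 1) + (c - (m + 1)))) (\<beta> $ k)))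
       else if j = ?s then (if c < m + 1 then cnjT (\<beta> $ c) else ret 0)
       else (if c < m + 1 then ret 0 else cnjT (\<gamma> $ (c - (m + 1)))))"
  let ?b = "matT (?s + 2) 1 (\<lambda>j _.
       if j < ?s then do { v \<leftarrow> sumT (m + 1) (\<lambda>k. mulT (fst ?J $$ (j, k)) (\<beta> $ k)); negT v }
       else ret 0)"
  let ?Jh = "matT ?w (?s + 2) (\<lambda>c j. cnjT (fst ?J $$ (j, c)))"
  let ?H = "mat_mulT (fst ?Jh) (fst ?J)" and ?g = "mat_mulT (fst ?Jh) (fst ?b)"
  let ?D = "solveT (fst ?H) (fst ?g)"
  let ?v = "vecT (m + 1) (\<lambda>k. addT (\<beta> $ k) (fst ?D $$ (k, 0)))"
  let ?v' = "vecT (n + 1) (\<lambda>l. addT (\<gamma> $ l) (fst ?D $$ ((m + 1) + l, 0)))"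
  have 1: "snd ?J \<le> (?s + 2) * ?w * (?w * 2)"
    by (intro snd_matT_le) (auto simp: snd_sumT_const simp del: mult_Suc_right)
  have 2: "snd ?b \<le> (?s + 2) * 1 * (?w * 2)"
    by (intro snd_matT_le) (auto simp: snd_sumT_const)
  have 3: "snd ?Jh \<le> ?w * (?s + 2) * 1" by (intro snd_matT_le) auto
  have dims: "dim_row (fst ?Jh) = ?w" "dim_col (fst ?Jh) = ?s + 2" "dim_col (fst ?J) = ?w" "dim_col (fst ?b) = 1"
    by (simp_all del: add_Suc_right)
  have 4: "snd ?H \<le> ?w * ?w * ((?s + 2) * 2)" using snd_mat_mulT_le[of "fst ?Jh" "fst ?J"] unfolding dims .
  have 5: "snd ?g \<le> ?w * 1 * ((?s + 2) * 2)" using snd_mat_mulT_le[of "fst ?Jh" "fst ?b"] unfolding dims .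
  have dims': "dim_row (fst ?H) = ?w" "dim_col (fst ?H) = ?w" "dim_col (fst ?g) = 1"
    unfolding mat_mulT_def matT_simps dim_row_mat dim_col_mat dims by (rule refl)+
  have 6: "snd ?D \<le> ?w * (?w * (3 * (?w + 1) + 1))" using solveT_snd[of "fst ?H" "fst ?g"] unfolding dims' .
  have 7: "snd ?v \<le> (m + 1) * 1" by (intro snd_vecT_le) simp
  have 8: "snd ?v' \<le> (n + 1) * 1" by (intro snd_vecT_le) simp
  have "snd (newton_stepT m n F p) =
      snd ?J + (snd ?b + (snd ?Jh + (snd ?H + (snd ?g + (snd ?D + (snd ?v + (snd ?v' + 0)))))))"
    unfolding p newton_stepT_def prod.case Let_def bindT_simps ret_simps ..
  also have "\<dots> \<le> (?s + 2) * ?w * (?w * 2) + ((?s + 2) * 1 * (?w * 2) + (?w * (?s + 2) * 1 +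
      (?w * ?w * ((?s + 2) * 2) + (?w * 1 * ((?s + 2) * 2) + (?w * (?w * (3 * (?w + 1) + 1)) +
      ((m + 1) * 1 + ((n + 1) * 1 + 0)))))))"
    using 1 2 3 4 5 6 7 8 by linarith
  also have "\<dots> = 4 * ((?s + 2) * (?w * ?w)) + 5 * ((?s + 2) * ?w) + 3 * (?w * ?w * ?w) + 4 * (?w * ?w) + ?w"
    by (simp add: algebra_simps)
  also have "\<dots> \<le> 4 * ((?s + 2) * (?w * ?w)) + 5 * ((?s + 2) * (?w * ?w)) + 3 * (?w * ?w * ?w) + 4 * (?w * ?w * ?w) + (?w * ?w * ?w)"
    by (intro add_mono mult_le_mono) auto
  also have "\<dots> \<le> 100 * ((?s + 2) * (?w * ?w)) + 20 * (?w * ?w * ?w)" by linarith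
  also have "\<dots> = 100 * (length F + 2) * (m + n + 2) ^ 2 + 20 * (m + n + 2) ^ 3"
  proof -
    have "?w = m + n + 2" by simp
    then show ?thesis by (simp only: power2_eq_square power3_eq_cube mult.assoc)
  qed
  finally show ?thesis .
qed

section \<open>Decompositions in general position\<close>

lemma sum_div_mod: "(\<Sum>j<a * b. f j) = (\<Sum>k<a. \<Sum>c<b. f (k * b + c))" for f :: "nat \<Rightarrow> complex"
proof (induction a)
  case (Suc a)
  have "(\<Sum>j<Suc a * b. f j) = (\<Sum>j<a * b + b. f j)" by (simp add: add.commute)
  then show ?case by (simp add: sum_split_add Suc)
qed simp

lemma monlist_11_nth':
  assumes "j < (m + 1) * (n + 1)"
  shows "monlist m n 1 1 ! j = (var_x (j div (n + 1)), var_x (j mod (n + 1)))"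
proof -
  have "j div (n + 1) \<le> m" using assms less_mult_imp_div_less[of j "m + 1" "n + 1"] by simp
  moreover have "j mod (n + 1) \<le> n" by (simp add: less_Suc_eq_le[symmetric])
  ultimately show ?thesis using monlist_11_nth[of "j div (n + 1)" m "j mod (n + 1)" n]
    by (metis div_mult_mod_eq)
qed

lemma monlist_11_length: "length (monlist m n 1 1) = (m + 1) * (n + 1)"
  by (simp add: monlist_length)

lemma peval_11:
  assumes "f \<in> S_comp m n 1 1"
  shows "peval f x y = (\<Sum>k\<le>m. \<Sum>c\<le>n. lookup f (var_x k, var_x c) * (x k * y c))"
proof -
  have "peval f x y = (\<Sum>k<m + 1. \<Sum>c<n + 1. lookup f (monlist m n 1 1 ! (k * (n + 1) + c)) *
      meval (monlist m n 1 1 ! (k * (n + 1) + c)) x y)"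
    unfolding peval_S_comp[OF assms] monlist_11_length by (rule sum_div_mod)
  also have "\<dots> = (\<Sum>k\<le>m. \<Sum>c\<le>n. lookup f (var_x k, var_x c) * (x k * y c))"
  proof (intro sum.cong refl)
    fix k c assume "k \<in> {..m}" "c \<in> {..n}"
    then have "monlist m n 1 1 ! (k * (n + 1) + c) = (var_x k, var_x c)" by (intro monlist_11_nth) auto
    then show "lookup f (monlist m n 1 1 ! (k * (n + 1) + c)) * meval (monlist m n 1 1 ! (k * (n + 1) + c)) x y =
        lookup f (var_x k, var_x c) * (x k * y c)"
      by (simp only: meval_def fst_conv snd_conv xpow_var_x)
  qed (simp_all add: lessThan_Suc_atMost)
  finally show ?thesis .
qed

definition points_span :: "nat \<Rightarrow> nat \<Rightarrow> nat \<Rightarrow> (nat \<Rightarrow> nat \<Rightarrow> complex) \<Rightarrow> (nat \<Rightarrow> nat \<Rightarrow> complex) \<Rightarrow> bipoly set" where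
  "points_span m n r be ga = {f \<in> S_comp m n 1 1. \<forall>t<r. peval f (be t) (ga t) = 0}"

text \<open>\<open>G\<close> is dual to the points, so the evaluations on bidegree (1,1) are
  independent. \<open>van\<close> says that in bidegree (d,1) the ideal generated by the (1,1) forms
  is the full ideal of the points. \<open>nonprop\<close> separates the \<beta> by 2 by 2 minors,
  and \<open>be_ind\<close> is the rank condition of step (2a).\<close>

locale good_points =
  fixes m n r d :: nat and be ga :: "nat \<Rightarrow> nat \<Rightarrow> complex" and G :: "nat \<Rightarrow> bipoly"
  assumes d: "2 \<le> d"
    and G: "\<And>t. t < r \<Longrightarrow> G t \<in> S_comp m n 1 1"
      "\<And>s t. s < r \<Longrightarrow> t < r \<Longrightarrow> peval (G s) (be t) (ga t) = of_bool (s = t)"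
    and van: "\<And>f. f \<in> S_comp m n d 1 \<Longrightarrow> (\<And>t. t < r \<Longrightarrow> peval f (be t) (ga t) = 0) \<Longrightarrow>
      f \<in> mult_span m n d (points_span m n r be ga)"
    and nonprop: "\<And>s t. s < r \<Longrightarrow> t < r \<Longrightarrow> s \<noteq> t \<Longrightarrow>
      \<exists>k\<le>m. \<exists>k'\<le>m. be s k * be t k' \<noteq> be s k' * be t k"
    and be_ind: "\<And>c. r \<le> m + 1 \<Longrightarrow> (\<And>k. k \<le> m \<Longrightarrow> (\<Sum>t<r. c t * be t k) = 0) \<Longrightarrow> \<forall>t<r. c t = 0"
begin

abbreviation "FF \<equiv> points_span m n r be ga"

lemma point_nonzero:
  assumes "t < r"
  shows "\<exists>k\<le>m. be t k \<noteq> 0" "\<exists>c\<le>n. ga t c \<noteq> 0"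
proof -
  have 1: "(\<Sum>k\<le>m. \<Sum>c\<le>n. lookup (G t) (var_x k, var_x c) * (be t k * ga t c)) = 1"
    using peval_11[OF G(1)[OF assms]] G(2)[OF assms assms] by simp
  show "\<exists>k\<le>m. be t k \<noteq> 0"
  proof (rule ccontr)
    assume "\<not> ?thesis"
    then have "(\<Sum>k\<le>m. \<Sum>c\<le>n. lookup (G t) (var_x k, var_x c) * (be t k * ga t c)) = 0"
      by (intro sum.neutral) auto
    then show False using 1 by simp
  qed
  show "\<exists>c\<le>n. ga t c \<noteq> 0"
  proof (rule ccontr)
    assume "\<not> ?thesis"
    then have "(\<Sum>k\<le>m. \<Sum>c\<le>n. lookup (G t) (var_x k, var_x c) * (be t k * ga t c)) = 0"
      by (intro sum.neutral ballI) auto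
    then show False using 1 by simp
  qed
qed

lemma var_S_comp: "k \<le> m \<Longrightarrow> monom (var_x k, 0) \<in> S_comp m n 1 0"
  "c \<le> n \<Longrightarrow> monom (0, var_x c) \<in> S_comp m n 0 1"
  "k \<le> m \<Longrightarrow> monom (single k j, 0) \<in> S_comp m n j 0"
  by (intro monom_S_comp, simp add: monlist_set var_x_def)+

lemma var_var_S_comp: "k \<le> m \<Longrightarrow> c \<le> n \<Longrightarrow> monom (var_x k, var_x c) \<in> S_comp m n 1 1"
  by (intro monom_S_comp) (simp add: monlist_set var_x_def)

lemma meval_simps [simp]: "meval (a, 0) x y = xpow a x" "meval (0, b) x y = xpow b y"
  "meval (a, b) x y = xpow a x * xpow b y"
  by (simp_all add: meval_def)

lemma mult_span_zero:
  assumes "f \<in> mult_span m n d FF" "\<And>f. f \<in> FF \<Longrightarrow> peval f x y = 0"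
  shows "peval f x y = 0"
proof -
  have "mult_span m n d FF \<subseteq> {f. peval f x y = 0}"
    unfolding mult_span_def using assms(2)
    by (intro bp.span_minimal) (auto simp: bp.subspace_def)
  then show ?thesis using assms(1) by auto
qed

text \<open>A monomial minus its interpolant lies in \<open>FF\<close>. So for a common zero the
  Kronecker product of x and y is a combination of those of the given points, with the values of the
  \<open>G t\<close> as weights.\<close>

lemma zero_expansion:
  assumes zero: "\<And>f. f \<in> FF \<Longrightarrow> peval f x y = 0" and kc: "k \<le> m" "c \<le> n"
  shows "x k * y c = (\<Sum>t<r. peval (G t) x y * be t k * ga t c)"
proof -
  let ?f = "monom (var_x k, var_x c) - (\<Sum>t<r. pscale (be t k * ga t c) (G t))"
  have "?f \<in> S_comp m n 1 1"
    using kc G by (intro S_comp_diff S_comp_sum S_comp_closed var_var_S_comp) auto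
  moreover have "peval ?f (be s) (ga s) = 0" if "s < r" for s
  proof -
    have "(\<Sum>t<r. be t k * ga t c * peval (G t) (be s) (ga s)) = (\<Sum>t<r. if t = s then be s k * ga s c else 0)"
      using that by (intro sum.cong) (auto simp: G)
    then show ?thesis using that by simp
  qed
  ultimately have "peval ?f x y = 0" by (intro zero) (simp add: points_span_def)
  then show ?thesis by (simp add: mult_ac)
qed

text \<open>The product of \<open>G t\<close>, a linear form vanishing at \<open>be t\<close> and a power of a variable vanishes at
  all points, hence at every common zero by the assumption \<open>van\<close>.\<close>

lemma zero_proportional:
  assumes zero: "\<And>f. f \<in> FF \<Longrightarrow> peval f x y = 0" and x: "\<exists>k\<le>m. x k \<noteq> 0"
    and t: "t < r" "peval (G t) x y \<noteq> 0" and k: "k \<le> m" "k' \<le> m"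
  shows "x k * be t k' = x k' * be t k"
proof -
  obtain k0 where k0: "k0 \<le> m" "x k0 \<noteq> 0" using x by blast
  let ?l = "pscale (be t k') (monom (var_x k, 0)) - pscale (be t k) (monom (var_x k', 0))"
  let ?f = "G t * ?l * monom (single k0 (d - 2), 0)"
  have "?l \<in> S_comp m n 1 0" using k by (intro S_comp_diff S_comp_closed var_S_comp)
  then have "?f \<in> S_comp m n (1 + 1 + (d - 2)) (1 + 0 + 0)"
    using k0 t by (intro S_comp_mult var_S_comp G)
  moreover have "1 + 1 + (d - 2) = d" "1 + 0 + 0 = (1 :: nat)" using d by simp_all
  ultimately have f: "?f \<in> S_comp m n d 1" by (simp only:)
  have "peval ?f (be s) (ga s) = 0" if "s < r" for s
    using that t by (cases "s = t") (auto simp: G)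
  then have "?f \<in> mult_span m n d FF" by (intro van f)
  then have "peval ?f x y = 0" by (rule mult_span_zero[OF _ zero])
  then show ?thesis using t k0 by (auto simp: xpow_single mult.commute)
qed

text \<open>Two nonzero weights would make the nonzero vector \<open>x\<close> proportional to two
  of the \<beta>, which are pairwise nonproportional.\<close>

lemma zero_unique:
  assumes zero: "\<And>f. f \<in> FF \<Longrightarrow> peval f x y = 0" and x: "\<exists>k\<le>m. x k \<noteq> 0"
    and s: "s < r" "peval (G s) x y \<noteq> 0" and t: "t < r" "peval (G t) x y \<noteq> 0"
  shows "s = t"
proof (rule ccontr)
  assume "s \<noteq> t"
  then obtain k k' where k: "k \<le> m" "k' \<le> m" "be s k * be t k' \<noteq> be s k' * be t k"
    using nonprop s t by blast
  obtain k0 where k0: "k0 \<le> m" "x k0 \<noteq> 0" using x by blast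
  have p: "x k0 * be u j = x j * be u k0" if "u = s \<or> u = t" "j \<le> m" for u j
    using zero_proportional[OF zero x, of u k0 j] that s t k0 by auto
  have "x k0 * x k0 * (be s k * be t k') = (x k0 * be s k) * (x k0 * be t k')" by simp
  also have "\<dots> = (x k * be s k0) * (x k' * be t k0)" using p k by simp
  also have "\<dots> = (x k' * be s k0) * (x k * be t k0)" by simp
  also have "\<dots> = x k0 * x k0 * (be s k' * be t k)"
    using p[of s k'] p[of t k] k by (metis mult.assoc mult.left_commute)
  finally show False using k(3) k0(2) by simp
qed

lemma zero_expansion_single:
  assumes zero: "\<And>f. f \<in> FF \<Longrightarrow> peval f x y = 0" and x: "\<exists>k\<le>m. x k \<noteq> 0"
    and s: "s < r" "\<And>t. t < r \<Longrightarrow> t \<noteq> s \<Longrightarrow> peval (G t) x y = 0" and kc: "k \<le> m" "c \<le> n"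
  shows "x k * y c = peval (G s) x y * be s k * ga s c"
proof -
  have "x k * y c = (\<Sum>t<r. peval (G t) x y * be t k * ga t c)"
    by (rule zero_expansion[OF zero kc])
  also have "\<dots> = (\<Sum>t<r. if t = s then peval (G s) x y * be s k * ga s c else 0)"
    by (intro sum.cong) (auto simp: s)
  finally show ?thesis using s by simp
qed

text \<open>If x is a multiple of the \<beta> with index \<open>s\<close>, a nonzero weight at
  another index would make two of the \<beta> proportional. Only the term of \<open>s\<close>
  remains in the expansion, and this determines \<open>y\<close>.\<close>

lemma fibre_ga:
  assumes zero: "\<And>f. f \<in> FF \<Longrightarrow> peval f x y = 0" and s: "s < r"
    and x: "a \<noteq> 0" "\<And>k. k \<le> m \<Longrightarrow> x k = a * be s k"
  shows "\<exists>b. \<forall>c\<le>n. y c = b * ga s c"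
proof -
  obtain k0 where k0: "k0 \<le> m" "be s k0 \<noteq> 0" using point_nonzero(1)[OF s] by blast
  have x0: "\<exists>k\<le>m. x k \<noteq> 0" using k0 x by (intro exI[of _ k0]) auto
  have "peval (G t) x y = 0" if t: "t < r" "t \<noteq> s" for t
  proof (rule ccontr)
    assume b: "peval (G t) x y \<noteq> 0"
    have "a * be s k * be t k' = a * be s k' * be t k" if "k \<le> m" "k' \<le> m" for k k'
      using zero_proportional[OF zero x0 t(1) b that] x(2) that by simp
    then show False using nonprop[OF s t(1)] t(2) x(1) by (metis mult.assoc mult_left_cancel)
  qed
  then have "x k0 * y c = peval (G s) x y * be s k0 * ga s c" if "c \<le> n" for c
    using zero_expansion_single[OF zero x0 s _ k0(1) that] by blast
  then have "y c = peval (G s) x y / a * ga s c" if "c \<le> n" for c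
    using that k0 x by (simp add: field_simps)
  then show ?thesis by blast
qed

lemma peval_11_cong:
  assumes "f \<in> S_comp m n 1 1" "\<And>k. k \<le> m \<Longrightarrow> x k = x' k" "\<And>c. c \<le> n \<Longrightarrow> y c = y' c"
  shows "peval f x y = peval f x' y'"
  unfolding peval_11[OF assms(1)] using assms(2,3) by (intro sum.cong) auto

lemma peval_11_bilinear:
  assumes "f \<in> S_comp m n 1 1"
  shows "peval f (\<lambda>k. x k + x' k) y = peval f x y + peval f x' y"
    "peval f x (\<lambda>c. a * y c) = a * peval f x y"
  unfolding peval_11[OF assms]
  by (simp_all add: sum.distrib[symmetric] sum_distrib_left algebra_simps)

text \<open>The expansion has a single term here too, but its index may a priori differ from
  \<open>s\<close>, because the \<gamma> are not assumed nonproportional; excluding this is the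
  point of the proof.\<close>

lemma fibre_be:
  assumes zero: "\<And>f. f \<in> FF \<Longrightarrow> peval f x y = 0" and s: "s < r"
    and y: "a \<noteq> 0" "\<And>c. c \<le> n \<Longrightarrow> y c = a * ga s c"
  shows "\<exists>b. \<forall>k\<le>m. x k = b * be s k"
proof (cases "\<exists>k\<le>m. x k \<noteq> 0")
  case False
  then show ?thesis by (intro exI[of _ 0]) auto
next
  case x0: True
  then obtain k0 where k0: "k0 \<le> m" "x k0 \<noteq> 0" by blast
  obtain c0 where c0: "c0 \<le> n" "ga s c0 \<noteq> 0" using point_nonzero(2)[OF s] by blast
  have "x k0 * y c0 \<noteq> 0" using k0 c0 y by simp
  then have "(\<Sum>t<r. peval (G t) x y * be t k0 * ga t c0) \<noteq> 0" using zero_expansion[OF zero k0(1) c0(1)] by simp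
  then obtain t where t: "t < r" "peval (G t) x y * be t k0 * ga t c0 \<noteq> 0"
    by (meson lessThan_iff sum.not_neutral_contains_not_neutral)
  have "peval (G u) x y = 0" if "u < r" "u \<noteq> t" for u
    using zero_unique[OF zero x0 that(1) _ t(1)] t(2) that(2) by fastforce
  then have e: "x k * y c = peval (G t) x y * be t k * ga t c" if "k \<le> m" "c \<le> n" for k c
    using zero_expansion_single[OF zero x0 t(1) _ that] by blast
  show ?thesis
  proof (cases "t = s")
    case True
    have "x k = peval (G s) x y / a * be s k" if "k \<le> m" for k
      using e[OF that c0(1)] c0 y True by (simp add: field_simps)
    then show ?thesis by blast
  next
    case False
    \<comment> \<open>If the index were another \<open>t\<close>, then the \<gamma> of
      \<open>s\<close> would be \<mu> times that of \<open>t\<close>. By bilinearity the sum of the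
      two \<beta> over this common \<gamma> is again a common zero, with the two nonzero weights
      \<open>1 / \<mu>\<close> and 1, against \<open>zero_unique\<close>.\<close>
    define \<mu> where "\<mu> = peval (G t) x y * be t k0 / (x k0 * a)"
    have \<mu>: "\<mu> \<noteq> 0" using t k0 y by (auto simp: \<mu>_def)
    have ga: "ga s c = \<mu> * ga t c" if "c \<le> n" for c
      using e[OF k0(1) that] y that k0(2) by (simp add: \<mu>_def field_simps)
    let ?x = "\<lambda>k. be s k + be t k" and ?y = "ga t"
    have *: "peval f ?x ?y = peval f (be s) (ga s) / \<mu> + peval f (be t) (ga t)" if f: "f \<in> S_comp m n 1 1" for f
    proof -
      have "peval f (be s) (ga s) = peval f (be s) (\<lambda>c. \<mu> * ga t c)"
        using ga by (intro peval_11_cong f) auto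
      then show ?thesis using \<mu> by (simp add: peval_11_bilinear[OF f])
    qed
    have zero': "peval f ?x ?y = 0" if "f \<in> FF" for f using that s t(1) by (simp add: points_span_def *)
    \<comment> \<open>The sum is a nonzero vector, as otherwise the two \<beta> would be opposite
      and hence proportional.\<close>
    have x0': "\<exists>k\<le>m. ?x k \<noteq> 0"
    proof (rule ccontr)
      assume "\<not> ?thesis"
      then have "be s k = - be t k" if "k \<le> m" for k using that by (auto simp: eq_neg_iff_add_eq_0)
      then show False using nonprop[OF s t(1)] False by auto
    qed
    have "peval (G s) ?x ?y \<noteq> 0" "peval (G t) ?x ?y \<noteq> 0"
      using False s t(1) \<mu> *[OF G(1)[OF s]] *[OF G(1)[OF t(1)]] by (simp_all add: G)
    then show ?thesis using zero_unique[OF zero' x0' s _ t(1)] False by blast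
  qed
qed

lemma HF_quot_points:
  "HF_quot m n (ideal_gen m n FF) d 1 = r"
proof -
  have sub: "FF \<subseteq> S_comp m n 1 1" by (auto simp: points_span_def)
  have eq: "ideal_gen m n FF \<inter> S_comp m n d 1 = mult_span m n d FF"
    using d by (intro ideal_gen_S_comp sub) simp
  define k where "k t = (SOME k. k \<le> m \<and> be t k \<noteq> 0)" for t
  have k: "k t \<le> m" "be t (k t) \<noteq> 0" if "t < r" for t
    using someI_ex[of "\<lambda>k. k \<le> m \<and> be t k \<noteq> 0"] point_nonzero(1)[OF that] by (auto simp: k_def)
  \<comment> \<open>Dual forms in bidegree (d,1): \<open>G t\<close> is multiplied by a power of a
    variable not vanishing at the point \<open>t\<close> and then normalized.\<close>
  let ?H = "\<lambda>t. pscale (1 / be t (k t) ^ (d - 1)) (G t * monom (single (k t) (d - 1), 0))"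
  show ?thesis
  proof (rule HF_quot_eq[where H = ?H and be = be and ga = ga])
    show "ideal_gen m n FF \<inter> S_comp m n d 1 = {f \<in> S_comp m n d 1. \<forall>t<r. peval f (be t) (ga t) = 0}"
    proof (intro equalityI subsetI)
      fix f assume f: "f \<in> ideal_gen m n FF \<inter> S_comp m n d 1"
      then have fm: "f \<in> mult_span m n d FF" by (simp only: eq)
      have "peval f (be t) (ga t) = 0" if "t < r" for t
        using that by (intro mult_span_zero[OF fm]) (simp add: points_span_def)
      then show "f \<in> {f \<in> S_comp m n d 1. \<forall>t<r. peval f (be t) (ga t) = 0}" using f by simp
    next
      fix f assume "f \<in> {f \<in> S_comp m n d 1. \<forall>t<r. peval f (be t) (ga t) = 0}"
      then have "f \<in> mult_span m n d FF" by (intro van) blast+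
      then show "f \<in> ideal_gen m n FF \<inter> S_comp m n d 1" by (simp only: eq)
    qed
    show "?H t \<in> S_comp m n d 1" if "t < r" for t
    proof -
      have "G t * monom (single (k t) (d - 1), 0) \<in> S_comp m n (1 + (d - 1)) (1 + 0)"
        by (intro S_comp_mult G(1)[OF that] var_S_comp(3) k(1)[OF that])
      moreover have "1 + (d - 1) = d" "1 + 0 = (1 :: nat)" using d by simp_all
      ultimately have "G t * monom (single (k t) (d - 1), 0) \<in> S_comp m n d 1" by (simp only:)
      then show ?thesis by (rule S_comp_closed(3))
    qed
    show "peval (?H s) (be t) (ga t) = of_bool (s = t)" if "s < r" "t < r" for s t
      using that k by (auto simp: G xpow_single)
  qed
qed

end

section \<open>The tensor of a point configuration and the kernel of its flattening\<close>

definition point_tensor :: "nat \<Rightarrow> nat \<Rightarrow> nat \<Rightarrow> nat \<Rightarrow> (nat \<Rightarrow> nat \<Rightarrow> complex) \<Rightarrow> (nat \<Rightarrow> nat \<Rightarrow> complex)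
    \<Rightarrow> (nat \<Rightarrow> nat \<Rightarrow> complex) \<Rightarrow> tensor" where
  "point_tensor l m n r al be ga = (\<lambda>(i, j, k). if i \<le> l \<and> j \<le> m \<and> k \<le> n
      then \<Sum>t<r. al t i * be t j * ga t k else 0)"

definition evrow :: "nat \<Rightarrow> (nat \<Rightarrow> complex) \<Rightarrow> (nat \<Rightarrow> complex) \<Rightarrow> nat \<Rightarrow> complex" where
  "evrow n x y j = x (j div (n + 1)) * y (j mod (n + 1))"

lemma meval_monlist_11:
  "j < (m + 1) * (n + 1) \<Longrightarrow> meval (monlist m n 1 1 ! j) x y = evrow n x y j"
  by (simp only: monlist_11_nth' meval_def evrow_def fst_conv snd_conv xpow_var_x)

lemma flattening1_point_tensor:
  assumes "i \<le> l" "j < (m + 1) * (n + 1)"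
  shows "flattening1 l m n (point_tensor l m n r al be ga) $$ (i, j) = (\<Sum>t<r. al t i * evrow n (be t) (ga t) j)"
proof -
  have "j div (n + 1) \<le> m" using assms less_mult_imp_div_less[of j "m + 1" "n + 1"] by simp
  moreover have "j mod (n + 1) \<le> n" by (simp add: less_Suc_eq_le[symmetric])
  ultimately show ?thesis using assms
    by (simp add: flattening1_def point_tensor_def evrow_def mult.assoc del: mult_Suc_right mult_Suc)
qed

text \<open>The factors \<open>al\<close>, \<open>be\<close>, \<open>ga\<close> may be any
  decomposition of \<open>A\<close>. Independence of the \<alpha> makes the kernel of the flattening
  equal to the (1,1) forms vanishing at the points.\<close>

locale good = good_points m n r d be ga G for m n r d be ga G +
  fixes l :: nat and al :: "nat \<Rightarrow> nat \<Rightarrow> complex" and A :: tensor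
  assumes A: "A = point_tensor l m n r al be ga"
    and al: "\<And>c. (\<And>i. i \<le> l \<Longrightarrow> (\<Sum>t<r. c t * al t i) = 0) \<Longrightarrow> \<forall>t<r. c t = 0"
begin

abbreviation "K \<equiv> (m + 1) * (n + 1)"
abbreviation "A1 \<equiv> flattening1 l m n A"
abbreviation "Ev t j \<equiv> evrow n (be t) (ga t) j"

lemma A1_dims: "dim_row A1 = l + 1" "dim_col A1 = K"
  by (simp_all add: flattening1_def)

lemma A1_sum: "i \<le> l \<Longrightarrow> (\<Sum>j<K. A1 $$ (i, j) * v j) = (\<Sum>t<r. (\<Sum>j<K. Ev t j * v j) * al t i)"
proof -
  assume i: "i \<le> l"
  have "(\<Sum>j<K. A1 $$ (i, j) * v j) = (\<Sum>j<K. \<Sum>t<r. Ev t j * v j * al t i)"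
    unfolding A using i by (intro sum.cong refl)
      (simp add: flattening1_point_tensor sum_distrib_right sum_distrib_left mult_ac del: mult_Suc mult_Suc_right)
  then show ?thesis by (subst (asm) sum.swap) (simp only: sum_distrib_right)
qed

lemma kerv_A1: "kerv A1 v \<longleftrightarrow> (\<forall>t<r. (\<Sum>j<K. Ev t j * v j) = 0)"
proof
  assume "kerv A1 v"
  then have "(\<Sum>t<r. (\<Sum>j<K. Ev t j * v j) * al t i) = 0" if "i \<le> l" for i
    using that A1_sum[of i v] by (simp add: kerv_def A1_dims del: mult_Suc mult_Suc_right)
  then show "\<forall>t<r. (\<Sum>j<K. Ev t j * v j) = 0" by (rule al)
next
  assume R: "\<forall>t<r. (\<Sum>j<K. Ev t j * v j) = 0"
  have "(\<Sum>j<K. A1 $$ (i, j) * v j) = 0" if "i \<le> l" for i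
    unfolding A1_sum[OF that] using R by simp
  then show "kerv A1 v" unfolding kerv_def A1_dims by simp
qed

lemma peval_Ev: "f \<in> S_comp m n 1 1 \<Longrightarrow>
    peval f x y = (\<Sum>j<K. evrow n x y j * lookup f (monlist m n 1 1 ! j))"
  unfolding peval_S_comp monlist_11_length
  by (intro sum.cong refl) (simp only: meval_monlist_11 lessThan_iff mult.commute)

lemma cpd_ideal_eq: "cpd_ideal l m n A = ideal_gen m n FF"
proof -
  have "A1 *\<^sub>v coeffs11 m n f = 0\<^sub>v (l + 1) \<longleftrightarrow> (\<forall>t<r. peval f (be t) (ga t) = 0)"
    if f: "f \<in> S_comp m n 1 1" for f
  proof -
    have c: "coeffs11 m n f $ j = lookup f (monlist m n 1 1 ! j)" if "j < K" for j
      using that unfolding coeffs11_def monlist_11_nth'[OF that] by simp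
    have "A1 *\<^sub>v coeffs11 m n f = 0\<^sub>v (l + 1) \<longleftrightarrow> kerv A1 (vec_index (coeffs11 m n f))"
      by (auto simp: vec_eq_iff kerv_def A1_dims scalar_prod_def coeffs11_def lessThan_atLeast0
          simp del: mult_Suc mult_Suc_right)
    also have "\<dots> \<longleftrightarrow> (\<forall>t<r. (\<Sum>j<K. Ev t j * lookup f (monlist m n 1 1 ! j)) = 0)"
      unfolding kerv_A1 by (simp add: c del: mult_Suc mult_Suc_right)
    finally show ?thesis using f by (simp add: peval_Ev del: mult_Suc mult_Suc_right)
  qed
  then have "{f \<in> S_comp m n 1 1. A1 *\<^sub>v coeffs11 m n f = 0\<^sub>v (l + 1)} = FF"
    by (auto simp: points_span_def)
  then show ?thesis by (simp add: cpd_ideal_def)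
qed

lemma HF_quot_cpd: "HF_quot m n (cpd_ideal l m n A) d 1 = r"
  using HF_quot_points by (simp add: cpd_ideal_eq)

end

section \<open>Correctness and cost of the steps\<close>

lemma evrow_sum:
  "(\<Sum>q<(m + 1) * (n + 1). evrow n x y q * f q) = (\<Sum>k\<le>m. \<Sum>c\<le>n. x k * y c * f (k * (n + 1) + c))"
proof -
  have "evrow n x y (k * (n + 1) + c) = x k * y c" if "c \<le> n" for k c
  proof -
    have "(k * (n + 1) + c) div (n + 1) = k" "(k * (n + 1) + c) mod (n + 1) = c"
      using that by (simp_all del: mult_Suc_right)
    then show ?thesis by (simp only: evrow_def)
  qed
  then show ?thesis unfolding sum_div_mod
    by (intro sum.cong) (auto simp: less_Suc_eq_le simp del: mult_Suc_right add_Suc_right)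
qed

lemma evrow_scale: "evrow n (\<lambda>k. a * x k) (\<lambda>c. b * y c) q = a * b * evrow n x y q"
  by (simp add: evrow_def)

lemma swap_coeffs_nth:
  assumes "k \<le> n" "c \<le> m"
  shows "swap_coeffs m n f $ (k * (m + 1) + c) = f $ (c * (n + 1) + k)"
proof -
  have "k * (m + 1) + c < (n + 1) * (m + 1)"
  proof -
    have "k * (m + 1) + c < (k + 1) * (m + 1)" using assms by simp
    also have "\<dots> \<le> (n + 1) * (m + 1)" using assms by (intro mult_le_mono1) simp
    finally show ?thesis .
  qed
  moreover have "(k * (m + 1) + c) div (m + 1) = k" "(k * (m + 1) + c) mod (m + 1) = c"
    using assms by (simp_all del: mult_Suc_right)
  ultimately show ?thesis by (simp only: swap_coeffs_def index_vec)
qed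

lemma kerv_resultant_map:
  "kerv (transpose_mat (resultant_map m n d e F)) u \<longleftrightarrow>
    (\<forall>k\<in>set (monlist m n (d - 1) (e - 1)). \<forall>f\<in>set F.
      (\<Sum>q<length (monlist m n d e). lookup (monom k * poly_of (monlist m n 1 1) (\<lambda>c. f $ c)) (monlist m n d e ! q) * u q) = 0)"
proof -
  let ?cs = "List.product (monlist m n (d - 1) (e - 1)) F" and ?ms = "monlist m n d e"
  let ?P = "\<lambda>(k, f). (\<Sum>q<length ?ms. lookup (monom k * poly_of (monlist m n 1 1) (\<lambda>c. f $ c)) (?ms ! q) * u q) = 0"
  have "kerv (transpose_mat (resultant_map m n d e F)) u \<longleftrightarrow> (\<forall>j<length ?cs. ?P (?cs ! j))"
    by (simp add: kerv_def resultant_map_def Let_def case_prod_beta)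
  also have "\<dots> \<longleftrightarrow> (\<forall>p\<in>set ?cs. ?P p)" by (rule all_set_conv_all_nth[symmetric])
  finally show ?thesis by auto
qed

context good_points
begin

text \<open>Representatives in some order, with independent scalings of the two factors. Order and
  scalings are what the eigenvalue computation cannot fix; step (3) absorbs the scalings into the
  \<alpha>.\<close>

definition points :: "(complex vec \<times> complex vec) list \<Rightarrow> bool" where
  "points ps \<longleftrightarrow> length ps = r \<and> (\<exists>\<sigma>. bij_betw \<sigma> {..<r} {..<r} \<and>
    (\<forall>i<r. \<exists>a b. a \<noteq> 0 \<and> b \<noteq> 0 \<and>
      ps ! i = (vec (m + 1) (\<lambda>k. a * be (\<sigma> i) k), vec (n + 1) (\<lambda>c. b * ga (\<sigma> i) c))))"

lemma dual_exists:
  "\<exists>H. (\<forall>t<r. H t \<in> S_comp m n d 1) \<and> (\<forall>s<r. \<forall>t<r. peval (H s) (be t) (ga t) = of_bool (s = t))"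
proof -
  define k where "k t = (SOME k. k \<le> m \<and> be t k \<noteq> 0)" for t
  have k: "k t \<le> m" "be t (k t) \<noteq> 0" if "t < r" for t
    using someI_ex[of "\<lambda>k. k \<le> m \<and> be t k \<noteq> 0"] point_nonzero(1)[OF that] by (auto simp: k_def)
  let ?H = "\<lambda>t. pscale (1 / be t (k t) ^ (d - 1)) (G t * monom (single (k t) (d - 1), 0))"
  have "?H t \<in> S_comp m n d 1" if "t < r" for t
  proof -
    have "G t * monom (single (k t) (d - 1), 0) \<in> S_comp m n (1 + (d - 1)) (1 + 0)"
      by (intro S_comp_mult G(1)[OF that] var_S_comp(3) k(1)[OF that])
    moreover have "1 + (d - 1) = d" "1 + 0 = (1 :: nat)" using d by simp_all
    ultimately have "G t * monom (single (k t) (d - 1), 0) \<in> S_comp m n d 1" by (simp only:)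
    then show ?thesis by (rule S_comp_closed(3))
  qed
  moreover have "peval (?H s) (be t) (ga t) = of_bool (s = t)" if "s < r" "t < r" for s t
    using that k by (auto simp: G xpow_single)
  ultimately show ?thesis by (intro exI[of _ ?H]) blast
qed

end

context good
begin

definition "rp = fst (rrefT K A1)"
definition "F = fst (null_basisT rp)"
definition "N = mat r K (\<lambda>(i, j). fst rp $$ (i, j))"

lemma rref_state_rp: "rref_state A1 (fst rp) (snd rp)"
  using rrefT_inv[of K A1] by unfold_locales (simp add: rp_def A1_dims del: mult_Suc mult_Suc_right)

text \<open>The nonzero rows of the reduced flattening are independent, as their pivot columns form
  an identity matrix, and they have the same kernel as the evaluations.
  \<open>same_kernel_rows\<close> yields both the number of pivots and the invertible
  factor.\<close>

lemma rank_A1: "length (snd rp) = r"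
  and N_factor: "\<exists>T. det (mat r r (\<lambda>(i, t). T i t)) \<noteq> 0 \<and> (\<forall>i<r. \<forall>j<K. N $$ (i, j) = (\<Sum>t<r. T i t * Ev t j))"
proof -
  interpret rs: rref_state A1 "fst rp" "snd rp" by (rule rref_state_rp)
  let ?R = "\<lambda>i j. fst rp $$ (i, j)" and ?p = "length (snd rp)"
  have "?p = r \<and> (\<exists>T. det (mat r r (\<lambda>(i, t). T i t)) \<noteq> 0 \<and> (\<forall>i<r. \<forall>j<K. ?R i j = (\<Sum>t<r. T i t * Ev t j)))"
  proof (rule same_kernel_rows[where g = "\<lambda>s j. lookup (G s) (monlist m n 1 1 ! j)"])
    show "(\<Sum>j<K. Ev t j * lookup (G s) (monlist m n 1 1 ! j)) = of_bool (s = t)" if "s < r" "t < r" for s t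
      using G(2)[OF that] unfolding peval_Ev[OF G(1)[OF that(1)]] .
    show "(\<Sum>j<K. ?R i j * v j) = 0" if "\<And>t. t < r \<Longrightarrow> (\<Sum>j<K. Ev t j * v j) = 0" "i < ?p" for v i
    proof -
      have "kerv (fst rp) v" unfolding rs.ker kerv_A1 using that(1) by blast
      then show ?thesis using that(2) rs.ps(3) unfolding kerv_def rs.dims A1_dims by simp
    qed
    show "(\<Sum>j<K. Ev t j * v j) = 0" if z: "\<And>i. i < ?p \<Longrightarrow> (\<Sum>j<K. ?R i j * v j) = 0" and t: "t < r" for v t
    proof -
      have "(\<Sum>j<K. ?R i j * v j) = 0" if "i < l + 1" for i
      proof (cases "i < ?p")
        case False
        then have "?R i j = 0" if "j < K" for j
          using rs.low[of i j] that \<open>i < l + 1\<close> unfolding A1_dims by simp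
        then show ?thesis by (intro sum.neutral) (simp del: mult_Suc mult_Suc_right)
      qed (rule z)
      then have "kerv (fst rp) v" unfolding kerv_def rs.dims A1_dims by blast
      then show ?thesis using t unfolding rs.ker kerv_A1 by blast
    qed
    show "\<forall>i<?p. u i = 0" if u: "\<And>j. j < K \<Longrightarrow> (\<Sum>i<?p. u i * ?R i j) = 0" for u
    proof (intro allI impI)
      fix p assume p: "p < ?p"
      then have "snd rp ! p \<in> set (snd rp)" by simp
      then have "snd rp ! p < K" using rs.ps(2) unfolding A1_dims by blast
      then have "0 = (\<Sum>i<?p. u i * ?R i (snd rp ! p))" using u by simp
      also have "\<dots> = (\<Sum>i<?p. if i = p then u i else 0)"
        using rs.piv[OF p] rs.ps(3) by (intro sum.cong) auto
      finally show "u p = 0" using p by simp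
    qed
  qed
  then show "?p = r" "\<exists>T. det (mat r r (\<lambda>(i, t). T i t)) \<noteq> 0 \<and> (\<forall>i<r. \<forall>j<K. N $$ (i, j) = (\<Sum>t<r. T i t * Ev t j))"
    by (simp_all add: N_def del: mult_Suc mult_Suc_right)
qed

lemma F_zero: "f \<in> set F \<Longrightarrow> f \<in> carrier_vec K \<and> (\<forall>t<r. (\<Sum>j<K. Ev t j * f $ j) = 0)"
  and F_span: "(\<And>t. t < r \<Longrightarrow> (\<Sum>j<K. Ev t j * v j) = 0) \<Longrightarrow>
    \<exists>c. \<forall>j<K. v j = (\<Sum>t<length F. c t * F ! t $ j)"
  and F_length: "length F \<le> K"
proof -
  interpret rs: rref_state A1 "fst rp" "snd rp" by (rule rref_state_rp)
  have F: "rs.F = F" by (simp add: rs.F_def F_def)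
  show "f \<in> carrier_vec K \<and> (\<forall>t<r. (\<Sum>j<K. Ev t j * f $ j) = 0)" if "f \<in> set F"
    using rs.F_ker[of f] that unfolding F A1_dims kerv_A1 by simp
  show "length F \<le> K" using rs.length_F unfolding F A1_dims by simp
  show "\<exists>c. \<forall>j<K. v j = (\<Sum>t<length F. c t * F ! t $ j)"
    if "\<And>t. t < r \<Longrightarrow> (\<Sum>j<K. Ev t j * v j) = 0"
  proof -
    have "kerv A1 v" unfolding kerv_A1 using that by blast
    then have "\<forall>j<K. v j = (\<Sum>t<length F. v (rs.free ! t) * F ! t $ j)"
      using rs.F_spans unfolding F A1_dims by simp
    then show ?thesis by (rule exI[of _ "\<lambda>t. v (rs.free ! t)"])
  qed
qed

text \<open>The computed kernel basis spans \<open>FF\<close>, so the equations solved by the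
  algorithm have the common zeros studied above.\<close>

lemma F_common_zero:
  assumes z: "\<And>j. j < length F \<Longrightarrow> (\<Sum>q<K. evrow n x y q * F ! j $ q) = 0" and f: "f \<in> FF"
  shows "peval f x y = 0"
proof -
  have fS: "f \<in> S_comp m n 1 1" using f by (simp add: points_span_def)
  let ?v = "\<lambda>q. lookup f (monlist m n 1 1 ! q)"
  have "(\<Sum>j<K. Ev t j * ?v j) = 0" if "t < r" for t
    using f that unfolding peval_Ev[OF fS, symmetric] by (simp add: points_span_def)
  from F_span[of ?v, OF this] obtain c where c: "\<forall>j<K. ?v j = (\<Sum>t<length F. c t * F ! t $ j)" ..
  have "peval f x y = (\<Sum>q<K. \<Sum>t<length F. c t * (evrow n x y q * F ! t $ q))"
    unfolding peval_Ev[OF fS] using c by (intro sum.cong) (auto simp: sum_distrib_left mult_ac)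
  also have "\<dots> = (\<Sum>t<length F. c t * (\<Sum>q<K. evrow n x y q * F ! t $ q))"
    by (subst sum.swap) (simp only: sum_distrib_left)
  finally show ?thesis using z by simp
qed

lemma F_at_point:
  assumes "j < length F" "s < r"
  shows "(\<Sum>q<K. evrow n (\<lambda>k. a * be s k) (\<lambda>c. b * ga s c) q * F ! j $ q) = 0"
proof -
  have "(\<Sum>q<K. evrow n (\<lambda>k. a * be s k) (\<lambda>c. b * ga s c) q * F ! j $ q) = a * b * (\<Sum>q<K. Ev s q * F ! j $ q)"
    unfolding evrow_scale sum_distrib_left by (simp only: mult.assoc)
  then show ?thesis using F_zero[OF nth_mem[OF assms(1)]] assms(2) by simp
qed

text \<open>By \<open>fibre_ga\<close> the equations with the \<beta> inserted have a
  one-dimensional solution space, spanned by the matching \<gamma>.\<close>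

lemma solve_ga:
  assumes s: "s < r" and a: "a \<noteq> 0"
  shows "\<exists>b. b \<noteq> 0 \<and> fst (solve_yT m n F (vec (m + 1) (\<lambda>k. a * be s k))) = vec (n + 1) (\<lambda>c. b * ga s c)"
proof (rule solve_yT_fst)
  have e: "(\<Sum>c\<le>n. (\<Sum>k\<le>m. F ! j $ (k * (n + 1) + c) * vec (m + 1) (\<lambda>k. a * be s k) $ k) * y c) =
      (\<Sum>q<K. evrow n (\<lambda>k. a * be s k) y q * F ! j $ q)" for j y
    unfolding evrow_sum sum_distrib_right by (subst sum.swap) (intro sum.cong refl, simp)
  show "(\<Sum>c\<le>n. (\<Sum>k\<le>m. F ! j $ (k * (n + 1) + c) * vec (m + 1) (\<lambda>k. a * be s k) $ k) * ga s c) = 0"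
    if "j < length F" for j unfolding e using F_at_point[OF that s, of a 1] by (simp only: mult_1)
  show "\<exists>b. \<forall>c\<le>n. y c = b * ga s c" if "\<And>j. j < length F \<Longrightarrow>
      (\<Sum>c\<le>n. (\<Sum>k\<le>m. F ! j $ (k * (n + 1) + c) * vec (m + 1) (\<lambda>k. a * be s k) $ k) * y c) = 0" for y
    using that unfolding e by (intro fibre_ga[OF F_common_zero s a]) auto
  show "\<exists>c\<le>n. ga s c \<noteq> 0" by (rule point_nonzero(2)[OF s])
qed

text \<open>The same with the two factors exchanged; uniqueness is now
  \<open>fibre_be\<close>.\<close>

lemma solve_be:
  assumes s: "s < r" and a: "a \<noteq> 0"
  shows "\<exists>b. b \<noteq> 0 \<and> fst (solve_yT n m (map (swap_coeffs m n) F) (vec (n + 1) (\<lambda>c. a * ga s c))) =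
    vec (m + 1) (\<lambda>k. b * be s k)"
proof (rule solve_yT_fst)
  have e: "(\<Sum>k\<le>m. (\<Sum>c\<le>n. map (swap_coeffs m n) F ! j $ (c * (m + 1) + k) * vec (n + 1) (\<lambda>c. a * ga s c) $ c) * x k) =
      (\<Sum>q<K. evrow n x (\<lambda>c. a * ga s c) q * F ! j $ q)" if "j < length F" for j x
    unfolding evrow_sum sum_distrib_right
  proof (intro sum.cong refl)
    fix k c assume "k \<in> {..m}" "c \<in> {..n}"
    then show "map (swap_coeffs m n) F ! j $ (c * (m + 1) + k) * vec (n + 1) (\<lambda>c. a * ga s c) $ c * x k =
        x k * (a * ga s c) * F ! j $ (k * (n + 1) + c)"
      using that swap_coeffs_nth[of c n k m "F ! j"] by simp
  qed
  show "(\<Sum>k\<le>m. (\<Sum>c\<le>n. map (swap_coeffs m n) F ! j $ (c * (m + 1) + k) * vec (n + 1) (\<lambda>c. a * ga s c) $ c) * be s k) = 0"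
    if "j < length (map (swap_coeffs m n) F)" for j
    using F_at_point[of j s 1 a] s that e[of j] by simp
  show "\<exists>b. \<forall>k\<le>m. x k = b * be s k" if z: "\<And>j. j < length (map (swap_coeffs m n) F) \<Longrightarrow>
      (\<Sum>k\<le>m. (\<Sum>c\<le>n. map (swap_coeffs m n) F ! j $ (c * (m + 1) + k) * vec (n + 1) (\<lambda>c. a * ga s c) $ c) * x k) = 0" for x
  proof (rule fibre_be[OF F_common_zero s a])
    show "(\<Sum>q<K. evrow n x (\<lambda>c. a * ga s c) q * F ! j $ q) = 0" if "j < length F" for j
      using z[of j] e[OF that] that by simp
  qed auto
  show "\<exists>k\<le>m. be s k \<noteq> 0" by (rule point_nonzero(1)[OF s])
qed

definition solve_bound :: "nat \<Rightarrow> nat \<Rightarrow> nat" where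
  "solve_bound a b = length F * (b + 1) * ((a + 1) * 2) +
     ((b + 1) * (length F * (3 * (b + 1) + 1)) + (b + 1) * (b + 1))"

definition "h2a \<rho> = poly_of (monlist m n 0 1) (\<lambda>c. \<rho> (RLin c))"

text \<open>\<open>h0\<close> must not vanish at a point, and the mixed eigenvalues must be
  distinct, so that the eigenvectors are determined up to scaling.\<close>

definition good_rand_2a :: "rand \<Rightarrow> bool" where
  "good_rand_2a \<rho> \<longleftrightarrow> (\<forall>t<r. peval (h2a \<rho>) (be t) (ga t) \<noteq> 0) \<and>
    inj_on (\<lambda>t. \<Sum>k<n + 1. \<rho> (RMix k) * (ga t k / peval (h2a \<rho>) (be t) (ga t))) {..<r}"

text \<open>The joint eigenvalues at a point are the coordinates of its \<gamma> divided by the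
  value of \<open>h0\<close>, hence homogeneous coordinates of \<gamma>. The \<beta> come from the
  fibre equations.\<close>

lemma step_2aT_good:
  assumes eig: "eig_ok eig ce" and r: "r \<le> m + 1" and \<rho>: "good_rand_2a \<rho>"
  shows "\<exists>ps. fst (step_2aT eig \<rho> m n r F N) = Some ps \<and> points ps"
    and "snd (step_2aT eig \<rho> m n r F N) \<le> r * (m + 1) * (K * 2) + (r * ((m + 1) * (7 * r + 1) + r + 2) +
      ((n + 1) * (r * (m + 1) * (K * 2)) + ((n + 1 + 1) * (ce + 20) * r ^ 3 + r * solve_bound n m)))"
proof -
  obtain T where T: "det (mat r r (\<lambda>(i, t). T i t)) \<noteq> 0"
    "\<And>i j. i < r \<Longrightarrow> j < K \<Longrightarrow> N $$ (i, j) = (\<Sum>t<r. T i t * Ev t j)"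
    using N_factor by blast
  let ?us = "monlist m n 1 0" and ?ms = "monlist m n 1 1"
  let ?gs = "map (\<lambda>j. monom (0, var_x j)) [0..<n + 1]"
  have len_us: "length ?us = m + 1" by (simp add: monlist_length)
  have gs: "peval (?gs ! k) (be t) (ga t) = ga t k" if "k < n + 1" for k t
    using that by (simp del: upt_Suc)
  interpret es: eigen_step eig ce \<rho> r m n 1 1 1 0 T N be ga "h2a \<rho>" ?gs
  proof
    show "eig_ok eig ce" by fact
    show "dim_row N = r" "dim_col N = length ?ms" unfolding monlist_11_length by (simp_all add: N_def)
    show "N $$ (i, q) = (\<Sum>t<r. T i t * meval (?ms ! q) (be t) (ga t))" if "i < r" "q < length ?ms" for i q
    proof -
      have q: "q < K" using that(2) unfolding monlist_11_length .
      show ?thesis unfolding T(2)[OF that(1) q] meval_monlist_11[OF q] ..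
    qed
    show "det (mat r r (\<lambda>(i, t). T i t)) \<noteq> 0" by fact
    show "0 < length ?us" using len_us by simp
    show "\<forall>t<r. b t = 0"
      if b: "\<And>c. c < length ?us \<Longrightarrow> (\<Sum>t<r. b t * meval (?us ! c) (be t) (ga t)) = 0" for b
    proof (rule be_ind[OF r])
      fix k assume "k \<le> m"
      then have "(var_x k, 0) \<in> set ?us" by (simp add: monlist_set var_x_def)
      then obtain c where "c < length ?us" "?us ! c = (var_x k, 0)" by (auto simp: in_set_conv_nth)
      then show "(\<Sum>t<r. b t * be t k) = 0" using b[of c] by simp
    qed
    show "h2a \<rho> \<in> S_comp m n (1 - 1) (1 - 0)" using poly_of_S_comp by (simp add: h2a_def)
    show "set ?gs \<subseteq> S_comp m n (1 - 1) (1 - 0)"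
    proof
      fix f assume "f \<in> set ?gs"
      then obtain c where c: "c \<in> set [0..<n + 1]" "f = monom (0, var_x c)" by (auto simp del: upt_Suc)
      then have "c \<le> n" by auto
      then show "f \<in> S_comp m n (1 - 1) (1 - 0)" using var_S_comp(2)[of c] c(2) by simp
    qed
    show "peval (h2a \<rho>) (be t) (ga t) \<noteq> 0" if "t < r" for t using \<rho> that by (simp add: good_rand_2a_def)
    have "(\<lambda>t. \<Sum>k<length ?gs. \<rho> (RMix k) * (peval (?gs ! k) (be t) (ga t) / peval (h2a \<rho>) (be t) (ga t))) =
        (\<lambda>t. \<Sum>k<n + 1. \<rho> (RMix k) * (ga t k / peval (h2a \<rho>) (be t) (ga t)))"
      by (intro ext sum.cong) (auto simp: gs simp del: upt_Suc)
    then show "inj_on (\<lambda>t. \<Sum>k<length ?gs. \<rho> (RMix k) *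
        (peval (?gs ! k) (be t) (ga t) / peval (h2a \<rho>) (be t) (ga t))) {..<r}"
      using \<rho> by (simp only: good_rand_2a_def)
  qed auto
  obtain \<sigma> where \<sigma>: "bij_betw \<sigma> {..<r} {..<r}" and joint: "fst (joint_eigenvaluesT eig \<rho> r es.js es.N0 es.Ns) =
      map (\<lambda>i. vec (length ?gs) (\<lambda>k. peval (?gs ! k) (be (\<sigma> i)) (ga (\<sigma> i)) / peval (h2a \<rho>) (be (\<sigma> i)) (ga (\<sigma> i)))) [0..<r]"
    using es.joint by blast
  define \<gamma>s where "\<gamma>s = fst (joint_eigenvaluesT eig \<rho> r es.js es.N0 es.Ns)"
  let ?S = "\<lambda>\<gamma>. solve_yT n m (map (swap_coeffs m n) F) \<gamma>"
  define ps where "ps = map (\<lambda>\<gamma>. (fst (?S \<gamma>), \<gamma>)) \<gamma>s"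
  have Ns: "map (\<lambda>j. fst (mult_mapT N ?ms (monom (0, var_x j)) ?us)) [0..<n + 1] = es.Ns"
    unfolding es.Ns_def map_map comp_def ..
  have ne: "\<not> (length es.js \<noteq> r)" using es.pivots(1) by simp
  have "fst (step_2aT eig \<rho> m n r F N) = Some ps"
    unfolding step_2aT_def Let_def if_P[OF r] bindT_simps h2a_def[symmetric] es.N0_def[symmetric]
      es.js_def[symmetric] if_not_P[OF ne] ret_simps fst_mapT Ns \<gamma>s_def[symmetric] ps_def ..
  moreover have \<gamma>: "\<gamma>s ! i = vec (n + 1) (\<lambda>c. 1 / peval (h2a \<rho>) (be (\<sigma> i)) (ga (\<sigma> i)) * ga (\<sigma> i) c)"
    if "i < r" for i
    unfolding \<gamma>s_def joint using that by (auto simp: gs simp del: upt_Suc intro!: eq_vecI)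
  have len: "length \<gamma>s = r" unfolding \<gamma>s_def joint by simp
  have "points ps" unfolding points_def
  proof (intro conjI exI[of _ \<sigma>] allI impI \<sigma>)
    show "length ps = r" by (simp add: ps_def len)
    fix i assume i: "i < r"
    then have s: "\<sigma> i < r" using \<sigma> by (auto simp: bij_betw_def)
    let ?b = "1 / peval (h2a \<rho>) (be (\<sigma> i)) (ga (\<sigma> i))"
    have b: "?b \<noteq> 0" using s \<rho> by (simp add: good_rand_2a_def)
    obtain a where "a \<noteq> 0" "fst (?S (\<gamma>s ! i)) = vec (m + 1) (\<lambda>k. a * be (\<sigma> i) k)"
      unfolding \<gamma>[OF i] using solve_be[OF s b] by blast
    then show "\<exists>a b. a \<noteq> 0 \<and> b \<noteq> 0 \<and>
        ps ! i = (vec (m + 1) (\<lambda>k. a * be (\<sigma> i) k), vec (n + 1) (\<lambda>c. b * ga (\<sigma> i) c))"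
      using b i by (intro exI[of _ a] exI[of _ ?b]) (simp add: ps_def len \<gamma>)
  qed
  ultimately show "\<exists>ps. fst (step_2aT eig \<rho> m n r F N) = Some ps \<and> points ps" by blast
  let ?Ns = "mapT (\<lambda>j. mult_mapT N ?ms (monom (0, var_x j)) ?us) [0..<n + 1]"
  let ?ps = "mapT (\<lambda>\<gamma>. do { \<beta> \<leftarrow> ?S \<gamma>; ret (\<beta>, \<gamma>) }) \<gamma>s"
  have mm: "snd (mult_mapT N ?ms g ?us) \<le> r * (m + 1) * (K * 2)" for g
    using mult_mapT_snd[of N ?ms g ?us] unfolding len_us monlist_11_length es.N .
  have t2: "snd (qr_pivotsT r es.N0) \<le> r * ((m + 1) * (7 * r + 1) + r + 2)"
    using qr_pivotsT_snd[of r es.N0] unfolding es.N0_def mult_mapT_dims len_us es.N .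
  have t3: "snd ?Ns \<le> length [0..<n + 1] * (r * (m + 1) * (K * 2))"
    by (rule snd_mapT_le) (rule mm)
  have t4: "snd (joint_eigenvaluesT eig \<rho> r es.js es.N0 es.Ns) \<le> (n + 1 + 1) * (ce + 20) * r ^ 3"
    using es.joint_snd by (simp del: upt_Suc add_Suc_right)
  have t5: "snd ?ps \<le> length \<gamma>s * solve_bound n m"
    by (rule snd_mapT_le) (use solve_yT_snd[of n m "map (swap_coeffs m n) F"] in \<open>simp add: solve_bound_def\<close>)
  have "snd (step_2aT eig \<rho> m n r F N) = snd (mult_mapT N ?ms (h2a \<rho>) ?us) + (snd (qr_pivotsT r es.N0) +
      (snd ?Ns + (snd (joint_eigenvaluesT eig \<rho> r es.js es.N0 es.Ns) + (snd ?ps + 0))))"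
    unfolding step_2aT_def Let_def if_P[OF r] bindT_simps h2a_def[symmetric] es.N0_def[symmetric]
      es.js_def[symmetric] if_not_P[OF ne] ret_simps fst_mapT Ns \<gamma>s_def[symmetric] ..
  also have "\<dots> \<le> r * (m + 1) * (K * 2) + (r * ((m + 1) * (7 * r + 1) + r + 2) +
      ((n + 1) * (r * (m + 1) * (K * 2)) + ((n + 1 + 1) * (ce + 20) * r ^ 3 + r * solve_bound n m)))"
    using mm[of "h2a \<rho>"] t2 t3 t4 t5 unfolding len by (simp only: length_upt diff_zero; linarith)
  finally show "snd (step_2aT eig \<rho> m n r F N) \<le> r * (m + 1) * (K * 2) + (r * ((m + 1) * (7 * r + 1) + r + 2) +
      ((n + 1) * (r * (m + 1) * (K * 2)) + ((n + 1 + 1) * (ce + 20) * r ^ 3 + r * solve_bound n m)))" .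
qed

end

section \<open>Step (2b): the left null space of the resultant map\<close>

context good
begin

definition "h2b \<rho> = poly_of (monlist m n (d - 1) 0) (\<lambda>c. \<rho> (RH0 c))"
definition "k2b \<rho> = poly_of (monlist m n (d - 2) 0) (\<lambda>c. \<rho> (RH c))"

definition good_rand_2b :: "rand \<Rightarrow> bool" where
  "good_rand_2b \<rho> \<longleftrightarrow> (\<forall>t<r. peval (h2b \<rho>) (be t) (ga t) \<noteq> 0) \<and> (\<forall>t<r. peval (k2b \<rho>) (be t) (ga t) \<noteq> 0) \<and>
    inj_on (\<lambda>t. \<Sum>k<m + 1. \<rho> (RMix k) *
      (be t k * peval (k2b \<rho>) (be t) (ga t) / peval (h2b \<rho>) (be t) (ga t))) {..<r}"

definition "KL = fst (kernelT (transpose_mat (resultant_map m n d 1 F)))"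

text \<open>The matrix contains only the monomial multiples of the computed basis \<open>F\<close>;
  as \<open>F\<close> spans \<open>FF\<close>, the null vector annihilates the whole degree (d,1)
  part of the ideal.\<close>

lemma kerv_resultant_mult_span:
  assumes u: "kerv (transpose_mat (resultant_map m n d 1 F)) u" and f: "f \<in> mult_span m n d FF"
  shows "(\<Sum>q<length (monlist m n d 1). lookup f (monlist m n d 1 ! q) * u q) = 0"
proof -
  let ?ms = "monlist m n d 1"
  let ?\<phi> = "\<lambda>f. \<Sum>q<length ?ms. lookup f (?ms ! q) * u q"
  have sub: "bp.subspace {f. ?\<phi> f = 0}"
    by (auto simp: bp.subspace_def lookup_add distrib_right sum.distrib mult.assoc simp flip: sum_distrib_left)
  have "monom k * g \<in> {f. ?\<phi> f = 0}" if k: "k \<in> set (monlist m n (d - 1) 0)" and g: "g \<in> FF" for k g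
  proof -
    have gS: "g \<in> S_comp m n 1 1" using g by (simp add: points_span_def)
    let ?v = "\<lambda>q. lookup g (monlist m n 1 1 ! q)"
    have "(\<Sum>j<K. Ev t j * ?v j) = 0" if "t < r" for t
      using g that unfolding peval_Ev[OF gS, symmetric] by (simp add: points_span_def)
    from F_span[of ?v, OF this] obtain c where c: "\<forall>j<K. ?v j = (\<Sum>t<length F. c t * F ! t $ j)" ..
    let ?P = "\<lambda>t. poly_of (monlist m n 1 1) (\<lambda>c. F ! t $ c)"
    have single_sum: "single k (\<Sum>t\<in>I. a t) = (\<Sum>t\<in>I. single k (a t))" for k I and a :: "nat \<Rightarrow> complex"
      by (induction I rule: infinite_finite_induct) (auto simp: single_add)
    have "g = poly_of (monlist m n 1 1) ?v" by (rule poly_of_lookup[OF gS, symmetric])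
    also have "\<dots> = (\<Sum>q<K. \<Sum>t<length F. pscale (c t) (single (monlist m n 1 1 ! q) (F ! t $ q)))"
      unfolding poly_of_def monlist_11_length using c
      by (intro sum.cong) (simp_all add: single_sum pscale_single)
    also have "\<dots> = (\<Sum>t<length F. pscale (c t) (?P t))"
      unfolding poly_of_def monlist_11_length bp.scale_sum_right by (rule sum.swap)
    finally have "monom k * g = (\<Sum>t<length F. pscale (c t) (monom k * ?P t))"
      by (simp only: sum_distrib_left pscale_mult)
    also have "\<dots> \<in> {f. ?\<phi> f = 0}"
    proof (intro bp.subspace_sum[OF sub] bp.subspace_scale[OF sub])
      fix t assume "t \<in> {..<length F}"
      then have "F ! t \<in> set F" by simp
      then show "monom k * ?P t \<in> {f. ?\<phi> f = 0}"
        using u k unfolding kerv_resultant_map by simp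
    qed
    finally show ?thesis .
  qed
  then have "mult_span m n d FF \<subseteq> {f. ?\<phi> f = 0}"
    unfolding mult_span_def by (intro bp.span_minimal sub) blast
  then show ?thesis using f by blast
qed

text \<open>The null space annihilates the degree (d,1) part of the ideal, which by
  \<open>van\<close> is everything vanishing at the points. Conversely each evaluation lies in the
  null space, hence in the span of \<open>KL\<close>. So both families have the same kernel and
  \<open>same_kernel_rows\<close> applies.\<close>

lemma KL_rank: "length KL = r"
  and KL_factor: "\<exists>T. det (mat r r (\<lambda>(i, t). T i t)) \<noteq> 0 \<and>
    (\<forall>i<r. \<forall>q<length (monlist m n d 1). KL ! i $ q = (\<Sum>t<r. T i t * meval (monlist m n d 1 ! q) (be t) (ga t)))"
proof -
  let ?ms = "monlist m n d 1" and ?Q = "transpose_mat (resultant_map m n d 1 F)"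
  let ?M = "length ?ms"
  have dimQ: "dim_col ?Q = ?M" by (simp add: resultant_map_def Let_def)
  note KL = kernelT_basis[where A = ?Q, folded KL_def, unfolded dimQ]
  have KLz: "kerv ?Q (vec_index (KL ! i))" if "i < length KL" for i
    using KL(1)[OF nth_mem[OF that]] by simp
  obtain H where H: "\<And>t. t < r \<Longrightarrow> H t \<in> S_comp m n d 1"
    "\<And>s t. s < r \<Longrightarrow> t < r \<Longrightarrow> peval (H s) (be t) (ga t) = of_bool (s = t)"
    using dual_exists by blast
  have "length KL = r \<and> (\<exists>T. det (mat r r (\<lambda>(i, t). T i t)) \<noteq> 0 \<and>
    (\<forall>i<r. \<forall>q<?M. KL ! i $ q = (\<Sum>t<r. T i t * meval (?ms ! q) (be t) (ga t))))"
  proof (rule same_kernel_rows[where g = "\<lambda>s q. lookup (H s) (?ms ! q)"])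
    show "(\<Sum>q<?M. meval (?ms ! q) (be t) (ga t) * lookup (H s) (?ms ! q)) = of_bool (s = t)"
      if "s < r" "t < r" for s t
      using H(2)[OF that] unfolding peval_S_comp[OF H(1)[OF that(1)]] by (simp only: mult.commute)
    show "(\<Sum>q<?M. KL ! i $ q * v q) = 0"
      if v: "\<And>t. t < r \<Longrightarrow> (\<Sum>q<?M. meval (?ms ! q) (be t) (ga t) * v q) = 0" and i: "i < length KL" for v i
    proof -
      have "poly_of ?ms v \<in> mult_span m n d FF"
      proof (rule van[OF poly_of_S_comp])
        show "peval (poly_of ?ms v) (be t) (ga t) = 0" if "t < r" for t
          unfolding peval_poly_of using v[OF that] by (simp only: mult.commute)
      qed
      from kerv_resultant_mult_span[OF KLz[OF i] this]
      have "(\<Sum>q<?M. lookup (poly_of ?ms v) (?ms ! q) * KL ! i $ q) = 0" .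
      moreover have "(\<Sum>q<?M. lookup (poly_of ?ms v) (?ms ! q) * KL ! i $ q) = (\<Sum>q<?M. KL ! i $ q * v q)"
        by (intro sum.cong refl) (simp add: lookup_poly_of monlist_distinct)
      ultimately show ?thesis by simp
    qed
    show "(\<Sum>q<?M. meval (?ms ! q) (be t) (ga t) * v q) = 0"
      if v: "\<And>i. i < length KL \<Longrightarrow> (\<Sum>q<?M. KL ! i $ q * v q) = 0" and t: "t < r" for v t
    proof -
      have "kerv ?Q (\<lambda>q. meval (?ms ! q) (be t) (ga t))"
        unfolding kerv_resultant_map
      proof (intro ballI)
        fix k f assume k: "k \<in> set (monlist m n (d - 1) (1 - 1))" and f: "f \<in> set F"
        let ?p = "poly_of (monlist m n 1 1) (\<lambda>c. f $ c)"
        have p0: "peval ?p (be t) (ga t) = 0"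
        proof -
          have "peval ?p (be t) (ga t) = (\<Sum>j<K. Ev t j * f $ j)"
            unfolding peval_poly_of monlist_11_length
            by (intro sum.cong refl) (simp only: meval_monlist_11 lessThan_iff mult.commute)
          then show ?thesis using F_zero[OF f] t by simp
        qed
        have "monom k * ?p \<in> S_comp m n (d - 1 + 1) (0 + 1)"
          using k by (intro S_comp_mult monom_S_comp poly_of_S_comp) simp
        then have kp: "monom k * ?p \<in> S_comp m n d 1" using d by simp
        have "(\<Sum>q<?M. lookup (monom k * ?p) (?ms ! q) * meval (?ms ! q) (be t) (ga t)) = peval (monom k * ?p) (be t) (ga t)"
          by (rule peval_S_comp[OF kp, symmetric])
        then show "(\<Sum>q<?M. lookup (monom k * ?p) (?ms ! q) * meval (?ms ! q) (be t) (ga t)) = 0"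
          by (simp only: peval_mult p0 mult_zero_right)
      qed
      then obtain c where c: "\<forall>q<?M. meval (?ms ! q) (be t) (ga t) = (\<Sum>i<length KL. c i * KL ! i $ q)"
        using KL(2) by blast
      have "(\<Sum>q<?M. meval (?ms ! q) (be t) (ga t) * v q) = (\<Sum>q<?M. \<Sum>i<length KL. c i * (KL ! i $ q * v q))"
        using c by (intro sum.cong) (auto simp: sum_distrib_right mult.assoc)
      also have "\<dots> = (\<Sum>i<length KL. c i * (\<Sum>q<?M. KL ! i $ q * v q))"
        by (subst sum.swap) (simp only: sum_distrib_left)
      finally show ?thesis using v by simp
    qed
    show "\<forall>i<length KL. u i = 0" if "\<And>q. q < ?M \<Longrightarrow> (\<Sum>i<length KL. u i * KL ! i $ q) = 0" for u
      by (rule KL(3)[OF that])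
  qed
  then show "length KL = r" "\<exists>T. det (mat r r (\<lambda>(i, t). T i t)) \<noteq> 0 \<and>
    (\<forall>i<r. \<forall>q<?M. KL ! i $ q = (\<Sum>t<r. T i t * meval (?ms ! q) (be t) (ga t)))" by auto
qed

definition bound_2b :: "nat \<Rightarrow> nat" where
  "bound_2b ce = (let M = length (monlist m n d 1); s = length (monlist m n (d - 1) 0) * length F in
     (M * (s * (3 * M + 1)) + M * M) + (r * K * (M * 2) + (r * (K * (7 * r + 1) + r + 2) +
      ((m + 1) * (r * K * (M * 2)) + ((m + 1 + 1) * (ce + 20) * r ^ 3 + r * solve_bound m n)))))"

text \<open>The joint eigenvalues at a point are the coordinates of its \<beta>, scaled by the
  quotient of the values of h and \<open>h0\<close>. This is why h must not vanish at the points
  either.\<close>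

lemma step_2bT_good:
  assumes eig: "eig_ok eig ce" and \<rho>: "good_rand_2b \<rho>"
  shows "\<exists>ps. fst (step_2bT eig \<rho> m n d 1 r F) = Some ps \<and> points ps"
    and "snd (step_2bT eig \<rho> m n d 1 r F) \<le> bound_2b ce"
proof -
  let ?us = "monlist m n 1 1" and ?ms = "monlist m n d 1" and ?Q = "transpose_mat (resultant_map m n d 1 F)"
  let ?M = "length ?ms"
  obtain T where T: "det (mat r r (\<lambda>(i, t). T i t)) \<noteq> 0"
    "\<And>i q. i < r \<Longrightarrow> q < ?M \<Longrightarrow> KL ! i $ q = (\<Sum>t<r. T i t * meval (?ms ! q) (be t) (ga t))"
    using KL_factor by blast
  define N' where "N' = mat_of_rows ?M KL"
  let ?gs = "map (\<lambda>k. monom (var_x k, 0) * k2b \<rho>) [0..<m + 1]"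
  have gs: "peval (?gs ! k) (be t) (ga t) = be t k * peval (k2b \<rho>) (be t) (ga t)" if "k < m + 1" for k t
    using that by (simp del: upt_Suc)
  interpret es: eigen_step eig ce \<rho> r m n d 1 1 1 T N' be ga "h2b \<rho>" ?gs
  proof
    show "eig_ok eig ce" by fact
    show "dim_row N' = r" "dim_col N' = ?M" by (simp_all add: N'_def KL_rank)
    have dimQ: "dim_col ?Q = ?M" by (simp add: resultant_map_def Let_def)
    show "N' $$ (i, q) = (\<Sum>t<r. T i t * meval (?ms ! q) (be t) (ga t))" if "i < r" "q < ?M" for i q
      using T(2)[OF that] that by (simp add: N'_def mat_of_rows_def KL_rank)
    show "det (mat r r (\<lambda>(i, t). T i t)) \<noteq> 0" by fact
    show "0 < length ?us" unfolding monlist_11_length by simp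
    show "\<forall>t<r. b t = 0"
      if b: "\<And>c. c < length ?us \<Longrightarrow> (\<Sum>t<r. b t * meval (?us ! c) (be t) (ga t)) = 0" for b
    \<comment> \<open>Pairing a relation among the evaluations with the dual form \<open>G s\<close>
      isolates its coefficient \<open>b s\<close>.\<close>
    proof (intro allI impI)
      fix s assume s: "s < r"
      have "(\<Sum>t<r. b t * peval (G s) (be t) (ga t)) =
          (\<Sum>t<r. \<Sum>c<length ?us. lookup (G s) (?us ! c) * (b t * meval (?us ! c) (be t) (ga t)))"
        unfolding peval_S_comp[OF G(1)[OF s]] sum_distrib_left by (simp only: mult.left_commute)
      also have "\<dots> = (\<Sum>c<length ?us. lookup (G s) (?us ! c) * (\<Sum>t<r. b t * meval (?us ! c) (be t) (ga t)))"
        by (subst sum.swap) (simp only: sum_distrib_left)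
      also have "\<dots> = 0" using b by (intro sum.neutral ballI) simp
      also have "(\<Sum>t<r. b t * peval (G s) (be t) (ga t)) = (\<Sum>t<r. if t = s then b s else 0)"
        using s by (intro sum.cong) (auto simp: G)
      finally show "b s = 0" using s by simp
    qed
    show "1 \<le> d" using d by simp
    show "h2b \<rho> \<in> S_comp m n (d - 1) (1 - 1)" using poly_of_S_comp by (simp add: h2b_def)
    show "set ?gs \<subseteq> S_comp m n (d - 1) (1 - 1)"
    proof
      fix f assume "f \<in> set ?gs"
      then obtain k where k: "k \<in> set [0..<m + 1]" "f = monom (var_x k, 0) * k2b \<rho>" by (auto simp del: upt_Suc)
      then have "k \<le> m" by auto
      then have "f \<in> S_comp m n (1 + (d - 2)) (0 + 0)" unfolding k(2) k2b_def
        by (intro S_comp_mult var_S_comp poly_of_S_comp)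
      moreover have "1 + (d - 2) = d - 1" "0 + 0 = 1 - (1 :: nat)" using d by simp_all
      ultimately show "f \<in> S_comp m n (d - 1) (1 - 1)" by (simp only:)
    qed
    show "peval (h2b \<rho>) (be t) (ga t) \<noteq> 0" if "t < r" for t using \<rho> that by (simp add: good_rand_2b_def)
    have "(\<lambda>t. \<Sum>k<length ?gs. \<rho> (RMix k) * (peval (?gs ! k) (be t) (ga t) / peval (h2b \<rho>) (be t) (ga t))) =
        (\<lambda>t. \<Sum>k<m + 1. \<rho> (RMix k) * (be t k * peval (k2b \<rho>) (be t) (ga t) / peval (h2b \<rho>) (be t) (ga t)))"
      by (intro ext sum.cong) (auto simp: gs simp del: upt_Suc)
    then show "inj_on (\<lambda>t. \<Sum>k<length ?gs. \<rho> (RMix k) *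
        (peval (?gs ! k) (be t) (ga t) / peval (h2b \<rho>) (be t) (ga t))) {..<r}"
      using \<rho> by (simp only: good_rand_2b_def)
  qed auto
  obtain \<sigma> where \<sigma>: "bij_betw \<sigma> {..<r} {..<r}" and joint: "fst (joint_eigenvaluesT eig \<rho> r es.js es.N0 es.Ns) =
      map (\<lambda>i. vec (length ?gs) (\<lambda>k. peval (?gs ! k) (be (\<sigma> i)) (ga (\<sigma> i)) / peval (h2b \<rho>) (be (\<sigma> i)) (ga (\<sigma> i)))) [0..<r]"
    using es.joint by blast
  define \<beta>s where "\<beta>s = fst (joint_eigenvaluesT eig \<rho> r es.js es.N0 es.Ns)"
  let ?S = "\<lambda>\<beta>. solve_yT m n F \<beta>"
  define ps where "ps = map (\<lambda>\<beta>. (\<beta>, fst (?S \<beta>))) \<beta>s"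
  have Ns: "map (\<lambda>k. fst (mult_mapT N' ?ms (monom (var_x k, 0) * k2b \<rho>) ?us)) [0..<m + 1] = es.Ns"
    unfolding es.Ns_def map_map comp_def ..
  have e11: "(1 :: nat) - 1 = 0" by simp
  have ne: "\<not> (length es.js \<noteq> r)" using es.pivots(1) by simp
  have ne': "\<not> (length KL \<noteq> r)" using KL_rank by simp
  have "fst (step_2bT eig \<rho> m n d 1 r F) = Some ps"
    unfolding step_2bT_def Let_def bindT_simps e11 KL_def[symmetric] h2b_def[symmetric] k2b_def[symmetric]
      N'_def[symmetric] es.N0_def[symmetric] es.js_def[symmetric] fst_mapT Ns \<beta>s_def[symmetric]
      if_not_P[OF ne] if_not_P[OF ne'] ret_simps ps_def ..
  moreover have \<beta>: "\<beta>s ! i = vec (m + 1) (\<lambda>k. peval (k2b \<rho>) (be (\<sigma> i)) (ga (\<sigma> i)) / peval (h2b \<rho>) (be (\<sigma> i)) (ga (\<sigma> i)) * be (\<sigma> i) k)"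
    if "i < r" for i
    unfolding \<beta>s_def joint using that by (auto simp: gs simp del: upt_Suc intro!: eq_vecI)
  have len: "length \<beta>s = r" unfolding \<beta>s_def joint by simp
  have "points ps" unfolding points_def
  proof (intro conjI exI[of _ \<sigma>] allI impI \<sigma>)
    show "length ps = r" by (simp add: ps_def len)
    fix i assume i: "i < r"
    then have s: "\<sigma> i < r" using \<sigma> by (auto simp: bij_betw_def)
    let ?a = "peval (k2b \<rho>) (be (\<sigma> i)) (ga (\<sigma> i)) / peval (h2b \<rho>) (be (\<sigma> i)) (ga (\<sigma> i))"
    have a: "?a \<noteq> 0" using s \<rho> by (simp add: good_rand_2b_def)
    obtain b where "b \<noteq> 0" "fst (?S (\<beta>s ! i)) = vec (n + 1) (\<lambda>c. b * ga (\<sigma> i) c)"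
      unfolding \<beta>[OF i] using solve_ga[OF s a] by blast
    then show "\<exists>a b. a \<noteq> 0 \<and> b \<noteq> 0 \<and>
        ps ! i = (vec (m + 1) (\<lambda>k. a * be (\<sigma> i) k), vec (n + 1) (\<lambda>c. b * ga (\<sigma> i) c))"
      using a i by (intro exI[of _ ?a] exI[of _ b]) (simp add: ps_def len \<beta>)
  qed
  ultimately show "\<exists>ps. fst (step_2bT eig \<rho> m n d 1 r F) = Some ps \<and> points ps" by blast
  let ?Ns = "mapT (\<lambda>k. mult_mapT N' ?ms (monom (var_x k, 0) * k2b \<rho>) ?us) [0..<m + 1]"
  let ?ps = "mapT (\<lambda>\<beta>. do { \<gamma> \<leftarrow> ?S \<beta>; ret (\<beta>, \<gamma>) }) \<beta>s"
  have mm: "snd (mult_mapT N' ?ms g ?us) \<le> r * K * (?M * 2)" for g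
    using mult_mapT_snd[of N' ?ms g ?us] unfolding monlist_11_length es.N .
  have dQ: "dim_row ?Q = length (monlist m n (d - 1) 0) * length F" "dim_col ?Q = ?M"
    by (simp_all add: resultant_map_def Let_def length_product)
  have t1: "snd (kernelT ?Q) \<le> ?M * (length (monlist m n (d - 1) 0) * length F * (3 * ?M + 1)) + ?M * ?M"
    using kernelT_snd[of ?Q] unfolding dQ .
  have t2: "snd (qr_pivotsT r es.N0) \<le> r * (K * (7 * r + 1) + r + 2)"
    using qr_pivotsT_snd[of r es.N0] unfolding es.N0_def mult_mapT_dims monlist_11_length es.N .
  have t3: "snd ?Ns \<le> length [0..<m + 1] * (r * K * (?M * 2))"
    by (rule snd_mapT_le) (rule mm)
  have t4: "snd (joint_eigenvaluesT eig \<rho> r es.js es.N0 es.Ns) \<le> (m + 1 + 1) * (ce + 20) * r ^ 3"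
    using es.joint_snd by (simp del: upt_Suc add_Suc_right)
  have t5: "snd ?ps \<le> length \<beta>s * solve_bound m n"
    by (rule snd_mapT_le) (use solve_yT_snd[of m n F] in \<open>simp add: solve_bound_def\<close>)
  have "snd (step_2bT eig \<rho> m n d 1 r F) = snd (kernelT ?Q) + (snd (mult_mapT N' ?ms (h2b \<rho>) ?us) + (snd (qr_pivotsT r es.N0) +
      (snd ?Ns + (snd (joint_eigenvaluesT eig \<rho> r es.js es.N0 es.Ns) + (snd ?ps + 0)))))"
    unfolding step_2bT_def Let_def bindT_simps e11 KL_def[symmetric] h2b_def[symmetric] k2b_def[symmetric]
      N'_def[symmetric] es.N0_def[symmetric] es.js_def[symmetric] fst_mapT Ns \<beta>s_def[symmetric]
      if_not_P[OF ne] if_not_P[OF ne'] ret_simps ..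
  also have "\<dots> \<le> bound_2b ce" unfolding bound_2b_def Let_def
    using t1 mm[of "h2b \<rho>"] t2 t3 t4 t5 unfolding len by (simp only: length_upt diff_zero; linarith)
  finally show "snd (step_2bT eig \<rho> m n d 1 r F) \<le> bound_2b ce" .
qed

text \<open>The points are exact zeros, also after rescaling, because the equations are
  bihomogeneous.\<close>

lemma newtonT_points:
  assumes "points ps"
  shows "map (\<lambda>p. fst (newtonT steps m n F p)) ps = ps"
proof (rule map_idI)
  fix p assume "p \<in> set ps"
  then obtain i where i: "i < r" "p = ps ! i" using assms by (auto simp: points_def in_set_conv_nth)
  obtain \<sigma> where \<sigma>: "bij_betw \<sigma> {..<r} {..<r}" and "\<forall>i<r. \<exists>a b. a \<noteq> 0 \<and> b \<noteq> 0 \<and>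
      ps ! i = (vec (m + 1) (\<lambda>k. a * be (\<sigma> i) k), vec (n + 1) (\<lambda>c. b * ga (\<sigma> i) c))"
    using assms unfolding points_def by blast
  then obtain a b where p: "p = (vec (m + 1) (\<lambda>k. a * be (\<sigma> i) k), vec (n + 1) (\<lambda>c. b * ga (\<sigma> i) c))"
    using i by blast
  define s where "s = \<sigma> i"
  have s: "s < r" using \<sigma> i by (auto simp: bij_betw_def s_def)
  note p = p[folded s_def]
  have "fst (newton_stepT m n F p) = p" unfolding p
  proof (rule newton_stepT_zero)
    fix j assume j: "j < length F"
    have "(\<Sum>k\<le>m. (\<Sum>c\<le>n. F ! j $ (k * (n + 1) + c) * vec (n + 1) (\<lambda>c. b * ga s c) $ c) * vec (m + 1) (\<lambda>k. a * be s k) $ k)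
        = (\<Sum>q<K. evrow n (\<lambda>k. a * be s k) (\<lambda>c. b * ga s c) q * F ! j $ q)"
      unfolding evrow_sum sum_distrib_right by (intro sum.cong refl) simp
    also have "\<dots> = 0" by (rule F_at_point[OF j s])
    finally show "(\<Sum>k\<le>m. (\<Sum>c\<le>n. F ! j $ (k * (n + 1) + c) * vec (n + 1) (\<lambda>c. b * ga s c) $ c) *
        vec (m + 1) (\<lambda>k. a * be s k) $ k) = 0" .
  qed auto
  then show "fst (newtonT steps m n F p) = p" unfolding newtonT_def
    by (intro fst_foldT_invariant[where P = "\<lambda>q. q = p"]) auto
qed

definition newton_bound :: "nat \<Rightarrow> nat" where
  "newton_bound steps = steps * (100 * (length F + 2) * (m + n + 2) ^ 2 + 20 * (m + n + 2) ^ 3)"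

lemma newtonT_snd: "snd (newtonT steps m n F p) \<le> newton_bound steps"
proof -
  have "snd (newtonT steps m n F p) \<le> length [0..<steps] * (100 * (length F + 2) * (m + n + 2) ^ 2 + 20 * (m + n + 2) ^ 3)"
    unfolding newtonT_def by (rule snd_foldT_le[where P = "\<lambda>_. True"]) (intro conjI TrueI newton_stepT_snd, rule TrueI)
  then show ?thesis by (simp add: newton_bound_def)
qed

text \<open>The dual forms provide a left inverse of the matrix of Kronecker products, so the linear
  system has exactly one solution: the \<alpha>, permuted like the points and divided by their
  scalings.\<close>

lemma step_3T_points:
  assumes "points ps"
  shows "is_decomposition l m n r A (fst (step_3T m n A1 ps))"
    and "snd (step_3T m n A1 ps) \<le> K * r * 1 + r * (K * (3 * (r + (l + 1)) + 1))"
proof -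
  obtain \<sigma> where len: "length ps = r" and \<sigma>: "bij_betw \<sigma> {..<r} {..<r}"
    and "\<forall>i<r. \<exists>a b. a \<noteq> 0 \<and> b \<noteq> 0 \<and>
      ps ! i = (vec (m + 1) (\<lambda>k. a * be (\<sigma> i) k), vec (n + 1) (\<lambda>c. b * ga (\<sigma> i) c))"
    using assms by (auto simp: points_def)
  then obtain a b where ab: "\<And>i. i < r \<Longrightarrow> a i \<noteq> 0" "\<And>i. i < r \<Longrightarrow> b i \<noteq> 0"
    and ps: "\<And>i. i < r \<Longrightarrow> ps ! i = (vec (m + 1) (\<lambda>k. a i * be (\<sigma> i) k), vec (n + 1) (\<lambda>c. b i * ga (\<sigma> i) c))"
    by metis
  have s: "\<sigma> i < r" if "i < r" for i using \<sigma> that by (auto simp: bij_betw_def)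
  let ?KT = "matT K (length ps) (\<lambda>j i. mulT (fst (ps ! i) $ (j div (n + 1))) (snd (ps ! i) $ (j mod (n + 1))))"
  have KM: "fst ?KT $$ (j, i) = a i * b i * Ev (\<sigma> i) j" if "j < K" "i < r" for i j
  proof -
    have "j div (n + 1) < m + 1" using that less_mult_imp_div_less[of j "m + 1" "n + 1"] by simp
    moreover have "j mod (n + 1) < n + 1" by simp
    ultimately show ?thesis using that by (simp add: ps len evrow_def del: mult_Suc mult_Suc_right)
  qed
  have KMc: "fst ?KT \<in> carrier_mat K r" by (simp add: len)
  define X where "X = mat r (l + 1) (\<lambda>(i, i'). al (\<sigma> i) i' / (a i * b i))"
  have KX: "fst ?KT * X = transpose_mat A1"
  proof (rule eq_matI)
    fix j i assume "j < dim_row (transpose_mat A1)" "i < dim_col (transpose_mat A1)"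
    then have ji: "j < K" "i \<le> l" unfolding index_transpose_mat A1_dims by auto
    have "(fst ?KT * X) $$ (j, i) = (\<Sum>t<r. fst ?KT $$ (j, t) * X $$ (t, i))"
      using ji KMc by (simp add: scalar_prod_def lessThan_atLeast0 X_def del: mult_Suc mult_Suc_right matT_simps)
    also have "\<dots> = (\<Sum>t<r. al (\<sigma> t) i * Ev (\<sigma> t) j)"
    proof (intro sum.cong refl)
      fix t assume "t \<in> {..<r}"
      then have t: "t < r" by simp
      show "fst ?KT $$ (j, t) * X $$ (t, i) = al (\<sigma> t) i * Ev (\<sigma> t) j"
        unfolding KM[OF ji(1) t] using t ab[OF t] ji(2) by (simp add: X_def)
    qed
    also have "\<dots> = (\<Sum>t<r. al t i * Ev t j)" by (rule sum.reindex_bij_betw[OF \<sigma>])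
    also have "\<dots> = transpose_mat A1 $$ (j, i)"
      using ji flattening1_point_tensor[of i l j m n r al be ga] A1_dims unfolding A[symmetric] by simp
    finally show "(fst ?KT * X) $$ (j, i) = transpose_mat A1 $$ (j, i)" .
  qed (simp_all add: X_def A1_dims del: mult_Suc mult_Suc_right)
  \<comment> \<open>The rows are the coefficient vectors of the dual forms, divided by the scalings
    of the representatives.\<close>
  define L where "L = mat r K (\<lambda>(i, j). lookup (G (\<sigma> i)) (monlist m n 1 1 ! j) / (a i * b i))"
  have LK: "L * fst ?KT = 1\<^sub>m r"
  proof (rule eq_matI)
    fix i i' assume "i < dim_row (1\<^sub>m r :: complex mat)" "i' < dim_col (1\<^sub>m r :: complex mat)"
    then have i: "i < r" "i' < r" by auto
    have "(L * fst ?KT) $$ (i, i') = (\<Sum>j<K. L $$ (i, j) * fst ?KT $$ (j, i'))"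
      using i KMc by (simp add: scalar_prod_def lessThan_atLeast0 L_def del: mult_Suc mult_Suc_right matT_simps)
    also have "\<dots> = (\<Sum>j<K. a i' * b i' / (a i * b i) * (Ev (\<sigma> i') j * lookup (G (\<sigma> i)) (monlist m n 1 1 ! j)))"
    proof (intro sum.cong refl)
      fix j assume "j \<in> {..<K}"
      then have j: "j < K" by (simp only: lessThan_iff)
      then show "L $$ (i, j) * fst ?KT $$ (j, i') = a i' * b i' / (a i * b i) *
          (Ev (\<sigma> i') j * lookup (G (\<sigma> i)) (monlist m n 1 1 ! j))"
        unfolding KM[OF j i(2)] using i(1) by (simp add: L_def del: mult_Suc mult_Suc_right)
    qed
    also have "\<dots> = a i' * b i' / (a i * b i) * peval (G (\<sigma> i)) (be (\<sigma> i')) (ga (\<sigma> i'))"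
      unfolding sum_distrib_left[symmetric] peval_Ev[OF G(1)[OF s[OF i(1)]]] ..
    also have "\<dots> = 1\<^sub>m r $$ (i, i')"
    proof -
      have "\<sigma> i = \<sigma> i' \<longleftrightarrow> i = i'" using \<sigma> i by (auto simp: bij_betw_def inj_on_def)
      then have "peval (G (\<sigma> i)) (be (\<sigma> i')) (ga (\<sigma> i')) = of_bool (i = i')"
        unfolding G(2)[OF s[OF i(1)] s[OF i(2)]] by simp
      then show ?thesis using i ab[OF i(1)] by (cases "i = i'") auto
    qed
    finally show "(L * fst ?KT) $$ (i, i') = 1\<^sub>m r $$ (i, i')" .
  qed (simp_all add: L_def len)
  have Y: "fst (solveT (fst ?KT) (transpose_mat A1)) = X"
  proof (rule solveT_unique[OF KMc _ _ KX _ LK])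
    show "transpose_mat A1 \<in> carrier_mat K (l + 1)" using A1_dims by auto
    show "X \<in> carrier_mat r (l + 1)" by (simp add: X_def)
    show "L \<in> carrier_mat r K" by (simp add: L_def)
  qed
  define ts where "ts = map (\<lambda>i. (row X i, ps ! i)) [0..<r]"
  have ts: "fst (step_3T m n A1 ps) = ts"
    unfolding step_3T_def bindT_simps ret_simps Y len[symmetric] ts_def ..
  show "is_decomposition l m n r A (fst (step_3T m n A1 ps))" unfolding ts is_decomposition_def
  proof (intro conjI)
    show "length ts = r" by (simp add: ts_def)
    show "\<forall>(a, b, c)\<in>set ts. a \<in> carrier_vec (l + 1) \<and> b \<in> carrier_vec (m + 1) \<and> c \<in> carrier_vec (n + 1)"
      by (auto simp: ts_def ps X_def)
    have "(\<Sum>(a, b, c)\<leftarrow>ts. a $ i * b $ j * c $ k) = (\<Sum>t<r. al t i * be t j * ga t k)"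
      if "i \<le> l" "j \<le> m" "k \<le> n" for i j k
    proof -
      have "(\<Sum>(a, b, c)\<leftarrow>ts. a $ i * b $ j * c $ k) = (\<Sum>t<r. X $$ (t, i) * fst (ps ! t) $ j * snd (ps ! t) $ k)"
        using that by (simp add: ts_def sum_list_sum_nth atLeast0LessThan case_prod_beta X_def)
      also have "\<dots> = (\<Sum>t<r. al (\<sigma> t) i * be (\<sigma> t) j * ga (\<sigma> t) k)"
        using that ab by (intro sum.cong refl) (simp add: X_def ps)
      also have "\<dots> = (\<Sum>t<r. al t i * be t j * ga t k)" by (rule sum.reindex_bij_betw[OF \<sigma>])
      finally show ?thesis .
    qed
    then show "A = tensor_of l m n ts" unfolding A point_tensor_def tensor_of_def by (intro ext) auto
  qed
  have "snd ?KT \<le> K * length ps * 1" by (rule snd_matT_le) simp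
  moreover have "snd (solveT (fst ?KT) (transpose_mat A1)) \<le> r * (K * (3 * (r + (l + 1)) + 1))"
    using solveT_snd[of "fst ?KT" "transpose_mat A1"] KMc A1_dims
    by (simp del: mult_Suc mult_Suc_right matT_simps)
  ultimately show "snd (step_3T m n A1 ps) \<le> K * r * 1 + r * (K * (3 * (r + (l + 1)) + 1))"
    unfolding step_3T_def bindT_simps ret_simps len by linarith
qed

end

section \<open>The total cost\<close>

text \<open>L, X, Y stand for l + 1, m + 1, n + 1, \<open>s\<close> for the number of generators,
  \<open>w\<close> for m + n + 2, \<open>st\<close> for the number of Newton steps. Everything
  outside the steps (2a) and (2b) is quadratic in \<open>M\<close>, because \<open>X * Y\<close>,
  \<open>r * (X * Y)\<close> and \<open>X * X\<close> are at most \<open>M\<close>.\<close>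

lemma common_cost:
  fixes r s L X Y w st :: nat
  assumes "r \<le> L" "X \<le> L" "Y \<le> X" "1 \<le> Y" "s \<le> X * Y" "w \<le> 2 * X"
  defines "M \<equiv> L * X * Y"
  shows "X * Y * (L * (3 * (X * Y) + 1)) + (X * Y * (X * Y) + (r * (st * (100 * (s + 2) * w ^ 2 + 20 * w ^ 3)) +
      (X * Y * r * 1 + r * (X * Y * (3 * (r + L) + 1))))) \<le> (1400 * st + 20) * M ^ 2"
proof -
  have pos: "1 \<le> X" "1 \<le> L" using assms by auto
  have KM: "X * Y \<le> M" using pos by (simp add: M_def)
  have rK: "r * (X * Y) \<le> M" using assms(1) by (simp add: M_def mult.assoc)
  have LM: "L \<le> M" using pos assms(4) by (simp add: M_def)
  have XX: "X * X \<le> M"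
  proof -
    have "X * X * 1 \<le> L * X * Y" using assms by (intro mult_le_mono) auto
    then show ?thesis by (simp add: M_def)
  qed
  have 1: "X * Y * (L * (3 * (X * Y) + 1)) \<le> 4 * (M * M)"
  proof -
    have "X * Y * (L * (3 * (X * Y) + 1)) = M * (3 * (X * Y) + 1)" by (simp only: M_def mult_ac)
    also have "\<dots> \<le> M * (3 * M + M)" using KM LM pos by (intro mult_le_mono2) linarith
    finally show ?thesis by simp
  qed
  have 2: "X * Y * (X * Y) \<le> M * M" using KM by (intro mult_le_mono)
  have 3: "r * (st * (100 * (s + 2) * w ^ 2 + 20 * w ^ 3)) \<le> 1360 * st * (M * M)"
  proof -
    have s2: "s + 2 \<le> 3 * (X * Y)"
    proof -
      have "1 * 1 \<le> X * Y" using pos assms(4) by (intro mult_le_mono) auto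
      then show ?thesis using assms(5) by linarith
    qed
    have w2: "w ^ 2 \<le> 4 * (X * X)"
    proof -
      have "w ^ 2 \<le> (2 * X) ^ 2" using assms(6) by (intro power_mono) auto
      then show ?thesis by (simp add: power2_eq_square)
    qed
    have w3: "w ^ 3 \<le> 8 * (X * X * X)"
    proof -
      have "w ^ 3 \<le> (2 * X) ^ 3" using assms(6) by (intro power_mono) auto
      then show ?thesis by (simp add: power3_eq_cube)
    qed
    have "(s + 2) * w ^ 2 \<le> (3 * (X * Y)) * (4 * (X * X))" using s2 w2 by (rule mult_le_mono)
    then have "r * ((s + 2) * w ^ 2) \<le> r * ((3 * (X * Y)) * (4 * (X * X)))" by (rule mult_le_mono2)
    also have "\<dots> = 12 * ((r * (X * Y)) * (X * X))" by (simp add: mult_ac)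
    also have "\<dots> \<le> 12 * (M * M)" using mult_le_mono[OF rK XX] by simp
    finally have a: "r * ((s + 2) * w ^ 2) \<le> 12 * (M * M)" .
    have rX: "r * X \<le> M"
    proof -
      have "r * X * 1 \<le> L * X * Y" using assms by (intro mult_le_mono) auto
      then show ?thesis by (simp add: M_def)
    qed
    have "r * w ^ 3 \<le> r * (8 * (X * X * X))" using w3 by (rule mult_le_mono2)
    also have "\<dots> = 8 * ((r * X) * (X * X))" by (simp add: mult_ac)
    also have "\<dots> \<le> 8 * (M * M)" using mult_le_mono[OF rX XX] by simp
    finally have b: "r * w ^ 3 \<le> 8 * (M * M)" .
    have "r * (st * (100 * (s + 2) * w ^ 2 + 20 * w ^ 3)) = st * (100 * (r * ((s + 2) * w ^ 2)) + 20 * (r * w ^ 3))"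
      by (simp only: distrib_left mult_ac)
    also have "\<dots> \<le> st * (100 * (12 * (M * M)) + 20 * (8 * (M * M)))"
      using a b by (intro mult_le_mono2 add_mono) auto
    also have "\<dots> = 1360 * st * (M * M)" by simp
    finally show ?thesis .
  qed
  have 4: "X * Y * r * 1 \<le> M * M"
  proof -
    have "1 \<le> M" using LM pos by simp
    then have "r * (X * Y) * 1 \<le> M * M" using rK by (intro mult_le_mono)
    then show ?thesis by (simp add: mult_ac)
  qed
  have 5: "r * (X * Y * (3 * (r + L) + 1)) \<le> 7 * (M * M)"
  proof -
    have "3 * (r + L) + 1 = 3 * r + 3 * L + 1" by simp
    then have "3 * (r + L) + 1 \<le> 7 * L" using assms(1) pos(2) by linarith
    then have "3 * (r + L) + 1 \<le> 7 * M" using LM by linarith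
    then have "(r * (X * Y)) * (3 * (r + L) + 1) \<le> M * (7 * M)" using rK by (intro mult_le_mono)
    then show ?thesis by (simp only: mult.assoc mult.left_commute[of M 7])
  qed
  have "X * Y * (L * (3 * (X * Y) + 1)) + (X * Y * (X * Y) + (r * (st * (100 * (s + 2) * w ^ 2 + 20 * w ^ 3)) +
      (X * Y * r * 1 + r * (X * Y * (3 * (r + L) + 1))))) \<le> 4 * (M * M) + (M * M + (1360 * st * (M * M) + (M * M + 7 * (M * M))))"
    using 1 2 3 4 5 by (intro add_mono)
  also have "\<dots> = (1360 * st + 13) * (M * M)" by (simp add: algebra_simps)
  also have "\<dots> \<le> (1400 * st + 20) * (M * M)" by (intro mult_le_mono1) simp
  finally show ?thesis by (simp only: power2_eq_square)
qed

text \<open>Letters as in \<open>common_cost\<close>. The condition \<open>r \<le> X\<close> of this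
  step keeps even the cubic eigenvalue term quadratic in \<open>M\<close>.\<close>

lemma cost_2a:
  fixes r s L X Y ce :: nat
  assumes "r \<le> L" "r \<le> X" "X \<le> L" "Y \<le> X" "1 \<le> Y" "s \<le> X * Y"
  defines "M \<equiv> L * X * Y"
  shows "r * X * (X * Y * 2) + (r * (X * (7 * r + 1) + r + 2) +
      (Y * (r * X * (X * Y * 2)) + ((Y + 1) * (ce + 20) * r ^ 3 + r * (s * X * (Y * 2) +
      (X * (s * (3 * X + 1)) + X * X))))) \<le> (2 * ce + 100) * M ^ 2"
proof -
  have pos: "1 \<le> X" "1 \<le> L" using assms by auto
  have KM: "X * Y \<le> M" using pos by (simp add: M_def)
  have rK: "r * (X * Y) \<le> M" using assms(1) by (simp add: M_def mult.assoc)
  have XX: "X * X \<le> M"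
  proof -
    have "X * X * 1 \<le> L * X * Y" using assms by (intro mult_le_mono) auto
    then show ?thesis by (simp add: M_def)
  qed
  have XM: "X \<le> M" using XX pos by (meson le_square order_trans)
  have rM: "r \<le> M" using XM assms(2) by simp
  have 1: "r * X * (X * Y * 2) \<le> 2 * (M * M)"
    using mult_le_mono[OF rK XM] by (simp add: mult_ac)
  have 2: "r * (X * (7 * r + 1) + r + 2) \<le> 11 * (M * M)"
  proof -
    have "X * (7 * r + 1) + r + 2 \<le> X * (7 * X + X) + X * X + 2 * (X * X)"
      using assms(2) pos by (intro add_mono mult_le_mono) (auto intro: order_trans[OF assms(2) le_square])
    also have "\<dots> = 11 * (X * X)" by (simp add: algebra_simps)
    also have "\<dots> \<le> 11 * M" using XX by simp
    finally have "r * (X * (7 * r + 1) + r + 2) \<le> M * (11 * M)" using rM by (intro mult_le_mono)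
    then show ?thesis by simp
  qed
  have 3: "Y * (r * X * (X * Y * 2)) \<le> 2 * (M * M)"
    using mult_le_mono[OF rK KM] by (simp add: mult_ac)
  have 4: "(Y + 1) * (ce + 20) * r ^ 3 \<le> (2 * ce + 40) * (M * M)"
  proof -
    have "Y * r ^ 3 = r * (r * Y) * r" by (simp add: power3_eq_cube mult_ac)
    also have "\<dots> \<le> L * (X * Y) * X" using assms by (intro mult_le_mono) auto
    also have "\<dots> = M * X" by (simp add: M_def mult_ac)
    also have "\<dots> \<le> M * M" using XM by simp
    finally have a: "Y * r ^ 3 \<le> M * M" .
    have "(Y + 1) * (ce + 20) * r ^ 3 \<le> (2 * Y) * (ce + 20) * r ^ 3"
      using assms(5) by (intro mult_le_mono1) simp
    also have "\<dots> = (2 * ce + 40) * (Y * r ^ 3)" by (simp add: algebra_simps)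
    also have "\<dots> \<le> (2 * ce + 40) * (M * M)" using a by (rule mult_le_mono2)
    finally show ?thesis .
  qed
  have 5: "r * (s * X * (Y * 2) + (X * (s * (3 * X + 1)) + X * X)) \<le> 7 * (M * M)"
  proof -
    have rs: "r * s \<le> M" using mult_le_mono2[OF assms(6), of r] rK by linarith
    have a: "(r * s) * (X * Y) \<le> M * M" using rs KM by (rule mult_le_mono)
    have "X * (3 * X + 1) \<le> X * (4 * X)" using pos by (intro mult_le_mono2) simp
    also have "\<dots> \<le> 4 * M" using XX by simp
    finally have "X * (3 * X + 1) \<le> 4 * M" .
    with rs have b: "(r * s) * (X * (3 * X + 1)) \<le> M * (4 * M)" by (rule mult_le_mono)
    have c: "r * (X * X) \<le> M * M" using rM XX by (rule mult_le_mono)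
    have "r * (s * X * (Y * 2) + (X * (s * (3 * X + 1)) + X * X)) =
        2 * ((r * s) * (X * Y)) + ((r * s) * (X * (3 * X + 1)) + r * (X * X))"
      by (simp only: distrib_left mult_ac)
    then show ?thesis using a b c by linarith
  qed
  have "r * X * (X * Y * 2) + (r * (X * (7 * r + 1) + r + 2) +
      (Y * (r * X * (X * Y * 2)) + ((Y + 1) * (ce + 20) * r ^ 3 + r * (s * X * (Y * 2) +
      (X * (s * (3 * X + 1)) + X * X))))) \<le>
      2 * (M * M) + (11 * (M * M) + (2 * (M * M) + ((2 * ce + 40) * (M * M) + 7 * (M * M))))"
    using 1 2 3 4 5 by (intro add_mono)
  also have "\<dots> = (2 * ce + 62) * (M * M)" by (simp add: algebra_simps)
  also have "\<dots> \<le> (2 * ce + 100) * (M * M)" by (intro mult_le_mono1) simp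
  finally show ?thesis by (simp only: power2_eq_square)
qed

text \<open>X and Y stand for m + 1 and n + 1, \<open>H\<close> and \<open>S\<close> for the numbers
  of rows and columns of the resultant map; \<open>P\<close> bounds all sizes. The fourth power
  comes from the m + 1 multiplication maps and the eigenvalue computations, while the elimination is
  only cubic.\<close>

lemma cost_2b:
  fixes r s X Y H S P ce :: nat
  assumes "r \<le> P" "X * Y \<le> P" "1 \<le> X" "1 \<le> Y" "s \<le> X * Y" "H \<le> P" "S \<le> P"
  shows "(H * (S * (3 * H + 1)) + H * H) + (r * (X * Y) * (H * 2) + (r * (X * Y * (7 * r + 1) + r + 2) +
      (X * (r * (X * Y) * (H * 2)) + ((X + 1) * (ce + 20) * r ^ 3 + r * (s * Y * (X * 2) +
      (Y * (s * (3 * Y + 1)) + Y * Y)))))) \<le> (2 * ce + 100) * P ^ 4"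
proof -
  let ?P2 = "P * P" and ?P3 = "P * P * P" and ?P4 = "P * P * P * P"
  have "1 * 1 \<le> X * Y" using assms by (intro mult_le_mono) auto
  then have P1: "1 \<le> P" using assms(2) by linarith
  have XP: "X \<le> P" and YP: "Y \<le> P"
    using assms by (metis mult.right_neutral mult_le_mono2 order_trans, metis mult.left_neutral mult_le_mono1 order_trans)
  have sP: "s \<le> P" using assms by linarith
  have P34: "?P3 \<le> ?P4" using P1 by simp
  have P24: "?P2 \<le> ?P4"
  proof -
    have "?P2 * 1 * 1 \<le> ?P2 * P * P" using P1 by (intro mult_le_mono) auto
    then show ?thesis by simp
  qed
  have 1: "H * (S * (3 * H + 1)) + H * H \<le> 5 * ?P4"
  proof -
    have "H * (S * (3 * H + 1)) \<le> P * (P * (3 * P + P))" using assms P1 by (intro mult_le_mono add_mono) auto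
    then have "H * (S * (3 * H + 1)) \<le> 4 * ?P3" by (simp add: algebra_simps)
    moreover have "H * H \<le> ?P2" using assms by (intro mult_le_mono)
    ultimately show ?thesis using P34 P24 by linarith
  qed
  have e2: "r * (X * Y) * (H * 2) \<le> 2 * ?P3"
    using mult_le_mono[OF mult_le_mono[OF assms(1,2)] assms(6)] by simp
  then have 2: "r * (X * Y) * (H * 2) \<le> 2 * ?P4" using P34 by linarith
  have 3: "r * (X * Y * (7 * r + 1) + r + 2) \<le> 11 * ?P4"
  proof -
    have "X * Y * (7 * r + 1) + r + 2 \<le> P * (7 * P + P) + P * P + 2 * (P * P)"
      using assms P1 by (intro add_mono mult_le_mono) (auto intro: order_trans[OF assms(1) le_square])
    also have "\<dots> = 11 * ?P2" by (simp add: algebra_simps)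
    finally have "r * (X * Y * (7 * r + 1) + r + 2) \<le> P * (11 * ?P2)" using assms(1) by (intro mult_le_mono)
    moreover have "P * (11 * ?P2) = 11 * ?P3" by simp
    ultimately show ?thesis using P34 by linarith
  qed
  have 4: "X * (r * (X * Y) * (H * 2)) \<le> 2 * ?P4"
    using mult_le_mono[OF XP e2] by (simp add: mult_ac)
  have 5: "(X + 1) * (ce + 20) * r ^ 3 \<le> (2 * ce + 40) * ?P4"
  proof -
    have "r ^ 3 \<le> P ^ 3" using assms(1) by (intro power_mono) auto
    moreover have "X + 1 \<le> 2 * P" using XP P1 by simp
    ultimately have "(X + 1) * (ce + 20) * r ^ 3 \<le> (2 * P) * (ce + 20) * P ^ 3" by (intro mult_le_mono) auto
    also have "\<dots> = (2 * ce + 40) * ?P4" by (simp add: power3_eq_cube algebra_simps)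
    finally show ?thesis .
  qed
  have 6: "r * (s * Y * (X * 2) + (Y * (s * (3 * Y + 1)) + Y * Y)) \<le> 7 * ?P4"
  proof -
    have "s * Y * (X * 2) \<le> 2 * ?P2" using mult_le_mono[OF sP assms(2)] by (simp add: mult_ac)
    moreover have "?P2 \<le> ?P3" using P1 by simp
    moreover have "Y * (s * (3 * Y + 1)) \<le> P * (P * (3 * P + P))" using YP sP P1 by (intro mult_le_mono add_mono) auto
    then have "Y * (s * (3 * Y + 1)) \<le> 4 * ?P3" by (simp add: algebra_simps)
    moreover have "Y * Y \<le> ?P2" using YP by (intro mult_le_mono)
    ultimately have "s * Y * (X * 2) + (Y * (s * (3 * Y + 1)) + Y * Y) \<le> 7 * ?P3" by linarith
    then have "r * (s * Y * (X * 2) + (Y * (s * (3 * Y + 1)) + Y * Y)) \<le> P * (7 * ?P3)"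
      using assms(1) by (intro mult_le_mono)
    then show ?thesis by (simp add: mult_ac)
  qed
  have "(H * (S * (3 * H + 1)) + H * H) + (r * (X * Y) * (H * 2) + (r * (X * Y * (7 * r + 1) + r + 2) +
      (X * (r * (X * Y) * (H * 2)) + ((X + 1) * (ce + 20) * r ^ 3 + r * (s * Y * (X * 2) +
      (Y * (s * (3 * Y + 1)) + Y * Y)))))) \<le>
      5 * ?P4 + (2 * ?P4 + (11 * ?P4 + (2 * ?P4 + ((2 * ce + 40) * ?P4 + 7 * ?P4))))"
    using 1 2 3 4 5 6 by (intro add_mono)
  also have "\<dots> = (2 * ce + 67) * ?P4" by (simp add: algebra_simps)
  also have "\<dots> \<le> (2 * ce + 100) * ?P4" by (intro mult_le_mono1) simp
  finally show ?thesis by (simp only: power4_eq_xxxx)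
qed

context good
begin

definition good_rand :: "rand \<Rightarrow> bool" where
  "good_rand \<rho> \<longleftrightarrow> (if r \<le> m + 1 then good_rand_2a \<rho> else good_rand_2b \<rho>)"

text \<open>The eigenvalue step enters only through its output being representatives of the points.
  The branch with exchanged factors disappears because \<open>d \<ge> 2\<close>.\<close>

lemma cpd_hnf_via_points:
  assumes ps: "points ps" and q: "fst (case fst (step_2aT eig \<rho> m n r F N) of
          Some ps \<Rightarrow> ret (Some ps) | None \<Rightarrow> step_2bT eig \<rho> m n d 1 r F) = Some ps"
  shows "\<exists>ts. fst (cpd_hnf eig steps d 1 \<rho> l m n A r) = Some ts \<and> is_decomposition l m n r A ts"
    and "snd (cpd_hnf eig steps d 1 \<rho> l m n A r) \<le> K * ((l + 1) * (3 * K + 1)) + (K * K +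
      (snd (step_2aT eig \<rho> m n r F N) + (snd (case fst (step_2aT eig \<rho> m n r F N) of
          Some ps \<Rightarrow> ret (Some ps) | None \<Rightarrow> step_2bT eig \<rho> m n d 1 r F) +
      (r * newton_bound steps + (K * r * 1 + r * (K * (3 * (r + (l + 1)) + 1)))))))"
proof -
  let ?q = "case fst (step_2aT eig \<rho> m n r F N) of
          Some ps \<Rightarrow> ret (Some ps) | None \<Rightarrow> step_2bT eig \<rho> m n d 1 r F"
  have rank: "\<not> (length (snd rp) \<noteq> r)" using rank_A1 by simp
  note unf = cpd_hnf_def Let_def bindT_simps case_prod_beta rp_def[symmetric] prod.collapse
      F_def[symmetric] if_not_P[OF rank] N_def[symmetric] if_P[OF d] q option.case ret_simps fst_mapT
  have "fst (cpd_hnf eig steps d 1 \<rho> l m n A r) = Some (fst (step_3T m n A1 (map (\<lambda>p. fst (newtonT steps m n F p)) ps)))"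
    unfolding unf ..
  then show "\<exists>ts. fst (cpd_hnf eig steps d 1 \<rho> l m n A r) = Some ts \<and> is_decomposition l m n r A ts"
    using step_3T_points(1)[OF ps] unfolding newtonT_points[OF ps] by blast
  have s: "snd (cpd_hnf eig steps d 1 \<rho> l m n A r) = snd (rrefT K A1) + (snd (null_basisT rp) +
      (snd (step_2aT eig \<rho> m n r F N) + (snd ?q + (snd (mapT (newtonT steps m n F) ps) +
      (snd (step_3T m n A1 (map (\<lambda>p. fst (newtonT steps m n F p)) ps)) + 0)))))"
    unfolding unf ..
  interpret rs: rref_state A1 "fst rp" "snd rp" by (rule rref_state_rp)
  have 1: "snd (rrefT K A1) \<le> K * ((l + 1) * (3 * K + 1))" using rrefT_snd[of K A1] unfolding A1_dims .
  have 2: "snd (null_basisT rp) \<le> K * K"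
    using null_basisT_snd[of "fst rp" "snd rp"] unfolding prod.collapse rs.dims A1_dims .
  have 3: "snd (mapT (newtonT steps m n F) ps) \<le> length ps * newton_bound steps"
    by (rule snd_mapT_le) (rule newtonT_snd)
  have len: "length ps = r" using ps by (simp add: points_def)
  show "snd (cpd_hnf eig steps d 1 \<rho> l m n A r) \<le> K * ((l + 1) * (3 * K + 1)) + (K * K +
      (snd (step_2aT eig \<rho> m n r F N) + (snd ?q +
      (r * newton_bound steps + (K * r * 1 + r * (K * (3 * (r + (l + 1)) + 1)))))))"
    unfolding s newtonT_points[OF ps] using 1 2 3[unfolded len] step_3T_points(2)[OF ps] by linarith
qed

lemma cpd_hnf_good:
  assumes eig: "eig_ok eig ce" and \<rho>: "good_rand \<rho>" and size: "n \<le> m" "m \<le> l" "r \<le> l + 1" "r \<le> m * n"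
  shows "\<exists>ts. fst (cpd_hnf eig steps d 1 \<rho> l m n A r) = Some ts \<and> is_decomposition l m n r A ts"
    and "snd (cpd_hnf eig steps d 1 \<rho> l m n A r) \<le> (1400 * steps + 2 * ce + 120) *
      ((l + 1) * (m + 1) * (n + 1)) ^ (if r \<le> m + 1 then 2 else 2 * d)"
proof -
  let ?M = "(l + 1) * (m + 1) * (n + 1)"
  have com: "K * ((l + 1) * (3 * K + 1)) + (K * K + (r * newton_bound steps +
      (K * r * 1 + r * (K * (3 * (r + (l + 1)) + 1))))) \<le> (1400 * steps + 20) * ?M ^ 2"
    unfolding newton_bound_def using size F_length by (intro common_cost) auto
  have "(\<exists>ts. fst (cpd_hnf eig steps d 1 \<rho> l m n A r) = Some ts \<and> is_decomposition l m n r A ts) \<and>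
      snd (cpd_hnf eig steps d 1 \<rho> l m n A r) \<le> (1400 * steps + 2 * ce + 120) *
      ?M ^ (if r \<le> m + 1 then 2 else 2 * d)"
  proof (cases "r \<le> m + 1")
    case True
    then have \<rho>2: "good_rand_2a \<rho>" using \<rho> by (simp add: good_rand_def)
    obtain ps where ps: "fst (step_2aT eig \<rho> m n r F N) = Some ps" "points ps"
      using step_2aT_good(1)[OF eig True \<rho>2] by blast
    have q: "(case fst (step_2aT eig \<rho> m n r F N) of
          Some ps \<Rightarrow> ret (Some ps) | None \<Rightarrow> step_2bT eig \<rho> m n d 1 r F) = ret (Some ps)" by (simp add: ps(1))
    note main = cpd_hnf_via_points[OF ps(2), of eig \<rho> steps, unfolded q ret_simps, OF refl]
    have "r * (m + 1) * (K * 2) + (r * ((m + 1) * (7 * r + 1) + r + 2) +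
      ((n + 1) * (r * (m + 1) * (K * 2)) + ((n + 1 + 1) * (ce + 20) * r ^ 3 + r * solve_bound n m)))
       \<le> (2 * ce + 100) * ?M ^ 2"
      unfolding solve_bound_def using size True F_length by (intro cost_2a) auto
    then have "snd (cpd_hnf eig steps d 1 \<rho> l m n A r) \<le> (1400 * steps + 20) * ?M ^ 2 + (2 * ce + 100) * ?M ^ 2"
      using main(2) com step_2aT_good(2)[OF eig True \<rho>2] by linarith
    also have "\<dots> = (1400 * steps + 2 * ce + 120) * ?M ^ 2" by (simp only: distrib_right[symmetric]) simp
    finally show ?thesis using main(1) True by simp
  next
    case False
    then have \<rho>2: "good_rand_2b \<rho>" using \<rho> by (simp add: good_rand_def)
    obtain ps where ps: "fst (step_2bT eig \<rho> m n d 1 r F) = Some ps" "points ps"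
      using step_2bT_good(1)[OF eig \<rho>2] by blast
    \<comment> \<open>For larger \<open>r\<close> step (2a) reports failure without any
      operation.\<close>
    have a: "step_2aT eig \<rho> m n r F N = ret None" using False by (simp add: step_2aT_def)
    have q: "(case fst (step_2aT eig \<rho> m n r F N) of
          Some ps \<Rightarrow> ret (Some ps) | None \<Rightarrow> step_2bT eig \<rho> m n d 1 r F) = step_2bT eig \<rho> m n d 1 r F"
      by (simp add: a)
    note main = cpd_hnf_via_points[OF ps(2), of eig \<rho> steps, unfolded q, OF ps(1), unfolded a ret_simps]
    let ?P = "(m + 1) ^ d * (n + 1)"
    have XP: "(m + 1) ^ d = (m + 1) * (m + 1) ^ (d - 1)" using d by (cases d) auto
    have "bound_2b ce \<le> (2 * ce + 100) * ?P ^ 4"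
      unfolding bound_2b_def Let_def solve_bound_def
    proof (rule cost_2b)
      have "(m + 1) * 1 * (n + 1) \<le> (m + 1) * (m + 1) ^ (d - 1) * (n + 1)"
        by (intro mult_le_mono) auto
      then show KP: "K \<le> ?P" unfolding XP by (simp only: mult_1_right)
      have "m * n \<le> K" by (intro mult_le_mono) auto
      then show "r \<le> ?P" using size(4) KP by linarith
      have "length (monlist m n d 1) = length (expos m d) * (n + 1)"
        by (simp add: monlist_length expos_length)
      then show "length (monlist m n d 1) \<le> ?P"
        using mult_le_mono1[OF expos_length_le] by (simp only:)
      have "length (monlist m n (d - 1) 0) \<le> (m + 1) ^ (d - 1)"
        using expos_length_le[of m "d - 1"] by (simp add: monlist_length expos_length)
      then have "length (monlist m n (d - 1) 0) * length F \<le> (m + 1) ^ (d - 1) * K"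
        using F_length by (rule mult_le_mono)
      also have "\<dots> = ?P" unfolding XP by (simp only: mult_ac)
      finally show "length (monlist m n (d - 1) 0) * length F \<le> ?P" .
      show "length F \<le> K" by (rule F_length)
    qed auto
    also have "\<dots> \<le> (2 * ce + 100) * ?M ^ (2 * d)"
    proof (intro mult_le_mono2)
      \<comment> \<open>Here \<open>4 \<le> 2 * d\<close> raises the power of \<open>n + 1\<close>,
        and afterwards \<open>m \<le> l\<close> turns one of the two factors \<open>m + 1\<close>
        into \<open>l + 1\<close>.\<close>
      have "?P ^ 4 = (m + 1) ^ (4 * d) * (n + 1) ^ 4"
        by (simp only: power_mult_distrib power_mult[symmetric] mult.commute[of d 4])
      also have "\<dots> \<le> (m + 1) ^ (4 * d) * (n + 1) ^ (2 * d)"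
        using d by (intro mult_le_mono2 power_increasing) auto
      also have "\<dots> = ((m + 1) * (m + 1) * (n + 1)) ^ (2 * d)"
        by (simp only: power_mult_distrib power_add[symmetric]) simp
      also have "\<dots> \<le> ?M ^ (2 * d)" using size by (intro power_mono mult_le_mono) auto
      finally show "?P ^ 4 \<le> ?M ^ (2 * d)" .
    qed
    finally have "bound_2b ce \<le> (2 * ce + 100) * ?M ^ (2 * d)" .
    moreover have "?M ^ 2 \<le> ?M ^ (2 * d)" using d by (intro power_increasing) auto
    then have "(1400 * steps + 20) * ?M ^ 2 \<le> (1400 * steps + 20) * ?M ^ (2 * d)" by (rule mult_le_mono2)
    ultimately have "snd (cpd_hnf eig steps d 1 \<rho> l m n A r) \<le>
        (1400 * steps + 20) * ?M ^ (2 * d) + (2 * ce + 100) * ?M ^ (2 * d)"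
      using main(2) com step_2bT_good(2)[OF eig \<rho>2] by linarith
    also have "\<dots> = (1400 * steps + 2 * ce + 120) * ?M ^ (2 * d)" by (simp only: distrib_right[symmetric]) simp
    finally show ?thesis using main(1) False by simp
  qed
  then show "\<exists>ts. fst (cpd_hnf eig steps d 1 \<rho> l m n A r) = Some ts \<and> is_decomposition l m n r A ts"
    "snd (cpd_hnf eig steps d 1 \<rho> l m n A r) \<le> (1400 * steps + 2 * ce + 120) *
      ?M ^ (if r \<le> m + 1 then 2 else 2 * d)" by blast+
qed

end

section \<open>Generic points\<close>

lemma polyfuns_sum: "(\<And>i. i \<in> I \<Longrightarrow> f i \<in> polyfuns) \<Longrightarrow> (\<lambda>x. \<Sum>i\<in>I. f i x) \<in> polyfuns"
  by (induction I rule: infinite_finite_induct) (auto intro: polyfuns.intros)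

lemma polyfuns_prod: "(\<And>i. i \<in> I \<Longrightarrow> f i \<in> polyfuns) \<Longrightarrow> (\<lambda>x. \<Prod>i\<in>I. f i x) \<in> polyfuns"
  by (induction I rule: infinite_finite_induct) (auto intro: polyfuns.intros)

lemma polyfuns_cmult: "f \<in> polyfuns \<Longrightarrow> (\<lambda>x. c * f x) \<in> polyfuns"
  by (intro polyfuns.intros)

lemma polyfuns_diff: "f \<in> polyfuns \<Longrightarrow> g \<in> polyfuns \<Longrightarrow> (\<lambda>x. f x - g x) \<in> polyfuns"
  using polyfuns.add[OF _ polyfuns_cmult[of g "-1"], of f] by simp

lemma polyfuns_power: "f \<in> polyfuns \<Longrightarrow> (\<lambda>x. f x ^ k) \<in> polyfuns"
  by (induction k) (auto intro: polyfuns.intros)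

text \<open>Leibniz formula.\<close>

lemma polyfuns_det:
  assumes "\<And>i j. i < n \<Longrightarrow> j < n \<Longrightarrow> f i j \<in> polyfuns"
  shows "(\<lambda>x. det (mat n n (\<lambda>(i, j). f i j x))) \<in> polyfuns"
proof -
  have "det (mat n n (\<lambda>(i, j). f i j x)) =
      (\<Sum>p\<in>{p. p permutes {0..<n}}. signof p * (\<Prod>i = 0..<n. f i (p i) x))" for x
    by (subst det_def'[of _ n], simp) (auto intro!: sum.cong prod.cong simp: permutes_in_image)
  moreover have "p i < n" if "p permutes {0..<n}" "i \<in> {0..<n}" for p i
    using permutes_in_image[OF that(1), of i] that(2) by simp
  ultimately show ?thesis
    using assms by (simp only:) (intro polyfuns_sum polyfuns_cmult polyfuns_prod; simp)
qed

lemma polyfuns_along_path: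
  assumes "p \<in> polyfuns"
  shows "\<exists>q. \<forall>t. poly q t = p (\<lambda>i. poly (c i) t)"
  using assms
proof induction
  case (const a)
  show ?case by (intro exI[of _ "[:a:]"]) simp
next
  case (add p q)
  then obtain p' q' where "\<forall>t. poly p' t = p (\<lambda>i. poly (c i) t)" "\<forall>t. poly q' t = q (\<lambda>i. poly (c i) t)"
    by blast
  then show ?case by (intro exI[of _ "p' + q'"]) simp
next
  case (mult p q)
  then obtain p' q' where "\<forall>t. poly p' t = p (\<lambda>i. poly (c i) t)" "\<forall>t. poly q' t = q (\<lambda>i. poly (c i) t)"
    by blast
  then show ?case by (intro exI[of _ "p' * q'"]) simp
qed auto

text \<open>Along the path both functions become univariate polynomials, nonzero because of the
  values at the two ends; their product has finitely many roots. This takes the place of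
  irreducibility, for linear spaces and for the parametrized tensors alike.\<close>

lemma path_avoids_zeros:
  fixes c :: "'i \<Rightarrow> complex poly"
  assumes "p \<in> polyfuns" "q \<in> polyfuns"
    and "p (\<lambda>i. poly (c i) 0) \<noteq> 0" "q (\<lambda>i. poly (c i) 1) \<noteq> 0"
  shows "\<exists>t. p (\<lambda>i. poly (c i) t) \<noteq> 0 \<and> q (\<lambda>i. poly (c i) t) \<noteq> 0"
proof -
  obtain p' q' where p': "\<And>t. poly p' t = p (\<lambda>i. poly (c i) t)" and q': "\<And>t. poly q' t = q (\<lambda>i. poly (c i) t)"
    using polyfuns_along_path[OF assms(1), of c] polyfuns_along_path[OF assms(2), of c] by blast
  have "p' \<noteq> 0" "q' \<noteq> 0" using p'[of 0] q'[of 1] assms by auto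
  then have "finite {t. poly (p' * q') t = 0}" by (intro poly_roots_finite) simp
  then obtain t where "poly (p' * q') t \<noteq> 0"
    using infinite_UNIV_char_0[where 'a = complex] by (metis (mono_tags, lifting) UNIV_eq_I mem_Collect_eq)
  then show ?thesis using p' q' by (intro exI[of _ t]) auto
qed

lemma coord_space_irreducible:
  assumes "p \<in> polyfuns" "q \<in> polyfuns" "u \<in> coord_space J" "v \<in> coord_space J" "p u \<noteq> 0" "q v \<noteq> 0"
  shows "\<exists>w\<in>coord_space J. p w \<noteq> 0 \<and> q w \<noteq> 0"
proof -
  have "\<exists>t. p (\<lambda>i. poly [:u i, v i - u i:] t) \<noteq> 0 \<and> q (\<lambda>i. poly [:u i, v i - u i:] t) \<noteq> 0"
    using assms by (intro path_avoids_zeros) simp_all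
  then obtain t where t: "p (\<lambda>i. poly [:u i, v i - u i:] t) \<noteq> 0" "q (\<lambda>i. poly [:u i, v i - u i:] t) \<noteq> 0"
    by blast
  have "(\<lambda>i. poly [:u i, v i - u i:] t) \<in> coord_space J" using assms by (simp add: coord_space_def)
  then show ?thesis using t by blast
qed

text \<open>Finitely many hypersurfaces can be avoided at once, so one product polynomial can
  express all generic requirements.\<close>

lemma nonvanishing_prod:
  assumes "finite I" "\<And>i. i \<in> I \<Longrightarrow> f i \<in> polyfuns" "\<And>i. i \<in> I \<Longrightarrow> \<exists>x\<in>coord_space J. f i x \<noteq> 0"
  shows "\<exists>x\<in>coord_space J. (\<Prod>i\<in>I. f i x) \<noteq> 0"
  using assms
proof (induction I rule: finite_induct)
  case empty
  have "(\<lambda>_. 0) \<in> coord_space J" by (simp add: coord_space_def)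
  then show ?case by auto
next
  case (insert i I)
  have "\<exists>x\<in>coord_space J. (\<Prod>i\<in>I. f i x) \<noteq> 0" using insert.prems by (intro insert.IH) auto
  then obtain x where "x \<in> coord_space J" "(\<Prod>i\<in>I. f i x) \<noteq> 0" by blast
  moreover obtain y where "y \<in> coord_space J" "f i y \<noteq> 0" using insert.prems(2) by blast
  ultimately obtain w where "w \<in> coord_space J" "f i w \<noteq> 0" "(\<Prod>i\<in>I. f i w) \<noteq> 0"
    using coord_space_irreducible[OF _ polyfuns_prod[of I f], of "f i"] insert.prems(1) by (metis insertCI)
  then show ?case using insert.hyps by (intro bexI[of _ w]) auto
qed

lemma generically_in_coord_space:
  assumes p: "p \<in> polyfuns" "v \<in> coord_space J" "p v \<noteq> 0"
    and Q: "\<And>x. x \<in> coord_space J \<Longrightarrow> p x \<noteq> 0 \<Longrightarrow> Q x"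
  shows "generically_in (coord_space J) Q"
  unfolding generically_in_def
proof (intro exI conjI ballI)
  let ?U = "{x \<in> coord_space J. \<exists>p'\<in>{p}. p' x \<noteq> 0}"
  show "zariski_open_in (coord_space J) ?U"
    unfolding zariski_open_in_def using p(1) by (intro exI[of _ "{p}"]) auto
  show "zariski_dense_in (coord_space J) ?U" unfolding zariski_dense_in_def
  proof (intro conjI allI impI)
    fix V assume V: "zariski_open_in (coord_space J) V \<and> V \<noteq> {}"
    then obtain P where P: "P \<subseteq> polyfuns" "V = {x \<in> coord_space J. \<exists>p\<in>P. p x \<noteq> 0}"
      by (auto simp: zariski_open_in_def)
    then obtain q x where q: "q \<in> P" "x \<in> coord_space J" "q x \<noteq> 0" using V by blast
    then obtain w where "w \<in> coord_space J" "p w \<noteq> 0" "q w \<noteq> 0"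
      using coord_space_irreducible[OF p(1) _ p(2) q(2) p(3)] P(1) by blast
    then show "?U \<inter> V \<noteq> {}" using P q(1) by blast
  qed auto
  fix x assume "x \<in> ?U"
  then show "Q x" using Q by auto
qed

text \<open>Distinctness of the mixed eigenvalues is made polynomial by clearing denominators. That
  the polynomials are not identically zero uses that \<open>a\<close> and \<open>b\<close> do not
  read the mixing weights, which can therefore be chosen afterwards.\<close>

lemma generic_mixing:
  fixes a b :: "nat \<Rightarrow> rand \<Rightarrow> complex" and v :: "nat \<Rightarrow> nat \<Rightarrow> complex"
  assumes J: "RMix ` {..<k} \<subseteq> J"
    and poly: "\<And>t. t < r \<Longrightarrow> a t \<in> polyfuns" "\<And>t. t < r \<Longrightarrow> b t \<in> polyfuns"
    and nz: "\<And>t. t < r \<Longrightarrow> \<exists>\<rho>\<in>coord_space J. a t \<rho> \<noteq> 0" "\<And>t. t < r \<Longrightarrow> \<exists>\<rho>\<in>coord_space J. b t \<rho> \<noteq> 0"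
    and indep: "\<And>t \<rho> \<rho>'. (\<And>x. x \<notin> range RMix \<Longrightarrow> \<rho> x = \<rho>' x) \<Longrightarrow> a t \<rho> = a t \<rho>' \<and> b t \<rho> = b t \<rho>'"
    and nonprop: "\<And>s t. s < r \<Longrightarrow> t < r \<Longrightarrow> s \<noteq> t \<Longrightarrow> \<exists>i<k. \<exists>j<k. v s i * v t j \<noteq> v s j * v t i"
  shows "\<exists>p\<in>polyfuns. (\<exists>\<rho>\<in>coord_space J. p \<rho> \<noteq> 0) \<and> (\<forall>\<rho>. p \<rho> \<noteq> 0 \<longrightarrow>
    (\<forall>t<r. a t \<rho> \<noteq> 0) \<and> (\<forall>t<r. b t \<rho> \<noteq> 0) \<and>
    inj_on (\<lambda>t. \<Sum>i<k. \<rho> (RMix i) * (v t i * b t \<rho> / a t \<rho>)) {..<r})"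
proof -
  \<comment> \<open>The difference of the mixed eigenvalues of \<open>s\<close> and
    \<open>t\<close>, multiplied by \<open>a s \<rho> * a t \<rho>\<close>.\<close>
  define D where "D s t \<rho> = (\<Sum>i<k. \<rho> (RMix i) * (v s i * (b s \<rho> * a t \<rho>) - v t i * (b t \<rho> * a s \<rho>)))" for s t \<rho>
  define f where "f x = (case x of Inl t \<Rightarrow> (\<lambda>\<rho>. a t \<rho> * b t \<rho>) | Inr (s, t) \<Rightarrow> D s t)" for x
  define I where "I = Inl ` {..<r} \<union> Inr ` {(s, t). s < r \<and> t < r \<and> s \<noteq> t}"
  have fin: "finite I"
  proof -
    have "{(s, t). s < r \<and> t < r \<and> s \<noteq> t} \<subseteq> {..<r} \<times> {..<r}" by auto
    then have "finite {(s, t). s < r \<and> t < r \<and> s \<noteq> t}" by (rule finite_subset) simp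
    then show ?thesis by (simp add: I_def)
  qed
  have D_poly: "D s t \<in> polyfuns" if "s < r" "t < r" for s t
    unfolding D_def[abs_def] using that poly
    by (intro polyfuns_sum polyfuns_diff polyfuns_cmult polyfuns.mult polyfuns.coord) auto
  have f_poly: "f x \<in> polyfuns" if "x \<in> I" for x
  proof (cases x)
    case (Inl t)
    then have "t < r" using that by (auto simp: I_def)
    then have "(\<lambda>\<rho>. a t \<rho> * b t \<rho>) \<in> polyfuns" using poly by (intro polyfuns.mult)
    then show ?thesis by (simp add: f_def Inl)
  qed (use that D_poly in \<open>auto simp: I_def f_def\<close>)
  have ab: "\<exists>\<rho>\<in>coord_space J. a t \<rho> * b t \<rho> \<noteq> 0" if "t < r" for t
    using nz(1)[OF that] nz(2)[OF that] coord_space_irreducible[OF poly(1)[OF that] poly(2)[OF that]]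
    by (metis no_zero_divisors)
  have f_nz: "\<exists>\<rho>\<in>coord_space J. f x \<rho> \<noteq> 0" if "x \<in> I" for x
  proof (cases x)
    case (Inl t)
    then show ?thesis using that ab by (auto simp: I_def f_def)
  next
    case (Inr st)
    obtain s t where p: "st = (s, t)" by force
    then have st: "x = Inr (s, t)" "s < r" "t < r" "s \<noteq> t" using that Inr by (auto simp: I_def)
    have "(\<lambda>\<rho>. a u \<rho> * b u \<rho>) \<in> polyfuns" if "u < r" for u using that poly by (intro polyfuns.mult) auto
    then obtain \<rho> where \<rho>: "\<rho> \<in> coord_space J" "a s \<rho> * b s \<rho> \<noteq> 0" "a t \<rho> * b t \<rho> \<noteq> 0"
      using ab[OF st(2)] ab[OF st(3)] st coord_space_irreducible[of "\<lambda>\<rho>. a s \<rho> * b s \<rho>" "\<lambda>\<rho>. a t \<rho> * b t \<rho>"]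
      by blast
    \<comment> \<open>If all coefficients of the mixing weights vanished, then \<open>v s\<close>
      would be the multiple \<mu> of \<open>v t\<close>.\<close>
    have "\<exists>i<k. v s i * (b s \<rho> * a t \<rho>) - v t i * (b t \<rho> * a s \<rho>) \<noteq> 0"
    proof (rule ccontr)
      assume "\<not> ?thesis"
      then have e: "v s i * (b s \<rho> * a t \<rho>) = v t i * (b t \<rho> * a s \<rho>)" if "i < k" for i using that by auto
      define \<mu> where "\<mu> = (b t \<rho> * a s \<rho>) / (b s \<rho> * a t \<rho>)"
      have "v s i = \<mu> * v t i" if "i < k" for i using e[OF that] \<rho> by (simp add: \<mu>_def field_simps)
      then show False using nonprop[OF st(2,3,4)] by auto
    qed
    then obtain i where i: "i < k" "v s i * (b s \<rho> * a t \<rho>) - v t i * (b t \<rho> * a s \<rho>) \<noteq> 0" by blast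
    \<comment> \<open>Only the weight with index \<open>i\<close> is switched on; \<open>a\<close>
      and \<open>b\<close> keep their values, and \<open>D s t\<close> reduces to the nonzero
      coefficient found.\<close>
    define \<rho>' where "\<rho>' x = (case x of RMix j \<Rightarrow> of_bool (j = i) | _ \<Rightarrow> \<rho> x)" for x
    have same: "a u \<rho>' = a u \<rho> \<and> b u \<rho>' = b u \<rho>" for u
      by (rule indep) (auto simp: \<rho>'_def split: rvar.split)
    have "\<rho>' \<in> coord_space J"
      using \<rho>(1) J i(1) by (auto simp: coord_space_def \<rho>'_def split: rvar.split)
    moreover have "D s t \<rho>' = (\<Sum>j<k. if j = i then v s i * (b s \<rho> * a t \<rho>) - v t i * (b t \<rho> * a s \<rho>) else 0)"
      unfolding D_def by (intro sum.cong) (auto simp: \<rho>'_def same)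
    then have "f x \<rho>' \<noteq> 0" using i by (simp add: f_def st(1))
    ultimately show ?thesis by blast
  qed
  have "(\<forall>t<r. a t \<rho> \<noteq> 0) \<and> (\<forall>t<r. b t \<rho> \<noteq> 0) \<and>
      inj_on (\<lambda>t. \<Sum>i<k. \<rho> (RMix i) * (v t i * b t \<rho> / a t \<rho>)) {..<r}"
    if "(\<Prod>x\<in>I. f x \<rho>) \<noteq> 0" for \<rho>
  proof (intro conjI allI impI)
    have F: "f x \<rho> \<noteq> 0" if "x \<in> I" for x using that \<open>(\<Prod>x\<in>I. f x \<rho>) \<noteq> 0\<close> fin by (metis prod_zero)
    have at: "a t \<rho> \<noteq> 0 \<and> b t \<rho> \<noteq> 0" if "t < r" for t using F[of "Inl t"] that by (auto simp: I_def f_def)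
    show "a t \<rho> \<noteq> 0" "b t \<rho> \<noteq> 0" if "t < r" for t using at[OF that] by auto
    show "inj_on (\<lambda>t. \<Sum>i<k. \<rho> (RMix i) * (v t i * b t \<rho> / a t \<rho>)) {..<r}"
    proof (rule inj_onI, rule ccontr)
      fix s t assume st: "s \<in> {..<r}" "t \<in> {..<r}" "s \<noteq> t"
        and eq: "(\<Sum>i<k. \<rho> (RMix i) * (v s i * b s \<rho> / a s \<rho>)) = (\<Sum>i<k. \<rho> (RMix i) * (v t i * b t \<rho> / a t \<rho>))"
      have "D s t \<rho> = (\<Sum>i<k. a s \<rho> * a t \<rho> * (\<rho> (RMix i) * (v s i * b s \<rho> / a s \<rho>))
          - a s \<rho> * a t \<rho> * (\<rho> (RMix i) * (v t i * b t \<rho> / a t \<rho>)))"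
        unfolding D_def using st at[of s] at[of t] by (intro sum.cong) (auto simp: field_simps)
      then have "D s t \<rho> = 0" unfolding sum_subtractf sum_distrib_left[symmetric] eq by simp
      then show False using F[of "Inr (s, t)"] st by (auto simp: I_def f_def)
    qed
  qed
  moreover have "(\<lambda>\<rho>. \<Prod>x\<in>I. f x \<rho>) \<in> polyfuns" by (rule polyfuns_prod) (rule f_poly)
  moreover have "\<exists>\<rho>\<in>coord_space J. (\<Prod>x\<in>I. f x \<rho>) \<noteq> 0" by (rule nonvanishing_prod[OF fin f_poly f_nz])
  ultimately show ?thesis by (intro bexI[of _ "\<lambda>\<rho>. \<Prod>x\<in>I. f x \<rho>"]) blast+
qed

lemma peval_poly_of_polyfun:
  "(\<lambda>\<rho>. peval (poly_of ms (\<lambda>c. \<rho> (R c))) x y) \<in> polyfuns"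
  unfolding peval_poly_of
  by (intro polyfuns_sum polyfuns.mult polyfuns.coord polyfuns.const)

lemma peval_poly_of_nonzero:
  assumes "k \<in> set ms" "meval k x y \<noteq> 0" "inj R" "R ` {..<length ms} \<subseteq> J"
  shows "\<exists>\<rho>\<in>coord_space J. peval (poly_of ms (\<lambda>c. \<rho> (R c))) x y \<noteq> 0"
proof -
  obtain c where c: "c < length ms" "ms ! c = k" using assms(1) by (auto simp: in_set_conv_nth)
  let ?\<rho> = "\<lambda>v. of_bool (v = R c)"
  have "peval (poly_of ms (\<lambda>c. ?\<rho> (R c))) x y = (\<Sum>i<length ms. if i = c then meval k x y else 0)"
    unfolding peval_poly_of using assms(3) c by (intro sum.cong) (auto simp: inj_eq)
  moreover have "?\<rho> \<in> coord_space J" using assms(4) c by (auto simp: coord_space_def)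
  ultimately show ?thesis using c assms(2) by (intro bexI[of _ ?\<rho>]) auto
qed

context good
begin

text \<open>Proportional \<gamma> would put one \<beta> into the fibre of the other, which by
  \<open>fibre_be\<close> consists of multiples.\<close>

lemma ga_nonprop:
  assumes "s < r" "t < r" "s \<noteq> t"
  shows "\<exists>i<n + 1. \<exists>j<n + 1. ga s i * ga t j \<noteq> ga s j * ga t i"
proof (rule ccontr)
  assume "\<not> ?thesis"
  then have eq: "ga s i * ga t j = ga s j * ga t i" if "i \<le> n" "j \<le> n" for i j using that by auto
  obtain c where c: "c \<le> n" "ga t c \<noteq> 0" using point_nonzero(2)[OF assms(2)] by blast
  have ga: "ga s i = ga s c / ga t c * ga t i" if "i \<le> n" for i
    using eq[OF that c(1)] c(2) by (simp add: field_simps)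
  then have nz: "ga s c / ga t c \<noteq> 0" using point_nonzero(2)[OF assms(1)] by auto
  have "\<exists>b. \<forall>k\<le>m. be s k = b * be t k"
    by (rule fibre_be[of "be s" "ga s", OF _ assms(2) nz ga]) (use assms in \<open>simp_all add: points_span_def\<close>)
  then show False using nonprop[OF assms] by auto
qed

text \<open>Step (2a) mixes the coordinates of the \<gamma>, with the constant 1 as second
  polynomial; step (2b) mixes those of the \<beta>, with the value of \<open>k2b\<close>.\<close>

lemma generic_rand: "generically_in (rand_space m n d 1) good_rand"
proof -
  define J where "J = RLin ` {..n} \<union> RH0 ` {..<length (monlist m n (d - 1) 0)} \<union>
          RH ` {..<length (monlist m n (d - 2) 0)} \<union> RMix ` {..max m n}"
  have J: "rand_space m n d 1 = coord_space J" using d by (simp add: rand_space_def J_def)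
  have "\<exists>p\<in>polyfuns. (\<exists>\<rho>\<in>coord_space J. p \<rho> \<noteq> 0) \<and> (\<forall>\<rho>. p \<rho> \<noteq> 0 \<longrightarrow> good_rand \<rho>)"
  proof (cases "r \<le> m + 1")
    case True
    have len: "length (monlist m n 0 1) = n + 1" by (simp add: monlist_length)
    have "\<exists>p\<in>polyfuns. (\<exists>\<rho>\<in>coord_space J. p \<rho> \<noteq> 0) \<and> (\<forall>\<rho>. p \<rho> \<noteq> 0 \<longrightarrow>
        (\<forall>t<r. peval (h2a \<rho>) (be t) (ga t) \<noteq> 0) \<and> (\<forall>t<r. (1 :: complex) \<noteq> 0) \<and>
        inj_on (\<lambda>t. \<Sum>i<n + 1. \<rho> (RMix i) * (ga t i * 1 / peval (h2a \<rho>) (be t) (ga t))) {..<r})"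
    proof (rule generic_mixing)
      show "RMix ` {..<n + 1} \<subseteq> J" by (auto simp: J_def)
      show "(\<lambda>\<rho>. peval (h2a \<rho>) (be t) (ga t)) \<in> polyfuns" for t
        unfolding h2a_def by (rule peval_poly_of_polyfun)
      show "(\<lambda>\<rho>. 1) \<in> polyfuns" by (rule polyfuns.const)
      have "(\<lambda>_. 0) \<in> coord_space J" by (simp add: coord_space_def)
      then show "\<exists>\<rho>\<in>coord_space J. (1 :: complex) \<noteq> 0" by auto
      show "\<exists>\<rho>\<in>coord_space J. peval (h2a \<rho>) (be t) (ga t) \<noteq> 0" if t: "t < r" for t
      proof -
        obtain c where "c \<le> n" "ga t c \<noteq> 0" using point_nonzero(2)[OF t] by blast
        moreover have "RLin ` {..<length (monlist m n 0 1)} \<subseteq> J" unfolding len by (auto simp: J_def)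
        ultimately show ?thesis unfolding h2a_def
          by (intro peval_poly_of_nonzero[of "(0, var_x c)"])
            (auto simp: monlist_set var_x_def xpow_single inj_on_def)
      qed
      show "peval (h2a \<rho>) (be t) (ga t) = peval (h2a \<rho>') (be t) (ga t) \<and> (1 :: complex) = 1"
        if "\<And>x. x \<notin> range RMix \<Longrightarrow> \<rho> x = \<rho>' x" for t \<rho> \<rho>'
      proof -
        have "\<rho> (RLin c) = \<rho>' (RLin c)" for c by (rule that) auto
        then show ?thesis by (simp add: h2a_def)
      qed
      show "\<exists>i<n + 1. \<exists>j<n + 1. ga s i * ga t j \<noteq> ga s j * ga t i" if "s < r" "t < r" "s \<noteq> t" for s t
        by (rule ga_nonprop[OF that])
    qed
    then show ?thesis using True by (simp add: good_rand_def good_rand_2a_def)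
  next
    case False
    have "\<exists>p\<in>polyfuns. (\<exists>\<rho>\<in>coord_space J. p \<rho> \<noteq> 0) \<and> (\<forall>\<rho>. p \<rho> \<noteq> 0 \<longrightarrow>
        (\<forall>t<r. peval (h2b \<rho>) (be t) (ga t) \<noteq> 0) \<and> (\<forall>t<r. peval (k2b \<rho>) (be t) (ga t) \<noteq> 0) \<and>
        inj_on (\<lambda>t. \<Sum>i<m + 1. \<rho> (RMix i) * (be t i * peval (k2b \<rho>) (be t) (ga t) / peval (h2b \<rho>) (be t) (ga t))) {..<r})"
    proof (rule generic_mixing)
      show "RMix ` {..<m + 1} \<subseteq> J" by (auto simp: J_def)
      show "(\<lambda>\<rho>. peval (h2b \<rho>) (be t) (ga t)) \<in> polyfuns" "(\<lambda>\<rho>. peval (k2b \<rho>) (be t) (ga t)) \<in> polyfuns" for t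
        unfolding h2b_def k2b_def by (rule peval_poly_of_polyfun)+
      show "\<exists>\<rho>\<in>coord_space J. peval (h2b \<rho>) (be t) (ga t) \<noteq> 0" if t: "t < r" for t
      proof -
        obtain k where "k \<le> m" "be t k \<noteq> 0" using point_nonzero(1)[OF t] by blast
        then show ?thesis unfolding h2b_def
          by (intro peval_poly_of_nonzero[of "(single k (d - 1), 0)"])
            (auto simp: monlist_set xpow_single J_def inj_on_def)
      qed
      show "\<exists>\<rho>\<in>coord_space J. peval (k2b \<rho>) (be t) (ga t) \<noteq> 0" if t: "t < r" for t
      proof -
        obtain k where "k \<le> m" "be t k \<noteq> 0" using point_nonzero(1)[OF t] by blast
        then show ?thesis unfolding k2b_def
          by (intro peval_poly_of_nonzero[of "(single k (d - 2), 0)"])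
            (auto simp: monlist_set xpow_single J_def inj_on_def)
      qed
      show "peval (h2b \<rho>) (be t) (ga t) = peval (h2b \<rho>') (be t) (ga t) \<and>
          peval (k2b \<rho>) (be t) (ga t) = peval (k2b \<rho>') (be t) (ga t)"
        if "\<And>x. x \<notin> range RMix \<Longrightarrow> \<rho> x = \<rho>' x" for t \<rho> \<rho>'
      proof -
        have "\<rho> (RH0 c) = \<rho>' (RH0 c)" "\<rho> (RH c) = \<rho>' (RH c)" for c by (rule that, auto)+
        then show ?thesis by (simp add: h2b_def k2b_def)
      qed
      show "\<exists>i<m + 1. \<exists>j<m + 1. be s i * be t j \<noteq> be s j * be t i" if "s < r" "t < r" "s \<noteq> t" for s t
        using nonprop[OF that] by (auto simp: less_Suc_eq_le)
    qed
    then show ?thesis using False by (simp add: good_rand_def good_rand_2b_def)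
  qed
  then obtain p \<rho> where p: "p \<in> polyfuns" "\<rho> \<in> coord_space J" "p \<rho> \<noteq> 0" "\<And>\<rho>. p \<rho> \<noteq> 0 \<Longrightarrow> good_rand \<rho>" by blast
  then show ?thesis unfolding J by (intro generically_in_coord_space[OF p(1-3)]) auto
qed

end

section \<open>An open condition for general position\<close>

lemma det_nonzero_solve:
  fixes M :: "nat \<Rightarrow> nat \<Rightarrow> complex"
  assumes "det (mat n n (\<lambda>(i, j). M i j)) \<noteq> 0"
  shows "\<exists>y. \<forall>i<n. (\<Sum>j<n. M i j * y j) = b i"
proof -
  let ?M = "mat n n (\<lambda>(i, j). M i j)"
  obtain B where B: "B \<in> carrier_mat n n" "?M * B = 1\<^sub>m n"
    using det_nonzero_inverse[OF mat_carrier assms] by metis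
  let ?y = "\<lambda>j. \<Sum>i<n. B $$ (j, i) * b i"
  have "(\<Sum>j<n. M i j * ?y j) = b i" if i: "i < n" for i
  proof -
    have "(\<Sum>j<n. M i j * ?y j) = (\<Sum>i'<n. (\<Sum>j<n. M i j * B $$ (j, i')) * b i')"
      unfolding sum_distrib_left sum_distrib_right by (subst sum.swap) (simp only: mult.assoc)
    also have "\<dots> = (\<Sum>i'<n. (?M * B) $$ (i, i') * b i')"
      using i B(1) by (intro sum.cong refl) (simp add: scalar_prod_def lessThan_atLeast0)
    also have "\<dots> = (\<Sum>i'<n. if i' = i then b i else 0)" unfolding B(2) using i by (intro sum.cong) auto
    finally show ?thesis using i by simp
  qed
  then show ?thesis by (intro exI[of _ ?y]) blast
qed

lemma peval_11_nonzero:
  assumes "f \<in> S_comp m n 1 1" "peval f x y \<noteq> 0"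
  shows "\<exists>k\<le>m. x k \<noteq> 0" "\<exists>c\<le>n. y c \<noteq> 0"
  using assms(2) unfolding peval_11[OF assms(1)]
  by (metis (no_types, lifting) atMost_iff mult_zero_left mult_zero_right sum.neutral)+

lemma is_decomposition_point_tensor:
  assumes "is_decomposition l m n r A ts"
  shows "A = point_tensor l m n r (\<lambda>t i. fst (ts ! t) $ i) (\<lambda>t j. fst (snd (ts ! t)) $ j) (\<lambda>t k. snd (snd (ts ! t)) $ k)"
proof -
  have "A = tensor_of l m n ts" "length ts = r" using assms by (auto simp: is_decomposition_def)
  then show ?thesis
    by (auto simp: tensor_of_def point_tensor_def sum_list_sum_nth atLeast0LessThan case_prod_beta intro!: ext)
qed

lemma point_tensor_decomposition:
  "is_decomposition l m n r (point_tensor l m n r al be ga)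
    (map (\<lambda>t. (vec (l + 1) (al t), vec (m + 1) (be t), vec (n + 1) (ga t))) [0..<r])"
  by (auto simp: is_decomposition_def tensor_of_def point_tensor_def sum_list_sum_nth atLeast0LessThan
      comp_def intro!: ext sum.cong)

lemma point_tensor_in_space: "point_tensor l m n r al be ga \<in> tensor_space l m n"
  by (auto simp: tensor_space_def coord_space_def point_tensor_def)

lemma lookup_monom_poly_of:
  "lookup (monom k * poly_of ms v) x = (\<Sum>q<length ms. v q * lookup (monom k * single (ms ! q) 1) x)"
proof -
  have "poly_of ms v = (\<Sum>q<length ms. pscale (v q) (single (ms ! q) 1))"
    by (simp add: poly_of_def pscale_single)
  then show ?thesis by (simp add: sum_distrib_left pscale_mult lookup_sum)
qed

text \<open>By Cramer's rule the columns of \<open>p1 - B2 adj(S) A1\<close>, where \<open>S = A1 B2\<close> on the first \<open>r\<close> rows,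
  lie in the kernel of the flattening and depend polynomially on the tensor. The nonvanishing of
  \<open>p2\<close> says that their multiples and the \<open>r\<close> fixed monomials \<open>x\<^sup>g y\<^sub>0\<close> span \<open>S\<^bsub>(d,1)\<^esub>\<close>.\<close>

locale open_cond =
  fixes l m n r d :: nat and gs :: "(nat \<Rightarrow>\<^sub>0 nat) list" and B2 :: "nat \<Rightarrow> nat \<Rightarrow> complex"
    and Bm :: "mono \<times> nat + nat \<Rightarrow> nat \<Rightarrow> complex"
  assumes d: "2 \<le> d" and rl: "r \<le> l + 1"
    and gs: "length gs = r" "\<And>t. t < r \<Longrightarrow> keys (gs ! t) \<subseteq> {..m}" "\<And>t. t < r \<Longrightarrow> mdeg (gs ! t) = d"
    and gs_lin: "\<And>t. r \<le> m + 1 \<Longrightarrow> t < r \<Longrightarrow> gs ! t = var_x t + single 0 (d - 1)"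
begin

abbreviation "K \<equiv> (m + 1) * (n + 1)"
abbreviation "ms11 \<equiv> monlist m n 1 1"
abbreviation "ms \<equiv> monlist m n d 1"

definition "A1 A b c = (A :: tensor) (b, c div (n + 1), c mod (n + 1))"
definition "Sm A = mat r r (\<lambda>(b, a). \<Sum>c<K. A1 A b c * B2 c a)"
text \<open>By the Cauchy-Binet formula a linear combination of the maximal minors of the first
  \<open>r\<close> rows of the flattening; the fixed multiplier \<open>B2\<close> spares the choice
  of columns.\<close>

definition "p1 A = det (Sm A)"
definition "kco A q c = p1 A * of_bool (q = c) - (\<Sum>a<r. \<Sum>b<r. B2 q a * adj_mat (Sm A) $$ (a, b) * A1 A b c)"
definition "kp A c = poly_of ms11 (\<lambda>q. kco A q c)"
definition "colp A x = (case x of Inl (k, c) \<Rightarrow> monom k * kp A c | Inr t \<Rightarrow> monom (gs ! t, var_x 0))"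
definition "CI = Inl ` (set (monlist m n (d - 1) 0) \<times> {..<K}) \<union> Inr ` {..<r}"
text \<open>The fixed multiplier \<open>Bm\<close> makes the wide matrix of the columns
  \<open>colp\<close> square; if the product is nonsingular, the columns span.\<close>

definition "p2 A = det (mat (length ms) (length ms) (\<lambda>(i, j). \<Sum>x\<in>CI. lookup (colp A x) (ms ! i) * Bm x j))"
definition "pp A = p1 A * p2 A"

lemma A1_poly: "(\<lambda>A. A1 A b c) \<in> polyfuns"
  unfolding A1_def by (rule polyfuns.coord)

lemma p1_poly: "p1 \<in> polyfuns"
proof -
  have "(\<lambda>A. det (mat r r (\<lambda>(b, a). \<Sum>c<K. A1 A b c * B2 c a))) \<in> polyfuns"
    by (intro polyfuns_det polyfuns_sum polyfuns.mult A1_poly polyfuns.const)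
  then show ?thesis by (simp add: p1_def[abs_def] Sm_def)
qed

text \<open>An entry of the adjugate is a signed minor; the shifted indices skip the deleted row
  \<open>b\<close> and column \<open>a\<close>.\<close>

lemma adj_poly:
  assumes "a < r" "b < r"
  shows "(\<lambda>A. adj_mat (Sm A) $$ (a, b)) \<in> polyfuns"
proof -
  let ?e = "\<lambda>A i j. \<Sum>c<K. A1 A (if i < b then i else Suc i) c * B2 c (if j < a then j else Suc j)"
  have "adj_mat (Sm A) $$ (a, b) = (-1) ^ (b + a) * det (mat (r - 1) (r - 1) (\<lambda>(i, j). ?e A i j))" for A
  proof -
    have "mat_delete (Sm A) b a = mat (r - 1) (r - 1) (\<lambda>(i, j). ?e A i j)"
      unfolding mat_delete_def Sm_def using assms by (intro eq_matI) auto
    moreover have "adj_mat (Sm A) $$ (a, b) = cofactor (Sm A) b a"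
      using assms by (simp add: adj_mat_def Sm_def)
    ultimately show ?thesis by (simp add: cofactor_def)
  qed
  moreover have "(\<lambda>A. (-1) ^ (b + a) * det (mat (r - 1) (r - 1) (\<lambda>(i, j). ?e A i j))) \<in> polyfuns"
    by (intro polyfuns_cmult polyfuns_det polyfuns_sum polyfuns.mult A1_poly polyfuns.const)
  ultimately show ?thesis by simp
qed

lemma kco_poly: "(\<lambda>A. kco A q c) \<in> polyfuns"
  unfolding kco_def
  by (intro polyfuns_diff polyfuns_sum polyfuns.mult p1_poly polyfuns.const A1_poly adj_poly) auto

lemma colp_poly: "(\<lambda>A. lookup (colp A x) k) \<in> polyfuns"
proof (cases x)
  case (Inl kc)
  then show ?thesis
    by (cases kc) (simp add: colp_def kp_def lookup_monom_poly_of,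
      intro polyfuns_sum polyfuns.mult kco_poly polyfuns.const)
next
  case (Inr t)
  then show ?thesis by (simp add: colp_def polyfuns.const)
qed

lemma pp_poly: "pp \<in> polyfuns"
proof -
  have "p2 \<in> polyfuns" unfolding p2_def[abs_def]
    by (intro polyfuns_det polyfuns_sum polyfuns.mult colp_poly polyfuns.const)
  then have "(\<lambda>A. p1 A * p2 A) \<in> polyfuns" by (intro polyfuns.mult p1_poly)
  then show ?thesis by (simp add: pp_def[abs_def])
qed

lemma CI_finite: "finite CI" and CI_sum: "(\<Sum>x\<in>CI. f x) =
    (\<Sum>kc\<in>set (monlist m n (d - 1) 0) \<times> {..<K}. f (Inl kc)) + (\<Sum>t<r. (f (Inr t) :: 'z :: comm_monoid_add))"
proof -
  show "finite CI" by (simp add: CI_def)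
  have "(\<Sum>x\<in>CI. f x) = (\<Sum>x\<in>Inl ` (set (monlist m n (d - 1) 0) \<times> {..<K}). f x) + (\<Sum>x\<in>Inr ` {..<r}. f x)"
    unfolding CI_def by (intro sum.union_disjoint) auto
  then show "(\<Sum>x\<in>CI. f x) =
    (\<Sum>kc\<in>set (monlist m n (d - 1) 0) \<times> {..<K}. f (Inl kc)) + (\<Sum>t<r. f (Inr t))"
    by (simp add: sum.reindex comp_def del: mult_Suc mult_Suc_right)
qed

lemma colp_S_comp:
  assumes "x \<in> CI"
  shows "colp A x \<in> S_comp m n d 1"
proof (cases x)
  case (Inl kc)
  then obtain k c where x: "x = Inl (k, c)" "k \<in> set (monlist m n (d - 1) 0)"
    using assms by (cases kc) (auto simp: CI_def)
  have "colp A x \<in> S_comp m n (d - 1 + 1) (0 + 1)"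
    unfolding x(1) colp_def kp_def sum.case prod.case
    by (intro S_comp_mult monom_S_comp poly_of_S_comp x(2))
  then show ?thesis using d by simp
next
  case (Inr t)
  then show ?thesis using assms gs by (auto simp: CI_def colp_def monlist_set var_x_def intro!: monom_S_comp)
qed

lemma A1_point_tensor:
  assumes "b \<le> l" "c < K"
  shows "A1 (point_tensor l m n r' al be ga) b c = (\<Sum>t<r'. al t b * evrow n (be t) (ga t) c)"
proof -
  have "c div (n + 1) \<le> m" using assms less_mult_imp_div_less[of c "m + 1" "n + 1"] by simp
  moreover have "c mod (n + 1) \<le> n" by (simp add: less_Suc_eq_le[symmetric])
  ultimately show ?thesis using assms by (simp add: A1_def point_tensor_def evrow_def mult.assoc)
qed

definition "VV be ga t a = (\<Sum>c<K. evrow n (be t) (ga t) c * B2 c a)"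

lemma Sm_point_tensor:
  assumes "b < r" "a < r"
  shows "Sm (point_tensor l m n r' al be ga) $$ (b, a) = (\<Sum>t<r'. al t b * VV be ga t a)"
proof -
  have "Sm (point_tensor l m n r' al be ga) $$ (b, a) =
      (\<Sum>c<K. \<Sum>t<r'. al t b * (evrow n (be t) (ga t) c * B2 c a))"
    unfolding Sm_def index_mat(1)[OF assms] prod.case
  proof (intro sum.cong refl)
    fix c assume "c \<in> {..<K}"
    then have c: "c < K" by (simp only: lessThan_iff)
    have b: "b \<le> l" using assms rl by simp
    show "A1 (point_tensor l m n r' al be ga) b c * B2 c a = (\<Sum>t<r'. al t b * (evrow n (be t) (ga t) c * B2 c a))"
      unfolding A1_point_tensor[OF b c] sum_distrib_right by (simp only: mult.assoc)
  qed
  also have "\<dots> = (\<Sum>t<r'. al t b * VV be ga t a)"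
    unfolding VV_def by (subst sum.swap) (simp only: sum_distrib_left)
  finally show ?thesis .
qed

text \<open>With fewer than \<open>r\<close> terms the matrix \<open>Sm A\<close> factors through a
  space of smaller dimension and is singular.\<close>

lemma rank_lower_bound:
  assumes "pp A \<noteq> 0" "is_decomposition l m n r' A ts"
  shows "r \<le> r'"
proof (rule ccontr)
  assume "\<not> r \<le> r'"
  then have "r' < r" by simp
  obtain al be ga where A: "A = point_tensor l m n r' al be ga"
    using is_decomposition_point_tensor[OF assms(2)] by blast
  obtain c where c: "\<exists>a<r. c a \<noteq> 0" "\<And>t. t < r' \<Longrightarrow> (\<Sum>a<r. VV be ga t a * c a) = 0"
    using \<open>r' < r\<close> by (rule dependent_columns[where M = "VV be ga"]) blast
  have "(\<Sum>a<r. (\<Sum>c<K. A1 A b c * B2 c a) * c a) = 0" if b: "b < r" for b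
  proof -
    have "(\<Sum>a<r. (\<Sum>c<K. A1 A b c * B2 c a) * c a) = (\<Sum>a<r. \<Sum>t<r'. al t b * (VV be ga t a * c a))"
    proof (intro sum.cong refl)
      fix a assume "a \<in> {..<r}"
      then have a: "a < r" by simp
      have "(\<Sum>c<K. A1 A b c * B2 c a) = (\<Sum>t<r'. al t b * VV be ga t a)"
        using Sm_point_tensor[OF b a, of r' al be ga] unfolding A[symmetric] Sm_def index_mat(1)[OF b a] prod.case .
      then show "(\<Sum>c<K. A1 A b c * B2 c a) * c a = (\<Sum>t<r'. al t b * (VV be ga t a * c a))"
        by (simp only: sum_distrib_right mult.assoc)
    qed
    also have "\<dots> = (\<Sum>t<r'. al t b * (\<Sum>a<r. VV be ga t a * c a))"
      by (subst sum.swap) (simp only: sum_distrib_left)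
    finally show ?thesis using c(2) by simp
  qed
  then have "p1 A = 0" using c(1) det_nonzero_iff[of r "\<lambda>b a. \<Sum>c<K. A1 A b c * B2 c a"]
    unfolding p1_def Sm_def by blast
  then show False using assms(1) by (simp add: pp_def)
qed

end

locale open_cond_at = open_cond l m n r d gs B2 Bm
  for l m n r d gs B2 Bm +
  fixes al be ga :: "nat \<Rightarrow> nat \<Rightarrow> complex" and A :: tensor
  assumes A: "A = point_tensor l m n r al be ga" and nz: "pp A \<noteq> 0"
begin

abbreviation "Ev t c \<equiv> evrow n (be t) (ga t) c"
abbreviation "FF \<equiv> points_span m n r be ga"

definition "Um = mat r r (\<lambda>(b, t). al t b)"
definition "Vm = mat r r (\<lambda>(t, a). VV be ga t a)"

text \<open>Hence the nonvanishing of \<open>p1\<close> makes both factors invertible: the first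
  \<open>r\<close> coordinates of the \<alpha> and the evaluations at the points are
  independent.\<close>

lemma UV: "Sm A = Um * Vm" "Um \<in> carrier_mat r r" "Vm \<in> carrier_mat r r"
proof -
  show "Um \<in> carrier_mat r r" "Vm \<in> carrier_mat r r" by (simp_all add: Um_def Vm_def)
  have dim: "dim_row (Sm A) = r" "dim_col (Sm A) = r" by (simp_all add: Sm_def)
  show "Sm A = Um * Vm"
  proof (rule eq_matI)
    fix i j assume "i < dim_row (Um * Vm)" "j < dim_col (Um * Vm)"
    then have ij: "i < r" "j < r" by (simp_all add: Um_def Vm_def)
    show "Sm A $$ (i, j) = (Um * Vm) $$ (i, j)"
      using Sm_point_tensor[OF ij, of r al be ga] ij unfolding A[symmetric]
      by (simp add: Um_def Vm_def scalar_prod_def lessThan_atLeast0)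
  qed (simp_all add: dim Um_def Vm_def)
qed

lemma dets: "det Um \<noteq> 0" "det Vm \<noteq> 0"
  using nz det_mult[OF UV(2,3)] by (auto simp: pp_def p1_def UV(1))

definition "Vi = (SOME B. B \<in> carrier_mat r r \<and> Vm * B = 1\<^sub>m r \<and> B * Vm = 1\<^sub>m r)"

lemma Vi: "Vi \<in> carrier_mat r r" "Vm * Vi = 1\<^sub>m r" "Vi * Vm = 1\<^sub>m r"
proof -
  obtain B where "B \<in> carrier_mat r r \<and> Vm * B = 1\<^sub>m r \<and> B * Vm = 1\<^sub>m r"
    using det_nonzero_inverse[OF UV(3) dets(2)] by metis
  then show "Vi \<in> carrier_mat r r" "Vm * Vi = 1\<^sub>m r" "Vi * Vm = 1\<^sub>m r"
    unfolding Vi_def by (metis (mono_tags, lifting) someI_ex)+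
qed

text \<open>The coefficient vectors are the columns of \<open>B2\<close> times the inverse of
  \<open>Vm\<close>, which makes them dual to the points.\<close>

definition "G s = poly_of ms11 (\<lambda>q. \<Sum>a<r. B2 q a * Vi $$ (a, s))"

lemma G: "G s \<in> S_comp m n 1 1" "s < r \<Longrightarrow> t < r \<Longrightarrow> peval (G s) (be t) (ga t) = of_bool (s = t)"
proof -
  show "G s \<in> S_comp m n 1 1" unfolding G_def by (rule poly_of_S_comp)
  assume st: "s < r" "t < r"
  have "peval (G s) (be t) (ga t) = (\<Sum>q<K. \<Sum>a<r. (Ev t q * B2 q a) * Vi $$ (a, s))"
    unfolding G_def peval_poly_of monlist_11_length
    by (intro sum.cong refl) (simp only: meval_monlist_11 lessThan_iff sum_distrib_left sum_distrib_right mult_ac)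
  also have "\<dots> = (\<Sum>a<r. VV be ga t a * Vi $$ (a, s))"
    unfolding VV_def sum_distrib_right by (rule sum.swap)
  also have "\<dots> = (Vm * Vi) $$ (t, s)"
    using st Vi(1) by (simp add: Vm_def scalar_prod_def lessThan_atLeast0)
  also have "\<dots> = of_bool (s = t)" unfolding Vi(2) using st by auto
  finally show "peval (G s) (be t) (ga t) = of_bool (s = t)" .
qed

text \<open>This is the identity of the adjugate with the determinant, conjugated by the invertible
  \<open>Vm\<close>.\<close>

lemma adj_product: "Vm * (adj_mat (Sm A) * Um) = p1 A \<cdot>\<^sub>m 1\<^sub>m r"
proof -
  have Sc: "Sm A \<in> carrier_mat r r" unfolding UV(1) using UV(2,3) by simp
  note adj = adj_mat[OF Sc]
  let ?Z = "adj_mat (Sm A) * Um"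
  have Z: "?Z \<in> carrier_mat r r" using adj(1) UV(2) by simp
  have ZV: "?Z * Vm = p1 A \<cdot>\<^sub>m 1\<^sub>m r"
    using adj(3) assoc_mult_mat[OF adj(1) UV(2,3)] by (simp add: p1_def UV(1))
  have "Vm * ?Z = Vm * ?Z * (Vm * Vi)"
    unfolding Vi(2) by (rule right_mult_one_mat[OF mult_carrier_mat[OF UV(3) Z], symmetric])
  also have "\<dots> = Vm * ?Z * Vm * Vi"
    by (rule assoc_mult_mat[OF mult_carrier_mat[OF UV(3) Z] UV(3) Vi(1), symmetric])
  also have "Vm * ?Z * Vm = Vm * (?Z * Vm)" by (rule assoc_mult_mat[OF UV(3) Z UV(3)])
  also have "\<dots> = p1 A \<cdot>\<^sub>m Vm"
    unfolding ZV mult_smult_distrib[OF UV(3) one_carrier_mat] right_mult_one_mat[OF UV(3)] ..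
  also have "p1 A \<cdot>\<^sub>m Vm * Vi = p1 A \<cdot>\<^sub>m 1\<^sub>m r"
    using mult_smult_assoc_mat[OF UV(3) Vi(1), of "p1 A"] by (simp add: Vi(2))
  finally show ?thesis .
qed

text \<open>Evaluating the column at a point gives \<open>p1 A\<close> times the evaluation row,
  minus \<open>Vm * adj_mat (Sm A) * Um\<close> applied to all evaluation rows; by
  \<open>adj_product\<close> the two cancel.\<close>

lemma kp_FF:
  assumes c: "c < K"
  shows "kp A c \<in> FF"
proof -
  have "peval (kp A c) (be t) (ga t) = 0" if t: "t < r" for t
  proof -
    have Sc: "Sm A \<in> carrier_mat r r" unfolding UV(1) using UV(2,3) by simp
    have adjc: "adj_mat (Sm A) \<in> carrier_mat r r" by (rule adj_mat(1)[OF Sc])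
    let ?ad = "\<lambda>a b. adj_mat (Sm A) $$ (a, b)"
    have "peval (kp A c) (be t) (ga t) = (\<Sum>q<K. kco A q c * Ev t q)"
      unfolding kp_def peval_poly_of monlist_11_length
      by (intro sum.cong refl) (simp only: meval_monlist_11 lessThan_iff)
    also have "\<dots> = (\<Sum>q<K. p1 A * of_bool (q = c) * Ev t q) -
        (\<Sum>q<K. \<Sum>a<r. (Ev t q * B2 q a) * (\<Sum>b<r. ?ad a b * A1 A b c))"
      unfolding kco_def left_diff_distrib sum_subtractf
      by (simp only: sum_distrib_left sum_distrib_right mult_ac)
    also have "(\<Sum>q<K. \<Sum>a<r. (Ev t q * B2 q a) * (\<Sum>b<r. ?ad a b * A1 A b c)) =
        (\<Sum>a<r. VV be ga t a * (\<Sum>b<r. ?ad a b * A1 A b c))"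
      unfolding VV_def by (subst sum.swap) (simp only: sum_distrib_right)
    also have "\<dots> = (\<Sum>a<r. VV be ga t a * (\<Sum>s<r. (adj_mat (Sm A) * Um) $$ (a, s) * Ev s c))"
    proof (rule sum.cong[OF refl])
      fix a assume "a \<in> {..<r}"
      then have a: "a < r" by simp
      have "(\<Sum>b<r. ?ad a b * A1 A b c) = (\<Sum>b<r. \<Sum>s<r. ?ad a b * al s b * Ev s c)"
      proof (intro sum.cong refl)
        fix b assume "b \<in> {..<r}"
        then have b: "b \<le> l" using rl by simp
        show "?ad a b * A1 A b c = (\<Sum>s<r. ?ad a b * al s b * Ev s c)"
          using A1_point_tensor[OF b c, of r al be ga] unfolding A[symmetric]
          by (simp only: sum_distrib_left mult.assoc)
      qed
      also have "\<dots> = (\<Sum>s<r. (\<Sum>b<r. ?ad a b * al s b) * Ev s c)"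
        by (subst sum.swap) (simp only: sum_distrib_right)
      also have "\<dots> = (\<Sum>s<r. (adj_mat (Sm A) * Um) $$ (a, s) * Ev s c)"
        using a adjc by (intro sum.cong refl) (simp add: Um_def scalar_prod_def lessThan_atLeast0)
      finally show "VV be ga t a * (\<Sum>b<r. ?ad a b * A1 A b c) =
          VV be ga t a * (\<Sum>s<r. (adj_mat (Sm A) * Um) $$ (a, s) * Ev s c)" by (simp only:)
    qed
    also have "\<dots> = (\<Sum>s<r. (\<Sum>a<r. VV be ga t a * (adj_mat (Sm A) * Um) $$ (a, s)) * Ev s c)"
      unfolding sum_distrib_left sum_distrib_right by (subst sum.swap) (simp only: mult.assoc)
    also have "\<dots> = (\<Sum>s<r. (Vm * (adj_mat (Sm A) * Um)) $$ (t, s) * Ev s c)"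
    proof (rule sum.cong[OF refl])
      fix s assume "s \<in> {..<r}"
      then have s: "s < r" by simp
      have "(Vm * Z) $$ (t, s) = (\<Sum>a<r. VV be ga t a * Z $$ (a, s))" if "Z \<in> carrier_mat r r" for Z
        using that s t by (simp add: Vm_def scalar_prod_def lessThan_atLeast0)
      from this[OF mult_carrier_mat[OF adjc UV(2)]]
      show "(\<Sum>a<r. VV be ga t a * (adj_mat (Sm A) * Um) $$ (a, s)) * Ev s c =
          (Vm * (adj_mat (Sm A) * Um)) $$ (t, s) * Ev s c" by (simp only:)
    qed
    also have "\<dots> = (\<Sum>s<r. if s = t then p1 A * Ev t c else 0)"
      unfolding adj_product using t by (intro sum.cong) auto
    also have "(\<Sum>q<K. p1 A * of_bool (q = c) * Ev t q) = (\<Sum>q<K. if q = c then p1 A * Ev t c else 0)"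
      by (intro sum.cong) auto
    finally show ?thesis using t c by (simp del: mult_Suc mult_Suc_right)
  qed
  then show ?thesis by (simp add: points_span_def kp_def poly_of_S_comp)
qed

text \<open>Solving the square system with matrix (columns times \<open>Bm\<close>) and applying
  \<open>Bm\<close> to the solution yields the coefficients.\<close>

lemma colp_spans:
  assumes f: "f \<in> S_comp m n d 1"
  shows "\<exists>x. f = (\<Sum>c\<in>CI. pscale (x c) (colp A c))"
proof -
  let ?H = "length ms"
  have "p2 A \<noteq> 0" using nz by (simp add: pp_def)
  then obtain y where y: "\<And>i. i < ?H \<Longrightarrow>
      (\<Sum>j<?H. (\<Sum>x\<in>CI. lookup (colp A x) (ms ! i) * Bm x j) * y j) = lookup f (ms ! i)"
    using det_nonzero_solve[of ?H "\<lambda>i j. \<Sum>x\<in>CI. lookup (colp A x) (ms ! i) * Bm x j" "\<lambda>i. lookup f (ms ! i)"]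
    unfolding p2_def by blast
  let ?x = "\<lambda>c. \<Sum>j<?H. Bm c j * y j"
  let ?g = "\<Sum>c\<in>CI. pscale (?x c) (colp A c)"
  have g: "?g \<in> S_comp m n d 1" by (intro S_comp_sum S_comp_closed(3) colp_S_comp)
  have "lookup ?g (ms ! i) = lookup f (ms ! i)" if "i < ?H" for i
  proof -
    have "lookup ?g (ms ! i) = (\<Sum>c\<in>CI. \<Sum>j<?H. lookup (colp A c) (ms ! i) * Bm c j * y j)"
      by (simp add: lookup_sum sum_distrib_right mult_ac)
    also have "\<dots> = (\<Sum>j<?H. (\<Sum>x\<in>CI. lookup (colp A x) (ms ! i) * Bm x j) * y j)"
      by (subst sum.swap) (simp only: sum_distrib_right)
    finally show ?thesis using y[OF that] by simp
  qed
  then have "poly_of ms (\<lambda>i. lookup ?g (ms ! i)) = poly_of ms (\<lambda>i. lookup f (ms ! i))"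
    unfolding poly_of_def by (intro sum.cong) auto
  then have "?g = f" unfolding poly_of_lookup[OF g] poly_of_lookup[OF f] .
  then show ?thesis by (intro exI[of _ ?x]) simp
qed

definition "Gam i t = ga i 0 * xpow (gs ! t) (be i)"

lemma peval_colp:
  assumes "i < r"
  shows "kc \<in> set (monlist m n (d - 1) 0) \<times> {..<K} \<Longrightarrow> peval (colp A (Inl kc)) (be i) (ga i) = 0"
    "peval (colp A (Inr t)) (be i) (ga i) = Gam i t"
  using assms kp_FF[of "snd kc"]
  by (auto simp: colp_def points_span_def meval_def Gam_def mult.commute split: prod.splits
      simp del: mult_Suc mult_Suc_right)

lemma peval_expansion:
  assumes f: "f = (\<Sum>c\<in>CI. pscale (x c) (colp A c))" and i: "i < r"
  shows "peval f (be i) (ga i) = (\<Sum>t<r. Gam i t * x (Inr t))"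
proof -
  have "peval f (be i) (ga i) = (\<Sum>c\<in>CI. x c * peval (colp A c) (be i) (ga i))" by (simp add: f)
  also have "\<dots> = (\<Sum>t<r. Gam i t * x (Inr t))"
    unfolding CI_sum peval_colp(2)[OF i] using peval_colp(1)[OF i]
    by (simp add: mult.commute del: mult_Suc mult_Suc_right)
  finally show ?thesis .
qed

lemma point_nz: "t < r \<Longrightarrow> \<exists>k\<le>m. be t k \<noteq> 0"
  using peval_11_nonzero(1)[OF G(1)[of t], of "be t" "ga t"] G(2)[of t t] by simp

text \<open>The ideal columns vanish at the points, so the values of any form of bidegree (d,1) are
  a combination of the columns of \<open>Gam\<close>; forms isolating a single point exist, hence
  \<open>Gam\<close> has no left kernel.\<close>

lemma det_Gam: "det (mat r r (\<lambda>(i, t). Gam i t)) \<noteq> 0"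
  unfolding det_nonzero_iff_left
proof (intro allI impI)
  fix c s assume c: "\<forall>t<r. (\<Sum>i<r. c i * Gam i t) = 0" and s: "s < r"
  obtain k where k: "k \<le> m" "be s k \<noteq> 0" using point_nz[OF s] by blast
  \<comment> \<open>A form that is nonzero at the point \<open>s\<close> and zero at the
    others.\<close>
  let ?f = "G s * monom (single k (d - 1), 0)"
  have "monom (single k (d - 1), 0) \<in> S_comp m n (d - 1) 0"
    using k by (intro monom_S_comp) (simp add: monlist_set)
  then have "?f \<in> S_comp m n (1 + (d - 1)) (1 + 0)" by (intro S_comp_mult G)
  moreover have "1 + (d - 1) = d" "1 + 0 = (1 :: nat)" using d by simp_all
  ultimately have "?f \<in> S_comp m n d 1" by (simp only:)
  then obtain x where x: "?f = (\<Sum>c\<in>CI. pscale (x c) (colp A c))" using colp_spans by blast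
  have "(\<Sum>i<r. c i * peval ?f (be i) (ga i)) = (\<Sum>i<r. \<Sum>t<r. c i * Gam i t * x (Inr t))"
  proof (rule sum.cong[OF refl])
    fix i assume "i \<in> {..<r}"
    then have i: "i < r" by simp
    show "c i * peval ?f (be i) (ga i) = (\<Sum>t<r. c i * Gam i t * x (Inr t))"
      unfolding peval_expansion[OF x i] by (simp only: sum_distrib_left mult.assoc)
  qed
  also have "\<dots> = (\<Sum>t<r. (\<Sum>i<r. c i * Gam i t) * x (Inr t))"
    by (subst sum.swap) (simp only: sum_distrib_right)
  also have "\<dots> = 0" using c by simp
  also have "(\<Sum>i<r. c i * peval ?f (be i) (ga i)) = (\<Sum>i<r. if i = s then c s * be s k ^ (d - 1) else 0)"
    using s by (intro sum.cong) (auto simp: G(2) meval_def xpow_single)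
  finally show "c s = 0" using s k by simp
qed

lemma Gam_right: "(\<And>i. i < r \<Longrightarrow> (\<Sum>t<r. Gam i t * c t) = 0) \<Longrightarrow> t < r \<Longrightarrow> c t = 0"
  using det_Gam[unfolded det_nonzero_iff, THEN spec[of _ c]] by simp

lemma Gam_left: "(\<And>t. t < r \<Longrightarrow> (\<Sum>i<r. c i * Gam i t) = 0) \<Longrightarrow> i < r \<Longrightarrow> c i = 0"
  using det_Gam[unfolded det_nonzero_iff_left, THEN spec[of _ c]] by simp

lemma good: "good m n r d be ga G l al A"
proof
  show "2 \<le> d" by (rule d)
  show "G t \<in> S_comp m n 1 1" for t by (rule G)
  show "peval (G s) (be t) (ga t) = of_bool (s = t)" if "s < r" "t < r" for s t by (rule G(2)[OF that])
  show "A = point_tensor l m n r al be ga" by (rule A)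
  show "\<forall>t<r. c t = 0" if c: "\<And>i. i \<le> l \<Longrightarrow> (\<Sum>t<r. c t * al t i) = 0" for c
  proof -
    have "(\<Sum>t<r. al t b * c t) = 0" if "b < r" for b using c[of b] that rl by (simp add: mult.commute)
    then show ?thesis using dets(1)[unfolded Um_def det_nonzero_iff, THEN spec[of _ c]] by simp
  qed
  show "f \<in> mult_span m n d FF"
    if f: "f \<in> S_comp m n d 1" and v: "\<And>t. t < r \<Longrightarrow> peval f (be t) (ga t) = 0" for f
  proof -
    obtain x where x: "f = (\<Sum>c\<in>CI. pscale (x c) (colp A c))" using colp_spans[OF f] by blast
    \<comment> \<open>Evaluation sees only the fixed monomials; as \<open>Gam\<close> is invertible
      their coefficients are zero, and the ideal columns remain.\<close>
    have "(\<Sum>t<r. Gam i t * x (Inr t)) = 0" if "i < r" for i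
      using v[OF that] peval_expansion[OF x that] by simp
    then have x0: "x (Inr t) = 0" if "t < r" for t by (rule Gam_right[of "\<lambda>t. x (Inr t)", OF _ that])
    have "f = (\<Sum>kc\<in>set (monlist m n (d - 1) 0) \<times> {..<K}. pscale (x (Inl kc)) (colp A (Inl kc)))"
      unfolding x CI_sum using x0 by simp
    also have "\<dots> \<in> mult_span m n d FF" unfolding mult_span_def
    proof (intro bp.span_sum bp.span_scale bp.span_base)
      fix kc assume "kc \<in> set (monlist m n (d - 1) 0) \<times> {..<K}"
      then obtain k c where kc: "kc = (k, c)" "k \<in> set (monlist m n (d - 1) 0)" "c < K" by blast
      have "colp A (Inl kc) = monom k * kp A c" by (simp only: colp_def kc(1) sum.case prod.case)
      then show "colp A (Inl kc) \<in> {monom k * f |k f. k \<in> set (monlist m n (d - 1) 0) \<and> f \<in> FF}"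
        using kp_FF[OF kc(3)] kc(2) by blast
    qed
    finally show ?thesis .
  qed
  have Gam_row: "\<exists>u<r. Gam t u \<noteq> 0" if "t < r" for t
  proof (rule ccontr)
    assume "\<not> ?thesis"
    then have "(\<Sum>i<r. of_bool (i = t) * Gam i u) = 0" if "u < r" for u
      using that by (intro sum.neutral) auto
    then have "(of_bool (t = t) :: complex) = 0" by (rule Gam_left[OF _ that])
    then show False by simp
  qed
  show "\<exists>k\<le>m. \<exists>k'\<le>m. be s k * be t k' \<noteq> be s k' * be t k" if st: "s < r" "t < r" "s \<noteq> t" for s t
  proof (rule ccontr)
    assume "\<not> ?thesis"
    then have eq: "be s k * be t k' = be s k' * be t k" if "k \<le> m" "k' \<le> m" for k k' using that by auto
    obtain k0 where k0: "k0 \<le> m" "be t k0 \<noteq> 0" using point_nz[OF st(2)] by blast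
    define \<mu> where "\<mu> = be s k0 / be t k0"
    have be: "be s k = \<mu> * be t k" if "k \<le> m" for k
      using eq[OF that k0(1)] k0(2) by (simp add: \<mu>_def field_simps)
    \<comment> \<open>All exponents in \<open>gs\<close> have degree \<open>d\<close>, so the factor
      \<open>\<mu> ^ d\<close> is the same for every monomial.\<close>
    have X: "xpow (gs ! u) (be s) = \<mu> ^ d * xpow (gs ! u) (be t)" if u: "u < r" for u
    proof -
      have "xpow (gs ! u) (be s) = (\<Prod>k\<in>keys (gs ! u). \<mu> ^ lookup (gs ! u) k * be t k ^ lookup (gs ! u) k)"
        unfolding xpow_def using gs(2)[OF u] be by (intro prod.cong) (auto simp: power_mult_distrib)
      also have "\<dots> = \<mu> ^ mdeg (gs ! u) * xpow (gs ! u) (be t)"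
        by (simp add: prod.distrib xpow_def mdeg_def power_sum)
      finally show ?thesis using gs(3)[OF u] by simp
    qed
    \<comment> \<open>Since the only y-variable present is \<open>y_0\<close>, the rows
      \<open>s\<close> and \<open>t\<close> of \<open>Gam\<close> are proportional and this
      combination of them vanishes. Then \<open>ga t 0 = 0\<close>, and row \<open>t\<close> would
      be zero.\<close>
    let ?c = "\<lambda>i. if i = s then ga t 0 else if i = t then - (ga s 0 * \<mu> ^ d) else 0"
    have "(\<Sum>i<r. ?c i * Gam i u) = 0" if u: "u < r" for u
    proof -
      have "(\<Sum>i<r. ?c i * Gam i u) = (\<Sum>i\<in>{s, t}. ?c i * Gam i u)"
        using st by (intro sum.mono_neutral_right) auto
      also have "\<dots> = 0" using st X[OF u] by (simp add: Gam_def)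
      finally show ?thesis .
    qed
    then have "?c s = 0" by (rule Gam_left[OF _ st(1)])
    then have "ga t 0 = 0" by simp
    then show False using Gam_row[OF st(2)] by (simp add: Gam_def)
  qed
  show "\<forall>t<r. c t = 0" if r: "r \<le> m + 1" and c: "\<And>k. k \<le> m \<Longrightarrow> (\<Sum>t<r. c t * be t k) = 0" for c
  proof -
    \<comment> \<open>For the monomials \<open>x_t x_0^(d-1)\<close> the row of \<open>Gam\<close>
      at a point is its \<beta> scaled by \<open>w\<close>, so a relation among the \<beta> is a
      left kernel vector of \<open>Gam\<close>.\<close>
    define w where "w i = ga i 0 * be i 0 ^ (d - 1)" for i
    have Gam: "Gam i t = w i * be i t" if "t < r" for i t
      by (simp add: w_def Gam_def gs_lin[OF r that] xpow_add xpow_single mult_ac)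
    have w: "w i \<noteq> 0" if "i < r" for i
    proof
      assume "w i = 0"
      then show False using Gam_row[OF that] Gam by force
    qed
    have "(\<Sum>i<r. c i / w i * Gam i t) = 0" if t: "t < r" for t
    proof -
      have "(\<Sum>i<r. c i / w i * Gam i t) = (\<Sum>i<r. c i * be i t)"
        using w by (intro sum.cong refl) (simp add: Gam[OF t])
      then show ?thesis using c[of t] t r by simp
    qed
    then have "c i / w i = 0" if "i < r" for i by (rule Gam_left[OF _ that])
    then show ?thesis using w by (meson divide_eq_0_iff)
  qed
qed

end

section \<open>Existence of a decomposition in general position\<close>

text \<open>Unit tensors suffice; this guarantees that the minimum in \<open>tensor_rank\<close> is
  attained.\<close>

lemma tensor_has_decomposition:
  assumes A: "A \<in> tensor_space l m n"
  shows "\<exists>r ts. is_decomposition l m n r A ts"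
proof -
  let ?I = "List.product [0..<l + 1] (List.product [0..<m + 1] [0..<n + 1])"
  let ?t = "\<lambda>(i, j, k). (A (i, j, k) \<cdot>\<^sub>v unit_vec (l + 1) i, unit_vec (m + 1) j, unit_vec (n + 1) k) :: complex vec \<times> complex vec \<times> complex vec"
  let ?ts = "map ?t ?I"
  have "tensor_of l m n ?ts (i, j, k) = A (i, j, k)" for i j k
  proof (cases "i \<le> l \<and> j \<le> m \<and> k \<le> n")
    case True
    have "(\<Sum>(a, b, c)\<leftarrow>?ts. a $ i * b $ j * c $ k) =
        (\<Sum>x\<leftarrow>?I. if x = (i, j, k) then A (i, j, k) else 0)"
      unfolding map_map comp_def using True
      by (intro arg_cong[where f = sum_list] map_cong refl) (auto simp del: upt_Suc split: if_splits)
    also have "\<dots> = (\<Sum>x\<in>set ?I. if x = (i, j, k) then A (i, j, k) else 0)"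
      by (intro sum_list_distinct_conv_sum_set distinct_product) auto
    also have "\<dots> = A (i, j, k)" using True by (simp add: less_Suc_eq_le del: upt_Suc)
    finally show ?thesis using True by (simp add: tensor_of_def del: upt_Suc)
  next
    case False
    then have "A (i, j, k) = 0" using A by (auto simp: tensor_space_def coord_space_def)
    then show ?thesis using False by (auto simp: tensor_of_def)
  qed
  then have "A = tensor_of l m n ?ts" by (auto intro!: ext)
  moreover have "\<forall>(a, b, c)\<in>set ?ts. a \<in> carrier_vec (l + 1) \<and> b \<in> carrier_vec (m + 1) \<and> c \<in> carrier_vec (n + 1)"
    by (auto simp del: upt_Suc)
  ultimately have "is_decomposition l m n (length ?ts) A ?ts" unfolding is_decomposition_def by blast
  then show ?thesis by blast
qed

lemma tensors_of_rank_decomposition: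
  assumes "A \<in> tensors_of_rank l m n r"
  shows "\<exists>al be ga. A = point_tensor l m n r al be ga"
proof -
  have "A \<in> tensor_space l m n" "tensor_rank l m n A = r" using assms by (auto simp: tensors_of_rank_def)
  then have "\<exists>ts. is_decomposition l m n r A ts"
    using LeastI_ex[OF tensor_has_decomposition] by (auto simp: tensor_rank_def)
  then show ?thesis using is_decomposition_point_tensor by blast
qed

context open_cond
begin

lemma point_tensor_rank:
  assumes "pp (point_tensor l m n r al be ga) \<noteq> 0"
  shows "point_tensor l m n r al be ga \<in> tensors_of_rank l m n r"
proof -
  have "tensor_rank l m n (point_tensor l m n r al be ga) = r"
    unfolding tensor_rank_def
    using point_tensor_decomposition rank_lower_bound[OF assms] by (intro Least_equality) blast+
  then show ?thesis using point_tensor_in_space by (simp add: tensors_of_rank_def)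
qed

text \<open>The tensors of rank \<open>r\<close> are parametrized by factors. To meet a given
  nonempty open set, the factors of one of its members are joined by a line to those of the witness.
  Where \<open>pp\<close> is nonzero on the way the rank is exactly \<open>r\<close>, so the path
  has not left the space.\<close>

lemma generically_in_rank:
  assumes nz: "pp (point_tensor l m n r al0 be0 ga0) \<noteq> 0"
    and Q: "\<And>al be ga. pp (point_tensor l m n r al be ga) \<noteq> 0 \<Longrightarrow> Q (point_tensor l m n r al be ga)"
  shows "generically_in (tensors_of_rank l m n r) Q"
  unfolding generically_in_def
proof (intro exI conjI ballI)
  let ?W = "tensors_of_rank l m n r"
  let ?U = "{x \<in> ?W. \<exists>p\<in>{pp}. p x \<noteq> 0}"
  show "zariski_open_in ?W ?U"
    unfolding zariski_open_in_def using pp_poly by (intro exI[of _ "{pp}"]) auto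
  show "zariski_dense_in ?W ?U" unfolding zariski_dense_in_def
  proof (intro conjI allI impI)
    fix V assume V: "zariski_open_in ?W V \<and> V \<noteq> {}"
    then obtain P where P: "P \<subseteq> polyfuns" "V = {x \<in> ?W. \<exists>p\<in>P. p x \<noteq> 0}"
      by (auto simp: zariski_open_in_def)
    then obtain q A where q: "q \<in> P" "A \<in> ?W" "q A \<noteq> 0" using V by blast
    obtain al be ga where A: "A = point_tensor l m n r al be ga"
      using tensors_of_rank_decomposition[OF q(2)] by blast
    \<comment> \<open>Each factor entry moves linearly from its value in the member at parameter 0
      to that in the witness at parameter 1; the tensor entries are cubic in the parameter.\<close>
    define L where "L u v t i = [:u t i, v t i - u t i:]" for u v :: "nat \<Rightarrow> nat \<Rightarrow> complex" and t i
    define c where "c = (\<lambda>(i, j, k). if i \<le> l \<and> j \<le> m \<and> k \<le> n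
        then \<Sum>t<r. L al al0 t i * L be be0 t j * L ga ga0 t k else 0)"
    have c: "(\<lambda>x. poly (c x) z) = point_tensor l m n r (\<lambda>t i. poly (L al al0 t i) z)
        (\<lambda>t i. poly (L be be0 t i) z) (\<lambda>t i. poly (L ga ga0 t i) z)" for z
      by (auto simp: c_def point_tensor_def poly_sum intro!: ext)
    have L: "(\<lambda>t i. poly (L u v t i) 0) = u" "(\<lambda>t i. poly (L u v t i) 1) = v" for u v
      by (auto simp: L_def)
    have "\<exists>z. q (\<lambda>x. poly (c x) z) \<noteq> 0 \<and> pp (\<lambda>x. poly (c x) z) \<noteq> 0"
      using q P pp_poly nz by (intro path_avoids_zeros) (auto simp: c L A)
    then obtain z where z: "q (\<lambda>x. poly (c x) z) \<noteq> 0" "pp (\<lambda>x. poly (c x) z) \<noteq> 0" by blast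
    have "(\<lambda>x. poly (c x) z) \<in> ?W" using z(2) unfolding c by (rule point_tensor_rank)
    then show "?U \<inter> V \<noteq> {}" using z P(2) q(1) by blast
  qed auto
  fix A assume A: "A \<in> ?U"
  then obtain al be ga where "A = point_tensor l m n r al be ga"
    using tensors_of_rank_decomposition by blast
  then show "Q A" using Q A by auto
qed

end

text \<open>A Vandermonde argument: at a suitable point \<open>x\<close> the monomials take distinct
  values, and the coordinatewise powers of \<open>x\<close> give the powers of these values.\<close>

lemma independent_monomials:
  fixes gs :: "(nat \<Rightarrow>\<^sub>0 nat) list"
  assumes dist: "distinct gs" and keys: "\<And>t. t < length gs \<Longrightarrow> keys (gs ! t) \<subseteq> {..m}"
  shows "\<exists>be. (\<forall>i. be i \<in> coord_space {..m}) \<and>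
    det (mat (length gs) (length gs) (\<lambda>(i, t). xpow (gs ! t) (be i))) \<noteq> 0"
proof -
  let ?r = "length gs"
  define I where "I = {(s, t). s < ?r \<and> t < ?r \<and> s \<noteq> t}"
  have fin: "finite I" by (rule finite_subset[of _ "{..<?r} \<times> {..<?r}"]) (auto simp: I_def)
  let ?f = "\<lambda>(s, t) x. xpow (gs ! s) x - xpow (gs ! t) x"
  have xpow_poly: "(\<lambda>x. xpow a x) \<in> polyfuns" for a
    unfolding xpow_def by (intro polyfuns_prod polyfuns_power polyfuns.coord)
  have "\<exists>x\<in>coord_space {..m}. (\<Prod>p\<in>I. ?f p x) \<noteq> 0"
  proof (rule nonvanishing_prod[OF fin])
    show "?f p \<in> polyfuns" for p
      by (cases p) (simp add: polyfuns_diff xpow_poly)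
    fix p assume "p \<in> I"
    then obtain s t where p: "p = (s, t)" "s < ?r" "t < ?r" "s \<noteq> t" by (auto simp: I_def)
    then have "gs ! s \<noteq> gs ! t" using dist by (simp add: nth_eq_iff_index_eq)
    then obtain k where k: "lookup (gs ! s) k \<noteq> lookup (gs ! t) k" by (metis poly_mapping_eqI)
    then have "k \<in> keys (gs ! s) \<or> k \<in> keys (gs ! t)" by (auto simp: in_keys_iff)
    then have km: "k \<le> m" using keys p by blast
    \<comment> \<open>Two monomials with different exponents of the variable \<open>k\<close> take
      different powers of 2 as values here.\<close>
    let ?x = "\<lambda>j. if j = k then 2 else if j \<le> m then 1 else (0 :: complex)"
    have x: "xpow (gs ! u) ?x = 2 ^ lookup (gs ! u) k" if "u < ?r" for u
    proof -
      have "xpow (gs ! u) ?x = (\<Prod>j\<in>{..m}. ?x j ^ lookup (gs ! u) j)"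
        using keys[OF that] by (intro xpow_superset) auto
      also have "\<dots> = (\<Prod>j\<in>{..m}. if j = k then 2 ^ lookup (gs ! u) k else 1)"
        by (intro prod.cong) auto
      finally show ?thesis using km by simp
    qed
    have "(2 :: complex) ^ lookup (gs ! s) k \<noteq> 2 ^ lookup (gs ! t) k"
    proof
      assume "(2 :: complex) ^ lookup (gs ! s) k = 2 ^ lookup (gs ! t) k"
      then have "cmod (2 ^ lookup (gs ! s) k) = cmod (2 ^ lookup (gs ! t) k)" by simp
      then show False using k by (simp add: norm_power)
    qed
    then have "?f p ?x \<noteq> 0" using x[OF p(2)] x[OF p(3)] by (simp add: p(1))
    moreover have "?x \<in> coord_space {..m}" using km by (auto simp: coord_space_def)
    ultimately show "\<exists>x\<in>coord_space {..m}. ?f p x \<noteq> 0" by blast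
  qed
  then obtain x where x: "x \<in> coord_space {..m}" "(\<Prod>p\<in>I. ?f p x) \<noteq> 0" by blast
  have nz: "?f p x \<noteq> 0" if "p \<in> I" for p
    using x(2) that unfolding prod_zero_iff[OF fin] by blast
  have inj: "inj_on (\<lambda>t. xpow (gs ! t) x) {..<?r}"
  proof (rule inj_onI, rule ccontr)
    fix s t assume "s \<in> {..<?r}" "t \<in> {..<?r}" "xpow (gs ! s) x = xpow (gs ! t) x" "s \<noteq> t"
    then show False using nz[of "(s, t)"] by (simp add: I_def)
  qed
  define be where "be i k = (if k \<le> m then x k ^ i else 0)" for i k :: nat
  have be: "xpow (gs ! t) (be i) = (xpow (gs ! t) x) ^ i" if "t < ?r" for t i
    unfolding xpow_def prod_power_distrib using keys[OF that]
    by (intro prod.cong) (auto simp: be_def power_mult[symmetric] mult.commute)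
  have "det (mat ?r ?r (\<lambda>(i, t). xpow (gs ! t) (be i))) \<noteq> 0"
    unfolding det_nonzero_iff_left
  proof (intro allI impI)
    fix c i assume c: "\<forall>t<?r. (\<Sum>i<?r. c i * xpow (gs ! t) (be i)) = 0" and i: "i < ?r"
    \<comment> \<open>A relation among the rows is a polynomial of degree below \<open>?r\<close>
      with \<open>?r\<close> distinct roots.\<close>
    define q where "q = (\<Sum>i<?r. Polynomial.monom (c i) i)"
    have coeff: "coeff q i = (if i < ?r then c i else 0)" for i
      by (simp add: q_def coeff_sum)
    have root: "poly q (xpow (gs ! t) x) = 0" if "t < ?r" for t
    proof -
      have "(\<Sum>i<?r. c i * xpow (gs ! t) (be i)) = 0" using c that by blast
      then show ?thesis by (simp add: q_def poly_sum poly_monom be[OF that])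
    qed
    have "q = 0"
    proof (rule ccontr)
      assume q: "q \<noteq> 0"
      have "degree q < ?r" using i coeff by (intro degree_lessI) auto
      moreover have "card ((\<lambda>t. xpow (gs ! t) x) ` {..<?r}) \<le> card {z. poly q z = 0}"
        using root by (intro card_mono poly_roots_finite[OF q]) auto
      moreover have "card {z. poly q z = 0} \<le> degree q" by (rule card_poly_roots_bound[OF q])
      ultimately show False using card_image[OF inj] by simp
    qed
    then show "c i = 0" using coeff[of i] i by simp
  qed
  moreover have "be i \<in> coord_space {..m}" for i by (auto simp: coord_space_def be_def)
  ultimately show ?thesis by blast
qed

text \<open>Column pivoting selects \<open>r\<close> columns forming an invertible block; its
  inverse, padded with zero rows, is the right inverse.\<close>

lemma right_inverse_of_independent_rows:
  fixes E :: "nat \<Rightarrow> nat \<Rightarrow> complex"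
  assumes K: "0 < K" and ind: "\<And>c. (\<And>j. j < K \<Longrightarrow> (\<Sum>i<r. c i * E i j) = 0) \<Longrightarrow> \<forall>i<r. c i = 0"
  shows "\<exists>B. \<forall>t<r. \<forall>s<r. (\<Sum>c<K. E t c * B c s) = of_bool (t = s)"
proof -
  let ?N = "mat r K (\<lambda>(i, j). E i j)"
  let ?js = "fst (qr_pivotsT r ?N)"
  have dim: "dim_row ?N = r" "dim_col ?N = K" by simp_all
  have rank: "\<forall>i<dim_row ?N. u i = 0"
    if "\<And>j. j < dim_col ?N \<Longrightarrow> (\<Sum>i<dim_row ?N. u i * ?N $$ (i, j)) = 0" for u
    using that ind[of u] by simp
  note qr = qr_pivotsT_fst[of ?N, unfolded dim, OF K rank[unfolded dim]]
  have js: "length ?js = r" "set ?js \<subseteq> {..<K}" using qr(1,2) by auto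
  have jt: "?js ! j < K" if "j < r" for j
  proof -
    have "?js ! j \<in> set ?js" using js(1) that by simp
    then show ?thesis using js(2) by blast
  qed
  have "det (mat r r (\<lambda>(t, j). E t (?js ! j))) \<noteq> 0"
    unfolding det_nonzero_iff
  proof (intro allI impI)
    fix c j assume c: "\<forall>i<r. (\<Sum>j<r. E i (?js ! j) * c j) = 0" and j: "j < r"
    have "(\<Sum>j<r. c j * ?N $$ (i, ?js ! j)) = 0" if "i < r" for i
      using c that jt by (simp add: mult.commute)
    then show "c j = 0" using qr(3)[of c] j by blast
  qed
  then obtain B where B: "B \<in> carrier_mat r r" "mat r r (\<lambda>(t, j). E t (?js ! j)) * B = 1\<^sub>m r"
    using det_nonzero_inverse[OF mat_carrier] by metis
  let ?B = "\<lambda>c s. \<Sum>j<r. of_bool (c = ?js ! j) * B $$ (j, s)"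
  have "(\<Sum>c<K. E t c * ?B c s) = of_bool (t = s)" if ts: "t < r" "s < r" for t s
  proof -
    have "(\<Sum>c<K. E t c * ?B c s) = (\<Sum>j<r. \<Sum>c<K. E t c * of_bool (c = ?js ! j) * B $$ (j, s))"
      unfolding sum_distrib_left by (subst sum.swap) (simp only: mult.assoc)
    also have "\<dots> = (\<Sum>j<r. E t (?js ! j) * B $$ (j, s))"
    proof (rule sum.cong[OF refl])
      fix j assume "j \<in> {..<r}"
      then have "?js ! j < K" using jt by simp
      moreover have "(\<Sum>c<K. E t c * of_bool (c = ?js ! j) * B $$ (j, s)) =
          (\<Sum>c<K. if c = ?js ! j then E t (?js ! j) * B $$ (j, s) else 0)"
        by (intro sum.cong) auto
      ultimately show "(\<Sum>c<K. E t c * of_bool (c = ?js ! j) * B $$ (j, s)) = E t (?js ! j) * B $$ (j, s)"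
        by simp
    qed
    also have "\<dots> = (mat r r (\<lambda>(t, j). E t (?js ! j)) * B) $$ (t, s)"
      using ts B(1) by (simp add: scalar_prod_def lessThan_atLeast0)
    finally show ?thesis unfolding B(2) using ts by simp
  qed
  then show ?thesis by (intro exI[of _ ?B]) blast
qed

lemma span_image_sum:
  assumes "finite C" "f \<in> bp.span (g ` C)"
  shows "\<exists>b. f = (\<Sum>c\<in>C. pscale (b c) (g c))"
proof -
  let ?S = "{f. \<exists>b. f = (\<Sum>c\<in>C. pscale (b c) (g c))}"
  have "bp.subspace ?S" unfolding bp.subspace_def
  proof (intro conjI ballI allI)
    show "0 \<in> ?S" by (intro CollectI exI[of _ "\<lambda>_. 0"]) simp
  next
    fix x y assume "x \<in> ?S" "y \<in> ?S"
    then obtain a b where "x = (\<Sum>c\<in>C. pscale (a c) (g c))" "y = (\<Sum>c\<in>C. pscale (b c) (g c))" by blast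
    then have "x + y = (\<Sum>c\<in>C. pscale (a c + b c) (g c))" by (simp add: bp.scale_left_distrib sum.distrib)
    then show "x + y \<in> ?S" by (intro CollectI exI[of _ "\<lambda>c. a c + b c"])
  next
    fix z x assume "x \<in> ?S"
    then obtain a where "x = (\<Sum>c\<in>C. pscale (a c) (g c))" by blast
    then have "pscale z x = (\<Sum>c\<in>C. pscale (z * a c) (g c))" by (simp add: bp.scale_sum_right)
    then show "pscale z x \<in> ?S" by (intro CollectI exI[of _ "\<lambda>c. z * a c"])
  qed
  moreover have "g c \<in> ?S" if "c \<in> C" for c
  proof -
    have "(\<Sum>c'\<in>C. pscale (of_bool (c' = c)) (g c')) = (\<Sum>c'\<in>C. if c' = c then g c else 0)"
      by (intro sum.cong) auto
    then have "g c = (\<Sum>c'\<in>C. pscale (of_bool (c' = c)) (g c'))" using assms(1) that by simp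
    then show ?thesis by (intro CollectI exI[of _ "\<lambda>c'. of_bool (c' = c)"])
  qed
  ultimately have "bp.span (g ` C) \<subseteq> ?S" by (intro bp.span_minimal) auto
  then show ?thesis using assms(2) by blast
qed

lemma peval_evrow:
  "f \<in> S_comp m n 1 1 \<Longrightarrow>
    peval f x y = (\<Sum>j<(m + 1) * (n + 1). evrow n x y j * lookup f (monlist m n 1 1 ! j))"
  unfolding peval_S_comp monlist_11_length
  by (intro sum.cong refl) (simp only: meval_monlist_11 lessThan_iff mult.commute)

lemma poly_of_sum:
  "(\<Sum>c\<in>I. pscale (v c) (poly_of ms (g c))) = poly_of ms (\<lambda>q. \<Sum>c\<in>I. v c * g c q)"
proof -
  have single_sum: "single k (\<Sum>t\<in>I. a t) = (\<Sum>t\<in>I. single k (a t))" for k I and a :: "'z \<Rightarrow> complex"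
    by (induction I rule: infinite_finite_induct) (auto simp: single_add)
  show ?thesis unfolding poly_of_def bp.scale_sum_right single_sum pscale_single by (rule sum.swap)
qed

text \<open>The dense set of the conjecture meets the open set where the chosen monomials are
  independent at the points. For this it is enough that the latter is nonempty.\<close>

lemma general_points:
  assumes conj: "regularity_conjecture" and d: "2 \<le> d" and mn: "0 < m" "0 < n"
    and rb: "ereal (real r) \<le> min (reg_bound m n d 1) (ereal (real (m * n)))"
    and gs: "length gs = r" "distinct gs" "\<And>t. t < r \<Longrightarrow> keys (gs ! t) \<subseteq> {..m}" "\<And>t. t < r \<Longrightarrow> mdeg (gs ! t) = d"
  shows "\<exists>z. indep_evaluations m n r z \<and> HF_quot m n (ideal_J m n r z) d 1 = r \<and>
    det (mat r r (\<lambda>(i, t). z (i, Inr 0) * xpow (gs ! t) (\<lambda>k. z (i, Inl k)))) \<noteq> 0"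
proof -
  obtain U where U: "zariski_dense_in (configs m n r) U"
    "\<And>z. z \<in> U \<Longrightarrow> indep_evaluations m n r z \<and> HF_quot m n (ideal_J m n r z) d 1 = r"
    using conj[unfolded regularity_conjecture_def, rule_format, of d m n r] d mn rb by auto
  define q where "q z = det (mat r r (\<lambda>(i, t). z (i, Inr 0) * xpow (gs ! t) (\<lambda>k. z (i, Inl k))))"
    for z :: "nat \<times> (nat + nat) \<Rightarrow> complex"
  have q_poly: "q \<in> polyfuns" unfolding q_def[abs_def] xpow_def
    by (intro polyfuns_det polyfuns.mult polyfuns.coord polyfuns_prod polyfuns_power)
  let ?V = "{z \<in> configs m n r. \<exists>p\<in>{q}. p z \<noteq> 0}"
  obtain be where be: "\<And>i. be i \<in> coord_space {..m}" "det (mat r r (\<lambda>(i, t). xpow (gs ! t) (be i))) \<noteq> 0"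
    using independent_monomials[OF gs(2), of m] gs(1,3) by auto
  \<comment> \<open>Each monomial has positive degree and vanishes at the origin, so a zero vector
    would give a zero row.\<close>
  have nz: "\<exists>k. be i k \<noteq> 0" if i: "i < r" for i
  proof (rule ccontr)
    assume "\<not> ?thesis"
    then have z: "be i k = 0" for k by simp
    have "xpow (gs ! t) (be i) = 0" if t: "t < r" for t
    proof -
      have "keys (gs ! t) \<noteq> {}" using gs(4)[OF t] d by (auto simp: mdeg_def)
      then obtain k where "k \<in> keys (gs ! t)" by blast
      then show ?thesis unfolding xpow_def by (intro prod_zero) (auto simp: z in_keys_iff)
    qed
    then have "(\<Sum>j<r. of_bool (j = i) * xpow (gs ! t) (be j)) = 0" if "t < r" for t
      using that by (intro sum.neutral) auto
    then have "(of_bool (i = i) :: complex) = 0"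
      using be(2)[unfolded det_nonzero_iff_left, THEN spec[of _ "\<lambda>j. of_bool (j = i)"]] i by blast
    then show False by simp
  qed
  \<comment> \<open>All points share the second factor (1, 0, ..., 0), so \<open>y_0 = 1\<close> and
    \<open>q z0\<close> is the determinant of the monomial values.\<close>
  define z0 where "z0 = (\<lambda>(i, x). if i < r then (case x of Inl k \<Rightarrow> be i k | Inr c \<Rightarrow> of_bool (c = (0 :: nat))) else 0)"
  have z0: "z0 (i, Inl k) = be i k" "z0 (i, Inr c) = of_bool (c = 0)" if "i < r" for i k c
    using that by (auto simp: z0_def)
  have "z0 \<in> configs m n r"
  proof -
    have "z0 \<in> coord_space ({..<r} \<times> (Inl ` {..m} \<union> Inr ` {..n}))"
      using be(1) by (auto simp: coord_space_def z0_def split: sum.splits)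
    moreover have "config_pt z0 i \<in> hcoords m \<times> hcoords n" if i: "i < r" for i
    proof -
      have "(\<lambda>c. of_bool (c = (0 :: nat))) \<in> hcoords n" by (auto simp: hcoords_def coord_space_def)
      then show ?thesis using be(1) nz[OF i] by (auto simp: config_pt_def z0[OF i] hcoords_def)
    qed
    ultimately show ?thesis by (simp add: configs_def)
  qed
  moreover have "mat r r (\<lambda>(i, t). z0 (i, Inr 0) * xpow (gs ! t) (\<lambda>k. z0 (i, Inl k))) =
      mat r r (\<lambda>(i, t). xpow (gs ! t) (be i))"
    by (intro eq_matI) (auto simp: z0)
  then have "q z0 \<noteq> 0" using be(2) by (simp add: q_def)
  ultimately have "?V \<noteq> {}" by blast
  moreover have "zariski_open_in (configs m n r) ?V"
    unfolding zariski_open_in_def using q_poly by (intro exI[of _ "{q}"]) auto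
  ultimately have "U \<inter> ?V \<noteq> {}" using U(1) unfolding zariski_dense_in_def by blast
  then obtain z where "z \<in> U" "q z \<noteq> 0" by blast
  then show ?thesis using U(2) unfolding q_def by blast
qed

text \<open>With unit vectors as \<alpha> and a right inverse of the evaluations as
  \<open>B2\<close>, the matrix \<open>Sm\<close> is the identity and the kernel columns form the
  projection onto the forms vanishing at the points. What remains is a dimension count in degree
  (d,1).\<close>

lemma exists_general_position:
  assumes conj: "regularity_conjecture" and d: "2 \<le> d" and mn: "0 < m" "0 < n" and rl: "r \<le> l + 1"
    and rb: "ereal (real r) \<le> min (reg_bound m n d 1) (ereal (real (m * n)))"
    and gs: "length gs = r" "distinct gs" "\<And>t. t < r \<Longrightarrow> keys (gs ! t) \<subseteq> {..m}" "\<And>t. t < r \<Longrightarrow> mdeg (gs ! t) = d"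
    and gs_lin: "\<And>t. r \<le> m + 1 \<Longrightarrow> t < r \<Longrightarrow> gs ! t = var_x t + single 0 (d - 1)"
  shows "\<exists>B2 Bm al be ga. open_cond.pp m n r d gs B2 Bm (point_tensor l m n r al be ga) \<noteq> 0"
proof -
  obtain z where ind: "indep_evaluations m n r z" and HF: "HF_quot m n (ideal_J m n r z) d 1 = r"
    and Gam: "det (mat r r (\<lambda>(i, t). z (i, Inr 0) * xpow (gs ! t) (\<lambda>k. z (i, Inl k)))) \<noteq> 0"
    using general_points[OF conj d mn rb gs] by blast
  define be where "be t k = z (t, Inl k)" for t k
  define ga where "ga t c = z (t, Inr c)" for t c
  have pt: "fst (config_pt z t) = be t" "snd (config_pt z t) = ga t" for t
    by (simp_all add: config_pt_def be_def[abs_def] ga_def[abs_def])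
  let ?K = "(m + 1) * (n + 1)" and ?ms11 = "monlist m n 1 1" and ?ms = "monlist m n d 1"
  let ?Ev = "\<lambda>t. evrow n (be t) (ga t)" and ?FF = "points_span m n r be ga"
  have "\<exists>B. \<forall>t<r. \<forall>s<r. (\<Sum>c<?K. ?Ev t c * B c s) = of_bool (t = s)"
  proof (rule right_inverse_of_independent_rows)
    show "\<forall>i<r. c i = 0" if c: "\<And>j. j < ?K \<Longrightarrow> (\<Sum>i<r. c i * ?Ev i j) = 0" for c
    proof -
      have "(\<Sum>i<r. c i * peval f (be i) (ga i)) = 0" if f: "f \<in> S_comp m n 1 1" for f
      proof -
        have "(\<Sum>i<r. c i * peval f (be i) (ga i)) =
            (\<Sum>j<?K. \<Sum>i<r. c i * ?Ev i j * lookup f (?ms11 ! j))"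
          unfolding peval_evrow[OF f] sum_distrib_left by (subst sum.swap) (simp only: mult.assoc)
        also have "\<dots> = (\<Sum>j<?K. (\<Sum>i<r. c i * ?Ev i j) * lookup f (?ms11 ! j))"
          by (simp only: sum_distrib_right)
        also have "\<dots> = 0" using c by (intro sum.neutral ballI) (simp only: lessThan_iff mult_zero_left)
        finally show ?thesis .
      qed
      then show ?thesis using ind unfolding indep_evaluations_def pt by blast
    qed
  qed simp
  then obtain B2 where B2: "\<And>t s. t < r \<Longrightarrow> s < r \<Longrightarrow> (\<Sum>c<?K. ?Ev t c * B2 c s) = of_bool (t = s)" by blast
  \<comment> \<open>\<open>Bm\<close> enters only \<open>p2\<close>; the columns are studied with a
    zero multiplier, and the final one is built from them.\<close>
  interpret o0: open_cond l m n r d gs B2 "\<lambda>_ _. 0"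
    using d rl gs gs_lin by unfold_locales auto
  define al where "al t i = (of_bool (t = i) :: complex)" for t i :: nat
  define A where "A = point_tensor l m n r al be ga"
  have VV: "o0.VV be ga t a = of_bool (t = a)" if "t < r" "a < r" for t a
    unfolding o0.VV_def using B2[OF that] .
  have Sm: "o0.Sm A = 1\<^sub>m r"
  proof (rule eq_matI)
    fix b a assume "b < dim_row (1\<^sub>m r :: complex mat)" "a < dim_col (1\<^sub>m r :: complex mat)"
    then have ba: "b < r" "a < r" by auto
    have "o0.Sm A $$ (b, a) = (\<Sum>t<r. if t = b then o0.VV be ga b a else 0)"
      unfolding A_def o0.Sm_point_tensor[OF ba] by (intro sum.cong) (auto simp: al_def)
    then show "o0.Sm A $$ (b, a) = 1\<^sub>m r $$ (b, a)" using ba by (simp add: VV)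
  qed (simp_all add: o0.Sm_def)
  have p1: "o0.p1 A = 1" by (simp add: o0.p1_def Sm)
  have adj: "adj_mat (o0.Sm A) = 1\<^sub>m r"
  proof -
    note a = adj_mat[OF one_carrier_mat[of r, where 'a = complex]]
    have "adj_mat (1\<^sub>m r :: complex mat) = 1\<^sub>m r * adj_mat (1\<^sub>m r)"
      by (rule left_mult_one_mat[OF a(1), symmetric])
    also have "\<dots> = 1\<^sub>m r" unfolding a(2) by (intro eq_matI) auto
    finally show ?thesis by (simp only: Sm)
  qed
  have A1: "o0.A1 A b c = ?Ev b c" if "b < r" "c < ?K" for b c
  proof -
    have b: "b \<le> l" using that rl by simp
    have "o0.A1 A b c = (\<Sum>t<r. if t = b then ?Ev b c else 0)"
      unfolding A_def o0.A1_point_tensor[OF b that(2)] by (intro sum.cong) (auto simp: al_def)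
    then show ?thesis using that by simp
  qed
  have kco: "o0.kco A q c = of_bool (q = c) - (\<Sum>a<r. B2 q a * ?Ev a c)" if c: "c < ?K" for q c
  proof -
    have "(\<Sum>a<r. \<Sum>b<r. B2 q a * 1\<^sub>m r $$ (a, b) * o0.A1 A b c) = (\<Sum>a<r. B2 q a * ?Ev a c)"
    proof (rule sum.cong[OF refl])
      fix a assume "a \<in> {..<r}"
      then have a: "a < r" by simp
      have "(\<Sum>b<r. B2 q a * 1\<^sub>m r $$ (a, b) * o0.A1 A b c) = (\<Sum>b<r. if b = a then B2 q a * o0.A1 A a c else 0)"
        using a by (intro sum.cong) auto
      then show "(\<Sum>b<r. B2 q a * 1\<^sub>m r $$ (a, b) * o0.A1 A b c) = B2 q a * ?Ev a c"
        using a A1[OF a c] by simp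
    qed
    then show ?thesis unfolding o0.kco_def adj p1 by simp
  qed
  \<comment> \<open>The projection fixes every form vanishing at the points, so the columns
    \<open>kp\<close> span these forms.\<close>
  have FF_kp: "f = (\<Sum>c<?K. pscale (lookup f (?ms11 ! c)) (o0.kp A c))" if f: "f \<in> ?FF" for f
  proof -
    let ?v = "\<lambda>c. lookup f (?ms11 ! c)"
    have fS: "f \<in> S_comp m n 1 1" using f by (simp add: points_span_def)
    have z: "(\<Sum>c<?K. ?Ev a c * ?v c) = 0" if "a < r" for a
      using f that unfolding peval_evrow[OF fS, symmetric] by (simp add: points_span_def)
    have "(\<Sum>c<?K. ?v c * o0.kco A q c) = ?v q" if q: "q < ?K" for q
    proof -
      have "(\<Sum>c<?K. ?v c * o0.kco A q c) = (\<Sum>c<?K. ?v c * of_bool (q = c)) - (\<Sum>c<?K. \<Sum>a<r. B2 q a * (?Ev a c * ?v c))"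
        unfolding sum_subtractf[symmetric]
        by (intro sum.cong refl) (simp only: kco lessThan_iff right_diff_distrib sum_distrib_left mult_ac)
      also have "(\<Sum>c<?K. \<Sum>a<r. B2 q a * (?Ev a c * ?v c)) = (\<Sum>a<r. B2 q a * (\<Sum>c<?K. ?Ev a c * ?v c))"
        by (subst sum.swap) (simp only: sum_distrib_left)
      also have "\<dots> = 0" using z by simp
      also have "(\<Sum>c<?K. ?v c * of_bool (q = c)) = (\<Sum>c<?K. if c = q then ?v q else 0)"
        by (intro sum.cong) auto
      finally show ?thesis using q by (simp del: mult_Suc mult_Suc_right)
    qed
    then have "poly_of ?ms11 (\<lambda>q. \<Sum>c<?K. ?v c * o0.kco A q c) = poly_of ?ms11 ?v"
      unfolding poly_of_def monlist_11_length by (intro sum.cong refl) (simp only: lessThan_iff)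
    then show ?thesis unfolding o0.kp_def poly_of_sum poly_of_lookup[OF fS] by simp
  qed
  let ?P = "mult_span m n d ?FF" and ?S = "S_comp m n d 1" and ?C = "bp.span (o0.colp A ` o0.CI)"
  have P_sub: "?P \<subseteq> ?C" unfolding mult_span_def
  proof (intro bp.span_minimal bp.subspace_span subsetI)
    fix h assume "h \<in> {monom k * f |k f. k \<in> set (monlist m n (d - 1) 0) \<and> f \<in> ?FF}"
    then obtain k f where h: "h = monom k * f" "k \<in> set (monlist m n (d - 1) 0)" "f \<in> ?FF" by blast
    have "h = monom k * (\<Sum>c<?K. pscale (lookup f (?ms11 ! c)) (o0.kp A c))"
      using FF_kp[OF h(3)] h(1) by simp
    also have "\<dots> = (\<Sum>c<?K. pscale (lookup f (?ms11 ! c)) (o0.colp A (Inl (k, c))))"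
      by (simp only: sum_distrib_left pscale_mult o0.colp_def sum.case prod.case)
    also have "\<dots> \<in> ?C"
      using h(2) by (intro bp.span_sum bp.span_scale bp.span_base imageI) (auto simp: o0.CI_def)
    finally show "h \<in> ?C" .
  qed
  have J: "ideal_J m n r z \<inter> ?S = ?P"
  proof -
    have "ideal_J m n r z = ideal_gen m n ?FF" by (simp add: ideal_J_def points_span_def pt)
    then show ?thesis using d by (simp only:) (intro ideal_gen_S_comp, auto simp: points_span_def)
  qed
  have P_S: "?P \<subseteq> ?S" using J by blast
  have P_zero: "peval f (be t) (ga t) = 0" if "f \<in> ?P" "t < r" for f t
  proof -
    have "?P \<subseteq> {f. peval f (be t) (ga t) = 0}" unfolding mult_span_def using that(2)
      by (intro bp.span_minimal) (auto simp: bp.subspace_def points_span_def)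
    then show ?thesis using that(1) by blast
  qed
  obtain B where B: "B \<subseteq> ?P" "bp.independent B" "?P \<subseteq> bp.span B" "card B = bp.dim ?P"
    using bp.basis_exists[of ?P] by metis
  have finB: "finite B" using independent_S_comp_card(1)[OF B(2), of m n d 1] B(1) P_S by blast
  \<comment> \<open>The inverse \<open>Gi\<close> of the matrix of monomial values turns the
    evaluations into functionals dual to the fixed monomials.\<close>
  define Gm where "Gm = mat r r (\<lambda>(i, t). z (i, Inr 0) * xpow (gs ! t) (\<lambda>k. z (i, Inl k)))"
  obtain Gi where Gi: "Gi \<in> carrier_mat r r" "Gi * Gm = 1\<^sub>m r"
    by (rule det_nonzero_inverse[OF mat_carrier Gam, folded Gm_def]) blast
  let ?L = "\<lambda>t f. \<Sum>i<r. Gi $$ (t, i) * peval f (be i) (ga i)"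
  let ?H = "\<lambda>t. o0.colp A (Inr t)"
  have H: "peval (?H t) (be i) (ga i) = Gm $$ (i, t)" if "i < r" "t < r" for i t
  proof -
    have "be i = (\<lambda>k. z (i, Inl k))" by (simp add: be_def[abs_def])
    then show ?thesis using that by (simp add: o0.colp_def meval_def Gm_def ga_def mult.commute)
  qed
  have ext: "bp.independent (B \<union> ?H ` {..<r}) \<and> card (B \<union> ?H ` {..<r}) = card B + r"
  proof (rule independent_extend_dual[OF B(2) finB, where L = ?L])
    show "?L t f = 0" if "f \<in> B" "t < r" for f t
      using that P_zero B(1) by (intro sum.neutral) auto
    show "?L t (f + g) = ?L t f + ?L t g" for t f g by (simp add: distrib_left sum.distrib)
    show "?L t (pscale c f) = c * ?L t f" for t c f by (simp add: sum_distrib_left mult.left_commute)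
    show "?L t (?H s) = of_bool (s = t)" if "s < r" "t < r" for s t
    proof -
      have "?L t (?H s) = (\<Sum>i<r. Gi $$ (t, i) * Gm $$ (i, s))"
        using that by (intro sum.cong refl) (simp add: H)
      also have "\<dots> = (Gi * Gm) $$ (t, s)"
        using that Gi(1) by (simp add: scalar_prod_def lessThan_atLeast0 Gm_def)
      finally show ?thesis unfolding Gi(2) using that by auto
    qed
  qed
  \<comment> \<open>Because of the truncated subtraction in \<open>HF_quot\<close> only this
    inequality follows; it is the direction required.\<close>
  have "bp.dim ?P + r \<ge> HF_S m n d 1" using HF unfolding HF_quot_def J HF_S_def by simp
  then have card: "HF_S m n d 1 \<le> card (B \<union> ?H ` {..<r})" using ext B(4) by simp
  have H_C: "?H t \<in> o0.colp A ` o0.CI" "?H t \<in> ?S" if "t < r" for t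
  proof -
    have "Inr t \<in> o0.CI" using that by (simp add: o0.CI_def)
    then show "?H t \<in> o0.colp A ` o0.CI" "?H t \<in> ?S" using o0.colp_S_comp by auto
  qed
  have S_sub: "?S \<subseteq> ?C"
  proof -
    have "B \<union> ?H ` {..<r} \<subseteq> ?C" using B(1) P_sub H_C(1) bp.span_base by auto
    then have 1: "bp.span (B \<union> ?H ` {..<r}) \<subseteq> ?C" by (intro bp.span_minimal bp.subspace_span)
    \<comment> \<open>The independent set already has at least as many elements as the dimension of
      the graded piece, so nothing can be added to it.\<close>
    have "f \<in> bp.span (B \<union> ?H ` {..<r})" if f: "f \<in> ?S" for f
    proof (rule ccontr)
      assume nf: "f \<notin> bp.span (B \<union> ?H ` {..<r})"
      then have "bp.independent (insert f (B \<union> ?H ` {..<r}))"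
        using ext by (intro bp.independent_insertI) auto
      moreover have "insert f (B \<union> ?H ` {..<r}) \<subseteq> ?S" using f B(1) P_S H_C(2) by auto
      ultimately have "card (insert f (B \<union> ?H ` {..<r})) \<le> HF_S m n d 1"
        by (rule independent_S_comp_card(2))
      moreover have "f \<notin> B \<union> ?H ` {..<r}" using nf by (metis bp.span_base)
      moreover have "finite (B \<union> ?H ` {..<r})" using finB by simp
      moreover from calculation(2,3) have "card (insert f (B \<union> ?H ` {..<r})) = Suc (card (B \<union> ?H ` {..<r}))"
        by (intro card_insert_disjoint)
      ultimately show False using card by linarith
    qed
    then show ?thesis using 1 by blast
  qed
  have ex: "\<exists>b. monom (?ms ! j) = (\<Sum>c\<in>o0.CI. pscale (b c) (o0.colp A c))" if "j < length ?ms" for j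
    using that S_sub monom_S_comp[of "?ms ! j" m n d 1] by (intro span_image_sum[OF o0.CI_finite]) auto
  define b where "b j = (SOME b. monom (?ms ! j) = (\<Sum>c\<in>o0.CI. pscale (b c) (o0.colp A c)))" for j
  have b: "monom (?ms ! j) = (\<Sum>c\<in>o0.CI. pscale (b j c) (o0.colp A c))" if "j < length ?ms" for j
    unfolding b_def by (rule someI_ex[OF ex[OF that]])
  \<comment> \<open>The coefficients expressing the monomials of degree (d,1) by the columns form a
    right inverse, so \<open>p2\<close> takes the value 1.\<close>
  define Bm where "Bm c j = b j c" for c j
  interpret o1: open_cond l m n r d gs B2 Bm by unfold_locales
  have "mat (length ?ms) (length ?ms) (\<lambda>(i, j). \<Sum>x\<in>o0.CI. lookup (o0.colp A x) (?ms ! i) * Bm x j) = 1\<^sub>m (length ?ms)"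
  proof (rule eq_matI)
    fix i j assume "i < dim_row (1\<^sub>m (length ?ms) :: complex mat)" "j < dim_col (1\<^sub>m (length ?ms) :: complex mat)"
    then have ij: "i < length ?ms" "j < length ?ms" by auto
    have "(\<Sum>x\<in>o0.CI. lookup (o0.colp A x) (?ms ! i) * Bm x j) = lookup (\<Sum>c\<in>o0.CI. pscale (b j c) (o0.colp A c)) (?ms ! i)"
      by (simp add: lookup_sum Bm_def mult.commute)
    also have "\<dots> = of_bool (i = j)"
      unfolding b[OF ij(2), symmetric] Defs.monom_def lookup_single when_def
      using ij nth_eq_iff_index_eq[OF monlist_distinct] by auto
    finally show "mat (length ?ms) (length ?ms) (\<lambda>(i, j). \<Sum>x\<in>o0.CI. lookup (o0.colp A x) (?ms ! i) * Bm x j) $$ (i, j) =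
        1\<^sub>m (length ?ms) $$ (i, j)" using ij by simp
  qed simp_all
  then have "o1.pp A = 1" by (simp add: o1.pp_def o1.p2_def p1)
  then have "o1.pp (point_tensor l m n r al be ga) \<noteq> 0" by (simp add: A_def)
  then show ?thesis by blast
qed

section \<open>The complexity of the algorithm\<close>

text \<open>With \<open>H\<close> and \<open>C\<close> the numbers of monomials in x of degrees d -
  1 and d, the relation d C = (m + d) H reduces the numerator of the bound to (n + 1) H m (1 - 1/d);
  dividing by H - 1 only helps.\<close>

lemma reg_bound_ge:
  assumes d: "2 \<le> d" and mn: "0 < m" "0 < n"
  shows "ereal (real m * real n * (1 - 1 / real d)) \<le> reg_bound m n d 1"
proof -
  define H where "H = real ((m + (d - 1)) choose (d - 1))"
  define C where "C = real ((m + d) choose d)"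
  \<comment> \<open>Pascal's rule with two positive summands gives \<open>H > 1\<close>, hence a
    positive denominator; this is where \<open>d \<ge> 2\<close> and \<open>m > 0\<close>
    enter.\<close>
  obtain e where e: "d = Suc (Suc e)" using d by (metis add_2_eq_Suc le_Suc_ex)
  obtain m' where m': "m = Suc m'" using mn(1) gr0_implies_Suc by blast
  have "(m + (d - 1)) choose (d - 1) = ((m' + Suc e) choose e) + ((m' + Suc e) choose Suc e)"
    by (simp add: e m')
  moreover have "0 < (m' + Suc e) choose e" "0 < (m' + Suc e) choose Suc e" by (simp_all add: zero_less_binomial)
  ultimately have H1: "H > 1" unfolding H_def by linarith
  have "Suc (d - 1) * ((m + d) choose d) = (m + d) * ((m + (d - 1)) choose (d - 1))"
    using Suc_times_binomial_eq[of "m + (d - 1)" "d - 1"] d by simp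
  then have "real d * C = real (m + d) * H" using d unfolding C_def H_def by (metis One_nat_def Suc_diff_1 of_nat_mult order_less_le_trans pos2)
  then have C: "C = (real m + real d) * H / real d" using d by (simp add: field_simps)
  have HF: "real (HF_S m n 1 1) = (real m + 1) * (real n + 1)" "real (HF_S m n (d - 1) (1 - 1)) = H"
    "real (HF_S m n d 1) = C * (real n + 1)"
    by (simp_all add: HF_S_eq monlist_length H_def C_def algebra_simps)
  have "(real m + 1) * (real n + 1) * H - C * (real n + 1) = (real n + 1) * H * (real m * (1 - 1 / real d))"
    using d by (simp add: C field_simps)
  moreover have "real m * real n * (1 - 1 / real d) * (H - 1) \<le> (real n + 1) * H * (real m * (1 - 1 / real d))"
  proof -
    have "real n * (H - 1) \<le> (real n + 1) * H" using H1 by (simp add: algebra_simps)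
    then have "real n * (H - 1) * (real m * (1 - 1 / real d)) \<le> (real n + 1) * H * (real m * (1 - 1 / real d))"
      using d by (intro mult_right_mono) auto
    then show ?thesis by (simp only: mult_ac)
  qed
  ultimately have "real m * real n * (1 - 1 / real d) \<le> ((real m + 1) * (real n + 1) * H - C * (real n + 1)) / (H - 1)"
    using H1 by (simp add: pos_le_divide_eq)
  moreover have "(d, 1 :: nat) \<noteq> (1, 1)" using d by simp
  ultimately show ?thesis unfolding reg_bound_def HF by simp
qed

text \<open>There must be \<open>r\<close> distinct monomials of degree \<open>d\<close> in x. For d
  = 2 the factor 1 - 1/d is one half and half of m^2 is below the binomial coefficient; for larger d
  already m^2 is below the value at d = 3.\<close>

lemma enough_monomials:
  assumes d: "2 \<le> d" and nm: "n \<le> m" and r: "real r \<le> real m * real n * (1 - 1 / real d)"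
  shows "r \<le> (m + d) choose d"
proof -
  have c1: "2 * ((m + 2) choose 2) = (m + 2) * (m + 1)"
    using Suc_times_binomial_eq[of "m + 1" 1] by (simp add: numeral_2_eq_2)
  have c2: "3 * ((m + 3) choose 3) = (m + 3) * ((m + 2) choose 2)"
    using Suc_times_binomial_eq[of "m + 2" 2] by (simp add: numeral_3_eq_3)
  have mn: "real m * real n \<le> real m * real m" using nm by (intro mult_left_mono) auto
  show ?thesis
  proof (cases "d = 2")
    case True
    then have "2 * real r \<le> real m * real m" using r mn by simp
    then have "2 * r \<le> m * m" by (metis of_nat_le_iff of_nat_mult of_nat_numeral)
    also have "\<dots> \<le> 2 * ((m + 2) choose 2)" unfolding c1 by simp
    finally show ?thesis by (simp add: True)
  next
    case False
    then have d3: "3 \<le> d" using d by simp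
    have "1 - 1 / real d \<le> 1" by simp
    then have "real m * real n * (1 - 1 / real d) \<le> real m * real n * 1" by (intro mult_left_mono) auto
    then have "real r \<le> real (m * m)" using r mn by simp
    then have "r \<le> m * m" by (simp only: of_nat_le_iff)
    also have "\<dots> \<le> (m + 3) choose 3"
    proof -
      have "6 * ((m + 3) choose 3) = 2 * (3 * ((m + 3) choose 3))" by simp
      also have "\<dots> = (m + 3) * (2 * ((m + 2) choose 2))" unfolding c2 by (rule mult.left_commute)
      also have "\<dots> = (m + 3) * ((m + 2) * (m + 1))" by (simp only: c1)
      also have "\<dots> = m * m * m + 6 * (m * m) + 11 * m + 6" by (simp add: algebra_simps)
      finally show ?thesis by simp
    qed
    also have "\<dots> = (m + 3) choose m" using binomial_symmetric[of m "m + 3"] by simp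
    also have "\<dots> \<le> (m + d) choose m" using d3 by (intro binomial_right_mono) simp
    also have "\<dots> = (m + d) choose d" using binomial_symmetric[of m "m + d"] by simp
    finally show ?thesis .
  qed
qed

text \<open>For small \<open>r\<close> the monomials are prescribed as \<open>x_t x_0^(d-1)\<close>,
  so that their independence at the points implies that of the \<beta>; otherwise any selection will
  do.\<close>

lemma exponents_exist:
  assumes d: "2 \<le> d" and r: "r \<le> (m + d) choose d"
  shows "\<exists>gs. length gs = r \<and> distinct gs \<and> (\<forall>t<r. keys (gs ! t) \<subseteq> {..m} \<and> mdeg (gs ! t) = d) \<and>
    (r \<le> m + 1 \<longrightarrow> (\<forall>t<r. gs ! t = var_x t + single 0 (d - 1)))"
proof (cases "r \<le> m + 1")
  case True
  let ?gs = "map (\<lambda>t. var_x t + single 0 (d - 1)) [0..<r]"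
  have "inj var_x"
  proof (rule injI)
    fix i j assume "var_x i = var_x j"
    then have "keys (var_x i) = keys (var_x j)" by simp
    then show "i = j" by (simp add: var_x_def)
  qed
  then have "inj_on (\<lambda>t. var_x t + single 0 (d - 1)) (set [0..<r])"
    by (intro inj_onI) (metis add_right_imp_eq injD)
  then have "distinct ?gs" unfolding distinct_map by (intro conjI distinct_upt)
  moreover have nth: "?gs ! t = var_x t + single 0 (d - 1)" if "t < r" for t using that by simp
  moreover have "keys (?gs ! t) \<subseteq> {..m} \<and> mdeg (?gs ! t) = d" if "t < r" for t
  proof -
    have "keys (var_x t) \<subseteq> {..m}" "keys (single 0 (d - 1)) \<subseteq> {..m}" using that True by (simp_all add: var_x_def)
    moreover have "mdeg (var_x t) + mdeg (single 0 (d - 1)) = d" using d by (simp add: var_x_def)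
    ultimately show ?thesis unfolding nth[OF that] keys_add_nat mdeg_add by blast
  qed
  moreover have "length ?gs = r" by simp
  ultimately show ?thesis by blast
next
  case False
  let ?gs = "take r (expos m d)"
  have len: "length ?gs = r" using r by (simp add: expos_length)
  have "?gs ! t \<in> set (expos m d)" if "t < r" for t
  proof -
    have "?gs ! t \<in> set ?gs" using that len by (intro nth_mem) simp
    then show ?thesis by (rule in_set_takeD)
  qed
  then have "keys (?gs ! t) \<subseteq> {..m} \<and> mdeg (?gs ! t) = d" if "t < r" for t
    using that unfolding expos_set by blast
  moreover have "distinct ?gs" by (intro distinct_take expos_distinct)
  ultimately show ?thesis using False len by blast
qed

lemma generically_in_mono:
  "generically_in W P \<Longrightarrow> (\<And>x. P x \<Longrightarrow> Q x) \<Longrightarrow> generically_in W Q"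
  unfolding generically_in_def by blast

theorem theorem1p1:
  fixes \<phi> :: real and eig :: "complex mat \<Rightarrow> complex mat timed" and steps :: nat
  assumes "regularity_conjecture"
    and "0 \<le> \<phi>" and "\<phi> < 1"
    and "eigensolver eig"
  shows "\<exists>C :: real. \<forall>l m n r :: nat.
    m \<le> l \<and> n \<le> m \<and> 0 < n \<and> real r \<le> \<phi> * real (m * n) \<and> r \<le> l + 1 \<longrightarrow>
    (\<exists>d :: nat. 1 \<le> d \<and> (d, 1 :: nat) \<noteq> (1, 1) \<and>
      generically_in (tensors_of_rank l m n r) (\<lambda>A.
        HF_quot m n (cpd_ideal l m n A) d 1 = r \<and>
        generically_in (rand_space m n d 1) (\<lambda>\<rho>.
          (\<exists>ts. fst (cpd_hnf eig steps d 1 \<rho> l m n A r) = Some ts \<and>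
                is_decomposition l m n r A ts) \<and>
          real (snd (cpd_hnf eig steps d 1 \<rho> l m n A r))
            \<le> C * real ((l + 1) * (m + 1) * (n + 1)) powr (5 / 2 * of_int \<lceil>1 / (1 - \<phi>)\<rceil> + 1))))"
proof -
  obtain ce where eig: "eig_ok eig ce" using assms(4) by (auto simp: eigensolver_eig_ok)
  define c where "c = \<lceil>1 / (1 - \<phi>)\<rceil>"
  \<comment> \<open>The lower bound 2 excludes the degree (1,1) when the ceiling is 1.\<close>
  define d where "d = max 2 (nat c)"
  \<comment> \<open>Depends only on the number of Newton steps and the constant of the eigensolver,
    hence is uniform in the format, the rank and \<phi>.\<close>
  define C where "C = real (1400 * steps + 2 * ce + 120)"
  have "1 \<le> 1 / (1 - \<phi>)" using assms(2,3) by (simp add: field_simps)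
  then have c1: "1 \<le> c" unfolding c_def by linarith
  have d2: "2 \<le> d" by (simp add: d_def)
  have "1 / (1 - \<phi>) \<le> real_of_int c" unfolding c_def by (rule le_of_int_ceiling)
  also have "\<dots> \<le> real d" unfolding d_def using c1 by (simp add: of_nat_max)
  finally have "1 \<le> real d * (1 - \<phi>)" using assms(3) by (simp add: pos_divide_le_eq)
  then have \<phi>d: "\<phi> \<le> 1 - 1 / real d" using d2 by (simp add: field_simps)
  have main: "generically_in (tensors_of_rank l m n r) (\<lambda>A.
        HF_quot m n (cpd_ideal l m n A) d 1 = r \<and>
        generically_in (rand_space m n d 1) (\<lambda>\<rho>.
          (\<exists>ts. fst (cpd_hnf eig steps d 1 \<rho> l m n A r) = Some ts \<and> is_decomposition l m n r A ts) \<and>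
          real (snd (cpd_hnf eig steps d 1 \<rho> l m n A r))
            \<le> C * real ((l + 1) * (m + 1) * (n + 1)) powr (5 / 2 * of_int c + 1)))"
    if size: "m \<le> l" "n \<le> m" "0 < n" "real r \<le> \<phi> * real (m * n)" "r \<le> l + 1" for l m n r
  proof -
    have r_le: "real r \<le> real m * real n * (1 - 1 / real d)"
    proof -
      have "\<phi> * real (m * n) \<le> (1 - 1 / real d) * real (m * n)" using \<phi>d by (intro mult_right_mono) auto
      then show ?thesis using size(4) by (simp add: mult_ac)
    qed
    have r_mn: "r \<le> m * n"
    proof -
      have "\<phi> * real (m * n) \<le> 1 * real (m * n)" using assms(3) by (intro mult_right_mono) auto
      then have "real r \<le> real (m * n)" using size(4) by simp
      then show ?thesis by (simp only: of_nat_le_iff)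
    qed
    have m0: "0 < m" using size by simp
    have rb: "ereal (real r) \<le> min (reg_bound m n d 1) (ereal (real (m * n)))"
    proof (intro min.boundedI)
      have "ereal (real r) \<le> ereal (real m * real n * (1 - 1 / real d))" using r_le by simp
      then show "ereal (real r) \<le> reg_bound m n d 1" using reg_bound_ge[OF d2 m0 size(3)] by (rule order_trans)
      show "ereal (real r) \<le> ereal (real (m * n))" using r_mn by (simp only: ereal_less_eq of_nat_le_iff)
    qed
    obtain gs where gs: "length gs = r" "distinct gs" "\<And>t. t < r \<Longrightarrow> keys (gs ! t) \<subseteq> {..m}"
      "\<And>t. t < r \<Longrightarrow> mdeg (gs ! t) = d" "\<And>t. r \<le> m + 1 \<Longrightarrow> t < r \<Longrightarrow> gs ! t = var_x t + single 0 (d - 1)"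
      using exponents_exist[OF d2 enough_monomials[OF d2 size(2) r_le]] by blast
    obtain B2 Bm al0 be0 ga0 where nz: "open_cond.pp m n r d gs B2 Bm (point_tensor l m n r al0 be0 ga0) \<noteq> 0"
      using exists_general_position[OF assms(1) d2 m0 size(3,5) rb gs] by blast
    interpret open_cond l m n r d gs B2 Bm
      by (rule open_cond.intro[OF d2 size(5) gs(1,3,4,5)])
    show ?thesis
    proof (rule generically_in_rank[OF nz])
      fix al be ga
      let ?A = "point_tensor l m n r al be ga"
      assume "pp ?A \<noteq> 0"
      then interpret at: open_cond_at l m n r d gs B2 Bm al be ga ?A by unfold_locales simp_all
      interpret g: good m n r d be ga at.G l al ?A by (rule at.good)
      have time: "real (snd (cpd_hnf eig steps d 1 \<rho> l m n ?A r))
          \<le> C * real ((l + 1) * (m + 1) * (n + 1)) powr (5 / 2 * of_int c + 1)" if "g.good_rand \<rho>" for \<rho>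
      proof -
        let ?M = "(l + 1) * (m + 1) * (n + 1)" and ?k = "if r \<le> m + 1 then 2 else 2 * d"
        have "snd (cpd_hnf eig steps d 1 \<rho> l m n ?A r) \<le> (1400 * steps + 2 * ce + 120) * ?M ^ ?k"
          by (rule g.cpd_hnf_good(2)[OF eig that size(2,1,5) r_mn])
        then have count: "real (snd (cpd_hnf eig steps d 1 \<rho> l m n ?A r)) \<le> C * real ?M ^ ?k"
          unfolding C_def by (metis of_nat_le_iff of_nat_mult of_nat_power)
        have "real ?M ^ ?k = real ?M powr real ?k"
        proof (rule powr_realpow[symmetric])
          have "0 < ?M" by simp
          then show "0 < real ?M" by (simp only: of_nat_0_less_iff)
        qed
        also have "\<dots> \<le> real ?M powr (5 / 2 * of_int c + 1)"
        proof (rule powr_mono)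
          \<comment> \<open>In the case \<open>r > m + 1\<close> the rank is positive, which forces
            \<phi> > 0 and a ceiling of at least 2. So \<open>d\<close> is the ceiling itself and
            the exponent is \<open>2 * c\<close>. In the other case the exponent is 2.\<close>
          show "real ?k \<le> 5 / 2 * of_int c + 1"
          proof (cases "r \<le> m + 1")
            case True
            then show ?thesis using c1 by simp
          next
            case False
            then have "0 < \<phi>" using size(4) assms(2) by (cases "\<phi> = 0") auto
            then have "1 < 1 / (1 - \<phi>)" using assms(3) by (simp add: field_simps)
            then have "2 \<le> c" unfolding c_def by linarith
            then have "real d = of_int c" by (simp add: d_def)
            then show ?thesis using False c1 by simp
          qed
          have "1 \<le> ?M" by simp
          then have "real 1 \<le> real ?M" by (simp only: of_nat_le_iff)
          then show "1 \<le> real ?M" by (simp only: of_nat_1)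
        qed
        finally have "C * real ?M ^ ?k \<le> C * real ?M powr (5 / 2 * of_int c + 1)"
          by (rule mult_left_mono) (simp add: C_def)
        with count show ?thesis by (rule order_trans)
      qed
      have "generically_in (rand_space m n d 1) (\<lambda>\<rho>.
          (\<exists>ts. fst (cpd_hnf eig steps d 1 \<rho> l m n ?A r) = Some ts \<and> is_decomposition l m n r ?A ts) \<and>
          real (snd (cpd_hnf eig steps d 1 \<rho> l m n ?A r))
            \<le> C * real ((l + 1) * (m + 1) * (n + 1)) powr (5 / 2 * of_int c + 1))"
        by (rule generically_in_mono[OF g.generic_rand])
          (use time g.cpd_hnf_good(1)[OF eig _ size(2,1,5) r_mn] in blast)
      then show "HF_quot m n (cpd_ideal l m n ?A) d 1 = r \<and> generically_in (rand_space m n d 1) (\<lambda>\<rho>.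
          (\<exists>ts. fst (cpd_hnf eig steps d 1 \<rho> l m n ?A r) = Some ts \<and> is_decomposition l m n r ?A ts) \<and>
          real (snd (cpd_hnf eig steps d 1 \<rho> l m n ?A r))
            \<le> C * real ((l + 1) * (m + 1) * (n + 1)) powr (5 / 2 * of_int c + 1))"
        using g.HF_quot_cpd by blast
    qed
  qed
  have "1 \<le> d" "(d, 1 :: nat) \<noteq> (1, 1)" using d2 by auto
  then show ?thesis using main unfolding c_def by (intro exI[of _ C]) blast
qed

end
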